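(* Let $H$ be a Hilbert space and $M\subseteq B(H)$ a von Neumann algebra. Suppose $X$ is a product system over $\mathbb{N}^2$ of $W^*$-correspondences over $M'$ defined by $(E,F,t)$, and suppose $(\mathrm{id},T,S)$ is a completely contractive representation of $X$ on $H$ such that $T$ and $S$ are injective maps. Let $\Theta$ and $\Phi$ be the normal completely positive maps defined on $M$ by $\Theta(a)=\tilde T(I_E\otimes a)\tilde T^*$ and $\Phi(a)=\tilde S(I_F\otimes a)\tilde S^*$ for $a\in M$. Let $X_{\Theta,\Phi}$ be the product system over $\mathbb{N}^2$ defined by $(E_\Theta,E_\Phi,t_{\Theta,\Phi})$, with $t_{\Theta,\Phi}$ as defined in the context, and let $(\mathrm{id},T_\Theta,T_\Phi)$ be the identity representation of $X_{\Theta,\Phi}$ on $H$. Then there are (surjective) isomorphisms of correspondences $w_E:E_\Theta\to E$ and $w_F:E_\Phi\to F$ such that (1) $t\circ(w_E\otimes w_F)=(w_F\otimes w_E)\circ t_{\Theta,\Phi}$, and (2) $T\circ w_E=T_\Theta$ and $S\circ w_F=T_\Phi$.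
   Context: Inner products are linear in the second variable. Correspondences. A $W^*$-correspondence over a von Neumann algebra $N$ is a right Hilbert $C^*$-module $E$ over $N$ that is self-dual, with a left action given by a normal $*$-homomorphism $\varphi_E:N\to\mathcal{L}(E)$. $E\otimes_N F$ is the balanced tensor product, with $\langle\xi_1\otimes\eta_1,\xi_2\otimes\eta_2\rangle=\langle\eta_1,\varphi_F(\langle\xi_1,\xi_2\rangle)\eta_2\rangle$ and $a(\xi\otimes\eta)b=a\xi\otimes\eta b$ (self-dual extension of the Hausdorff completion). An isomorphism of correspondences is a surjective bimodule map preserving inner products. If $\sigma$ is a normal representation of $N$ on $H$, $E\otimes_\sigma H$ (also written $E\otimes H$) is the Hausdorff completion of the algebraic tensor product for $\langle\xi\otimes h,\eta\otimes k\rangle=\langle h,\sigma(\langle\xi,\eta\rangle)k\rangle$; for $a\in\sigma(N)'$, $I_E\otimes a$ maps $\xi\otimes h$ to $\xi\otimes ah$. Representations and product systems. A completely contractive (c.c.) representation of $E$ on $H$ is a pair $(\sigma,T)$ with $\sigma$ a normal $*$-representation of $N$ on $H$ and $T:E\to B(H)$ linear, completely contractive (operator space structure of $E$ from its linking algebra) with $T(a\xi b)=\sigma(a)T(\xi)\sigma(b)$. Put $\tilde T(\xi\otimes h)=T(\xi)h$, a contraction $E\otimes_\sigma H\to H$. A product system over $\mathbb{N}^2$ of $W^*$-correspondences over $N$ amounts to a triple $(E,F,t)$, with $E,F$ $W^*$-correspondences over $N$ and $t:E\otimes F\to F\otimes E$ an isomorphism of correspondences (fibers $X(m,n)=E^{\otimes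 m}\otimes F^{\otimes n}$). A c.c. representation of it on $H$ is a triple $(\sigma,T,S)$ where $(\sigma,T)$, $(\sigma,S)$ are c.c. representations of $E$, $F$ on $H$ with $\tilde T(I_E\otimes\tilde S)=\tilde S(I_F\otimes\tilde T)(t\otimes I_H)$. Here $N=M'$ and $\sigma=\mathrm{id}$ is the identity representation of $M'$ on $H$. The correspondence $E_\Theta$. $M\otimes_\Theta H$ is the Hausdorff completion of the algebraic tensor product for $\langle a\otimes h,b\otimes k\rangle=\langle h,\Theta(a^*b)k\rangle$, with $M$ acting by $(a\otimes I)(b\otimes_\Theta h)=ab\otimes_\Theta h$. $E_\Theta=\{R:H\to M\otimes_\Theta H\text{ bounded linear}: Ra=(a\otimes I)R,\ a\in M\}$ is a $W^*$-correspondence over $M'$ with right action $Rd=R\circ d$, left action $d\cdot R=(I_M\otimes d)\circ R$, where $(I_M\otimes d)(a\otimes_\Theta h)=a\otimes_\Theta dh$, and inner product $\langle R_1,R_2\rangle=R_1^*R_2$. $T_\Theta(R)=W_\Theta^*R$ where $W_\Theta h=I\otimes_\Theta h$. Similarly for $\Phi$. The isomorphism $t_{\Theta,\Phi}$. $H_{\Phi,\Theta}=M\otimes_\Phi M\otimes_\Theta H$ is the Hausdorff completion of $M\otimes M\otimes H$ for $\langle a_1\otimes b_1\otimes h_1,a_2\otimes b_2\otimes h_2\rangle=\langle h_1,\Theta(b_1^*\Phi(a_1^*a_2)b_2)h_2\rangle$, with $M$ acting by left multiplication on the first factor and $M'$ acting on $H$. $E_{\Phi,\Theta}$ is the space of bounded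 $Z:H\to H_{\Phi,\Theta}$ intertwining the actions of $M$, a $W^*$-correspondence over $M'$ with right action by composition, left action $d\cdot Z=(I\otimes I\otimes d)Z$ and inner product $Z_1^*Z_2$. The map $\Gamma_{\Phi,\Theta}:E_\Theta\otimes_{M'}E_\Phi\to E_{\Phi,\Theta}$, $R\otimes Y\mapsto(I_M\otimes R)Y$ (where $(I_M\otimes R)(a\otimes_\Phi h)=a\otimes_\Phi Rh$), is an isomorphism of correspondences. $H_{\Theta,\Phi}$, $E_{\Theta,\Phi}$, $\Gamma_{\Theta,\Phi}$ are defined by interchanging $\Theta$ and $\Phi$. Under the hypotheses of the claim, the maps $$\Lambda_{\Theta,\Phi}:H_{\Theta,\Phi}\to F\otimes E\otimes H,\quad \Lambda_{\Theta,\Phi}(a\otimes_\Theta b\otimes_\Phi h)=(I_F\otimes(I_E\otimes a)\tilde T^*b)\tilde S^*h,$$ $$\Lambda_{\Phi,\Theta}:H_{\Phi,\Theta}\to E\otimes F\otimes H,\quad \Lambda_{\Phi,\Theta}(a\otimes_\Phi b\otimes_\Theta h)=(I_E\otimes(I_F\otimes a)\tilde S^*b)\tilde T^*h$$ are unitaries, and one puts $u=\Lambda_{\Theta,\Phi}^{-1}\circ(t\otimes I_H)\circ\Lambda_{\Phi,\Theta}:H_{\Phi,\Theta}\to H_{\Theta,\Phi}$, which intertwines the actions of $M$ and of $M'$. Let $\Psi:E_{\Phi,\Theta}\to E_{\Theta,\Phi}$, $\Psi(Z)=u\circ Z$, and $$t_{\Theta,\Phi}=\Gamma_{\Theta,\Phi}^{-1}\circ\Psi\circ\Gamma_{\Phi,\Theta}:E_\Theta\otimes_{M'}E_\Phi\to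 E_\Phi\otimes_{M'}E_\Theta .$$ *)

theory Defs
  imports
    Complex_Main
    "HOL-Library.FuncSet"
    "HOL-Library.Poly_Mapping"
    "HOL-Algebra.Module"
    "HOL-Algebra.Order"
    "HOL-Algebra.Algebraic_Closure_Type"
begin

section \<open>Hilbert spaces and bounded operators\<close>

text \<open>
  Tensor products and completions depend on terms, so every space is a carrier set inside a type.
  Complex vector spaces are modules, in the sense of HOL-Algebra, over the field of complex
  numbers; the fields \<open>mult\<close> and \<open>one\<close> that a module record inherits from the record of rings
  are never used. Operators are extensional functions on the carrier, so that equality of
  operators is equality of functions. Inner products are linear in the second variable.
\<close>

abbreviation complex_field :: "complex ring" where
  "complex_field \<equiv> ring_of_type_algebra"

record 'a hspace = "(complex, 'a) module" +
  cinner :: "'a \<Rightarrow> 'a \<Rightarrow> complex"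

definition hnorm :: "'a hspace \<Rightarrow> 'a \<Rightarrow> real" where
  "hnorm H x = sqrt (Re (cinner H x x))"

locale hilbert_space = Module.module complex_field H for H :: "'a hspace" (structure) +
  assumes cinner_add: "\<lbrakk>x \<in> carrier H; y \<in> carrier H; z \<in> carrier H\<rbrakk>
      \<Longrightarrow> cinner H x (y \<oplus> z) = cinner H x y + cinner H x z"
    and cinner_smult: "\<lbrakk>x \<in> carrier H; y \<in> carrier H\<rbrakk>
      \<Longrightarrow> cinner H x (c \<odot> y) = c * cinner H x y"
    and cinner_commute: "\<lbrakk>x \<in> carrier H; y \<in> carrier H\<rbrakk>
      \<Longrightarrow> cinner H y x = cnj (cinner H x y)"
    and cinner_nonneg: "x \<in> carrier H \<Longrightarrow> 0 \<le> Re (cinner H x x)"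
    and cinner_definite: "\<lbrakk>x \<in> carrier H; cinner H x x = 0\<rbrakk> \<Longrightarrow> x = \<zero>"
    and complete: "\<lbrakk>\<And>n. xs n \<in> carrier H;
        \<forall>e>0. \<exists>k. \<forall>m\<ge>k. \<forall>n\<ge>k. hnorm H (xs m \<ominus> xs n) < e\<rbrakk>
      \<Longrightarrow> \<exists>l\<in>carrier H. (\<lambda>n::nat. hnorm H (xs n \<ominus> l)) \<longlonglongrightarrow> 0"

definition bop :: "'a hspace \<Rightarrow> 'b hspace \<Rightarrow> ('a \<Rightarrow> 'b) set" where
  "bop H K = {A \<in> carrier H \<rightarrow>\<^sub>E carrier K.
     (\<forall>x\<in>carrier H. \<forall>y\<in>carrier H. A (x \<oplus>\<^bsub>H\<^esub> y) = A x \<oplus>\<^bsub>K\<^esub> A y) \<and>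
     (\<forall>c. \<forall>x\<in>carrier H. A (c \<odot>\<^bsub>H\<^esub> x) = c \<odot>\<^bsub>K\<^esub> A x) \<and>
     (\<exists>C. \<forall>x\<in>carrier H. hnorm K (A x) \<le> C * hnorm H x)}"

definition opnorm :: "'a hspace \<Rightarrow> 'b hspace \<Rightarrow> ('a \<Rightarrow> 'b) \<Rightarrow> real" where
  "opnorm H K A = Inf {C. 0 \<le> C \<and> (\<forall>x\<in>carrier H. hnorm K (A x) \<le> C * hnorm H x)}"

definition adj :: "'a hspace \<Rightarrow> 'b hspace \<Rightarrow> ('a \<Rightarrow> 'b) \<Rightarrow> ('b \<Rightarrow> 'a)" where
  "adj H K A = (THE B. B \<in> bop K H \<and>
     (\<forall>x\<in>carrier H. \<forall>y\<in>carrier K. cinner K (A x) y = cinner H x (B y)))"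

definition op_one :: "'a hspace \<Rightarrow> 'a \<Rightarrow> 'a" where
  "op_one H = (\<lambda>x\<in>carrier H. x)"

definition op_zero :: "'a hspace \<Rightarrow> 'b hspace \<Rightarrow> 'a \<Rightarrow> 'b" where
  "op_zero H K = (\<lambda>x\<in>carrier H. \<zero>\<^bsub>K\<^esub>)"

definition op_add :: "'a hspace \<Rightarrow> 'b hspace \<Rightarrow> ('a \<Rightarrow> 'b) \<Rightarrow> ('a \<Rightarrow> 'b) \<Rightarrow> 'a \<Rightarrow> 'b" where
  "op_add H K A B = (\<lambda>x\<in>carrier H. A x \<oplus>\<^bsub>K\<^esub> B x)"

definition op_smult :: "'a hspace \<Rightarrow> 'b hspace \<Rightarrow> complex \<Rightarrow> ('a \<Rightarrow> 'b) \<Rightarrow> 'a \<Rightarrow> 'b" where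
  "op_smult H K c A = (\<lambda>x\<in>carrier H. c \<odot>\<^bsub>K\<^esub> A x)"

text \<open>The order is only used between self-adjoint operators, whose quadratic forms are real.\<close>

definition op_le :: "'a hspace \<Rightarrow> ('a \<Rightarrow> 'a) \<Rightarrow> ('a \<Rightarrow> 'a) \<Rightarrow> bool" where
  "op_le H A B \<longleftrightarrow> (\<forall>x\<in>carrier H. Re (cinner H x (A x)) \<le> Re (cinner H x (B x)))"

definition commutant :: "'a hspace \<Rightarrow> ('a \<Rightarrow> 'a) set \<Rightarrow> ('a \<Rightarrow> 'a) set" where
  "commutant H M = {b \<in> bop H H. \<forall>a\<in>M. compose (carrier H) a b = compose (carrier H) b a}"

text \<open>Such a set is automatically a unital subalgebra of the bounded operators.\<close>

definition von_neumann_algebra :: "'a hspace \<Rightarrow> ('a \<Rightarrow> 'a) set \<Rightarrow> bool" where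
  "von_neumann_algebra H M \<longleftrightarrow> M \<subseteq> bop H H \<and> (\<forall>a\<in>M. adj H H a \<in> M) \<and>
     commutant H (commutant H M) = M"

text \<open>
  The bounded operator from \<open>K\<close> to \<open>L\<close> prescribed on a total family \<open>e\<close> of vectors.
\<close>

definition op_ext ::
  "'a hspace \<Rightarrow> 'b hspace \<Rightarrow> 'x set \<Rightarrow> ('x \<Rightarrow> 'a) \<Rightarrow> ('x \<Rightarrow> 'b) \<Rightarrow> 'a \<Rightarrow> 'b" where
  "op_ext K L I e v = (THE A. A \<in> bop K L \<and> (\<forall>x\<in>I. A (e x) = v x))"


section \<open>Hausdorff completions\<close>

text \<open>
  All the spaces below are Hausdorff completions of an algebraic tensor product for a form given
  on elementary tensors by a kernel \<open>\<kappa>\<close>. The algebraic tensor product is represented by the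
  free vector space on the symbols of the elementary tensors: the tensor relations are null for
  the (semi-definite) form, hence disappear in the Hausdorff completion. The completion
  consists of the Cauchy sequences of formal linear combinations modulo null sequences.
\<close>

type_synonym 'x hcompl = "(nat \<Rightarrow> ('x \<Rightarrow>\<^sub>0 complex)) set"

definition ker_form ::
  "('x \<Rightarrow> 'x \<Rightarrow> complex) \<Rightarrow> ('x \<Rightarrow>\<^sub>0 complex) \<Rightarrow> ('x \<Rightarrow>\<^sub>0 complex) \<Rightarrow> complex" where
  "ker_form \<kappa> f g = (\<Sum>x\<in>Poly_Mapping.keys f. \<Sum>y\<in>Poly_Mapping.keys g. cnj (Poly_Mapping.lookup f x) * Poly_Mapping.lookup g y * \<kappa> x y)"

definition ker_norm :: "('x \<Rightarrow> 'x \<Rightarrow> complex) \<Rightarrow> ('x \<Rightarrow>\<^sub>0 complex) \<Rightarrow> real" where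
  "ker_norm \<kappa> f = sqrt (Re (ker_form \<kappa> f f))"

definition ker_cauchy ::
  "'x set \<Rightarrow> ('x \<Rightarrow> 'x \<Rightarrow> complex) \<Rightarrow> (nat \<Rightarrow> ('x \<Rightarrow>\<^sub>0 complex)) set" where
  "ker_cauchy I \<kappa> = {f. (\<forall>n. Poly_Mapping.keys (f n) \<subseteq> I) \<and>
     (\<forall>e>0. \<exists>k. \<forall>m\<ge>k. \<forall>n\<ge>k. ker_norm \<kappa> (f m - f n) < e)}"

definition ker_rel ::
  "'x set \<Rightarrow> ('x \<Rightarrow> 'x \<Rightarrow> complex) \<Rightarrow> (nat \<Rightarrow> ('x \<Rightarrow>\<^sub>0 complex)) rel" where
  "ker_rel I \<kappa> = {(f, g). f \<in> ker_cauchy I \<kappa> \<and> g \<in> ker_cauchy I \<kappa> \<and>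
     (\<lambda>n. ker_norm \<kappa> (f n - g n)) \<longlonglongrightarrow> 0}"

definition hcompletion :: "'x set \<Rightarrow> ('x \<Rightarrow> 'x \<Rightarrow> complex) \<Rightarrow> 'x hcompl hspace" where
  "hcompletion I \<kappa> =
    \<lparr>carrier = ker_cauchy I \<kappa> // ker_rel I \<kappa>,
     monoid.mult = undefined,
     monoid.one = undefined,
     ring.zero = ker_rel I \<kappa> `` {\<lambda>n. 0},
     ring.add = (\<lambda>A B. ker_rel I \<kappa> `` {\<lambda>n. f n + g n |f g. f \<in> A \<and> g \<in> B}),
     module.smult = (\<lambda>c A. ker_rel I \<kappa> `` {\<lambda>n. Poly_Mapping.map (\<lambda>z. c * z) (f n) |f. f \<in> A}),
     cinner = (\<lambda>A B. THE z. \<exists>f\<in>A. \<exists>g\<in>B. (\<lambda>n. ker_form \<kappa> (f n) (g n)) \<longlonglongrightarrow> z)\<rparr>"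

definition hcompl_elem :: "'x set \<Rightarrow> ('x \<Rightarrow> 'x \<Rightarrow> complex) \<Rightarrow> 'x \<Rightarrow> 'x hcompl" where
  "hcompl_elem I \<kappa> x = ker_rel I \<kappa> `` {\<lambda>n. Poly_Mapping.single x 1}"


section \<open>W*-correspondences\<close>

record ('n, 'e) corr = "(complex, 'e) module" +
  ract :: "'e \<Rightarrow> 'n \<Rightarrow> 'e"
  lact :: "'n \<Rightarrow> 'e \<Rightarrow> 'e"
  ip :: "'e \<Rightarrow> 'e \<Rightarrow> 'n"

definition enorm :: "'h hspace \<Rightarrow> ('h \<Rightarrow> 'h, 'e, 'z) corr_scheme \<Rightarrow> 'e \<Rightarrow> real" where
  "enorm H E \<xi> = sqrt (opnorm H H (ip E \<xi> \<xi>))"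

locale hilbert_module =
  H: hilbert_space H + Module.module complex_field E
  for H :: "'h hspace" and N :: "('h \<Rightarrow> 'h) set"
    and E :: "('h \<Rightarrow> 'h, 'e, 'z) corr_scheme" (structure) +
  assumes von_neumann: "von_neumann_algebra H N"
    and ract_closed: "\<lbrakk>\<xi> \<in> carrier E; a \<in> N\<rbrakk> \<Longrightarrow> ract E \<xi> a \<in> carrier E"
    and ract_add_left: "\<lbrakk>\<xi> \<in> carrier E; \<eta> \<in> carrier E; a \<in> N\<rbrakk>
      \<Longrightarrow> ract E (\<xi> \<oplus> \<eta>) a = ract E \<xi> a \<oplus> ract E \<eta> a"
    and ract_add_right: "\<lbrakk>\<xi> \<in> carrier E; a \<in> N; b \<in> N\<rbrakk>
      \<Longrightarrow> ract E \<xi> (op_add H H a b) = ract E \<xi> a \<oplus> ract E \<xi> b"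
    and ract_smult_left: "\<lbrakk>\<xi> \<in> carrier E; a \<in> N\<rbrakk> \<Longrightarrow> ract E (c \<odot> \<xi>) a = c \<odot> ract E \<xi> a"
    and ract_smult_right: "\<lbrakk>\<xi> \<in> carrier E; a \<in> N\<rbrakk>
      \<Longrightarrow> ract E \<xi> (op_smult H H c a) = c \<odot> ract E \<xi> a"
    and ract_mult: "\<lbrakk>\<xi> \<in> carrier E; a \<in> N; b \<in> N\<rbrakk>
      \<Longrightarrow> ract E \<xi> (compose (carrier H) a b) = ract E (ract E \<xi> a) b"
    and ract_one: "\<xi> \<in> carrier E \<Longrightarrow> ract E \<xi> (op_one H) = \<xi>"
    and ip_closed: "\<lbrakk>\<xi> \<in> carrier E; \<eta> \<in> carrier E\<rbrakk> \<Longrightarrow> ip E \<xi> \<eta> \<in> N"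
    and ip_add: "\<lbrakk>\<xi> \<in> carrier E; \<eta> \<in> carrier E; \<zeta> \<in> carrier E\<rbrakk>
      \<Longrightarrow> ip E \<xi> (\<eta> \<oplus> \<zeta>) = op_add H H (ip E \<xi> \<eta>) (ip E \<xi> \<zeta>)"
    and ip_smult: "\<lbrakk>\<xi> \<in> carrier E; \<eta> \<in> carrier E\<rbrakk>
      \<Longrightarrow> ip E \<xi> (c \<odot> \<eta>) = op_smult H H c (ip E \<xi> \<eta>)"
    and ip_ract: "\<lbrakk>\<xi> \<in> carrier E; \<eta> \<in> carrier E; a \<in> N\<rbrakk>
      \<Longrightarrow> ip E \<xi> (ract E \<eta> a) = compose (carrier H) (ip E \<xi> \<eta>) a"
    and ip_adj: "\<lbrakk>\<xi> \<in> carrier E; \<eta> \<in> carrier E\<rbrakk> \<Longrightarrow> ip E \<eta> \<xi> = adj H H (ip E \<xi> \<eta>)"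
    and ip_nonneg: "\<xi> \<in> carrier E \<Longrightarrow> op_le H (op_zero H H) (ip E \<xi> \<xi>)"
    and ip_definite: "\<lbrakk>\<xi> \<in> carrier E; ip E \<xi> \<xi> = op_zero H H\<rbrakk> \<Longrightarrow> \<xi> = \<zero>"
    and complete: "\<lbrakk>\<And>n. xs n \<in> carrier E;
        \<forall>e>0. \<exists>k. \<forall>m\<ge>k. \<forall>n\<ge>k. enorm H E (xs m \<ominus> xs n) < e\<rbrakk>
      \<Longrightarrow> \<exists>l\<in>carrier E. (\<lambda>n::nat. enorm H E (xs n \<ominus> l)) \<longlonglongrightarrow> 0"

text \<open>
  Bounded module maps into \<open>N\<close> from a submodule \<open>U\<close> of \<open>E\<close>. Saying that \<open>E\<close> represents
  those of \<open>U\<close> means that \<open>E\<close> is the self-dual extension of \<open>U\<close>;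
  for \<open>U = carrier E\<close> this is self-duality of \<open>E\<close>.
\<close>

definition bounded_module_map :: "'h hspace \<Rightarrow> ('h \<Rightarrow> 'h) set \<Rightarrow>
    ('h \<Rightarrow> 'h, 'e, 'z) corr_scheme \<Rightarrow> 'e set \<Rightarrow> ('e \<Rightarrow> 'h \<Rightarrow> 'h) \<Rightarrow> bool" where
  "bounded_module_map H N E U f \<longleftrightarrow> f \<in> U \<rightarrow> N \<and>
     (\<forall>x\<in>U. \<forall>y\<in>U. f (x \<oplus>\<^bsub>E\<^esub> y) = op_add H H (f x) (f y)) \<and>
     (\<forall>c. \<forall>x\<in>U. f (c \<odot>\<^bsub>E\<^esub> x) = op_smult H H c (f x)) \<and>
     (\<forall>x\<in>U. \<forall>a\<in>N. f (ract E x a) = compose (carrier H) (f x) a) \<and>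
     (\<exists>C. \<forall>x\<in>U. opnorm H H (f x) \<le> C * enorm H E x)"

definition represents_dual :: "'h hspace \<Rightarrow> ('h \<Rightarrow> 'h) set \<Rightarrow>
    ('h \<Rightarrow> 'h, 'e, 'z) corr_scheme \<Rightarrow> 'e set \<Rightarrow> bool" where
  "represents_dual H N E U \<longleftrightarrow> (\<forall>f. bounded_module_map H N E U f \<longrightarrow>
     (\<exists>!\<xi>. \<xi> \<in> carrier E \<and> (\<forall>x\<in>U. f x = ip E \<xi> x)))"

text \<open>
  The self-adjoint parts of \<open>N\<close> and of the algebra of adjointable operators on \<open>E\<close>, as
  ordered sets. A positive map is normal if it preserves suprema of bounded increasing nets of
  self-adjoint elements. (A map that is its own adjoint is automatically linear.)
\<close>

definition sa_part :: "'h hspace \<Rightarrow> ('h \<Rightarrow> 'h) set \<Rightarrow> ('h \<Rightarrow> 'h) gorder" where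
  "sa_part H N = \<lparr>carrier = {a \<in> N. adj H H a = a}, eq = (=), le = op_le H\<rparr>"

definition sa_adjointable ::
  "'h hspace \<Rightarrow> ('h \<Rightarrow> 'h, 'e, 'z) corr_scheme \<Rightarrow> ('e \<Rightarrow> 'e) gorder" where
  "sa_adjointable H E =
    \<lparr>carrier = {A \<in> carrier E \<rightarrow>\<^sub>E carrier E.
       \<forall>\<xi>\<in>carrier E. \<forall>\<eta>\<in>carrier E. ip E (A \<xi>) \<eta> = ip E \<xi> (A \<eta>)},
     eq = (=),
     le = (\<lambda>A B. \<forall>\<xi>\<in>carrier E. op_le H (ip E \<xi> (A \<xi>)) (ip E \<xi> (B \<xi>)))\<rparr>"

definition normal_map :: "('a, 'y) gorder_scheme \<Rightarrow> ('b, 'z) gorder_scheme \<Rightarrow> ('a \<Rightarrow> 'b) \<Rightarrow> bool" where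
  "normal_map P Q \<phi> \<longleftrightarrow> (\<forall>D s. D \<subseteq> carrier P \<longrightarrow> D \<noteq> {} \<longrightarrow>
     (\<forall>x\<in>D. \<forall>y\<in>D. \<exists>z\<in>D. x \<sqsubseteq>\<^bsub>P\<^esub> z \<and> y \<sqsubseteq>\<^bsub>P\<^esub> z) \<longrightarrow> is_lub P s D \<longrightarrow> is_lub Q (\<phi> s) (\<phi> ` D))"

text \<open>
  The left action is a normal *-homomorphism into the adjointable operators;
  \<open>lact_adj\<close> contains both adjointability and preservation of adjoints. It need not be unital.
\<close>

locale w_correspondence = hilbert_module +
  assumes self_dual: "represents_dual H N E (carrier E)"
    and lact_closed: "\<lbrakk>a \<in> N; \<xi> \<in> carrier E\<rbrakk> \<Longrightarrow> lact E a \<xi> \<in> carrier E"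
    and lact_add: "\<lbrakk>a \<in> N; b \<in> N; \<xi> \<in> carrier E\<rbrakk>
      \<Longrightarrow> lact E (op_add H H a b) \<xi> = lact E a \<xi> \<oplus> lact E b \<xi>"
    and lact_smult: "\<lbrakk>a \<in> N; \<xi> \<in> carrier E\<rbrakk>
      \<Longrightarrow> lact E (op_smult H H c a) \<xi> = c \<odot> lact E a \<xi>"
    and lact_mult: "\<lbrakk>a \<in> N; b \<in> N; \<xi> \<in> carrier E\<rbrakk>
      \<Longrightarrow> lact E (compose (carrier H) a b) \<xi> = lact E a (lact E b \<xi>)"
    and lact_adj: "\<lbrakk>a \<in> N; \<xi> \<in> carrier E; \<eta> \<in> carrier E\<rbrakk>
      \<Longrightarrow> ip E (lact E a \<xi>) \<eta> = ip E \<xi> (lact E (adj H H a) \<eta>)"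
    and lact_normal:
      "normal_map (sa_part H N) (sa_adjointable H E) (\<lambda>a. \<lambda>\<xi>\<in>carrier E. lact E a \<xi>)"

text \<open>Like operators, isomorphisms are extensional, so that they are determined by their values.\<close>

definition corr_iso :: "('h \<Rightarrow> 'h) set \<Rightarrow> ('h \<Rightarrow> 'h, 'e, 'y) corr_scheme \<Rightarrow>
    ('h \<Rightarrow> 'h, 'f, 'z) corr_scheme \<Rightarrow> ('e \<Rightarrow> 'f) \<Rightarrow> bool" where
  "corr_iso N E F w \<longleftrightarrow> w \<in> carrier E \<rightarrow>\<^sub>E carrier F \<and> w ` carrier E = carrier F \<and>
     (\<forall>\<xi>\<in>carrier E. \<forall>\<eta>\<in>carrier E. w (\<xi> \<oplus>\<^bsub>E\<^esub> \<eta>) = w \<xi> \<oplus>\<^bsub>F\<^esub> w \<eta>) \<and>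
     (\<forall>c. \<forall>\<xi>\<in>carrier E. w (c \<odot>\<^bsub>E\<^esub> \<xi>) = c \<odot>\<^bsub>F\<^esub> w \<xi>) \<and>
     (\<forall>a\<in>N. \<forall>\<xi>\<in>carrier E. w (lact E a \<xi>) = lact F a (w \<xi>) \<and> w (ract E \<xi> a) = ract F (w \<xi>) a) \<and>
     (\<forall>\<xi>\<in>carrier E. \<forall>\<eta>\<in>carrier E. ip F (w \<xi>) (w \<eta>) = ip E \<xi> \<eta>)"


section \<open>Balanced tensor products of W*-correspondences\<close>

text \<open>
  A balanced tensor product is a correspondence together with its map of elementary tensors.
  By the formula for the inner product and its definiteness, \<open>tens\<close> is bilinear and balanced,
  and the norm closure \<open>tens_closure\<close> of the span of the elementary tensors is the Hausdorff
  completion of the algebraic tensor product; the last condition of \<open>is_tensor\<close> says that the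
  whole correspondence is the self-dual extension of that completion. These conditions determine
  it up to a unique isomorphism respecting elementary tensors.
\<close>

record ('n, 'p, 'e, 'f) corr_tensor = "('n, 'p) corr" +
  tens :: "'e \<Rightarrow> 'f \<Rightarrow> 'p"

definition tens_closure :: "'h hspace \<Rightarrow> ('h \<Rightarrow> 'h, 'e, 'y) corr_scheme \<Rightarrow>
    ('h \<Rightarrow> 'h, 'f, 'z) corr_scheme \<Rightarrow> ('h \<Rightarrow> 'h, 'p, 'e, 'f) corr_tensor \<Rightarrow> 'p set" where
  "tens_closure H E F P = {x \<in> carrier P. \<forall>\<epsilon>>0. \<exists>n::nat. \<exists>\<xi> \<eta>.
     (\<forall>i<n. \<xi> i \<in> carrier E \<and> \<eta> i \<in> carrier F) \<and>
     enorm H P (x \<ominus>\<^bsub>P\<^esub> (\<Oplus>\<^bsub>P\<^esub>i\<in>{..<n}. tens P (\<xi> i) (\<eta> i))) < \<epsilon>}"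

definition is_tensor :: "'h hspace \<Rightarrow> ('h \<Rightarrow> 'h) set \<Rightarrow> ('h \<Rightarrow> 'h, 'e, 'y) corr_scheme \<Rightarrow>
    ('h \<Rightarrow> 'h, 'f, 'z) corr_scheme \<Rightarrow> ('h \<Rightarrow> 'h, 'p, 'e, 'f) corr_tensor \<Rightarrow> bool" where
  "is_tensor H N E F P \<longleftrightarrow> w_correspondence H N P \<and>
     (\<forall>\<xi>\<in>carrier E. \<forall>\<eta>\<in>carrier F. tens P \<xi> \<eta> \<in> carrier P) \<and>
     (\<forall>\<xi>\<^sub>1\<in>carrier E. \<forall>\<eta>\<^sub>1\<in>carrier F. \<forall>\<xi>\<^sub>2\<in>carrier E. \<forall>\<eta>\<^sub>2\<in>carrier F.
        ip P (tens P \<xi>\<^sub>1 \<eta>\<^sub>1) (tens P \<xi>\<^sub>2 \<eta>\<^sub>2) = ip F \<eta>\<^sub>1 (lact F (ip E \<xi>\<^sub>1 \<xi>\<^sub>2) \<eta>\<^sub>2)) \<and>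
     (\<forall>a\<in>N. \<forall>\<xi>\<in>carrier E. \<forall>\<eta>\<in>carrier F.
        lact P a (tens P \<xi> \<eta>) = tens P (lact E a \<xi>) \<eta> \<and>
        ract P (tens P \<xi> \<eta>) a = tens P \<xi> (ract F \<eta> a)) \<and>
     represents_dual H N P (tens_closure H E F P)"

definition tens_map :: "('h \<Rightarrow> 'h) set \<Rightarrow>
    ('h \<Rightarrow> 'h, 'e, 'x) corr_scheme \<Rightarrow> ('h \<Rightarrow> 'h, 'f, 'y) corr_scheme \<Rightarrow>
    ('h \<Rightarrow> 'h, 'p, 'e, 'f) corr_tensor \<Rightarrow> ('h \<Rightarrow> 'h, 'q, 'g, 'k) corr_tensor \<Rightarrow>
    ('e \<Rightarrow> 'g) \<Rightarrow> ('f \<Rightarrow> 'k) \<Rightarrow> 'p \<Rightarrow> 'q" where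
  "tens_map N E F P Q v w = (THE W. corr_iso N P Q W \<and>
     (\<forall>\<xi>\<in>carrier E. \<forall>\<eta>\<in>carrier F. W (tens P \<xi> \<eta>) = tens Q (v \<xi>) (w \<eta>)))"

text \<open>
  A product system over pairs of natural numbers, given by \<open>(E, F, t)\<close>;
  \<open>EF\<close> and \<open>FE\<close> are the tensor products of \<open>E\<close> and \<open>F\<close> in the two orders.
\<close>

definition product_system :: "'h hspace \<Rightarrow> ('h \<Rightarrow> 'h) set \<Rightarrow>
    ('h \<Rightarrow> 'h, 'e) corr \<Rightarrow> ('h \<Rightarrow> 'h, 'f) corr \<Rightarrow> ('h \<Rightarrow> 'h, 'p, 'e, 'f) corr_tensor \<Rightarrow>
    ('h \<Rightarrow> 'h, 'q, 'f, 'e) corr_tensor \<Rightarrow> ('p \<Rightarrow> 'q) \<Rightarrow> bool" where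
  "product_system H N E F EF FE t \<longleftrightarrow>
     w_correspondence H N E \<and> w_correspondence H N F \<and>
     is_tensor H N E F EF \<and> is_tensor H N F E FE \<and> corr_iso N EF FE t"


section \<open>Tensor products of correspondences with Hilbert spaces\<close>

text \<open>
  \<open>htensor E K \<sigma>\<close> is the Hilbert space \<open>E \<otimes>\<^sub>\<sigma> K\<close> for a representation \<open>\<sigma>\<close> on \<open>K\<close>;
  the identity representation of an algebra of operators on \<open>H\<close> is \<open>id\<close>.
\<close>

definition hten_ker :: "('n, 'e, 'z) corr_scheme \<Rightarrow> 'k hspace \<Rightarrow> ('n \<Rightarrow> 'k \<Rightarrow> 'k) \<Rightarrow>
    'e \<times> 'k \<Rightarrow> 'e \<times> 'k \<Rightarrow> complex" where
  "hten_ker E K \<sigma> = (\<lambda>(\<xi>, h) (\<eta>, k). cinner K h (\<sigma> (ip E \<xi> \<eta>) k))"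

definition htensor :: "('n, 'e, 'z) corr_scheme \<Rightarrow> 'k hspace \<Rightarrow> ('n \<Rightarrow> 'k \<Rightarrow> 'k) \<Rightarrow>
    ('e \<times> 'k) hcompl hspace" where
  "htensor E K \<sigma> = hcompletion (carrier E \<times> carrier K) (hten_ker E K \<sigma>)"

definition hten :: "('n, 'e, 'z) corr_scheme \<Rightarrow> 'k hspace \<Rightarrow> ('n \<Rightarrow> 'k \<Rightarrow> 'k) \<Rightarrow>
    'e \<Rightarrow> 'k \<Rightarrow> ('e \<times> 'k) hcompl" where
  "hten E K \<sigma> \<xi> h = hcompl_elem (carrier E \<times> carrier K) (hten_ker E K \<sigma>) (\<xi>, h)"

text \<open>\<open>I\<^sub>E \<otimes> A\<close> and \<open>w \<otimes> I\<close>.\<close>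

definition id_hten :: "('n, 'e, 'z) corr_scheme \<Rightarrow> 'k hspace \<Rightarrow> ('n \<Rightarrow> 'k \<Rightarrow> 'k) \<Rightarrow>
    'l hspace \<Rightarrow> ('n \<Rightarrow> 'l \<Rightarrow> 'l) \<Rightarrow> ('k \<Rightarrow> 'l) \<Rightarrow> ('e \<times> 'k) hcompl \<Rightarrow> ('e \<times> 'l) hcompl" where
  "id_hten E K \<sigma> L \<rho> A = op_ext (htensor E K \<sigma>) (htensor E L \<rho>) (carrier E \<times> carrier K)
     (\<lambda>(\<xi>, h). hten E K \<sigma> \<xi> h) (\<lambda>(\<xi>, h). hten E L \<rho> \<xi> (A h))"

definition map_hten :: "('n, 'e, 'y) corr_scheme \<Rightarrow> ('n, 'f, 'z) corr_scheme \<Rightarrow> 'k hspace \<Rightarrow>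
    ('n \<Rightarrow> 'k \<Rightarrow> 'k) \<Rightarrow> ('e \<Rightarrow> 'f) \<Rightarrow> ('e \<times> 'k) hcompl \<Rightarrow> ('f \<times> 'k) hcompl" where
  "map_hten E F K \<sigma> w = op_ext (htensor E K \<sigma>) (htensor F K \<sigma>) (carrier E \<times> carrier K)
     (\<lambda>(\<xi>, h). hten E K \<sigma> \<xi> h) (\<lambda>(\<xi>, h). hten F K \<sigma> (w \<xi>) h)"

definition hten_rep :: "('h \<Rightarrow> 'h, 'f, 'z) corr_scheme \<Rightarrow> 'h hspace \<Rightarrow> ('h \<Rightarrow> 'h) \<Rightarrow>
    ('f \<times> 'h) hcompl \<Rightarrow> ('f \<times> 'h) hcompl" where
  "hten_rep F H a = map_hten F F H id (lact F a)"

definition htensor2 :: "('h \<Rightarrow> 'h, 'e, 'y) corr_scheme \<Rightarrow> ('h \<Rightarrow> 'h, 'f, 'z) corr_scheme \<Rightarrow>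
    'h hspace \<Rightarrow> ('e \<times> ('f \<times> 'h) hcompl) hcompl hspace" where
  "htensor2 E F H = htensor E (htensor F H id) (hten_rep F H)"

text \<open>The canonical identification of \<open>(E \<otimes> F) \<otimes> H\<close> with \<open>E \<otimes> (F \<otimes> H)\<close>.\<close>

definition hten_assoc :: "'h hspace \<Rightarrow> ('h \<Rightarrow> 'h, 'e) corr \<Rightarrow> ('h \<Rightarrow> 'h, 'f) corr \<Rightarrow>
    ('h \<Rightarrow> 'h, 'p, 'e, 'f) corr_tensor \<Rightarrow>
    ('p \<times> 'h) hcompl \<Rightarrow> ('e \<times> ('f \<times> 'h) hcompl) hcompl" where
  "hten_assoc H E F P = op_ext (htensor P H id) (htensor2 E F H)
     (carrier E \<times> carrier F \<times> carrier H)
     (\<lambda>(\<xi>, \<eta>, h). hten P H id (tens P \<xi> \<eta>) h)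
     (\<lambda>(\<xi>, \<eta>, h). hten E (htensor F H id) (hten_rep F H) \<xi> (hten F H id \<eta> h))"

text \<open>\<open>t \<otimes> I\<^sub>H\<close> as an operator from \<open>E \<otimes> F \<otimes> H\<close> to \<open>F \<otimes> E \<otimes> H\<close>.\<close>

definition flip_hten :: "'h hspace \<Rightarrow> ('h \<Rightarrow> 'h, 'e) corr \<Rightarrow> ('h \<Rightarrow> 'h, 'f) corr \<Rightarrow>
    ('h \<Rightarrow> 'h, 'p, 'e, 'f) corr_tensor \<Rightarrow> ('h \<Rightarrow> 'h, 'q, 'f, 'e) corr_tensor \<Rightarrow> ('p \<Rightarrow> 'q) \<Rightarrow>
    ('e \<times> ('f \<times> 'h) hcompl) hcompl \<Rightarrow> ('f \<times> ('e \<times> 'h) hcompl) hcompl" where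
  "flip_hten H E F EF FE t = (\<lambda>x\<in>carrier (htensor2 E F H).
     hten_assoc H F E FE (map_hten EF FE H id t
       (the_inv_into (carrier (htensor EF H id)) (hten_assoc H E F EF) x)))"


section \<open>Completely contractive representations\<close>

text \<open>
  Norms of \<open>n \<times> n\<close> matrices. An element \<open>\<xi>\<close> of \<open>E\<close> is, in the linking algebra of adjointable
  operators on \<open>E \<oplus> N\<close>, the corner \<open>a \<mapsto> \<xi> a\<close>; so a matrix over \<open>E\<close> has the norm of the
  operator that it induces from the Hilbert module \<open>N\<^sup>n\<close> to the Hilbert module \<open>E\<^sup>n\<close>.
\<close>

definition module_tuple_norm ::
  "'h hspace \<Rightarrow> ('h \<Rightarrow> 'h, 'e, 'z) corr_scheme \<Rightarrow> nat \<Rightarrow> (nat \<Rightarrow> 'e) \<Rightarrow> real" where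
  "module_tuple_norm H E n \<eta> =
     sqrt (opnorm H H (\<lambda>h\<in>carrier H. \<Oplus>\<^bsub>H\<^esub>i\<in>{..<n}. ip E (\<eta> i) (\<eta> i) h))"

definition alg_tuple_norm :: "'h hspace \<Rightarrow> nat \<Rightarrow> (nat \<Rightarrow> 'h \<Rightarrow> 'h) \<Rightarrow> real" where
  "alg_tuple_norm H n a =
     sqrt (opnorm H H (\<lambda>h\<in>carrier H. \<Oplus>\<^bsub>H\<^esub>j\<in>{..<n}. adj H H (a j) (a j h)))"

definition module_matrix_norm :: "'h hspace \<Rightarrow> ('h \<Rightarrow> 'h) set \<Rightarrow>
    ('h \<Rightarrow> 'h, 'e, 'z) corr_scheme \<Rightarrow> nat \<Rightarrow> (nat \<Rightarrow> nat \<Rightarrow> 'e) \<Rightarrow> real" where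
  "module_matrix_norm H N E n \<xi> = Inf {C. 0 \<le> C \<and> (\<forall>a. (\<forall>j<n. a j \<in> N) \<longrightarrow>
     module_tuple_norm H E n (\<lambda>i. \<Oplus>\<^bsub>E\<^esub>j\<in>{..<n}. ract E (\<xi> i j) (a j))
       \<le> C * alg_tuple_norm H n a)}"

definition op_matrix_norm :: "'h hspace \<Rightarrow> nat \<Rightarrow> (nat \<Rightarrow> nat \<Rightarrow> 'h \<Rightarrow> 'h) \<Rightarrow> real" where
  "op_matrix_norm H n A = Inf {C. 0 \<le> C \<and> (\<forall>h. (\<forall>j<n. h j \<in> carrier H) \<longrightarrow>
     sqrt (\<Sum>i<n. (hnorm H (\<Oplus>\<^bsub>H\<^esub>j\<in>{..<n}. A i j (h j)))\<^sup>2) \<le> C * sqrt (\<Sum>j<n. (hnorm H (h j))\<^sup>2))}"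

text \<open>\<open>T\<close> together with the identity representation of \<open>N\<close> on \<open>H\<close>.\<close>

definition cc_rep :: "'h hspace \<Rightarrow> ('h \<Rightarrow> 'h) set \<Rightarrow> ('h \<Rightarrow> 'h, 'e, 'z) corr_scheme \<Rightarrow>
    ('e \<Rightarrow> 'h \<Rightarrow> 'h) \<Rightarrow> bool" where
  "cc_rep H N E T \<longleftrightarrow> T \<in> carrier E \<rightarrow> bop H H \<and>
     (\<forall>\<xi>\<in>carrier E. \<forall>\<eta>\<in>carrier E. T (\<xi> \<oplus>\<^bsub>E\<^esub> \<eta>) = op_add H H (T \<xi>) (T \<eta>)) \<and>
     (\<forall>c. \<forall>\<xi>\<in>carrier E. T (c \<odot>\<^bsub>E\<^esub> \<xi>) = op_smult H H c (T \<xi>)) \<and>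
     (\<forall>n \<xi>. (\<forall>i<n. \<forall>j<n. \<xi> i j \<in> carrier E) \<longrightarrow>
        op_matrix_norm H n (\<lambda>i j. T (\<xi> i j)) \<le> module_matrix_norm H N E n \<xi>) \<and>
     (\<forall>a\<in>N. \<forall>b\<in>N. \<forall>\<xi>\<in>carrier E. T (ract E (lact E a \<xi>) b) =
        compose (carrier H) a (compose (carrier H) (T \<xi>) b))"

definition tilde :: "'h hspace \<Rightarrow> ('h \<Rightarrow> 'h, 'e, 'z) corr_scheme \<Rightarrow> ('e \<Rightarrow> 'h \<Rightarrow> 'h) \<Rightarrow>
    ('e \<times> 'h) hcompl \<Rightarrow> 'h" where
  "tilde H E T = op_ext (htensor E H id) H (carrier E \<times> carrier H)
     (\<lambda>(\<xi>, h). hten E H id \<xi> h) (\<lambda>(\<xi>, h). T \<xi> h)"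

definition cc_product_rep :: "'h hspace \<Rightarrow> ('h \<Rightarrow> 'h) set \<Rightarrow>
    ('h \<Rightarrow> 'h, 'e) corr \<Rightarrow> ('h \<Rightarrow> 'h, 'f) corr \<Rightarrow> ('h \<Rightarrow> 'h, 'p, 'e, 'f) corr_tensor \<Rightarrow>
    ('h \<Rightarrow> 'h, 'q, 'f, 'e) corr_tensor \<Rightarrow> ('p \<Rightarrow> 'q) \<Rightarrow>
    ('e \<Rightarrow> 'h \<Rightarrow> 'h) \<Rightarrow> ('f \<Rightarrow> 'h \<Rightarrow> 'h) \<Rightarrow> bool" where
  "cc_product_rep H N E F EF FE t T S \<longleftrightarrow> cc_rep H N E T \<and> cc_rep H N F S \<and>
     (\<forall>x\<in>carrier (htensor2 E F H).
        tilde H E T (id_hten E (htensor F H id) (hten_rep F H) H id (tilde H F S) x) =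
        tilde H F S (id_hten F (htensor E H id) (hten_rep E H) H id (tilde H E T)
          (flip_hten H E F EF FE t x)))"

definition cp_map :: "'h hspace \<Rightarrow> ('h \<Rightarrow> 'h) set \<Rightarrow> ('h \<Rightarrow> 'h, 'e, 'z) corr_scheme \<Rightarrow>
    ('e \<Rightarrow> 'h \<Rightarrow> 'h) \<Rightarrow> ('h \<Rightarrow> 'h) \<Rightarrow> 'h \<Rightarrow> 'h" where
  "cp_map H M E T = (\<lambda>a\<in>M. \<lambda>h\<in>carrier H.
     tilde H E T (id_hten E H id H id a (adj (htensor E H id) H (tilde H E T) h)))"


section \<open>The correspondence of a completely positive map\<close>

text \<open>\<open>stine H M \<Theta>\<close> is the Hilbert space \<open>M \<otimes>\<^sub>\<Theta> H\<close>, and \<open>stine_elem\<close> its elementary tensors.\<close>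

definition stine_ker :: "'h hspace \<Rightarrow> (('h \<Rightarrow> 'h) \<Rightarrow> 'h \<Rightarrow> 'h) \<Rightarrow>
    ('h \<Rightarrow> 'h) \<times> 'h \<Rightarrow> ('h \<Rightarrow> 'h) \<times> 'h \<Rightarrow> complex" where
  "stine_ker H \<Theta> = (\<lambda>(a, h) (b, k). cinner H h (\<Theta> (compose (carrier H) (adj H H a) b) k))"

definition stine :: "'h hspace \<Rightarrow> ('h \<Rightarrow> 'h) set \<Rightarrow> (('h \<Rightarrow> 'h) \<Rightarrow> 'h \<Rightarrow> 'h) \<Rightarrow>
    (('h \<Rightarrow> 'h) \<times> 'h) hcompl hspace" where
  "stine H M \<Theta> = hcompletion (M \<times> carrier H) (stine_ker H \<Theta>)"

definition stine_elem :: "'h hspace \<Rightarrow> ('h \<Rightarrow> 'h) set \<Rightarrow> (('h \<Rightarrow> 'h) \<Rightarrow> 'h \<Rightarrow> 'h) \<Rightarrow>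
    ('h \<Rightarrow> 'h) \<Rightarrow> 'h \<Rightarrow> (('h \<Rightarrow> 'h) \<times> 'h) hcompl" where
  "stine_elem H M \<Theta> a h = hcompl_elem (M \<times> carrier H) (stine_ker H \<Theta>) (a, h)"

definition stine_left :: "'h hspace \<Rightarrow> ('h \<Rightarrow> 'h) set \<Rightarrow> (('h \<Rightarrow> 'h) \<Rightarrow> 'h \<Rightarrow> 'h) \<Rightarrow>
    ('h \<Rightarrow> 'h) \<Rightarrow> (('h \<Rightarrow> 'h) \<times> 'h) hcompl \<Rightarrow> (('h \<Rightarrow> 'h) \<times> 'h) hcompl" where
  "stine_left H M \<Theta> a = op_ext (stine H M \<Theta>) (stine H M \<Theta>) (M \<times> carrier H)
     (\<lambda>(b, h). stine_elem H M \<Theta> b h) (\<lambda>(b, h). stine_elem H M \<Theta> (compose (carrier H) a b) h)"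

definition stine_right :: "'h hspace \<Rightarrow> ('h \<Rightarrow> 'h) set \<Rightarrow> (('h \<Rightarrow> 'h) \<Rightarrow> 'h \<Rightarrow> 'h) \<Rightarrow>
    ('h \<Rightarrow> 'h) \<Rightarrow> (('h \<Rightarrow> 'h) \<times> 'h) hcompl \<Rightarrow> (('h \<Rightarrow> 'h) \<times> 'h) hcompl" where
  "stine_right H M \<Theta> d = op_ext (stine H M \<Theta>) (stine H M \<Theta>) (M \<times> carrier H)
     (\<lambda>(b, h). stine_elem H M \<Theta> b h) (\<lambda>(b, h). stine_elem H M \<Theta> b (d h))"

text \<open>
  The operators from \<open>H\<close> to \<open>K\<close> intertwining the identity representation of \<open>M\<close> with a
  representation \<open>\<pi>\<close> on \<open>K\<close>, as a correspondence over the commutant of \<open>M\<close>, which acts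
  on \<open>K\<close> by \<open>\<rho>\<close>.
\<close>

definition intertwiners :: "'h hspace \<Rightarrow> ('h \<Rightarrow> 'h) set \<Rightarrow> 'k hspace \<Rightarrow>
    (('h \<Rightarrow> 'h) \<Rightarrow> 'k \<Rightarrow> 'k) \<Rightarrow> (('h \<Rightarrow> 'h) \<Rightarrow> 'k \<Rightarrow> 'k) \<Rightarrow> ('h \<Rightarrow> 'h, 'h \<Rightarrow> 'k) corr" where
  "intertwiners H M K \<pi> \<rho> =
    \<lparr>carrier = {R \<in> bop H K. \<forall>a\<in>M. compose (carrier H) R a = compose (carrier H) (\<pi> a) R},
     monoid.mult = undefined,
     monoid.one = undefined,
     ring.zero = op_zero H K,
     ring.add = op_add H K,
     module.smult = op_smult H K,
     ract = (\<lambda>R d. compose (carrier H) R d),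
     lact = (\<lambda>d R. compose (carrier H) (\<rho> d) R),
     ip = (\<lambda>R\<^sub>1 R\<^sub>2. compose (carrier H) (adj H K R\<^sub>1) R\<^sub>2)\<rparr>"

definition cp_corr :: "'h hspace \<Rightarrow> ('h \<Rightarrow> 'h) set \<Rightarrow> (('h \<Rightarrow> 'h) \<Rightarrow> 'h \<Rightarrow> 'h) \<Rightarrow>
    ('h \<Rightarrow> 'h, 'h \<Rightarrow> (('h \<Rightarrow> 'h) \<times> 'h) hcompl) corr" where
  "cp_corr H M \<Theta> = intertwiners H M (stine H M \<Theta>) (stine_left H M \<Theta>) (stine_right H M \<Theta>)"

definition cp_rep :: "'h hspace \<Rightarrow> ('h \<Rightarrow> 'h) set \<Rightarrow> (('h \<Rightarrow> 'h) \<Rightarrow> 'h \<Rightarrow> 'h) \<Rightarrow>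
    ('h \<Rightarrow> (('h \<Rightarrow> 'h) \<times> 'h) hcompl) \<Rightarrow> 'h \<Rightarrow> 'h" where
  "cp_rep H M \<Theta> R =
     compose (carrier H) (adj H (stine H M \<Theta>) (\<lambda>h\<in>carrier H. stine_elem H M \<Theta> (op_one H) h)) R"


section \<open>The isomorphism belonging to a pair of completely positive maps\<close>

text \<open>\<open>stine2 H M \<Phi> \<Theta>\<close> is the Hilbert space \<open>M \<otimes>\<^sub>\<Phi> M \<otimes>\<^sub>\<Theta> H\<close>.\<close>

definition stine2_ker :: "'h hspace \<Rightarrow> (('h \<Rightarrow> 'h) \<Rightarrow> 'h \<Rightarrow> 'h) \<Rightarrow> (('h \<Rightarrow> 'h) \<Rightarrow> 'h \<Rightarrow> 'h) \<Rightarrow>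
    ('h \<Rightarrow> 'h) \<times> ('h \<Rightarrow> 'h) \<times> 'h \<Rightarrow> ('h \<Rightarrow> 'h) \<times> ('h \<Rightarrow> 'h) \<times> 'h \<Rightarrow> complex" where
  "stine2_ker H \<Phi> \<Theta> = (\<lambda>(a\<^sub>1, b\<^sub>1, h\<^sub>1) (a\<^sub>2, b\<^sub>2, h\<^sub>2). cinner H h\<^sub>1
     (\<Theta> (compose (carrier H) (adj H H b\<^sub>1)
       (compose (carrier H) (\<Phi> (compose (carrier H) (adj H H a\<^sub>1) a\<^sub>2)) b\<^sub>2)) h\<^sub>2))"

definition stine2 :: "'h hspace \<Rightarrow> ('h \<Rightarrow> 'h) set \<Rightarrow>
    (('h \<Rightarrow> 'h) \<Rightarrow> 'h \<Rightarrow> 'h) \<Rightarrow> (('h \<Rightarrow> 'h) \<Rightarrow> 'h \<Rightarrow> 'h) \<Rightarrow>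
    (('h \<Rightarrow> 'h) \<times> ('h \<Rightarrow> 'h) \<times> 'h) hcompl hspace" where
  "stine2 H M \<Phi> \<Theta> = hcompletion (M \<times> M \<times> carrier H) (stine2_ker H \<Phi> \<Theta>)"

definition stine2_elem :: "'h hspace \<Rightarrow> ('h \<Rightarrow> 'h) set \<Rightarrow>
    (('h \<Rightarrow> 'h) \<Rightarrow> 'h \<Rightarrow> 'h) \<Rightarrow> (('h \<Rightarrow> 'h) \<Rightarrow> 'h \<Rightarrow> 'h) \<Rightarrow>
    ('h \<Rightarrow> 'h) \<Rightarrow> ('h \<Rightarrow> 'h) \<Rightarrow> 'h \<Rightarrow> (('h \<Rightarrow> 'h) \<times> ('h \<Rightarrow> 'h) \<times> 'h) hcompl" where
  "stine2_elem H M \<Phi> \<Theta> a b h = hcompl_elem (M \<times> M \<times> carrier H) (stine2_ker H \<Phi> \<Theta>) (a, b, h)"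

definition stine2_left :: "'h hspace \<Rightarrow> ('h \<Rightarrow> 'h) set \<Rightarrow>
    (('h \<Rightarrow> 'h) \<Rightarrow> 'h \<Rightarrow> 'h) \<Rightarrow> (('h \<Rightarrow> 'h) \<Rightarrow> 'h \<Rightarrow> 'h) \<Rightarrow> ('h \<Rightarrow> 'h) \<Rightarrow>
    (('h \<Rightarrow> 'h) \<times> ('h \<Rightarrow> 'h) \<times> 'h) hcompl \<Rightarrow> (('h \<Rightarrow> 'h) \<times> ('h \<Rightarrow> 'h) \<times> 'h) hcompl" where
  "stine2_left H M \<Phi> \<Theta> c = op_ext (stine2 H M \<Phi> \<Theta>) (stine2 H M \<Phi> \<Theta>) (M \<times> M \<times> carrier H)
     (\<lambda>(a, b, h). stine2_elem H M \<Phi> \<Theta> a b h)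
     (\<lambda>(a, b, h). stine2_elem H M \<Phi> \<Theta> (compose (carrier H) c a) b h)"

definition stine2_right :: "'h hspace \<Rightarrow> ('h \<Rightarrow> 'h) set \<Rightarrow>
    (('h \<Rightarrow> 'h) \<Rightarrow> 'h \<Rightarrow> 'h) \<Rightarrow> (('h \<Rightarrow> 'h) \<Rightarrow> 'h \<Rightarrow> 'h) \<Rightarrow> ('h \<Rightarrow> 'h) \<Rightarrow>
    (('h \<Rightarrow> 'h) \<times> ('h \<Rightarrow> 'h) \<times> 'h) hcompl \<Rightarrow> (('h \<Rightarrow> 'h) \<times> ('h \<Rightarrow> 'h) \<times> 'h) hcompl" where
  "stine2_right H M \<Phi> \<Theta> d = op_ext (stine2 H M \<Phi> \<Theta>) (stine2 H M \<Phi> \<Theta>) (M \<times> M \<times> carrier H)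
     (\<lambda>(a, b, h). stine2_elem H M \<Phi> \<Theta> a b h)
     (\<lambda>(a, b, h). stine2_elem H M \<Phi> \<Theta> a b (d h))"

definition cp_corr2 :: "'h hspace \<Rightarrow> ('h \<Rightarrow> 'h) set \<Rightarrow>
    (('h \<Rightarrow> 'h) \<Rightarrow> 'h \<Rightarrow> 'h) \<Rightarrow> (('h \<Rightarrow> 'h) \<Rightarrow> 'h \<Rightarrow> 'h) \<Rightarrow>
    ('h \<Rightarrow> 'h, 'h \<Rightarrow> (('h \<Rightarrow> 'h) \<times> ('h \<Rightarrow> 'h) \<times> 'h) hcompl) corr" where
  "cp_corr2 H M \<Phi> \<Theta> =
     intertwiners H M (stine2 H M \<Phi> \<Theta>) (stine2_left H M \<Phi> \<Theta>) (stine2_right H M \<Phi> \<Theta>)"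

text \<open>
  For \<open>x\<close> in \<open>M \<otimes>\<^sub>\<Theta> H\<close>, \<open>stine_insert H M \<Phi> \<Theta> a x\<close> is the vector \<open>a \<otimes>\<^sub>\<Phi> x\<close> of
  \<open>M \<otimes>\<^sub>\<Phi> M \<otimes>\<^sub>\<Theta> H\<close>; with it \<open>stine_map\<close> is \<open>I\<^sub>M \<otimes> R\<close>.
\<close>

definition stine_insert :: "'h hspace \<Rightarrow> ('h \<Rightarrow> 'h) set \<Rightarrow>
    (('h \<Rightarrow> 'h) \<Rightarrow> 'h \<Rightarrow> 'h) \<Rightarrow> (('h \<Rightarrow> 'h) \<Rightarrow> 'h \<Rightarrow> 'h) \<Rightarrow> ('h \<Rightarrow> 'h) \<Rightarrow>
    (('h \<Rightarrow> 'h) \<times> 'h) hcompl \<Rightarrow> (('h \<Rightarrow> 'h) \<times> ('h \<Rightarrow> 'h) \<times> 'h) hcompl" where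
  "stine_insert H M \<Phi> \<Theta> a = op_ext (stine H M \<Theta>) (stine2 H M \<Phi> \<Theta>) (M \<times> carrier H)
     (\<lambda>(b, h). stine_elem H M \<Theta> b h) (\<lambda>(b, h). stine2_elem H M \<Phi> \<Theta> a b h)"

definition stine_map :: "'h hspace \<Rightarrow> ('h \<Rightarrow> 'h) set \<Rightarrow>
    (('h \<Rightarrow> 'h) \<Rightarrow> 'h \<Rightarrow> 'h) \<Rightarrow> (('h \<Rightarrow> 'h) \<Rightarrow> 'h \<Rightarrow> 'h) \<Rightarrow>
    ('h \<Rightarrow> (('h \<Rightarrow> 'h) \<times> 'h) hcompl) \<Rightarrow>
    (('h \<Rightarrow> 'h) \<times> 'h) hcompl \<Rightarrow> (('h \<Rightarrow> 'h) \<times> ('h \<Rightarrow> 'h) \<times> 'h) hcompl" where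
  "stine_map H M \<Phi> \<Theta> R = op_ext (stine H M \<Phi>) (stine2 H M \<Phi> \<Theta>) (M \<times> carrier H)
     (\<lambda>(a, h). stine_elem H M \<Phi> a h) (\<lambda>(a, h). stine_insert H M \<Phi> \<Theta> a (R h))"

text \<open>
  \<open>cp_Gamma H M \<Phi> \<Theta> P\<close> is the isomorphism \<open>\<Gamma>\<^sub>\<Phi>\<^sub>,\<^sub>\<Theta>\<close> defined on the tensor product \<open>P\<close> of the
  correspondences of \<open>\<Theta>\<close> and of \<open>\<Phi>\<close>, in this order.
\<close>

definition cp_Gamma :: "'h hspace \<Rightarrow> ('h \<Rightarrow> 'h) set \<Rightarrow>
    (('h \<Rightarrow> 'h) \<Rightarrow> 'h \<Rightarrow> 'h) \<Rightarrow> (('h \<Rightarrow> 'h) \<Rightarrow> 'h \<Rightarrow> 'h) \<Rightarrow>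
    ('h \<Rightarrow> 'h, 'p, 'h \<Rightarrow> (('h \<Rightarrow> 'h) \<times> 'h) hcompl, 'h \<Rightarrow> (('h \<Rightarrow> 'h) \<times> 'h) hcompl) corr_tensor \<Rightarrow>
    'p \<Rightarrow> 'h \<Rightarrow> (('h \<Rightarrow> 'h) \<times> ('h \<Rightarrow> 'h) \<times> 'h) hcompl" where
  "cp_Gamma H M \<Phi> \<Theta> P = (THE g. corr_iso (commutant H M) P (cp_corr2 H M \<Phi> \<Theta>) g \<and>
     (\<forall>R\<in>carrier (cp_corr H M \<Theta>). \<forall>Y\<in>carrier (cp_corr H M \<Phi>).
        g (tens P R Y) = compose (carrier H) (stine_map H M \<Phi> \<Theta> R) Y))"

text \<open>
  For \<open>\<Theta>\<close> and \<open>\<Phi>\<close> given by \<open>(E, T)\<close> and \<open>(F, S)\<close>, \<open>cp_Lambda H M E F T S \<Theta> \<Phi>\<close> is the unitary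
  \<open>\<Lambda>\<^sub>\<Phi>\<^sub>,\<^sub>\<Theta>\<close> from \<open>M \<otimes>\<^sub>\<Phi> M \<otimes>\<^sub>\<Theta> H\<close> to \<open>E \<otimes> F \<otimes> H\<close>; interchanging the roles of the two pairs
  gives \<open>\<Lambda>\<^sub>\<Theta>\<^sub>,\<^sub>\<Phi>\<close>.
\<close>

definition cp_Lambda :: "'h hspace \<Rightarrow> ('h \<Rightarrow> 'h) set \<Rightarrow>
    ('h \<Rightarrow> 'h, 'e) corr \<Rightarrow> ('h \<Rightarrow> 'h, 'f) corr \<Rightarrow> ('e \<Rightarrow> 'h \<Rightarrow> 'h) \<Rightarrow> ('f \<Rightarrow> 'h \<Rightarrow> 'h) \<Rightarrow>
    (('h \<Rightarrow> 'h) \<Rightarrow> 'h \<Rightarrow> 'h) \<Rightarrow> (('h \<Rightarrow> 'h) \<Rightarrow> 'h \<Rightarrow> 'h) \<Rightarrow>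
    (('h \<Rightarrow> 'h) \<times> ('h \<Rightarrow> 'h) \<times> 'h) hcompl \<Rightarrow> ('e \<times> ('f \<times> 'h) hcompl) hcompl" where
  "cp_Lambda H M E F T S \<Theta> \<Phi> = op_ext (stine2 H M \<Phi> \<Theta>) (htensor2 E F H) (M \<times> M \<times> carrier H)
     (\<lambda>(a, b, h). stine2_elem H M \<Phi> \<Theta> a b h)
     (\<lambda>(a, b, h). id_hten E H id (htensor F H id) (hten_rep F H)
        (\<lambda>k\<in>carrier H. id_hten F H id H id a (adj (htensor F H id) H (tilde H F S) (b k)))
        (adj (htensor E H id) H (tilde H E T) h))"

definition cp_u :: "'h hspace \<Rightarrow> ('h \<Rightarrow> 'h) set \<Rightarrow>
    ('h \<Rightarrow> 'h, 'e) corr \<Rightarrow> ('h \<Rightarrow> 'h, 'f) corr \<Rightarrow> ('h \<Rightarrow> 'h, 'p, 'e, 'f) corr_tensor \<Rightarrow>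
    ('h \<Rightarrow> 'h, 'q, 'f, 'e) corr_tensor \<Rightarrow> ('p \<Rightarrow> 'q) \<Rightarrow>
    ('e \<Rightarrow> 'h \<Rightarrow> 'h) \<Rightarrow> ('f \<Rightarrow> 'h \<Rightarrow> 'h) \<Rightarrow>
    (('h \<Rightarrow> 'h) \<Rightarrow> 'h \<Rightarrow> 'h) \<Rightarrow> (('h \<Rightarrow> 'h) \<Rightarrow> 'h \<Rightarrow> 'h) \<Rightarrow>
    (('h \<Rightarrow> 'h) \<times> ('h \<Rightarrow> 'h) \<times> 'h) hcompl \<Rightarrow> (('h \<Rightarrow> 'h) \<times> ('h \<Rightarrow> 'h) \<times> 'h) hcompl" where
  "cp_u H M E F EF FE t T S \<Theta> \<Phi> = (\<lambda>x\<in>carrier (stine2 H M \<Phi> \<Theta>).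
     the_inv_into (carrier (stine2 H M \<Theta> \<Phi>)) (cp_Lambda H M F E S T \<Phi> \<Theta>)
       (flip_hten H E F EF FE t (cp_Lambda H M E F T S \<Theta> \<Phi> x)))"

text \<open>
  The map \<open>t\<^sub>\<Theta>\<^sub>,\<^sub>\<Phi>\<close> from \<open>P\<close>, the tensor product of the correspondences of \<open>\<Theta>\<close> and \<open>\<Phi>\<close>,
  to \<open>Q\<close>, their tensor product in the opposite order.
\<close>

definition cp_t :: "'h hspace \<Rightarrow> ('h \<Rightarrow> 'h) set \<Rightarrow>
    ('h \<Rightarrow> 'h, 'e) corr \<Rightarrow> ('h \<Rightarrow> 'h, 'f) corr \<Rightarrow> ('h \<Rightarrow> 'h, 'p, 'e, 'f) corr_tensor \<Rightarrow>
    ('h \<Rightarrow> 'h, 'q, 'f, 'e) corr_tensor \<Rightarrow> ('p \<Rightarrow> 'q) \<Rightarrow>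
    ('e \<Rightarrow> 'h \<Rightarrow> 'h) \<Rightarrow> ('f \<Rightarrow> 'h \<Rightarrow> 'h) \<Rightarrow>
    (('h \<Rightarrow> 'h) \<Rightarrow> 'h \<Rightarrow> 'h) \<Rightarrow> (('h \<Rightarrow> 'h) \<Rightarrow> 'h \<Rightarrow> 'h) \<Rightarrow>
    ('h \<Rightarrow> 'h, 'r, 'h \<Rightarrow> (('h \<Rightarrow> 'h) \<times> 'h) hcompl, 'h \<Rightarrow> (('h \<Rightarrow> 'h) \<times> 'h) hcompl) corr_tensor \<Rightarrow>
    ('h \<Rightarrow> 'h, 's, 'h \<Rightarrow> (('h \<Rightarrow> 'h) \<times> 'h) hcompl, 'h \<Rightarrow> (('h \<Rightarrow> 'h) \<times> 'h) hcompl) corr_tensor \<Rightarrow>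
    'r \<Rightarrow> 's" where
  "cp_t H M E F EF FE t T S \<Theta> \<Phi> P Q = (\<lambda>p\<in>carrier P.
     the_inv_into (carrier Q) (cp_Gamma H M \<Theta> \<Phi> Q)
       (compose (carrier H) (cp_u H M E F EF FE t T S \<Theta> \<Phi>) (cp_Gamma H M \<Phi> \<Theta> P p)))"

end

theory Submission
  imports Defs
begin

text \<open>
  Let \<open>N\<close> be the algebra over which \<open>E\<close> and \<open>F\<close> are correspondences; its commutant, written \<open>M'\<close> in the
  locales below, is the algebra \<open>M\<close> of the theorem. The proof takes place in the picture of intertwiners.
  An element \<open>\<xi>\<close> of \<open>E\<close> is seen as the operator \<open>h \<mapsto> \<xi> \<otimes> h\<close> from \<open>H\<close> to \<open>E \<otimes> H\<close>. Self-duality says that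
  these are all the operators intertwining the actions of \<open>M\<close>: for such an operator \<open>R\<close> the map
  \<open>\<eta> \<mapsto> R\<^sup>* (\<eta> \<otimes> \<cdot>)\<close> is a bounded module map into \<open>N\<close>, represented by an element of \<open>E\<close>
  (\<open>intertwiner_represented\<close>). So a Hilbert space with commuting actions of \<open>M\<close> and \<open>N\<close> which is
  unitarily equivalent to \<open>E \<otimes> H\<close> determines \<open>E\<close> as its correspondence of intertwiners
  (\<open>intertwiner_model\<close>), and all the isomorphisms of the theorem come from unitaries.

  Write \<open>T\<close> also for the induced map from \<open>E \<otimes> H\<close> to \<open>H\<close>.
  By definition of \<open>\<Theta>\<close> the map \<open>a \<otimes> h \<mapsto> (I \<otimes> a) T\<^sup>* h\<close> is an isometry \<open>V\<close> from \<open>M \<otimes>\<^sub>\<Theta> H\<close> to \<open>E \<otimes> H\<close>.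
  It is onto: the projection onto the complement of its range commutes with \<open>M\<close>, so it maps \<open>\<xi> \<otimes> h\<close>
  to \<open>\<zeta> \<otimes> h\<close> for some \<open>\<zeta>\<close> in \<open>E\<close>; since \<open>T\<^sup>*\<close> takes its values in the range, \<open>T \<zeta> = 0\<close>, and \<open>\<zeta> = 0\<close>
  because \<open>T\<close> is injective (\<open>intertwining_isometry_onto\<close>, \<open>V_onto\<close>). Therefore \<open>E\<^sub>\<Theta>\<close> is a copy of \<open>E\<close>,
  which is the isomorphism \<open>w\<^sub>E\<close>, and \<open>T \<circ> w\<^sub>E = T\<^sub>\<Theta>\<close> because \<open>V\<close> maps \<open>I \<otimes> h\<close> to \<open>T\<^sup>* h\<close>.

  The same argument identifies \<open>P \<otimes> H\<close> with \<open>E \<otimes> (F \<otimes> H)\<close> for a tensor product \<open>P\<close> of \<open>E\<close> and \<open>F\<close>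
  (\<open>J_onto\<close>); hence tensor products are unique, and \<open>w\<^sub>E \<otimes> w\<^sub>F\<close> exists. Finally \<open>\<Lambda>\<close> is a unitary from
  \<open>M \<otimes>\<^sub>\<Phi> M \<otimes>\<^sub>\<Theta> H\<close> to \<open>E \<otimes> F \<otimes> H\<close> (\<open>Lam_onto\<close>), so this space is a model of \<open>E \<otimes> F\<close>; the map \<open>\<Gamma>\<close> is the
  passage from \<open>E\<^sub>\<Theta> \<otimes> E\<^sub>\<Phi>\<close> to the intertwiners of this model (\<open>cp_tensor\<close>), and \<open>u\<close> was defined so that it
  acts as \<open>t\<close> there (\<open>u_g\<close>). This is the exchange relation.

  The analytic work is to see that the operators in question exist. Positivity of the form on
  \<open>E \<otimes> H\<close> and boundedness of \<open>I \<otimes> A\<close> and of the left action follow from one estimate for the orbit of a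
  vector under a symmetric operator (\<open>symmetric_orbit_bound\<close>), which stands in for spectral theory. That
  \<open>T\<close> induces a contraction on \<open>E \<otimes> H\<close> is more delicate, since complete contractivity only compares
  \<open>T\<close> with matrices over \<open>E\<close>; the passage to vectors is \<open>domination_by_compression\<close>.
\<close>


section \<open>Vectors, operators and adjoints\<close>

lemma complex_field_simps [simp]:
  "carrier complex_field = UNIV" "a \<oplus>\<^bsub>complex_field\<^esub> b = a + b"
  "a \<otimes>\<^bsub>complex_field\<^esub> b = a * b" "\<one>\<^bsub>complex_field\<^esub> = 1" "\<zero>\<^bsub>complex_field\<^esub> = 0"
  by (simp_all add: ring_of_type_algebra_def)

lemma complex_field_cring: "cring complex_field"
  by (rule cring_from_type_algebra)

lemma le_of_square_le:
  fixes a b :: real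
  assumes "a * a \<le> a * b" "0 \<le> a" "0 \<le> b"
  shows "a \<le> b"
  using assms by (cases "a = 0") simp_all

lemma compose_eqD: "compose A f g = compose A f' g' \<Longrightarrow> x \<in> A \<Longrightarrow> f (g x) = f' (g' x)"
  by (metis compose_eq)

lemma compose_eqD': "compose A f g = h \<Longrightarrow> x \<in> A \<Longrightarrow> f (g x) = h x"
  by (metis compose_eq)

lemma null_comparison:
  fixes f :: "nat \<Rightarrow> 'a :: real_normed_vector" and g :: "nat \<Rightarrow> real"
  assumes "\<And>n. norm (f n) \<le> g n" "g \<longlonglongrightarrow> 0"
  shows "f \<longlonglongrightarrow> 0"
  by (rule tendsto_0_le[OF assms(2), of f 1])
    (use assms(1) order_trans[OF assms(1) abs_ge_self] in \<open>auto intro!: always_eventually\<close>)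

text \<open>The discriminant argument, used for inner products and for positive semi-definite forms alike.\<close>

lemma cauchy_schwarz_scalar:
  assumes "0 \<le> a" "0 \<le> d" and pos: "\<And>c. 0 \<le> a + 2 * Re (c * b) + (cmod c)\<^sup>2 * d"
  shows "(cmod b)\<^sup>2 \<le> a * d"
proof (cases "d = 0")
  case True
  have "b = 0"
  proof (rule ccontr)
    assume b: "b \<noteq> 0"
    \<comment> \<open>\<open>c = - s \<cdot> cnj b\<close> turns the left-hand side of \<open>pos\<close> into \<open>-1\<close>.\<close>
    define s where "s = (a + 1) / (2 * (cmod b)\<^sup>2)"
    have "Re (cnj b * b) = (cmod b)\<^sup>2"
      by (metis Re_complex_of_real complex_norm_square mult.commute)
    then have "Re (- of_real s * cnj b * b) = - s * (cmod b)\<^sup>2"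
      by (simp add: mult.assoc)
    then have "0 \<le> a + 2 * (- s * (cmod b)\<^sup>2)"
      using pos[of "- of_real s * cnj b"] True by simp
    then show False
      using b by (simp add: s_def)
  qed
  then show ?thesis using True by simp
next
  case False
  then have d: "d > 0" using assms by simp
  define c where "c = - cnj b / of_real d"
  have "c * b = of_real (- (cmod b)\<^sup>2 / d)"
    using complex_norm_square[of b] by (simp add: c_def mult.commute)
  then have "Re (c * b) = - (cmod b)\<^sup>2 / d" by (metis Re_complex_of_real)
  moreover have "(cmod c)\<^sup>2 * d = (cmod b)\<^sup>2 / d"
    using d by (simp add: c_def norm_divide power_divide power2_eq_square)
  ultimately have "0 \<le> a - (cmod b)\<^sup>2 / d"
    using pos[of c] by simp
  then show ?thesis using d by (simp add: field_simps)
qed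

lemma module_complexI:
  fixes V (structure)
  assumes "\<And>x y. x \<in> carrier V \<Longrightarrow> y \<in> carrier V \<Longrightarrow> x \<oplus> y \<in> carrier V"
    "\<zero> \<in> carrier V"
    "\<And>c x. x \<in> carrier V \<Longrightarrow> c \<odot> x \<in> carrier V"
    "\<And>x y z. x \<in> carrier V \<Longrightarrow> y \<in> carrier V \<Longrightarrow> z \<in> carrier V \<Longrightarrow> (x \<oplus> y) \<oplus> z = x \<oplus> (y \<oplus> z)"
    "\<And>x y. x \<in> carrier V \<Longrightarrow> y \<in> carrier V \<Longrightarrow> x \<oplus> y = y \<oplus> x"
    "\<And>x. x \<in> carrier V \<Longrightarrow> \<zero> \<oplus> x = x"
    "\<And>x. x \<in> carrier V \<Longrightarrow> (-1) \<odot> x \<oplus> x = \<zero>"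
    "\<And>a b x. x \<in> carrier V \<Longrightarrow> (a + b) \<odot> x = a \<odot> x \<oplus> b \<odot> x"
    "\<And>a x y. x \<in> carrier V \<Longrightarrow> y \<in> carrier V \<Longrightarrow> a \<odot> (x \<oplus> y) = a \<odot> x \<oplus> a \<odot> y"
    "\<And>a b x. x \<in> carrier V \<Longrightarrow> (a * b) \<odot> x = a \<odot> (b \<odot> x)"
    "\<And>x. x \<in> carrier V \<Longrightarrow> 1 \<odot> x = x"
  shows "Module.module complex_field V"
proof (rule moduleI)
  show "abelian_group V"
  proof (rule abelian_groupI)
    fix x assume "x \<in> carrier V"
    then show "\<exists>y\<in>carrier V. y \<oplus> x = \<zero>"
      using assms(3,7) by (intro bexI[of _ "(-1) \<odot> x"])
  qed (rule assms; assumption)+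
qed (use assms in \<open>auto intro: complex_field_cring\<close>)

lemma module_diff_eq:
  fixes V (structure)
  assumes "Module.module complex_field V" "x \<in> carrier V" "y \<in> carrier V"
  shows "x \<ominus> y = x \<oplus> (-1) \<odot> y"
proof -
  interpret Module.module complex_field V by fact
  have "(-1) \<odot> y \<oplus> y = (-1 + 1) \<odot> y"
    using assms(3) smult_l_distr[of "-1" 1 y] smult_one[of y] by simp
  also have "\<dots> = \<zero>" using assms(3) smult_l_null by simp
  finally have "\<ominus> y = (-1) \<odot> y" using assms(3) smult_closed[of "-1" y]
    using M.minus_equality[of "(-1) \<odot> y" y] by simp
  then show ?thesis by (simp add: a_minus_def)
qed

context hilbert_space begin

lemma add_closed
 [simp]: "x \<in> carrier H \<Longrightarrow> y \<in> carrier H \<Longrightarrow> x \<oplus> y \<in> carrier H"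
  by (rule M.a_closed)

lemma scale_closed [simp]: "x \<in> carrier H \<Longrightarrow> c \<odot> x \<in> carrier H"
  using smult_closed by simp

lemma zero_vec_closed [simp]: "\<zero> \<in> carrier H"
  by simp

lemma diff_eq: "x \<in> carrier H \<Longrightarrow> y \<in> carrier H \<Longrightarrow> x \<ominus> y = x \<oplus> (-1) \<odot> y"
  by (rule module_diff_eq[OF module_axioms])

lemma diff_closed [simp]: "x \<in> carrier H \<Longrightarrow> y \<in> carrier H \<Longrightarrow> x \<ominus> y \<in> carrier H"
  by (simp add: diff_eq)

lemma scale_zero [simp]: "c \<odot> \<zero> = \<zero>"
  using smult_r_null by simp

lemma scale_one [simp]: "x \<in> carrier H \<Longrightarrow> 1 \<odot> x = x"
  using smult_one by simp

lemma scale_scale: "x \<in> carrier H \<Longrightarrow> a \<odot> (b \<odot> x) = (a * b) \<odot> x"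
  using smult_assoc1[of a b x] by simp

lemma scale_add: "x \<in> carrier H \<Longrightarrow> y \<in> carrier H \<Longrightarrow> a \<odot> (x \<oplus> y) = a \<odot> x \<oplus> a \<odot> y"
  using smult_r_distr[of a x y] by simp

lemma zero_scale [simp]: "x \<in> carrier H \<Longrightarrow> 0 \<odot> x = \<zero>"
  using smult_l_null by simp

lemma cinner_add_right [simp]: "\<lbrakk>x \<in> carrier H; y \<in> carrier H; z \<in> carrier H\<rbrakk>
      \<Longrightarrow> cinner H x (y \<oplus> z) = cinner H x y + cinner H x z"
  by (rule cinner_add)

lemma cinner_scale_right [simp]: "\<lbrakk>x \<in> carrier H; y \<in> carrier H\<rbrakk>
      \<Longrightarrow> cinner H x (c \<odot> y) = c * cinner H x y"
  by (rule cinner_smult)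

lemma cinner_add_left [simp]: "\<lbrakk>x \<in> carrier H; y \<in> carrier H; z \<in> carrier H\<rbrakk>
      \<Longrightarrow> cinner H (y \<oplus> z) x = cinner H y x + cinner H z x"
  using cinner_commute[of x "y \<oplus> z"] cinner_commute[of x y] cinner_commute[of x z] by simp

lemma cinner_scale_left [simp]: "\<lbrakk>x \<in> carrier H; y \<in> carrier H\<rbrakk>
      \<Longrightarrow> cinner H (c \<odot> y) x = cnj c * cinner H y x"
  using cinner_commute[of x "c \<odot> y"] cinner_commute[of x y] by simp

lemma cinner_zero_right [simp]: "x \<in> carrier H \<Longrightarrow> cinner H x \<zero> = 0"
  using cinner_scale_right[of x \<zero> 0] zero_scale[of \<zero>] by simp

lemma cinner_zero_left [simp]: "x \<in> carrier H \<Longrightarrow> cinner H \<zero> x = 0"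
  using cinner_commute[of x \<zero>] by simp

lemma cinner_diff_right [simp]: "\<lbrakk>x \<in> carrier H; y \<in> carrier H; z \<in> carrier H\<rbrakk>
      \<Longrightarrow> cinner H x (y \<ominus> z) = cinner H x y - cinner H x z"
  by (simp add: diff_eq)

lemma cinner_diff_left [simp]: "\<lbrakk>x \<in> carrier H; y \<in> carrier H; z \<in> carrier H\<rbrakk>
      \<Longrightarrow> cinner H (y \<ominus> z) x = cinner H y x - cinner H z x"
  by (simp add: diff_eq)

lemma cinner_self: "x \<in> carrier H \<Longrightarrow> cinner H x x = of_real ((hnorm H x)\<^sup>2)"
  using cinner_commute[of x x] cinner_nonneg[of x]
  by (simp add: hnorm_def complex_eq_iff)

lemma hnorm_sq: "x \<in> carrier H \<Longrightarrow> (hnorm H x)\<^sup>2 = Re (cinner H x x)"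
  using cinner_self by simp

lemma hnorm_nonneg [simp]: "x \<in> carrier H \<Longrightarrow> 0 \<le> hnorm H x"
  by (simp add: hnorm_def cinner_nonneg)

lemma vec_eqI:
  assumes "x \<in> carrier H" "y \<in> carrier H" "\<And>z. z \<in> carrier H \<Longrightarrow> cinner H z x = cinner H z y"
  shows "x = y"
proof -
  have "cinner H (x \<ominus> y) (x \<ominus> y) = 0"
    using assms by simp
  then have "x \<ominus> y = \<zero>"
    using assms cinner_definite by simp
  then show ?thesis using assms
    using M.minus_equality[of x "\<ominus> y"] M.minus_minus[of y] by (simp add: M.minus_eq)
qed

lemma hnorm_zero_iff: "x \<in> carrier H \<Longrightarrow> hnorm H x = 0 \<longleftrightarrow> x = \<zero>"
  using cinner_self[of x] cinner_definite[of x] by (auto simp: hnorm_def)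

lemma cauchy_schwarz:
  assumes "x \<in> carrier H" "y \<in> carrier H"
  shows "cmod (cinner H x y) \<le> hnorm H x * hnorm H y"
proof -
  have "(cmod (cinner H x y))\<^sup>2 \<le> (hnorm H x)\<^sup>2 * (hnorm H y)\<^sup>2"
  proof (rule cauchy_schwarz_scalar)
    fix c
    have "0 \<le> Re (cinner H (x \<oplus> c \<odot> y) (x \<oplus> c \<odot> y))"
      using assms by (intro cinner_nonneg) simp
    also have "cinner H (x \<oplus> c \<odot> y) (x \<oplus> c \<odot> y)
       = cinner H x x + (c * cinner H x y + cnj (c * cinner H x y)) + (c * cnj c) * cinner H y y"
      using assms cinner_commute[of x y] by (simp add: algebra_simps)
    also have "Re \<dots> = (hnorm H x)\<^sup>2 + 2 * Re (c * cinner H x y) + (cmod c)\<^sup>2 * (hnorm H y)\<^sup>2"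
      using assms complex_norm_square[of c]
      by (simp add: hnorm_sq) (simp add: cinner_self cmod_power2[unfolded power2_eq_square] power2_eq_square)
    finally show "0 \<le> (hnorm H x)\<^sup>2 + 2 * Re (c * cinner H x y) + (cmod c)\<^sup>2 * (hnorm H y)\<^sup>2" .
  qed simp_all
  then show ?thesis
    using assms by (metis hnorm_nonneg mult_nonneg_nonneg power2_le_imp_le power_mult_distrib)
qed

lemma hnorm_scale: "x \<in> carrier H \<Longrightarrow> hnorm H (c \<odot> x) = cmod c * hnorm H x"
proof -
  assume x: "x \<in> carrier H"
  have "cinner H (c \<odot> x) (c \<odot> x) = of_real ((cmod c)\<^sup>2 * (hnorm H x)\<^sup>2)"
    using x cinner_self[of x] complex_norm_square[of c] by (simp del: cinner_self)
  then have "Re (cinner H (c \<odot> x) (c \<odot> x)) = (cmod c)\<^sup>2 * (hnorm H x)\<^sup>2"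
    by (simp only: Re_complex_of_real)
  then have "(hnorm H (c \<odot> x))\<^sup>2 = (cmod c * hnorm H x)\<^sup>2"
    using hnorm_sq[OF scale_closed[OF x], of c] by (simp only: power_mult_distrib)
  then show ?thesis by (rule power2_eq_imp_eq) (use x in simp_all)
qed

lemma hnorm_triangle:
  assumes "x \<in> carrier H" "y \<in> carrier H"
  shows "hnorm H (x \<oplus> y) \<le> hnorm H x + hnorm H y"
proof -
  have "(hnorm H (x \<oplus> y))\<^sup>2 = (hnorm H x)\<^sup>2 + 2 * Re (cinner H x y) + (hnorm H y)\<^sup>2"
    using assms cinner_commute[of x y] by (simp add: hnorm_sq)
  also have "\<dots> \<le> (hnorm H x)\<^sup>2 + 2 * (hnorm H x * hnorm H y) + (hnorm H y)\<^sup>2"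
    using cauchy_schwarz[OF assms] complex_Re_le_cmod[of "cinner H x y"] by simp
  also have "\<dots> = (hnorm H x + hnorm H y)\<^sup>2"
    by (simp add: power2_sum)
  finally show ?thesis by (rule power2_le_imp_le) (use assms in simp)
qed

lemma hnorm_diff_commute:
  "x \<in> carrier H \<Longrightarrow> y \<in> carrier H \<Longrightarrow> hnorm H (x \<ominus> y) = hnorm H (y \<ominus> x)"
  by (simp add: hnorm_def)

lemma hnorm_diff_triangle:
  assumes "x \<in> carrier H" "y \<in> carrier H" "z \<in> carrier H"
  shows "hnorm H (x \<ominus> z) \<le> hnorm H (x \<ominus> y) + hnorm H (y \<ominus> z)"
proof -
  have "x \<ominus> z = (x \<ominus> y) \<oplus> (y \<ominus> z)"
    using assms by (intro vec_eqI) simp_all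
  then show ?thesis using assms hnorm_triangle[of "x \<ominus> y" "y \<ominus> z"] by simp
qed

lemma cinner_tendsto:
  assumes "\<And>n. xs n \<in> carrier H" "l \<in> carrier H" "y \<in> carrier H"
    "(\<lambda>n. hnorm H (xs n \<ominus> l)) \<longlonglongrightarrow> 0"
  shows "(\<lambda>n. cinner H y (xs n)) \<longlonglongrightarrow> cinner H y l"
proof -
  have "(\<lambda>n. hnorm H y * hnorm H (xs n \<ominus> l)) \<longlonglongrightarrow> 0"
    using tendsto_mult_left[OF assms(4), of "hnorm H y"] by simp
  then have "(\<lambda>n. cinner H y (xs n) - cinner H y l) \<longlonglongrightarrow> 0"
  proof (rule null_comparison[rotated])
    fix n
    show "cmod (cinner H y (xs n) - cinner H y l) \<le> hnorm H y * hnorm H (xs n \<ominus> l)"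
      using assms(1-3) cauchy_schwarz[of y "xs n \<ominus> l"] by simp
  qed
  then show ?thesis by (simp add: LIM_zero_iff)
qed

lemma hnorm_tendsto:
  assumes "\<And>n. xs n \<in> carrier H" "l \<in> carrier H"
    "(\<lambda>n. hnorm H (xs n \<ominus> l)) \<longlonglongrightarrow> 0"
  shows "(\<lambda>n. hnorm H (xs n)) \<longlonglongrightarrow> hnorm H l"
proof -
  have *: "\<bar>hnorm H (xs n) - hnorm H l\<bar> \<le> hnorm H (xs n \<ominus> l)" for n
  proof -
    have "hnorm H (xs n) \<le> hnorm H (xs n \<ominus> l) + hnorm H l"
      using hnorm_diff_triangle[of "xs n" l \<zero>] assms by (simp add: diff_eq)
    moreover have "hnorm H l \<le> hnorm H (xs n \<ominus> l) + hnorm H (xs n)"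
      using hnorm_diff_triangle[of l "xs n" \<zero>] assms hnorm_diff_commute[of "xs n" l]
      by (simp add: diff_eq)
    ultimately show ?thesis by simp
  qed
  have "(\<lambda>n. hnorm H (xs n) - hnorm H l) \<longlonglongrightarrow> 0"
    by (rule null_comparison[OF _ assms(3)]) (simp add: *)
  then show ?thesis by (simp add: LIM_zero_iff)
qed

lemma finsum_vec_closed [simp]:
  "(\<And>i. i \<in> A \<Longrightarrow> f i \<in> carrier H) \<Longrightarrow> (\<Oplus>i\<in>A. f i) \<in> carrier H"
  by (rule M.finsum_closed) auto

lemma cinner_finsum_right:
  assumes "finite A" "\<And>i. i \<in> A \<Longrightarrow> f i \<in> carrier H" "x \<in> carrier H"
  shows "cinner H x (\<Oplus>i\<in>A. f i) = (\<Sum>i\<in>A. cinner H x (f i))"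
  using assms by (induction A rule: finite_induct) (auto simp: M.finsum_insert Pi_iff)

lemma cinner_finsum_left:
  assumes "finite A" "\<And>i. i \<in> A \<Longrightarrow> f i \<in> carrier H" "x \<in> carrier H"
  shows "cinner H (\<Oplus>i\<in>A. f i) x = (\<Sum>i\<in>A. cinner H (f i) x)"
  using assms by (induction A rule: finite_induct) (auto simp: M.finsum_insert Pi_iff)

text \<open>
  The representing vector minimizes the strictly convex functional \<open>\<parallel>x\<parallel>\<^sup>2 - 2 Re (\<phi> x)\<close>; by the
  parallelogram law every minimizing sequence is a Cauchy sequence.
\<close>

lemma riesz:
  assumes add: "\<And>x y. x \<in> carrier H \<Longrightarrow> y \<in> carrier H \<Longrightarrow> \<phi> (x \<oplus> y) = \<phi> x + \<phi> y"
    and scale: "\<And>c x. x \<in> carrier H \<Longrightarrow> \<phi> (c \<odot> x) = c * \<phi> x"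
    and bounded: "\<And>x. x \<in> carrier H \<Longrightarrow> cmod (\<phi> x) \<le> C * hnorm H x"
  shows "\<exists>y\<in>carrier H. \<forall>x\<in>carrier H. \<phi> x = cinner H y x"
proof -
  define q where "q x = (hnorm H x)\<^sup>2 - 2 * Re (\<phi> x)" for x
  have lower: "- C\<^sup>2 \<le> q x" if "x \<in> carrier H" for x
  proof -
    have "Re (\<phi> x) \<le> C * hnorm H x"
      using bounded[OF that] complex_Re_le_cmod[of "\<phi> x"] by linarith
    moreover have "0 \<le> (hnorm H x - C)\<^sup>2" by simp
    ultimately show ?thesis by (simp add: q_def power2_diff algebra_simps)
  qed
  define m where "m = Inf (q ` carrier H)"
  have bdd: "bdd_below (q ` carrier H)" using lower by (auto intro!: bdd_belowI2)
  have m_le: "m \<le> q x" if "x \<in> carrier H" for x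
    unfolding m_def using bdd that by (auto intro: cInf_lower)
  have "\<exists>x\<in>carrier H. q x < m + 1 / real (Suc n)" for n
  proof -
    have "Inf (q ` carrier H) < m + 1 / real (Suc n)" by (simp add: m_def)
    from cInf_lessD[OF _ this] zero_vec_closed obtain z
      where "z \<in> q ` carrier H" "z < m + 1 / real (Suc n)" by fast
    then show ?thesis by auto
  qed
  then obtain xs where xs: "\<And>n. xs n \<in> carrier H" "\<And>n. q (xs n) < m + 1 / real (Suc n)"
    using choice[of "\<lambda>n x. x \<in> carrier H \<and> q x < m + 1 / real (Suc n)"] by blast
  have par: "(hnorm H (x \<ominus> y))\<^sup>2 \<le> 2 * q x + 2 * q y - 4 * m"
    if "x \<in> carrier H" "y \<in> carrier H" for x y
  proof -
    have "m \<le> q ((1/2) \<odot> (x \<oplus> y))" using that by (intro m_le) simp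
    also have "\<dots> = (hnorm H (x \<oplus> y))\<^sup>2 / 4 - Re (\<phi> x) - Re (\<phi> y)"
      unfolding q_def using that
      by (simp only: hnorm_scale scale add_closed power_mult_distrib add) (simp add: power2_eq_square)
    finally have "4 * m \<le> (hnorm H (x \<oplus> y))\<^sup>2 - 4 * Re (\<phi> x) - 4 * Re (\<phi> y)" by linarith
    moreover have "(hnorm H (x \<oplus> y))\<^sup>2 + (hnorm H (x \<ominus> y))\<^sup>2
        = 2 * (hnorm H x)\<^sup>2 + 2 * (hnorm H y)\<^sup>2"
      using that by (simp add: hnorm_sq)
    ultimately show ?thesis by (simp add: q_def)
  qed
  have "\<exists>k. \<forall>i\<ge>k. \<forall>j\<ge>k. hnorm H (xs i \<ominus> xs j) < e" if "e > 0" for e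
  proof -
    have "0 < e\<^sup>2 / 4" using \<open>e > 0\<close> by simp
    from reals_Archimedean[OF this] obtain k where k: "inverse (real (Suc k)) < e\<^sup>2 / 4" ..
    have "hnorm H (xs i \<ominus> xs j) < e" if "i \<ge> k" "j \<ge> k" for i j
    proof -
      have "1 / real (Suc i) \<le> inverse (real (Suc k))" "1 / real (Suc j) \<le> inverse (real (Suc k))"
        using that by (auto simp: field_simps)
      then have "(hnorm H (xs i \<ominus> xs j))\<^sup>2 < e\<^sup>2"
        using par[OF xs(1)[of i] xs(1)[of j]] xs(2)[of i] xs(2)[of j] k by linarith
      then show ?thesis by (rule power2_less_imp_less) (use \<open>e > 0\<close> in simp)
    qed
    then show ?thesis by blast
  qed
  then obtain y where y: "y \<in> carrier H" "(\<lambda>n. hnorm H (xs n \<ominus> y)) \<longlonglongrightarrow> 0"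
    using complete[of xs] xs by blast
  have phidiff: "\<phi> (a \<ominus> b) = \<phi> a - \<phi> b" if "a \<in> carrier H" "b \<in> carrier H" for a b
    using that by (simp add: diff_eq add scale)
  have "(\<lambda>n. \<phi> (xs n) - \<phi> y) \<longlonglongrightarrow> 0"
  proof (rule null_comparison)
    show "(\<lambda>n. C * hnorm H (xs n \<ominus> y)) \<longlonglongrightarrow> 0"
      using tendsto_mult_left[OF y(2), of C] by simp
    show "cmod (\<phi> (xs n) - \<phi> y) \<le> C * hnorm H (xs n \<ominus> y)" for n
      using bounded xs(1) y(1) by (simp add: phidiff[symmetric])
  qed
  then have "(\<lambda>n. \<phi> (xs n)) \<longlonglongrightarrow> \<phi> y" by (simp add: LIM_zero_iff)
  then have "(\<lambda>n. q (xs n)) \<longlonglongrightarrow> q y"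
    unfolding q_def using hnorm_tendsto[OF xs(1) y] by (intro tendsto_intros)
  moreover have "(\<lambda>n. m + 1 / real (Suc n)) \<longlonglongrightarrow> m + 0"
    by (intro tendsto_intros LIMSEQ_inverse_real_of_nat[unfolded inverse_eq_divide])
  ultimately have "q y \<le> m + 0"
    using xs(2) by (intro LIMSEQ_le[where X = "\<lambda>n. q (xs n)"]) (auto intro: less_imp_le)
  then have qy: "q y \<le> q x" if "x \<in> carrier H" for x using m_le[OF that] by simp
  have "\<phi> x = cinner H y x" if x: "x \<in> carrier H" for x
  proof -
    define b where "b = cinner H y x - \<phi> x"
    have "(cmod b)\<^sup>2 \<le> 0 * (hnorm H x)\<^sup>2"
    proof (rule cauchy_schwarz_scalar)
      fix c
      have "q y \<le> q (y \<oplus> c \<odot> x)" using x y by (intro qy) simp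
      also have "q (y \<oplus> c \<odot> x) = q y + 2 * Re (c * b) + (cmod c)\<^sup>2 * (hnorm H x)\<^sup>2"
      proof -
        have "(hnorm H (y \<oplus> c \<odot> x))\<^sup>2
            = (hnorm H y)\<^sup>2 + 2 * Re (c * cinner H y x) + (hnorm H (c \<odot> x))\<^sup>2"
          using x y(1) cinner_commute[of y x] by (simp add: hnorm_sq algebra_simps)
        then show ?thesis using x y(1)
          by (simp add: q_def b_def hnorm_scale power_mult_distrib add scale algebra_simps)
      qed
      finally show "0 \<le> 0 + 2 * Re (c * b) + (cmod c)\<^sup>2 * (hnorm H x)\<^sup>2" by simp
    qed simp_all
    then show ?thesis by (simp add: b_def)
  qed
  then show ?thesis using y(1) by blast
qed

end

subsection \<open>Bounded operators\<close>

lemma bopD: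
  assumes "A \<in> bop H K"
  shows bop_funcset: "A \<in> carrier H \<rightarrow>\<^sub>E carrier K"
    and bop_closed: "x \<in> carrier H \<Longrightarrow> A x \<in> carrier K"
    and bop_add: "x \<in> carrier H \<Longrightarrow> y \<in> carrier H \<Longrightarrow> A (x \<oplus>\<^bsub>H\<^esub> y) = A x \<oplus>\<^bsub>K\<^esub> A y"
    and bop_scale: "x \<in> carrier H \<Longrightarrow> A (c \<odot>\<^bsub>H\<^esub> x) = c \<odot>\<^bsub>K\<^esub> A x"
  using assms unfolding bop_def by auto

lemma bop_eqI:
  assumes "A \<in> bop H K" "B \<in> bop H K" "\<And>x. x \<in> carrier H \<Longrightarrow> A x = B x"
  shows "A = B"
  using assms bop_funcset[of A H K] bop_funcset[of B H K] by (intro PiE_ext[of A _ _ B]) auto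

lemma bop_boundE:
  assumes "hilbert_space H" "A \<in> bop H K"
  obtains C where "0 \<le> C" "\<And>x. x \<in> carrier H \<Longrightarrow> hnorm K (A x) \<le> C * hnorm H x"
proof -
  interpret hilbert_space H by fact
  obtain C where C: "\<And>x. x \<in> carrier H \<Longrightarrow> hnorm K (A x) \<le> C * hnorm H x"
    using assms(2) unfolding bop_def by blast
  show thesis
  proof (rule that[of "max 0 C"])
    fix x assume "x \<in> carrier H"
    then show "hnorm K (A x) \<le> max 0 C * hnorm H x"
      using C[of x] mult_right_mono[of C "max 0 C" "hnorm H x"] by simp
  qed simp
qed

lemma bop_zero:
  assumes "hilbert_space H" "hilbert_space K" "A \<in> bop H K"
  shows "A \<zero>\<^bsub>H\<^esub> = \<zero>\<^bsub>K\<^esub>"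
proof -
  interpret H: hilbert_space H by fact
  interpret K: hilbert_space K by fact
  show ?thesis using bop_scale[OF assms(3), of "\<zero>\<^bsub>H\<^esub>" 0] bop_closed[OF assms(3)] 
    by (metis H.zero_vec_closed H.zero_scale K.zero_scale)
qed

lemma additive_finsum:
  assumes A: "abelian_monoid A" and B: "abelian_monoid B" and I: "finite I"
    and f: "\<And>x. x \<in> carrier A \<Longrightarrow> f x \<in> carrier B" "f \<zero>\<^bsub>A\<^esub> = \<zero>\<^bsub>B\<^esub>"
    and add: "\<And>x y. x \<in> carrier A \<Longrightarrow> y \<in> carrier A \<Longrightarrow> f (x \<oplus>\<^bsub>A\<^esub> y) = f x \<oplus>\<^bsub>B\<^esub> f y"
    and v: "\<And>i. i \<in> I \<Longrightarrow> v i \<in> carrier A"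
  shows "f (\<Oplus>\<^bsub>A\<^esub>i\<in>I. v i) = (\<Oplus>\<^bsub>B\<^esub>i\<in>I. f (v i))"
proof -
  interpret A: abelian_monoid A by fact
  interpret B: abelian_monoid B by fact
  show ?thesis using I v
    by (induction I rule: finite_induct) (auto simp: A.finsum_insert B.finsum_insert Pi_iff f add)
qed

lemma bop_finsum:
  assumes "hilbert_space H" "hilbert_space K" "A \<in> bop H K" "finite I"
    "\<And>i. i \<in> I \<Longrightarrow> f i \<in> carrier H"
  shows "A (\<Oplus>\<^bsub>H\<^esub>i\<in>I. f i) = (\<Oplus>\<^bsub>K\<^esub>i\<in>I. A (f i))"
proof -
  interpret H: hilbert_space H by fact
  interpret K: hilbert_space K by fact
  show ?thesis
    by (rule additive_finsum[OF H.M.abelian_monoid_axioms K.M.abelian_monoid_axioms assms(4)])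
      (simp_all add: bop_closed[OF assms(3)] bop_add[OF assms(3)] bop_zero[OF assms(1-3)] assms(5))
qed

text \<open>An operator which has a formal adjoint is linear, so that only its bound is to be checked.\<close>

lemma bopI_formal_adjoint:
  assumes "hilbert_space H" "hilbert_space K" "A \<in> carrier H \<rightarrow>\<^sub>E carrier K"
    "\<And>y. y \<in> carrier K \<Longrightarrow> B y \<in> carrier H"
    "\<And>x y. x \<in> carrier H \<Longrightarrow> y \<in> carrier K \<Longrightarrow> cinner K y (A x) = cinner H (B y) x"
    "\<And>x. x \<in> carrier H \<Longrightarrow> hnorm K (A x) \<le> C * hnorm H x"
  shows "A \<in> bop H K"
proof -
  interpret H: hilbert_space H by fact
  interpret K: hilbert_space K by fact
  have [simp]: "A x \<in> carrier K" if "x \<in> carrier H" for x using assms(3) that by auto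
  have "A (x \<oplus>\<^bsub>H\<^esub> y) = A x \<oplus>\<^bsub>K\<^esub> A y" if "x \<in> carrier H" "y \<in> carrier H" for x y
    using that by (intro K.vec_eqI) (simp_all add: assms(4,5))
  moreover have "A (c \<odot>\<^bsub>H\<^esub> x) = c \<odot>\<^bsub>K\<^esub> A x" if "x \<in> carrier H" for x c
    using that by (intro K.vec_eqI) (simp_all add: assms(4,5))
  ultimately show ?thesis using assms(3,6) unfolding bop_def by blast
qed

lemma
  assumes "hilbert_space H" "hilbert_space K" "A \<in> bop H K"
  shows adj_bop: "adj H K A \<in> bop K H"
    and cinner_adj_right: "x \<in> carrier H \<Longrightarrow> y \<in> carrier K
      \<Longrightarrow> cinner H x (adj H K A y) = cinner K (A x) y"
proof -
  interpret H: hilbert_space H by fact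
  interpret K: hilbert_space K by fact
  note Ac = bop_closed[OF assms(3)]
  obtain C where C: "0 \<le> C" "\<And>x. x \<in> carrier H \<Longrightarrow> hnorm K (A x) \<le> C * hnorm H x"
    using bop_boundE assms(1,3) by blast
  have "\<exists>z\<in>carrier H. \<forall>x\<in>carrier H. cinner K y (A x) = cinner H z x" if y: "y \<in> carrier K" for y
  proof (rule H.riesz)
    fix x assume x: "x \<in> carrier H"
    show "cmod (cinner K y (A x)) \<le> (hnorm K y * C) * hnorm H x"
      using K.cauchy_schwarz[OF y Ac[OF x]] mult_left_mono[OF C(2)[OF x], of "hnorm K y"] y
      by (simp add: mult.assoc)
  qed (use y in \<open>simp_all add: bop_add[OF assms(3)] bop_scale[OF assms(3)] Ac\<close>)
  then obtain B where B: "\<And>y. y \<in> carrier K \<Longrightarrow> B y \<in> carrier H"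
      "\<And>x y. x \<in> carrier H \<Longrightarrow> y \<in> carrier K \<Longrightarrow> cinner K y (A x) = cinner H (B y) x"
    by metis
  define B' where "B' = restrict B (carrier K)"
  have B': "B' \<in> bop K H \<and> (\<forall>x\<in>carrier H. \<forall>y\<in>carrier K. cinner K (A x) y = cinner H x (B' y))"
  proof
    have eq: "cinner H x (B y) = cinner K (A x) y" if "x \<in> carrier H" "y \<in> carrier K" for x y
      using B(2)[OF that] that
      by (metis Ac B(1) H.cinner_commute K.cinner_commute)
    show "\<forall>x\<in>carrier H. \<forall>y\<in>carrier K. cinner K (A x) y = cinner H x (B' y)"
      using eq by (simp add: B'_def)
    show "B' \<in> bop K H"
    proof (rule bopI_formal_adjoint[OF assms(2,1), where B = A and C = C])
      fix y assume y: "y \<in> carrier K"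
      have "(hnorm H (B y))\<^sup>2 = Re (cinner K (A (B y)) y)"
        using y B(1) by (simp add: H.hnorm_sq eq)
      also have "\<dots> \<le> hnorm K (A (B y)) * hnorm K y"
        using K.cauchy_schwarz[of "A (B y)" y] complex_Re_le_cmod y Ac B(1) order_trans by blast
      also have "\<dots> \<le> C * hnorm H (B y) * hnorm K y"
        using C(2)[OF B(1)[OF y]] y by (intro mult_right_mono) auto
      finally have "hnorm H (B y) * hnorm H (B y) \<le> hnorm H (B y) * (C * hnorm K y)"
        by (simp add: power2_eq_square mult_ac)
      then have "hnorm H (B y) \<le> C * hnorm K y"
        by (rule le_of_square_le) (use C(1) B(1) y in simp_all)
      then show "hnorm H (B' y) \<le> C * hnorm K y" using y by (simp add: B'_def)
    qed (use B(1) eq Ac in \<open>auto simp: B'_def\<close>)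
  qed
  have "adj H K A = B'"
    unfolding adj_def
  proof (rule the_equality, rule B')
    fix D assume D: "D \<in> bop K H \<and> (\<forall>x\<in>carrier H. \<forall>y\<in>carrier K. cinner K (A x) y = cinner H x (D y))"
    show "D = B'"
    proof (rule bop_eqI)
      fix y assume y: "y \<in> carrier K"
      show "D y = B' y"
        using D B' y bop_closed[of D K H y] bop_closed[of B' K H y] by (intro H.vec_eqI) auto
    qed (use D B' in auto)
  qed
  with B' show "adj H K A \<in> bop K H"
    "x \<in> carrier H \<Longrightarrow> y \<in> carrier K \<Longrightarrow> cinner H x (adj H K A y) = cinner K (A x) y" by auto
qed

lemma cinner_adj_left:
  assumes "hilbert_space H" "hilbert_space K" "A \<in> bop H K" "x \<in> carrier H" "y \<in> carrier K"
  shows "cinner H (adj H K A y) x = cinner K y (A x)"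
proof -
  interpret H: hilbert_space H by fact
  interpret K: hilbert_space K by fact
  have "adj H K A y \<in> carrier H" by (rule bop_closed[OF adj_bop]) fact+
  then show ?thesis
    using cinner_adj_right[OF assms(1-5)] assms(4,5) bop_closed[OF assms(3)]
      H.cinner_commute[of x] K.cinner_commute[of _ y] by simp
qed

lemma adj_closed:
  "\<lbrakk>hilbert_space H; hilbert_space K; A \<in> bop H K; y \<in> carrier K\<rbrakk> \<Longrightarrow> adj H K A y \<in> carrier H"
  by (rule bop_closed[OF adj_bop])

lemma adj_unique:
  assumes "hilbert_space H" "hilbert_space K" "A \<in> bop H K" "B \<in> bop K H"
    "\<And>x y. x \<in> carrier H \<Longrightarrow> y \<in> carrier K \<Longrightarrow> cinner H x (B y) = cinner K (A x) y"
  shows "adj H K A = B"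
proof -
  interpret H: hilbert_space H by fact
  show ?thesis
  proof (rule bop_eqI[OF adj_bop[OF assms(1-3)] assms(4)])
    fix y assume y: "y \<in> carrier K"
    show "adj H K A y = B y"
      using y adj_closed[OF assms(1-3)] bop_closed[OF assms(4)]
      by (intro H.vec_eqI) (simp_all add: assms(5) cinner_adj_right[OF assms(1-3)])
  qed
qed

lemma adj_adj:
  assumes "hilbert_space H" "hilbert_space K" "A \<in> bop H K"
  shows "adj K H (adj H K A) = A"
  by (rule adj_unique) (use assms in \<open>auto intro: adj_bop simp: cinner_adj_left\<close>)

lemma bop_compose:
  assumes "hilbert_space H" "hilbert_space K" "B \<in> bop H K" "A \<in> bop K L"
  shows "compose (carrier H) A B \<in> bop H L"
proof -
  obtain C where C: "0 \<le> C" "\<And>x. x \<in> carrier H \<Longrightarrow> hnorm K (B x) \<le> C * hnorm H x"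
    using bop_boundE[OF assms(1,3)] by blast
  obtain D where D: "0 \<le> D" "\<And>x. x \<in> carrier K \<Longrightarrow> hnorm L (A x) \<le> D * hnorm K x"
    using bop_boundE[OF assms(2,4)] by blast
  interpret H: hilbert_space H by fact
  note B = bop_closed[OF assms(3)] bop_add[OF assms(3)] bop_scale[OF assms(3)]
  note A = bop_closed[OF assms(4)] bop_add[OF assms(4)] bop_scale[OF assms(4)]
  have "hnorm L (A (B x)) \<le> (D * C) * hnorm H x" if "x \<in> carrier H" for x
    using D(2)[OF B(1)[OF that]] mult_left_mono[OF C(2)[OF that] D(1)] by (simp add: mult.assoc)
  then show ?thesis
    unfolding bop_def by (auto simp: compose_eq A B compose_def intro!: exI[of _ "D * C"])
qed

lemma adj_compose:
  assumes "hilbert_space H" "hilbert_space K" "hilbert_space L" "B \<in> bop H K" "A \<in> bop K L"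
  shows "adj H L (compose (carrier H) A B) = compose (carrier L) (adj H K B) (adj K L A)"
proof (rule adj_unique)
  show "compose (carrier H) A B \<in> bop H L"
    using assms(1,2,4,5) by (rule bop_compose)
  show "compose (carrier L) (adj H K B) (adj K L A) \<in> bop L H"
    using assms by (intro bop_compose[of L K]) (simp_all add: adj_bop)
  fix x y assume "x \<in> carrier H" "y \<in> carrier L"
  then show "cinner H x (compose (carrier L) (adj H K B) (adj K L A) y)
      = cinner L (compose (carrier H) A B x) y"
    by (simp add: compose_eq cinner_adj_right[OF assms(1,2,4)] cinner_adj_right[OF assms(2,3,5)]
      adj_closed[OF assms(2,3,5)] bop_closed[OF assms(4)])
qed (use assms in simp_all)

lemma op_one_bop: "hilbert_space H \<Longrightarrow> op_one H \<in> bop H H"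
proof -
  assume "hilbert_space H"
  then interpret hilbert_space H .
  show ?thesis unfolding bop_def op_one_def by (auto intro!: exI[of _ 1])
qed

lemma op_zero_bop: "hilbert_space H \<Longrightarrow> hilbert_space K \<Longrightarrow> op_zero H K \<in> bop H K"
proof -
  assume "hilbert_space H" "hilbert_space K"
  then interpret H: hilbert_space H + K: hilbert_space K by auto
  show ?thesis unfolding bop_def op_zero_def 
    by (auto intro!: exI[of _ 0] simp: hnorm_def)
qed

lemma op_add_bop:
  assumes "hilbert_space H" "hilbert_space K" "A \<in> bop H K" "B \<in> bop H K"
  shows "op_add H K A B \<in> bop H K"
proof -
  interpret H: hilbert_space H by fact
  interpret K: hilbert_space K by fact
  obtain C where C: "0 \<le> C" "\<And>x. x \<in> carrier H \<Longrightarrow> hnorm K (B x) \<le> C * hnorm H x"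
    using bop_boundE[OF assms(1,4)] by blast
  obtain D where D: "0 \<le> D" "\<And>x. x \<in> carrier H \<Longrightarrow> hnorm K (A x) \<le> D * hnorm H x"
    using bop_boundE[OF assms(1,3)] by blast
  show ?thesis
  proof (rule bopI_formal_adjoint[OF assms(1,2),
        where B = "\<lambda>y. adj H K A y \<oplus>\<^bsub>H\<^esub> adj H K B y" and C = "D + C"])
    fix x assume x: "x \<in> carrier H"
    show "hnorm K (op_add H K A B x) \<le> (D + C) * hnorm H x"
      unfolding op_add_def restrict_apply'[OF x] distrib_right
      using K.hnorm_triangle[OF bop_closed[OF assms(3) x] bop_closed[OF assms(4) x]] C(2)[OF x] D(2)[OF x]
      by linarith
  qed (simp_all add: op_add_def bop_closed[OF assms(3)] bop_closed[OF assms(4)]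
      adj_closed[OF assms(1-3)] adj_closed[OF assms(1,2,4)]
      cinner_adj_left[OF assms(1-3)] cinner_adj_left[OF assms(1,2,4)])
qed

lemma op_smult_bop:
  assumes "hilbert_space H" "hilbert_space K" "A \<in> bop H K"
  shows "op_smult H K c A \<in> bop H K"
proof -
  interpret H: hilbert_space H by fact
  interpret K: hilbert_space K by fact
  obtain D where D: "0 \<le> D" "\<And>x. x \<in> carrier H \<Longrightarrow> hnorm K (A x) \<le> D * hnorm H x"
    using bop_boundE[OF assms(1,3)] by blast
  show ?thesis
  proof (rule bopI_formal_adjoint[OF assms(1,2),
        where B = "\<lambda>y. cnj c \<odot>\<^bsub>H\<^esub> adj H K A y" and C = "cmod c * D"])
    fix x assume x: "x \<in> carrier H"
    show "hnorm K (op_smult H K c A x) \<le> cmod c * D * hnorm H x"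
      unfolding op_smult_def restrict_apply'[OF x] K.hnorm_scale[OF bop_closed[OF assms(3) x]] mult.assoc
      using D(2)[OF x] by (rule mult_left_mono) simp
  qed (simp_all add: op_smult_def bop_closed[OF assms(3)]
      adj_closed[OF assms(1-3)] cinner_adj_left[OF assms(1-3)])
qed

lemma opnorm_bound:
  assumes "hilbert_space H" "A \<in> bop H K" "x \<in> carrier H"
  shows "hnorm K (A x) \<le> opnorm H K A * hnorm H x"
proof -
  interpret H: hilbert_space H by fact
  let ?S = "{C. 0 \<le> C \<and> (\<forall>x\<in>carrier H. hnorm K (A x) \<le> C * hnorm H x)}"
  obtain C where "0 \<le> C" and C: "\<And>x. x \<in> carrier H \<Longrightarrow> hnorm K (A x) \<le> C * hnorm H x"
    by (rule bop_boundE[OF assms(1,2)]) blast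
  then have ne: "?S \<noteq> {}" by blast
  show ?thesis
  proof (cases "hnorm H x = 0")
    case True
    then show ?thesis using C[OF assms(3)] by simp
  next
    case False
    then have pos: "hnorm H x > 0" using H.hnorm_nonneg[OF assms(3)] by linarith
    have "hnorm K (A x) / hnorm H x \<le> Inf ?S"
      using ne
    proof (rule cInf_greatest)
      fix C assume "C \<in> ?S"
      then have "hnorm K (A x) \<le> C * hnorm H x" using assms(3) by blast
      then show "hnorm K (A x) / hnorm H x \<le> C" using pos by (simp only: pos_divide_le_eq)
    qed
    then show ?thesis unfolding opnorm_def using pos by (simp only: pos_divide_le_eq)
  qed
qed

lemma opnorm_le:
  assumes "0 \<le> C" "\<And>x. x \<in> carrier H \<Longrightarrow> hnorm K (A x) \<le> C * hnorm H x"
  shows "opnorm H K A \<le> C"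
  unfolding opnorm_def using assms by (intro cInf_lower bdd_belowI[of _ 0]) auto

lemma opnorm_nonneg:
  assumes "hilbert_space H" "A \<in> bop H K"
  shows "0 \<le> opnorm H K A"
  unfolding opnorm_def
proof (rule cInf_greatest)
  show "{C. 0 \<le> C \<and> (\<forall>x\<in>carrier H. hnorm K (A x) \<le> C * hnorm H x)} \<noteq> {}"
    by (rule bop_boundE[OF assms]) blast
qed simp

lemma form_le_opnorm:
  assumes H: "hilbert_space H" and A: "A \<in> bop H H" and x: "x \<in> carrier H"
  shows "Re (cinner H x (A x)) \<le> opnorm H H A * (hnorm H x)\<^sup>2"
proof -
  interpret hilbert_space H by fact
  have "Re (cinner H x (A x)) \<le> hnorm H x * hnorm H (A x)"
    using cauchy_schwarz[OF x bop_closed[OF A x]] complex_Re_le_cmod order_trans by blast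
  also have "\<dots> \<le> hnorm H x * (opnorm H H A * hnorm H x)"
    by (intro mult_left_mono opnorm_bound[OF H A x] hnorm_nonneg x)
  finally show ?thesis by (simp only: power2_eq_square mult_ac)
qed

section \<open>Total families and the completion of a positive kernel\<close>

definition lincomb :: "'b hspace \<Rightarrow> ('x \<Rightarrow> 'b) \<Rightarrow> ('x \<Rightarrow>\<^sub>0 complex) \<Rightarrow> 'b" where
  "lincomb L v f = (\<Oplus>\<^bsub>L\<^esub>x\<in>Poly_Mapping.keys f. Poly_Mapping.lookup f x \<odot>\<^bsub>L\<^esub> v x)"

definition total_family :: "'b hspace \<Rightarrow> 'x set \<Rightarrow> ('x \<Rightarrow> 'b) \<Rightarrow> bool" where
  "total_family K I e \<longleftrightarrow> (\<forall>x\<in>I. e x \<in> carrier K) \<and>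
     (\<forall>z\<in>carrier K. (\<forall>x\<in>I. cinner K (e x) z = 0) \<longrightarrow> z = \<zero>\<^bsub>K\<^esub>)"

lemma total_family_eqI:
  assumes "hilbert_space K" "total_family K I e" "y \<in> carrier K" "z \<in> carrier K"
    "\<And>x. x \<in> I \<Longrightarrow> cinner K (e x) y = cinner K (e x) z"
  shows "y = z"
proof -
  interpret hilbert_space K by fact
  have *: "e x \<in> carrier K" if "x \<in> I" for x
    using assms(2) that by (simp add: total_family_def)
  have "\<forall>x\<in>I. cinner K (e x) (y \<ominus>\<^bsub>K\<^esub> z) = 0"
    using assms(3-5) * by simp
  then have zero: "y \<ominus>\<^bsub>K\<^esub> z = \<zero>\<^bsub>K\<^esub>"
    using assms(2) diff_closed[OF assms(3,4)] unfolding total_family_def by blast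
  show ?thesis
  proof (rule vec_eqI[OF assms(3,4)])
    fix w assume w: "w \<in> carrier K"
    show "cinner K w y = cinner K w z"
      using cinner_diff_right[OF w assms(3,4)] w unfolding zero by simp
  qed
qed

lemma bop_eq_on_total:
  assumes "hilbert_space K" "hilbert_space L" "total_family K I e" "A \<in> bop K L" "B \<in> bop K L"
    "\<And>x. x \<in> I \<Longrightarrow> A (e x) = B (e x)"
  shows "A = B"
proof -
  interpret L: hilbert_space L by fact
  have e: "e x \<in> carrier K" if "x \<in> I" for x
    using assms(3) that by (simp add: total_family_def)
  have *: "adj K L A y = adj K L B y" if y: "y \<in> carrier L" for y
    using adj_closed[OF assms(1,2) assms(4) y] adj_closed[OF assms(1,2) assms(5) y]
    by (rule total_family_eqI[OF assms(1,3)])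
      (simp add: e y assms(6) cinner_adj_right[OF assms(1,2) assms(4)]
        cinner_adj_right[OF assms(1,2) assms(5)])
  have "A z = B z" if z: "z \<in> carrier K" for z
  proof (rule L.vec_eqI)
    fix y assume y: "y \<in> carrier L"
    show "cinner L y (A z) = cinner L y (B z)"
      using *[OF y] cinner_adj_left[OF assms(1,2,4) z y] cinner_adj_left[OF assms(1,2,5) z y]
      by simp
  qed (use z bop_closed[OF assms(4)] bop_closed[OF assms(5)] in simp_all)
  then show ?thesis by (rule bop_eqI[OF assms(4,5)])
qed

lemma op_ext_eq:
  assumes "hilbert_space K" "hilbert_space L" "total_family K I e" "A \<in> bop K L"
    "\<And>x. x \<in> I \<Longrightarrow> A (e x) = v x"
  shows "op_ext K L I e v = A"
  unfolding op_ext_def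
proof (rule the_equality)
  show "A \<in> bop K L \<and> (\<forall>x\<in>I. A (e x) = v x)" using assms by simp
next
  fix B assume "B \<in> bop K L \<and> (\<forall>x\<in>I. B (e x) = v x)"
  then show "B = A" using bop_eq_on_total[OF assms(1-3), of B A] assms(4,5) by simp
qed

lemma total_family_image:
  assumes "hilbert_space K" "hilbert_space L" "total_family K I e" "U \<in> bop K L"
    "U ` carrier K = carrier L"
  shows "total_family L I (\<lambda>x. U (e x))"
  unfolding total_family_def
proof (intro conjI ballI impI)
  interpret K: hilbert_space K by fact
  interpret L: hilbert_space L by fact
  have e: "e x \<in> carrier K" if "x \<in> I" for x
    using assms(3) that by (simp add: total_family_def)
  show "U (e x) \<in> carrier L" if "x \<in> I" for x
    by (rule bop_closed[OF assms(4) e[OF that]])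
  fix z assume z: "z \<in> carrier L" "\<forall>x\<in>I. cinner L (U (e x)) z = 0"
  have "adj K L U z = \<zero>\<^bsub>K\<^esub>"
    by (rule total_family_eqI[OF assms(1,3)])
      (simp_all add: z e cinner_adj_right[OF assms(1,2,4)] adj_closed[OF assms(1,2,4)])
  then have *: "cinner L (U y) z = 0" if "y \<in> carrier K" for y
    using cinner_adj_right[OF assms(1,2,4) that z(1)] that by simp
  obtain y where "y \<in> carrier K" "z = U y" using assms(5) z(1) by blast
  then have "cinner L z z = 0" using *[of y] by simp
  then show "z = \<zero>\<^bsub>L\<^esub>" using z(1) L.cinner_definite by simp
qed

subsection \<open>Formal linear combinations\<close>

abbreviation coef :: "('x \<Rightarrow>\<^sub>0 complex) \<Rightarrow> 'x \<Rightarrow> complex" where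
  "coef \<equiv> Poly_Mapping.lookup"

abbreviation supp :: "('x \<Rightarrow>\<^sub>0 complex) \<Rightarrow> 'x set" where
  "supp \<equiv> Poly_Mapping.keys"

definition sc :: "complex \<Rightarrow> ('x \<Rightarrow>\<^sub>0 complex) \<Rightarrow> ('x \<Rightarrow>\<^sub>0 complex)" where
  "sc c f = Poly_Mapping.map (\<lambda>z. c * z) f"

lemma coef_sc [simp]: "coef (sc c f) x = c * coef f x"
  by (simp add: sc_def map.rep_eq when_def)

lemma supp_sc: "supp (sc c f) \<subseteq> supp f"
  by (auto simp: in_keys_iff)

lemma supp_diff: "supp (f - g) \<subseteq> supp f \<union> supp g"
  by (auto simp: in_keys_iff lookup_minus)

lemma supp_add: "supp (f + g) \<subseteq> supp f \<union> supp g"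
  by (auto simp: in_keys_iff lookup_add)

lemma ker_form_superset:
  assumes "finite A" "supp f \<subseteq> A" "finite B" "supp g \<subseteq> B"
  shows "ker_form \<kappa> f g = (\<Sum>x\<in>A. \<Sum>y\<in>B. cnj (coef f x) * coef g y * \<kappa> x y)"
proof -
  have "ker_form \<kappa> f g = (\<Sum>x\<in>supp f. \<Sum>y\<in>B. cnj (coef f x) * coef g y * \<kappa> x y)"
    unfolding ker_form_def
    by (intro sum.cong refl sum.mono_neutral_left) (use assms in \<open>auto simp: in_keys_iff\<close>)
  also have "\<dots> = (\<Sum>x\<in>A. \<Sum>y\<in>B. cnj (coef f x) * coef g y * \<kappa> x y)"
    by (intro sum.mono_neutral_left) (use assms in \<open>auto simp: in_keys_iff\<close>)
  finally show ?thesis .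
qed

lemma ker_form_add_right: "ker_form \<kappa> f (g + h) = ker_form \<kappa> f g + ker_form \<kappa> f h"
proof -
  note * = ker_form_superset[of "supp f" f "supp g \<union> supp h"]
  show ?thesis
    by (simp add: * supp_add lookup_add sum.distrib[symmetric] algebra_simps)
qed

lemma ker_form_diff_right: "ker_form \<kappa> f (g - h) = ker_form \<kappa> f g - ker_form \<kappa> f h"
proof -
  note * = ker_form_superset[of "supp f" f "supp g \<union> supp h"]
  show ?thesis
    by (simp add: * supp_diff lookup_minus sum_subtractf[symmetric] algebra_simps)
qed

lemma ker_form_add_left: "ker_form \<kappa> (g + h) f = ker_form \<kappa> g f + ker_form \<kappa> h f"
proof -
  note * = ker_form_superset[of "supp g \<union> supp h" _ "supp f" f]
  show ?thesis
    by (simp add: * supp_add lookup_add sum.distrib[symmetric] algebra_simps)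
qed

lemma ker_form_diff_left: "ker_form \<kappa> (g - h) f = ker_form \<kappa> g f - ker_form \<kappa> h f"
proof -
  note * = ker_form_superset[of "supp g \<union> supp h" _ "supp f" f]
  show ?thesis
    by (simp add: * supp_diff lookup_minus sum_subtractf[symmetric] algebra_simps)
qed

lemma ker_form_sc_right: "ker_form \<kappa> f (sc c g) = c * ker_form \<kappa> f g"
proof -
  note * = ker_form_superset[of "supp f" f "supp g"]
  show ?thesis by (simp add: * supp_sc sum_distrib_left mult_ac)
qed

lemma ker_form_sc_left: "ker_form \<kappa> (sc c g) f = cnj c * ker_form \<kappa> g f"
proof -
  note * = ker_form_superset[of "supp g" _ "supp f" f]
  show ?thesis by (simp add: * supp_sc sum_distrib_left mult_ac)
qed

lemma ker_form_single: "ker_form \<kappa> (Poly_Mapping.single x 1) (Poly_Mapping.single y 1) = \<kappa> x y"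
  by (simp add: ker_form_superset[of "{x}" _ "{y}"])

context hilbert_space begin

lemma lincomb_closed [simp]:
  "(\<And>x. x \<in> supp f \<Longrightarrow> v x \<in> carrier H) \<Longrightarrow> lincomb H v f \<in> carrier H"
  by (simp add: lincomb_def)

lemma cinner_lincomb_right:
  assumes "\<And>x. x \<in> supp f \<Longrightarrow> v x \<in> carrier H" "y \<in> carrier H"
  shows "cinner H y (lincomb H v f) = (\<Sum>x\<in>supp f. coef f x * cinner H y (v x))"
  using assms by (simp add: lincomb_def cinner_finsum_right)

lemma cinner_lincomb_left:
  assumes "\<And>x. x \<in> supp f \<Longrightarrow> v x \<in> carrier H" "y \<in> carrier H"
  shows "cinner H (lincomb H v f) y = (\<Sum>x\<in>supp f. cnj (coef f x) * cinner H (v x) y)"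
  using assms by (simp add: lincomb_def cinner_finsum_left)

lemma cinner_lincomb:
  assumes "\<And>x. x \<in> supp f \<Longrightarrow> v x \<in> carrier H" "\<And>x. x \<in> supp g \<Longrightarrow> w x \<in> carrier H"
  shows "cinner H (lincomb H v f) (lincomb H w g)
    = (\<Sum>x\<in>supp f. \<Sum>y\<in>supp g. cnj (coef f x) * coef g y * cinner H (v x) (w y))"
proof -
  have "cinner H (lincomb H v f) (lincomb H w g)
      = (\<Sum>x\<in>supp f. cnj (coef f x) * cinner H (v x) (lincomb H w g))"
    by (rule cinner_lincomb_left) (simp_all add: assms)
  also have "\<dots> = (\<Sum>x\<in>supp f. cnj (coef f x) * (\<Sum>y\<in>supp g. coef g y * cinner H (v x) (w y)))"
    by (intro sum.cong refl arg_cong2[of _ _ _ _ "(*)"] cinner_lincomb_right) (simp_all add: assms)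
  finally show ?thesis by (simp add: sum_distrib_left mult.assoc)
qed

lemma cinner_lincomb_superset:
  assumes "\<And>x. x \<in> A \<Longrightarrow> v x \<in> carrier H" "y \<in> carrier H" "finite A" "supp f \<subseteq> A"
  shows "cinner H y (lincomb H v f) = (\<Sum>x\<in>A. coef f x * cinner H y (v x))"
proof -
  have "cinner H y (lincomb H v f) = (\<Sum>x\<in>supp f. coef f x * cinner H y (v x))"
    by (rule cinner_lincomb_right) (use assms in auto)
  also have "\<dots> = (\<Sum>x\<in>A. coef f x * cinner H y (v x))"
    by (intro sum.mono_neutral_left) (use assms in \<open>auto simp: in_keys_iff\<close>)
  finally show ?thesis .
qed

lemma lincomb_add:
  assumes "\<And>x. x \<in> I \<Longrightarrow> v x \<in> carrier H" "supp f \<subseteq> I" "supp g \<subseteq> I"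
  shows "lincomb H v (f + g) = lincomb H v f \<oplus> lincomb H v g"
proof -
  have v: "v x \<in> carrier H" if "x \<in> supp f \<union> supp g" for x using assms that by auto
  have c: "lincomb H v f \<in> carrier H" "lincomb H v g \<in> carrier H" "lincomb H v (f + g) \<in> carrier H"
    using v supp_add[of f g] by (auto intro!: lincomb_closed)
  show ?thesis
  proof (rule vec_eqI)
    fix z assume z: "z \<in> carrier H"
    have eq: "cinner H z (lincomb H v h) = (\<Sum>x\<in>supp f \<union> supp g. coef h x * cinner H z (v x))"
      if "supp h \<subseteq> supp f \<union> supp g" for h
      by (rule cinner_lincomb_superset) (use v z that in auto)
    show "cinner H z (lincomb H v (f + g)) = cinner H z (lincomb H v f \<oplus> lincomb H v g)"
      using z c supp_add[of f g] by (simp add: eq lookup_add sum.distrib[symmetric] algebra_simps)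
  qed (use c in simp_all)
qed

lemma lincomb_sc:
  assumes "\<And>x. x \<in> I \<Longrightarrow> v x \<in> carrier H" "supp f \<subseteq> I"
  shows "lincomb H v (sc c f) = c \<odot> lincomb H v f"
proof -
  have v: "v x \<in> carrier H" if "x \<in> supp f" for x using assms that by auto
  have c: "lincomb H v f \<in> carrier H" "lincomb H v (sc c f) \<in> carrier H"
    using v supp_sc[of c f] by (auto intro!: lincomb_closed)
  show ?thesis
  proof (rule vec_eqI)
    fix z assume z: "z \<in> carrier H"
    show "cinner H z (lincomb H v (sc c f)) = cinner H z (c \<odot> lincomb H v f)"
      using z c v supp_sc[of c f]
      by (simp add: cinner_lincomb_superset[of "supp f"] sum_distrib_left mult_ac)
  qed (use c in simp_all)
qed

lemma lincomb_diff:
  assumes "\<And>x. x \<in> I \<Longrightarrow> v x \<in> carrier H" "supp f \<subseteq> I" "supp g \<subseteq> I"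
  shows "lincomb H v (f - g) = lincomb H v f \<ominus> lincomb H v g"
proof -
  have eq: "f - g = f + sc (-1) g" by (rule poly_mapping_eqI) (simp add: lookup_add lookup_minus)
  have s: "supp (sc (-1) g) \<subseteq> I" using assms(3) supp_sc[of "-1" g] by blast
  moreover have "lincomb H v f \<in> carrier H" "lincomb H v g \<in> carrier H"
    using assms by (auto intro!: lincomb_closed)
  ultimately show ?thesis unfolding eq
    using lincomb_add[where v = v and f = f and g = "sc (-1) g" and I = I, OF assms(1,2) s]
      lincomb_sc[where v = v and f = g and c = "-1" and I = I, OF assms(1,3)] diff_eq by simp
qed

lemma lincomb_single: "v x \<in> carrier H \<Longrightarrow> lincomb H v (Poly_Mapping.single x 1) = v x"
  by (simp add: lincomb_def M.finsum_insert Pi_iff)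

end

lemma bop_lincomb:
  assumes "hilbert_space H" "hilbert_space K" "A \<in> bop H K" "\<And>x. x \<in> supp f \<Longrightarrow> v x \<in> carrier H"
  shows "A (lincomb H v f) = lincomb K (\<lambda>x. A (v x)) f"
proof -
  interpret H: hilbert_space H by fact
  interpret K: hilbert_space K by fact
  have "A (lincomb H v f) = (\<Oplus>\<^bsub>K\<^esub>x\<in>supp f. A (coef f x \<odot>\<^bsub>H\<^esub> v x))"
    unfolding lincomb_def by (rule bop_finsum[OF assms(1-3)]) (use assms(4) in simp_all)
  also have "\<dots> = lincomb K (\<lambda>x. A (v x)) f"
    unfolding lincomb_def
    by (rule K.M.finsum_cong') (use assms(4) bop_scale[OF assms(3)] bop_closed[OF assms(3)] in auto)
  finally show ?thesis .
qed

subsection \<open>The completion\<close>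

locale psd_kernel =
  fixes I :: "'x set" and \<kappa> :: "'x \<Rightarrow> 'x \<Rightarrow> complex"
  assumes hermitian: "\<lbrakk>x \<in> I; y \<in> I\<rbrakk> \<Longrightarrow> \<kappa> y x = cnj (\<kappa> x y)"
    and psd: "supp f \<subseteq> I \<Longrightarrow> 0 \<le> Re (ker_form \<kappa> f f)"
begin

abbreviation nrm where "nrm \<equiv> ker_norm \<kappa>"
abbreviation frm where "frm \<equiv> ker_form \<kappa>"
abbreviation cls where "cls f \<equiv> ker_rel I \<kappa> `` {f}"
abbreviation "K \<equiv> hcompletion I \<kappa>"
abbreviation "e \<equiv> hcompl_elem I \<kappa>"

lemma frm_commute:
  assumes "supp f \<subseteq> I" "supp g \<subseteq> I"
  shows "frm g f = cnj (frm f g)"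
proof -
  have *: "\<kappa> y x = cnj (\<kappa> x y)" if "x \<in> supp f" "y \<in> supp g" for x y
    using assms that hermitian by blast
  show ?thesis
    unfolding ker_form_def by (subst sum.swap) (simp add: * mult_ac cong: sum.cong)
qed

lemma nrm_nonneg: "supp f \<subseteq> I \<Longrightarrow> 0 \<le> nrm f"
  by (simp add: ker_norm_def psd)

lemma nrm_sq: "supp f \<subseteq> I \<Longrightarrow> (nrm f)\<^sup>2 = Re (frm f f)"
  by (simp add: ker_norm_def psd)

lemma frm_sum_sq:
  assumes "supp f \<subseteq> I" "supp g \<subseteq> I"
  shows "(nrm (f + g))\<^sup>2 = (nrm f)\<^sup>2 + 2 * Re (frm f g) + (nrm g)\<^sup>2"
proof -
  have "supp (f + g) \<subseteq> I" using assms supp_add[of f g] by auto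
  then show ?thesis using assms frm_commute[OF assms]
    by (simp add: nrm_sq ker_form_add_left ker_form_add_right)
qed

lemma nrm_sc: "supp f \<subseteq> I \<Longrightarrow> nrm (sc c f) = cmod c * nrm f"
proof -
  assume f: "supp f \<subseteq> I"
  have "frm (sc c f) (sc c f) = of_real ((cmod c)\<^sup>2) * frm f f"
    unfolding ker_form_sc_left ker_form_sc_right complex_norm_square by simp
  then have "Re (frm (sc c f) (sc c f)) = (cmod c)\<^sup>2 * Re (frm f f)" by simp
  then have "(nrm (sc c f))\<^sup>2 = (cmod c * nrm f)\<^sup>2"
    using nrm_sq[OF f] nrm_sq[of "sc c f"] supp_sc[of c f] f
    by (simp only: power_mult_distrib order_trans)
  then show ?thesis
    by (rule power2_eq_imp_eq) (use nrm_nonneg f supp_sc[of c f] in auto)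
qed

lemma frm_cauchy_schwarz:
  assumes "supp f \<subseteq> I" "supp g \<subseteq> I"
  shows "cmod (frm f g) \<le> nrm f * nrm g"
proof -
  have "(cmod (frm f g))\<^sup>2 \<le> (nrm f)\<^sup>2 * (nrm g)\<^sup>2"
  proof (rule cauchy_schwarz_scalar)
    fix c
    have s: "supp (sc c g) \<subseteq> I" using supp_sc[of c g] assms by auto
    have "0 \<le> (nrm (f + sc c g))\<^sup>2" by simp
    then show "0 \<le> (nrm f)\<^sup>2 + 2 * Re (c * frm f g) + (cmod c)\<^sup>2 * (nrm g)\<^sup>2"
      unfolding frm_sum_sq[OF assms(1) s] nrm_sc[OF assms(2)] power_mult_distrib ker_form_sc_right .
  qed simp_all
  then have "(cmod (frm f g))\<^sup>2 \<le> (nrm f * nrm g)\<^sup>2" by (simp only: power_mult_distrib)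
  then show ?thesis
    by (rule power2_le_imp_le) (simp add: nrm_nonneg assms)
qed

lemma nrm_triangle:
  assumes "supp f \<subseteq> I" "supp g \<subseteq> I"
  shows "nrm (f + g) \<le> nrm f + nrm g"
proof (rule power2_le_imp_le)
  have "Re (frm f g) \<le> nrm f * nrm g"
    using frm_cauchy_schwarz[OF assms] complex_Re_le_cmod[of "frm f g"] by linarith
  then show "(nrm (f + g))\<^sup>2 \<le> (nrm f + nrm g)\<^sup>2"
    unfolding frm_sum_sq[OF assms] power2_sum by linarith
qed (simp add: nrm_nonneg assms)

lemma nrm_zero: "nrm 0 = 0" by (simp add: ker_norm_def ker_form_def)

lemma nrm_diff_commute: "supp f \<subseteq> I \<Longrightarrow> supp g \<subseteq> I \<Longrightarrow> nrm (f - g) = nrm (g - f)"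
  by (simp add: ker_norm_def ker_form_diff_left ker_form_diff_right)

lemma nrm_diff_triangle:
  assumes "supp f \<subseteq> I" "supp g \<subseteq> I" "supp h \<subseteq> I"
  shows "nrm (f - h) \<le> nrm (f - g) + nrm (g - h)"
proof -
  have "supp (f - g) \<subseteq> I" "supp (g - h) \<subseteq> I"
    using assms supp_diff[of f g] supp_diff[of g h] by auto
  from nrm_triangle[OF this] show ?thesis by simp
qed

lemma nrm_diff_abs:
  assumes "supp f \<subseteq> I" "supp g \<subseteq> I"
  shows "\<bar>nrm f - nrm g\<bar> \<le> nrm (f - g)"
  using nrm_diff_triangle[of f g 0] nrm_diff_triangle[of g f 0] nrm_diff_commute[OF assms] assms
  by simp

lemma cauchy_supp: "f \<in> ker_cauchy I \<kappa> \<Longrightarrow> supp (f n) \<subseteq> I"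
  by (simp add: ker_cauchy_def)

lemma ker_cauchyE:
  assumes "f \<in> ker_cauchy I \<kappa>" "0 < \<epsilon>"
  obtains k where "\<And>m n. m \<ge> k \<Longrightarrow> n \<ge> k \<Longrightarrow> nrm (f m - f n) < \<epsilon>"
  using assms unfolding ker_cauchy_def by blast

lemma cauchy_bounded:
  assumes "f \<in> ker_cauchy I \<kappa>"
  obtains B where "0 < B" "\<And>n. nrm (f n) \<le> B"
proof -
  note s = cauchy_supp[OF assms]
  obtain k where k: "\<And>m n. m \<ge> k \<Longrightarrow> n \<ge> k \<Longrightarrow> nrm (f m - f n) < 1"
    using ker_cauchyE[OF assms zero_less_one] by blast
  define B where "B = (\<Sum>i\<le>k. nrm (f i)) + 1"
  have nn: "0 \<le> nrm (f i)" for i by (rule nrm_nonneg[OF s])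
  have "nrm (f n) \<le> B" for n
  proof (cases "n \<le> k")
    case True
    then have "nrm (f n) \<le> (\<Sum>i\<le>k. nrm (f i))"
      using nn by (intro member_le_sum) auto
    then show ?thesis by (simp add: B_def)
  next
    case False
    then have "nrm (f n) \<le> nrm (f k) + 1"
      using nrm_diff_abs[OF s[of n] s[of k]] k[of n k] by simp
    also have "nrm (f k) \<le> (\<Sum>i\<le>k. nrm (f i))"
      using nn by (intro member_le_sum) auto
    finally show ?thesis by (simp add: B_def)
  qed
  moreover have "0 < B" unfolding B_def using nn by (intro add_nonneg_pos sum_nonneg) auto
  ultimately show thesis by (rule that[rotated])
qed

lemma frm_diff_bound:
  assumes "supp f \<subseteq> I" "supp g \<subseteq> I" "supp f' \<subseteq> I" "supp g' \<subseteq> I"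
  shows "cmod (frm f g - frm f' g') \<le> nrm (f - f') * nrm g + nrm f' * nrm (g - g')"
proof -
  have s: "supp (f - f') \<subseteq> I" "supp (g - g') \<subseteq> I"
    using assms supp_diff[of f f'] supp_diff[of g g'] by auto
  have "frm f g - frm f' g' = frm (f - f') g + frm f' (g - g')"
    by (simp add: ker_form_diff_left ker_form_diff_right)
  also have "cmod \<dots> \<le> cmod (frm (f - f') g) + cmod (frm f' (g - g'))" by (rule norm_triangle_ineq)
  also have "\<dots> \<le> nrm (f - f') * nrm g + nrm f' * nrm (g - g')"
    using frm_cauchy_schwarz s assms by (intro add_mono) auto
  finally show ?thesis .
qed

lemma frm_convergent:
  assumes f: "f \<in> ker_cauchy I \<kappa>" and g: "g \<in> ker_cauchy I \<kappa>"
  shows "convergent (\<lambda>n. frm (f n) (g n))"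
proof -
  obtain A where A: "0 < A" "\<And>n. nrm (f n) \<le> A" using cauchy_bounded[OF f] by metis
  obtain B where B: "0 < B" "\<And>n. nrm (g n) \<le> B" using cauchy_bounded[OF g] by metis
  have "Cauchy (\<lambda>n. frm (f n) (g n))"
    unfolding Cauchy_def dist_norm
  proof (intro allI impI)
    fix \<epsilon> :: real assume \<epsilon>: "0 < \<epsilon>"
    then have pos: "0 < \<epsilon> / (2 * B)" "0 < \<epsilon> / (2 * A)" using A B by auto
    obtain k where k: "\<And>m n. m \<ge> k \<Longrightarrow> n \<ge> k \<Longrightarrow> nrm (f m - f n) < \<epsilon> / (2 * B)"
      using ker_cauchyE[OF f pos(1)] by blast
    obtain l where l: "\<And>m n. m \<ge> l \<Longrightarrow> n \<ge> l \<Longrightarrow> nrm (g m - g n) < \<epsilon> / (2 * A)"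
      using ker_cauchyE[OF g pos(2)] by blast
    have "cmod (frm (f m) (g m) - frm (f n) (g n)) < \<epsilon>" if "m \<ge> max k l" "n \<ge> max k l" for m n
    proof -
      have "cmod (frm (f m) (g m) - frm (f n) (g n))
          \<le> nrm (f m - f n) * nrm (g m) + nrm (f n) * nrm (g m - g n)"
        by (rule frm_diff_bound) (simp_all add: cauchy_supp f g)
      also have "\<dots> \<le> nrm (f m - f n) * B + A * nrm (g m - g n)"
        using A B supp_diff[of "f m" "f n"] supp_diff[of "g m" "g n"] cauchy_supp[OF f] cauchy_supp[OF g]
        by (intro add_mono mult_left_mono mult_right_mono nrm_nonneg) blast+
      also have "\<dots> < \<epsilon> / (2 * B) * B + A * (\<epsilon> / (2 * A))"
        using k[of m n] l[of m n] that A B by (intro add_strict_mono mult_strict_left_mono mult_strict_right_mono) auto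
      also have "\<dots> = \<epsilon>" using A B by simp
      finally show ?thesis .
    qed
    then show "\<exists>M. \<forall>m\<ge>M. \<forall>n\<ge>M. cmod (frm (f m) (g m) - frm (f n) (g n)) < \<epsilon>" by blast
  qed
  then show ?thesis by (simp add: Cauchy_convergent_iff)
qed

lemma rel_refl: "f \<in> ker_cauchy I \<kappa> \<Longrightarrow> (f, f) \<in> ker_rel I \<kappa>"
  by (simp add: ker_rel_def nrm_zero)

lemma rel_sym: "(f, g) \<in> ker_rel I \<kappa> \<Longrightarrow> (g, f) \<in> ker_rel I \<kappa>"
  unfolding ker_rel_def using cauchy_supp nrm_diff_commute by auto

lemma rel_trans:
  assumes "(f, g) \<in> ker_rel I \<kappa>" "(g, h) \<in> ker_rel I \<kappa>"
  shows "(f, h) \<in> ker_rel I \<kappa>"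
proof -
  from assms have c: "f \<in> ker_cauchy I \<kappa>" "g \<in> ker_cauchy I \<kappa>" "h \<in> ker_cauchy I \<kappa>"
    and l: "(\<lambda>n. nrm (f n - g n)) \<longlonglongrightarrow> 0" "(\<lambda>n. nrm (g n - h n)) \<longlonglongrightarrow> 0"
    by (auto simp: ker_rel_def)
  have "(\<lambda>n. nrm (f n - h n)) \<longlonglongrightarrow> 0"
  proof (rule null_comparison)
    fix n
    have "supp (f n - h n) \<subseteq> I" using supp_diff[of "f n" "h n"] cauchy_supp[OF c(1)] cauchy_supp[OF c(3)] by blast
    then show "norm (nrm (f n - h n)) \<le> nrm (f n - g n) + nrm (g n - h n)"
      using nrm_diff_triangle[OF cauchy_supp[OF c(1)] cauchy_supp[OF c(2)] cauchy_supp[OF c(3)], of n n n]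
        nrm_nonneg by simp
    show "(\<lambda>n. nrm (f n - g n) + nrm (g n - h n)) \<longlonglongrightarrow> 0"
      using tendsto_add[OF l] by simp
  qed
  with c show ?thesis by (simp add: ker_rel_def)
qed

lemma rel_equiv: "equiv (ker_cauchy I \<kappa>) (ker_rel I \<kappa>)"
proof (rule equivI)
  show "ker_rel I \<kappa> \<subseteq> ker_cauchy I \<kappa> \<times> ker_cauchy I \<kappa>" by (auto simp: ker_rel_def)
  show "refl_on (ker_cauchy I \<kappa>) (ker_rel I \<kappa>)" by (rule refl_onI) (rule rel_refl)
  show "sym (ker_rel I \<kappa>)" by (rule symI) (rule rel_sym)
  show "trans (ker_rel I \<kappa>)" by (rule transI) (rule rel_trans)
qed

lemma cls_eq_iff:
  "f \<in> ker_cauchy I \<kappa> \<Longrightarrow> g \<in> ker_cauchy I \<kappa> \<Longrightarrow> cls f = cls g \<longleftrightarrow> (f, g) \<in> ker_rel I \<kappa>"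
  using eq_equiv_class_iff[OF rel_equiv] by blast

lemma cls_union:
  assumes "S \<noteq> {}" "\<And>s. s \<in> S \<Longrightarrow> (s, s0) \<in> ker_rel I \<kappa>"
  shows "ker_rel I \<kappa> `` S = cls s0"
  using assms by (auto intro: rel_trans rel_sym)

lemma cauchy_add:
  assumes "f \<in> ker_cauchy I \<kappa>" "g \<in> ker_cauchy I \<kappa>"
  shows "(\<lambda>n. f n + g n) \<in> ker_cauchy I \<kappa>"
  unfolding ker_cauchy_def
proof (intro CollectI conjI allI impI)
  note s = cauchy_supp[OF assms(1)] cauchy_supp[OF assms(2)]
  show "supp (f n + g n) \<subseteq> I" for n using supp_add[of "f n" "g n"] s by blast
  fix \<epsilon> :: real assume "0 < \<epsilon>"
  then have half: "0 < \<epsilon> / 2" by simp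
  obtain k where k: "\<And>m n. m \<ge> k \<Longrightarrow> n \<ge> k \<Longrightarrow> nrm (f m - f n) < \<epsilon> / 2"
    using ker_cauchyE[OF assms(1) half] by blast
  obtain l where l: "\<And>m n. m \<ge> l \<Longrightarrow> n \<ge> l \<Longrightarrow> nrm (g m - g n) < \<epsilon> / 2"
    using ker_cauchyE[OF assms(2) half] by blast
  have "nrm (f m + g m - (f n + g n)) < \<epsilon>" if "m \<ge> max k l" "n \<ge> max k l" for m n
  proof -
    have "supp (f m - f n) \<subseteq> I" "supp (g m - g n) \<subseteq> I"
      using supp_diff[of "f m" "f n"] supp_diff[of "g m" "g n"] s by blast+
    from nrm_triangle[OF this] show ?thesis
      using k[of m n] l[of m n] that by (simp add: algebra_simps)
  qed
  then show "\<exists>k. \<forall>m\<ge>k. \<forall>n\<ge>k. nrm (f m + g m - (f n + g n)) < \<epsilon>" by blast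
qed

lemma sc_diff: "sc c f - sc c g = sc c (f - g)"
  by (rule poly_mapping_eqI) (simp add: lookup_minus algebra_simps)

lemma cauchy_sc:
  assumes "f \<in> ker_cauchy I \<kappa>"
  shows "(\<lambda>n. sc c (f n)) \<in> ker_cauchy I \<kappa>"
  unfolding ker_cauchy_def
proof (intro CollectI conjI allI impI)
  note s = cauchy_supp[OF assms(1)]
  show "supp (sc c (f n)) \<subseteq> I" for n using supp_sc[of c "f n"] s by blast
  fix \<epsilon> :: real assume \<epsilon>: "0 < \<epsilon>"
  then have pos: "0 < \<epsilon> / (cmod c + 1)" by (simp add: add_nonneg_pos)
  obtain k where k: "\<And>m n. m \<ge> k \<Longrightarrow> n \<ge> k \<Longrightarrow> nrm (f m - f n) < \<epsilon> / (cmod c + 1)"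
    using ker_cauchyE[OF assms pos] by blast
  have "nrm (sc c (f m) - sc c (f n)) < \<epsilon>" if "m \<ge> k" "n \<ge> k" for m n
  proof -
    have d: "supp (f m - f n) \<subseteq> I" using supp_diff[of "f m" "f n"] s by blast
    have "nrm (sc c (f m) - sc c (f n)) = cmod c * nrm (f m - f n)"
      unfolding sc_diff by (rule nrm_sc[OF d])
    also have "\<dots> \<le> (cmod c + 1) * nrm (f m - f n)"
      using nrm_nonneg[OF d] by (simp add: distrib_right)
    also have "\<dots> < (cmod c + 1) * (\<epsilon> / (cmod c + 1))"
      using k[OF that] by (intro mult_strict_left_mono) (simp_all add: add_nonneg_pos)
    also have "\<dots> = \<epsilon>" using norm_ge_zero[of c] by (simp add: add_nonneg_eq_0_iff)
    finally show ?thesis .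
  qed
  then show "\<exists>k. \<forall>m\<ge>k. \<forall>n\<ge>k. nrm (sc c (f m) - sc c (f n)) < \<epsilon>" by blast
qed

lemma cauchy_const: "supp f \<subseteq> I \<Longrightarrow> (\<lambda>_. f) \<in> ker_cauchy I \<kappa>"
  by (simp add: ker_cauchy_def nrm_zero)

lemma carrier_completion: "carrier K = cls ` ker_cauchy I \<kappa>"
  by (auto simp: hcompletion_def quotient_def)

lemma add_cls:
  assumes f: "f \<in> ker_cauchy I \<kappa>" and g: "g \<in> ker_cauchy I \<kappa>"
  shows "cls f \<oplus>\<^bsub>K\<^esub> cls g = cls (\<lambda>n. f n + g n)"
proof -
  have "ker_rel I \<kappa> `` {\<lambda>n. f' n + g' n |f' g'. f' \<in> cls f \<and> g' \<in> cls g} = cls (\<lambda>n. f n + g n)"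
  proof (rule cls_union)
    show "{\<lambda>n. f' n + g' n |f' g'. f' \<in> cls f \<and> g' \<in> cls g} \<noteq> {}"
      using rel_refl f g by auto
    fix s assume "s \<in> {\<lambda>n. f' n + g' n |f' g'. f' \<in> cls f \<and> g' \<in> cls g}"
    then obtain f' g' where s: "s = (\<lambda>n. f' n + g' n)" "(f, f') \<in> ker_rel I \<kappa>" "(g, g') \<in> ker_rel I \<kappa>"
      by auto
    then have c: "f' \<in> ker_cauchy I \<kappa>" "g' \<in> ker_cauchy I \<kappa>"
      and l: "(\<lambda>n. nrm (f n - f' n)) \<longlonglongrightarrow> 0" "(\<lambda>n. nrm (g n - g' n)) \<longlonglongrightarrow> 0"
      by (auto simp: ker_rel_def)
    have "(\<lambda>n. nrm (f n + g n - (f' n + g' n))) \<longlonglongrightarrow> 0"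
    proof (rule null_comparison)
      fix n
      have d: "supp (f n - f' n) \<subseteq> I" "supp (g n - g' n) \<subseteq> I"
        using supp_diff[of "f n" "f' n"] supp_diff[of "g n" "g' n"] cauchy_supp f g c by blast+
      have "supp (f n - f' n + (g n - g' n)) \<subseteq> I"
        using d supp_add[of "f n - f' n" "g n - g' n"] by blast
      then have "norm (nrm (f n - f' n + (g n - g' n))) \<le> nrm (f n - f' n) + nrm (g n - g' n)"
        using nrm_triangle[OF d] nrm_nonneg by simp
      then show "norm (nrm (f n + g n - (f' n + g' n))) \<le> nrm (f n - f' n) + nrm (g n - g' n)"
        by (simp add: algebra_simps)
      show "(\<lambda>n. nrm (f n - f' n) + nrm (g n - g' n)) \<longlonglongrightarrow> 0" using tendsto_add[OF l] by simp
    qed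
    then have "((\<lambda>n. f n + g n), s) \<in> ker_rel I \<kappa>"
      using f g c by (simp add: ker_rel_def s cauchy_add)
    then show "(s, \<lambda>n. f n + g n) \<in> ker_rel I \<kappa>" by (rule rel_sym)
  qed
  then show ?thesis by (simp add: hcompletion_def)
qed

lemma smult_cls:
  assumes f: "f \<in> ker_cauchy I \<kappa>"
  shows "c \<odot>\<^bsub>K\<^esub> cls f = cls (\<lambda>n. sc c (f n))"
proof -
  have "ker_rel I \<kappa> `` {\<lambda>n. sc c (f' n) |f'. f' \<in> cls f} = cls (\<lambda>n. sc c (f n))"
  proof (rule cls_union)
    show "{\<lambda>n. sc c (f' n) |f'. f' \<in> cls f} \<noteq> {}" using rel_refl f by auto
    fix s assume "s \<in> {\<lambda>n. sc c (f' n) |f'. f' \<in> cls f}"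
    then obtain f' where s: "s = (\<lambda>n. sc c (f' n))" "(f, f') \<in> ker_rel I \<kappa>" by auto
    then have c: "f' \<in> ker_cauchy I \<kappa>" and l: "(\<lambda>n. nrm (f n - f' n)) \<longlonglongrightarrow> 0"
      by (auto simp: ker_rel_def)
    have eq: "nrm (sc c (f n) - sc c (f' n)) = cmod c * nrm (f n - f' n)" for n
      unfolding sc_diff
      by (rule nrm_sc) (use supp_diff[of "f n" "f' n"] cauchy_supp[OF f] cauchy_supp[OF c] in blast)
    have "(\<lambda>n. nrm (sc c (f n) - sc c (f' n))) \<longlonglongrightarrow> 0"
      unfolding eq using tendsto_mult_left[OF l, of "cmod c"] by simp
    then have "((\<lambda>n. sc c (f n)), s) \<in> ker_rel I \<kappa>"
      using f c by (simp add: ker_rel_def s cauchy_sc)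
    then show "(s, \<lambda>n. sc c (f n)) \<in> ker_rel I \<kappa>" by (rule rel_sym)
  qed
  then show ?thesis by (simp add: hcompletion_def sc_def)
qed

lemma zero_cls: "\<zero>\<^bsub>K\<^esub> = cls (\<lambda>_. 0)" by (simp add: hcompletion_def)

lemma cinner_cls:
  assumes f: "f \<in> ker_cauchy I \<kappa>" and g: "g \<in> ker_cauchy I \<kappa>"
  shows "(\<lambda>n. frm (f n) (g n)) \<longlonglongrightarrow> cinner K (cls f) (cls g)"
proof -
  obtain z where z: "(\<lambda>n. frm (f n) (g n)) \<longlonglongrightarrow> z"
    using frm_convergent[OF f g] by (auto simp: convergent_def)
  have "cinner K (cls f) (cls g) = z"
    unfolding hcompletion_def hspace.simps
  proof (rule the_equality)
    show "\<exists>f\<in>cls f. \<exists>g\<in>cls g. (\<lambda>n. frm (f n) (g n)) \<longlonglongrightarrow> z"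
      using z rel_refl f g by auto
    fix z' assume "\<exists>f\<in>cls f. \<exists>g\<in>cls g. (\<lambda>n. frm (f n) (g n)) \<longlonglongrightarrow> z'"
    then obtain f' g' where "(f, f') \<in> ker_rel I \<kappa>" "(g, g') \<in> ker_rel I \<kappa>"
      and z': "(\<lambda>n. frm (f' n) (g' n)) \<longlonglongrightarrow> z'" by auto
    then have c: "f' \<in> ker_cauchy I \<kappa>" "g' \<in> ker_cauchy I \<kappa>"
      and l: "(\<lambda>n. nrm (f n - f' n)) \<longlonglongrightarrow> 0" "(\<lambda>n. nrm (g n - g' n)) \<longlonglongrightarrow> 0"
      by (auto simp: ker_rel_def)
    obtain A where A: "0 < A" "\<And>n. nrm (f' n) \<le> A" using cauchy_bounded[OF c(1)] by metis
    obtain B where B: "0 < B" "\<And>n. nrm (g n) \<le> B" using cauchy_bounded[OF g] by metis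
    have "(\<lambda>n. frm (f n) (g n) - frm (f' n) (g' n)) \<longlonglongrightarrow> 0"
    proof (rule null_comparison)
      fix n
      have "cmod (frm (f n) (g n) - frm (f' n) (g' n))
          \<le> nrm (f n - f' n) * nrm (g n) + nrm (f' n) * nrm (g n - g' n)"
        by (rule frm_diff_bound) (simp_all add: cauchy_supp f g c)
      also have "\<dots> \<le> nrm (f n - f' n) * B + A * nrm (g n - g' n)"
        using A B supp_diff[of "f n" "f' n"] supp_diff[of "g n" "g' n"]
          cauchy_supp[OF f, of n] cauchy_supp[OF g, of n] cauchy_supp[OF c(1), of n] cauchy_supp[OF c(2), of n]
        by (intro add_mono mult_left_mono mult_right_mono nrm_nonneg) blast+
      finally show "norm (frm (f n) (g n) - frm (f' n) (g' n))
          \<le> nrm (f n - f' n) * B + A * nrm (g n - g' n)" .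
      show "(\<lambda>n. nrm (f n - f' n) * B + A * nrm (g n - g' n)) \<longlonglongrightarrow> 0"
        using tendsto_add[OF tendsto_mult_right[OF l(1), of B] tendsto_mult_left[OF l(2), of A]] by simp
    qed
    then have "(\<lambda>n. frm (f' n) (g' n)) \<longlonglongrightarrow> z"
      by (rule Lim_transform2[OF z])
    then show "z' = z" using z' LIMSEQ_unique by blast
  qed
  with z show ?thesis by simp
qed

lemma hnorm_cls:
  assumes f: "f \<in> ker_cauchy I \<kappa>"
  shows "(\<lambda>n. nrm (f n)) \<longlonglongrightarrow> hnorm K (cls f)"
  unfolding hnorm_def ker_norm_def
  by (intro tendsto_real_sqrt tendsto_Re cinner_cls f)

lemma completion_module: "Module.module complex_field K"
proof (rule module_complexI)
  note [simp] = add_cls smult_cls cauchy_add cauchy_sc zero_cls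
  have z [simp]: "(\<lambda>_. 0) \<in> ker_cauchy I \<kappa>" by (rule cauchy_const) simp
  fix x y w assume x: "x \<in> carrier K"
  then obtain f where f: "f \<in> ker_cauchy I \<kappa>" "x = cls f" by (auto simp: carrier_completion)
  show "c \<odot>\<^bsub>K\<^esub> x \<in> carrier K" for c using f by (simp add: carrier_completion)
  show "\<zero>\<^bsub>K\<^esub> \<oplus>\<^bsub>K\<^esub> x = x" using f by simp
  have "sc (-1) (f n) + f n = 0" for n by (rule poly_mapping_eqI) (simp add: lookup_add)
  then show "(-1) \<odot>\<^bsub>K\<^esub> x \<oplus>\<^bsub>K\<^esub> x = \<zero>\<^bsub>K\<^esub>" using f by simp
  have "sc (a + b) (f n) = sc a (f n) + sc b (f n)" for n a b
    by (rule poly_mapping_eqI) (simp add: lookup_add algebra_simps)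
  then show "(a + b) \<odot>\<^bsub>K\<^esub> x = a \<odot>\<^bsub>K\<^esub> x \<oplus>\<^bsub>K\<^esub> b \<odot>\<^bsub>K\<^esub> x" for a b using f by simp
  have "sc (a * b) (f n) = sc a (sc b (f n))" for n a b
    by (rule poly_mapping_eqI) simp
  then show "(a * b) \<odot>\<^bsub>K\<^esub> x = a \<odot>\<^bsub>K\<^esub> (b \<odot>\<^bsub>K\<^esub> x)" for a b using f by simp
  have "sc 1 (f n) = f n" for n by (rule poly_mapping_eqI) simp
  then show "1 \<odot>\<^bsub>K\<^esub> x = x" using f by simp
  assume y: "y \<in> carrier K"
  then obtain g where g: "g \<in> ker_cauchy I \<kappa>" "y = cls g" by (auto simp: carrier_completion)
  show "x \<oplus>\<^bsub>K\<^esub> y \<in> carrier K" using f g by (simp add: carrier_completion)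
  show "x \<oplus>\<^bsub>K\<^esub> y = y \<oplus>\<^bsub>K\<^esub> x" using f g by (simp add: add.commute)
  have "sc a (f n + g n) = sc a (f n) + sc a (g n)" for n a
    by (rule poly_mapping_eqI) (simp add: lookup_add algebra_simps)
  then show "a \<odot>\<^bsub>K\<^esub> (x \<oplus>\<^bsub>K\<^esub> y) = a \<odot>\<^bsub>K\<^esub> x \<oplus>\<^bsub>K\<^esub> a \<odot>\<^bsub>K\<^esub> y" for a using f g by simp
  assume "w \<in> carrier K"
  then obtain h where h: "h \<in> ker_cauchy I \<kappa>" "w = cls h" by (auto simp: carrier_completion)
  show "x \<oplus>\<^bsub>K\<^esub> y \<oplus>\<^bsub>K\<^esub> w = x \<oplus>\<^bsub>K\<^esub> (y \<oplus>\<^bsub>K\<^esub> w)" using f g h by (simp add: add.assoc)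
next
  show "\<zero>\<^bsub>K\<^esub> \<in> carrier K" by (simp add: zero_cls carrier_completion cauchy_const)
qed

lemma diff_cls:
  assumes f: "f \<in> ker_cauchy I \<kappa>" and g: "g \<in> ker_cauchy I \<kappa>"
  shows "cls f \<ominus>\<^bsub>K\<^esub> cls g = cls (\<lambda>n. f n - g n)"
proof -
  have "f n + sc (-1) (g n) = f n - g n" for n
    by (rule poly_mapping_eqI) (simp add: lookup_add lookup_minus)
  then have eq: "(\<lambda>n. f n + sc (-1) (g n)) = (\<lambda>n. f n - g n)" by (rule ext)
  have "cls f \<in> carrier K" "cls g \<in> carrier K" using f g by (auto simp: carrier_completion)
  then have "cls f \<ominus>\<^bsub>K\<^esub> cls g = cls f \<oplus>\<^bsub>K\<^esub> (-1) \<odot>\<^bsub>K\<^esub> cls g"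
    by (rule module_diff_eq[OF completion_module])
  then show ?thesis unfolding smult_cls[OF g] add_cls[OF f cauchy_sc[OF g]] eq .
qed

lemma cauchy_diff:
  assumes "f \<in> ker_cauchy I \<kappa>" "g \<in> ker_cauchy I \<kappa>"
  shows "(\<lambda>n. f n - g n) \<in> ker_cauchy I \<kappa>"
proof -
  have "f n + sc (-1) (g n) = f n - g n" for n
    by (rule poly_mapping_eqI) (simp add: lookup_add lookup_minus)
  then show ?thesis using cauchy_add[OF assms(1) cauchy_sc[OF assms(2), of "-1"]] by simp
qed

text \<open>The vector represented by a formal linear combination.\<close>

abbreviation emb where "emb f \<equiv> cls (\<lambda>_. f)"

lemma emb_approx:
  assumes f: "f \<in> ker_cauchy I \<kappa>"
  shows "(\<lambda>n. hnorm K (cls f \<ominus>\<^bsub>K\<^esub> emb (f n))) \<longlonglongrightarrow> 0"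
proof (rule LIMSEQ_I)
  fix \<epsilon> :: real assume \<epsilon>: "0 < \<epsilon>"
  then have half: "0 < \<epsilon> / 2" by simp
  obtain k where k: "\<And>m n. m \<ge> k \<Longrightarrow> n \<ge> k \<Longrightarrow> nrm (f m - f n) < \<epsilon> / 2"
    using ker_cauchyE[OF f half] by blast
  have "norm (hnorm K (cls f \<ominus>\<^bsub>K\<^esub> emb (f n)) - 0) < \<epsilon>" if "n \<ge> k" for n
  proof -
    have c: "(\<lambda>m. f m - f n) \<in> ker_cauchy I \<kappa>"
      using cauchy_diff[OF f cauchy_const[OF cauchy_supp[OF f]]] .
    have lim: "(\<lambda>m. nrm (f m - f n)) \<longlonglongrightarrow> hnorm K (cls f \<ominus>\<^bsub>K\<^esub> emb (f n))"
      using hnorm_cls[OF c] diff_cls[OF f cauchy_const[OF cauchy_supp[OF f]], of n] by simp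
    have "hnorm K (cls f \<ominus>\<^bsub>K\<^esub> emb (f n)) \<le> \<epsilon> / 2"
      by (rule LIMSEQ_le_const2[OF lim]) (use k that in \<open>auto intro!: exI[of _ k] less_imp_le\<close>)
    moreover have "0 \<le> hnorm K (cls f \<ominus>\<^bsub>K\<^esub> emb (f n))"
      by (rule LIMSEQ_le_const[OF lim])
        (use nrm_nonneg cauchy_supp[OF c] in auto)
    ultimately show ?thesis using \<epsilon> by simp
  qed
  then show "\<exists>no. \<forall>n\<ge>no. norm (hnorm K (cls f \<ominus>\<^bsub>K\<^esub> emb (f n)) - 0) < \<epsilon>" by blast
qed

lemma hnorm_emb:
  assumes "supp f \<subseteq> I"
  shows "hnorm K (emb f) = nrm f"
  using hnorm_cls[OF cauchy_const[OF assms]] LIMSEQ_unique tendsto_const by blast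

lemma completion_hilbert: "hilbert_space K"
proof -
  have z: "(\<lambda>_. 0) \<in> ker_cauchy I \<kappa>" by (rule cauchy_const) simp
  have inner_axioms: "cinner K x (y \<oplus>\<^bsub>K\<^esub> w) = cinner K x y + cinner K x w"
    "cinner K x (c \<odot>\<^bsub>K\<^esub> y) = c * cinner K x y" "cinner K y x = cnj (cinner K x y)"
    "0 \<le> Re (cinner K x x)"
    if x: "x \<in> carrier K" and y: "y \<in> carrier K" and w: "w \<in> carrier K" for x y w c
  proof -
    obtain f g h where f: "f \<in> ker_cauchy I \<kappa>" "x = cls f" and g: "g \<in> ker_cauchy I \<kappa>" "y = cls g"
      and h: "h \<in> ker_cauchy I \<kappa>" "w = cls h"
      using x y w by (auto simp: carrier_completion)
    note s = cauchy_supp[OF f(1)] cauchy_supp[OF g(1)] cauchy_supp[OF h(1)]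
    note lfg = cinner_cls[OF f(1) g(1), folded f(2) g(2)]
    note lgf = cinner_cls[OF g(1) f(1), folded f(2) g(2)]
    note lfh = cinner_cls[OF f(1) h(1), folded f(2) h(2)]
    note lff = cinner_cls[OF f(1) f(1), folded f(2)]
    have "(\<lambda>n. frm (f n) (g n + h n)) \<longlonglongrightarrow> cinner K x (y \<oplus>\<^bsub>K\<^esub> w)"
      using cinner_cls[OF f(1) cauchy_add[OF g(1) h(1)]] f g h by (simp add: add_cls)
    then show "cinner K x (y \<oplus>\<^bsub>K\<^esub> w) = cinner K x y + cinner K x w"
      unfolding ker_form_add_right using LIMSEQ_unique tendsto_add[OF lfg lfh] by blast
    have "(\<lambda>n. frm (f n) (sc c (g n))) \<longlonglongrightarrow> cinner K x (c \<odot>\<^bsub>K\<^esub> y)"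
      using cinner_cls[OF f(1) cauchy_sc[OF g(1)]] f g by (simp add: smult_cls)
    then show "cinner K x (c \<odot>\<^bsub>K\<^esub> y) = c * cinner K x y"
      unfolding ker_form_sc_right using LIMSEQ_unique tendsto_mult_left[OF lfg] by blast
    have "(\<lambda>n. cnj (frm (f n) (g n))) \<longlonglongrightarrow> cnj (cinner K x y)"
      by (intro tendsto_cnj lfg)
    then show "cinner K y x = cnj (cinner K x y)"
      using LIMSEQ_unique[OF lgf] frm_commute[OF s(1) s(2)] by simp
    show "0 \<le> Re (cinner K x x)"
      by (rule LIMSEQ_le_const[OF tendsto_Re[OF lff]]) (use psd s in auto)
  qed
  have definite: "x = \<zero>\<^bsub>K\<^esub>" if x: "x \<in> carrier K" and 0: "cinner K x x = 0" for x
  proof -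
    obtain f where f: "f \<in> ker_cauchy I \<kappa>" "x = cls f" using x by (auto simp: carrier_completion)
    have "(\<lambda>n. nrm (f n)) \<longlonglongrightarrow> 0"
      using hnorm_cls[OF f(1)] 0 f(2) by (simp add: hnorm_def)
    then show ?thesis
      unfolding zero_cls f(2) cls_eq_iff[OF f(1) z] using f(1) z by (simp add: ker_rel_def)
  qed
  have complete: "\<exists>l\<in>carrier K. (\<lambda>n::nat. hnorm K (xs n \<ominus>\<^bsub>K\<^esub> l)) \<longlonglongrightarrow> 0"
    if xs: "\<And>n. xs n \<in> carrier K"
      and cauchy: "\<forall>e>0. \<exists>k. \<forall>m\<ge>k. \<forall>n\<ge>k. hnorm K (xs m \<ominus>\<^bsub>K\<^esub> xs n) < e" for xs
  proof -
    \<comment> \<open>The limit is the class of a sequence of formal combinations that approximate the \<open>xs n\<close>.\<close>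
    have "\<exists>g. supp g \<subseteq> I \<and> hnorm K (xs n \<ominus>\<^bsub>K\<^esub> emb g) < 1 / real (Suc n)" for n
    proof -
      obtain f where f: "f \<in> ker_cauchy I \<kappa>" "xs n = cls f" using xs[of n] by (auto simp: carrier_completion)
      have "0 < 1 / real (Suc n)" by simp
      from LIMSEQ_D[OF emb_approx[OF f(1)] this] obtain m
        where "norm (hnorm K (cls f \<ominus>\<^bsub>K\<^esub> emb (f m)) - 0) < 1 / real (Suc n)" by blast
      then have "hnorm K (xs n \<ominus>\<^bsub>K\<^esub> emb (f m)) < 1 / real (Suc n)"
        using f(2) by (simp only: real_norm_def diff_0_right abs_less_iff)
      then show ?thesis using cauchy_supp[OF f(1)] by blast
    qed
    then obtain g where g: "\<And>n. supp (g n) \<subseteq> I"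
      "\<And>n. hnorm K (xs n \<ominus>\<^bsub>K\<^esub> emb (g n)) < 1 / real (Suc n)" by metis
    have tri: "hnorm K (x \<ominus>\<^bsub>K\<^esub> w) \<le> hnorm K (x \<ominus>\<^bsub>K\<^esub> y) + hnorm K (y \<ominus>\<^bsub>K\<^esub> w)"
      if x: "x \<in> carrier K" and y: "y \<in> carrier K" and w: "w \<in> carrier K" for x y w
    proof -
      obtain f g h where f: "f \<in> ker_cauchy I \<kappa>" "x = cls f" and g: "g \<in> ker_cauchy I \<kappa>" "y = cls g"
        and h: "h \<in> ker_cauchy I \<kappa>" "w = cls h"
        using x y w by (auto simp: carrier_completion)
      note l = hnorm_cls[OF cauchy_diff]
      show ?thesis unfolding f(2) g(2) h(2) diff_cls[OF f(1) h(1)] diff_cls[OF f(1) g(1)] diff_cls[OF g(1) h(1)]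
        by (rule LIMSEQ_le[OF l[OF f(1) h(1)] tendsto_add[OF l[OF f(1) g(1)] l[OF g(1) h(1)]]])
          (use nrm_diff_triangle cauchy_supp f(1) g(1) h(1) in auto)
    qed
    have comm: "hnorm K (x \<ominus>\<^bsub>K\<^esub> y) = hnorm K (y \<ominus>\<^bsub>K\<^esub> x)"
      if x: "x \<in> carrier K" and y: "y \<in> carrier K" for x y
    proof -
      obtain f g where f: "f \<in> ker_cauchy I \<kappa>" "x = cls f" and g: "g \<in> ker_cauchy I \<kappa>" "y = cls g"
        using x y by (auto simp: carrier_completion)
      note l = hnorm_cls[OF cauchy_diff]
      have "nrm (g n - f n) = nrm (f n - g n)" for n
        using nrm_diff_commute cauchy_supp f(1) g(1) by blast
      then show ?thesis unfolding f(2) g(2) diff_cls[OF f(1) g(1)] diff_cls[OF g(1) f(1)]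
        using LIMSEQ_unique[OF l[OF f(1) g(1)]] l[OF g(1) f(1)] by simp
    qed
    have emb: "emb (g n) \<in> carrier K" for n
      using g(1) by (auto simp: carrier_completion cauchy_const)
    have gdiff: "hnorm K (emb (g m) \<ominus>\<^bsub>K\<^esub> emb (g n)) = nrm (g m - g n)" for m n
      using diff_cls[OF cauchy_const[OF g(1)] cauchy_const[OF g(1)], of m n]
        hnorm_emb[of "g m - g n"] supp_diff[of "g m" "g n"] g(1)[of m] g(1)[of n] by auto
    have gc: "g \<in> ker_cauchy I \<kappa>"
      unfolding ker_cauchy_def
    proof (intro CollectI conjI allI impI g(1))
      fix \<epsilon> :: real assume \<epsilon>: "0 < \<epsilon>"
      then have e3: "0 < \<epsilon> / 3" by simp
      from cauchy e3 obtain k where k: "\<And>m n. m \<ge> k \<Longrightarrow> n \<ge> k \<Longrightarrow> hnorm K (xs m \<ominus>\<^bsub>K\<^esub> xs n) < \<epsilon> / 3"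
        by blast
      from reals_Archimedean[OF e3] obtain l where l: "inverse (real (Suc l)) < \<epsilon> / 3" ..
      have small: "hnorm K (xs n \<ominus>\<^bsub>K\<^esub> emb (g n)) < \<epsilon> / 3" if "n \<ge> l" for n
      proof -
        have "1 / real (Suc n) \<le> inverse (real (Suc l))" using that by (auto simp: field_simps)
        then show ?thesis using g(2)[of n] l by linarith
      qed
      have "nrm (g m - g n) < \<epsilon>" if "m \<ge> max k l" "n \<ge> max k l" for m n
      proof -
        have "hnorm K (emb (g m) \<ominus>\<^bsub>K\<^esub> emb (g n))
          \<le> hnorm K (emb (g m) \<ominus>\<^bsub>K\<^esub> xs m) + hnorm K (xs m \<ominus>\<^bsub>K\<^esub> emb (g n))"
          by (rule tri[OF emb xs emb])
        also have "hnorm K (xs m \<ominus>\<^bsub>K\<^esub> emb (g n))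
          \<le> hnorm K (xs m \<ominus>\<^bsub>K\<^esub> xs n) + hnorm K (xs n \<ominus>\<^bsub>K\<^esub> emb (g n))"
          by (rule tri[OF xs xs emb])
        finally show ?thesis
          using k[of m n] small[of m] small[of n] that comm[OF emb xs, of m m] unfolding gdiff by simp
      qed
      then show "\<exists>k. \<forall>m\<ge>k. \<forall>n\<ge>k. nrm (g m - g n) < \<epsilon>" by blast
    qed
    have gK: "cls g \<in> carrier K" using gc by (simp add: carrier_completion)
    have "(\<lambda>n. hnorm K (xs n \<ominus>\<^bsub>K\<^esub> cls g)) \<longlonglongrightarrow> 0"
    proof (rule null_comparison)
      fix n
      have "0 \<le> Re (cinner K (xs n \<ominus>\<^bsub>K\<^esub> cls g) (xs n \<ominus>\<^bsub>K\<^esub> cls g))"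
      proof -
        interpret Module.module complex_field K by (rule completion_module)
        have "xs n \<ominus>\<^bsub>K\<^esub> cls g \<in> carrier K" using M.minus_closed[OF xs gK] .
        then show ?thesis using inner_axioms(4) by blast
      qed
      then have "norm (hnorm K (xs n \<ominus>\<^bsub>K\<^esub> cls g)) = hnorm K (xs n \<ominus>\<^bsub>K\<^esub> cls g)"
        by (simp add: hnorm_def)
      also have "\<dots> \<le> hnorm K (xs n \<ominus>\<^bsub>K\<^esub> emb (g n)) + hnorm K (emb (g n) \<ominus>\<^bsub>K\<^esub> cls g)"
        by (rule tri[OF xs emb gK])
      also have "\<dots> \<le> inverse (real (Suc n)) + hnorm K (cls g \<ominus>\<^bsub>K\<^esub> emb (g n))"
        using g(2)[of n] comm[OF emb gK, of n] by (simp add: inverse_eq_divide)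
      finally show "norm (hnorm K (xs n \<ominus>\<^bsub>K\<^esub> cls g))
        \<le> inverse (real (Suc n)) + hnorm K (cls g \<ominus>\<^bsub>K\<^esub> emb (g n))" .
      show "(\<lambda>n. inverse (real (Suc n)) + hnorm K (cls g \<ominus>\<^bsub>K\<^esub> emb (g n))) \<longlonglongrightarrow> 0"
        using tendsto_add[OF LIMSEQ_inverse_real_of_nat emb_approx[OF gc]] by simp
    qed
    then show ?thesis using gK by blast
  qed
  show ?thesis
  proof (intro hilbert_space.intro completion_module hilbert_space_axioms.intro)
    fix x y assume x: "x \<in> carrier K" and y: "y \<in> carrier K"
    show "cinner K x (c \<odot>\<^bsub>K\<^esub> y) = c * cinner K x y" for c by (rule inner_axioms(2)[OF x y y])
    show "cinner K y x = cnj (cinner K x y)" by (rule inner_axioms(3)[OF x y y])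
    fix w assume w: "w \<in> carrier K"
    show "cinner K x (y \<oplus>\<^bsub>K\<^esub> w) = cinner K x y + cinner K x w" by (rule inner_axioms(1)[OF x y w])
  next
    fix x assume x: "x \<in> carrier K"
    show "0 \<le> Re (cinner K x x)" by (rule inner_axioms(4)[OF x x x])
    show "x = \<zero>\<^bsub>K\<^esub>" if "cinner K x x = 0" using x that by (rule definite)
  qed (rule complete)
qed

sublocale K: hilbert_space K by (rule completion_hilbert)

lemma elem_closed [simp]: "x \<in> I \<Longrightarrow> e x \<in> carrier K"
  unfolding hcompl_elem_def carrier_completion by (intro imageI cauchy_const) simp

lemma cinner_elem: "x \<in> I \<Longrightarrow> y \<in> I \<Longrightarrow> cinner K (e x) (e y) = \<kappa> x y"
  using cinner_cls[OF cauchy_const cauchy_const, of "Poly_Mapping.single x 1" "Poly_Mapping.single y 1"]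
  by (simp add: hcompl_elem_def ker_form_single LIMSEQ_const_iff)

lemma emb_closed: "supp f \<subseteq> I \<Longrightarrow> emb f \<in> carrier K"
  by (simp add: carrier_completion cauchy_const)

lemma emb_eq_lincomb:
  assumes "supp f \<subseteq> I"
  shows "emb f = lincomb K e f"
proof (rule K.vec_eqI[OF emb_closed[OF assms] K.lincomb_closed])
  fix x assume "x \<in> supp f" then show "e x \<in> carrier K" using assms by auto
next
  fix z assume z: "z \<in> carrier K"
  have es: "e x \<in> carrier K" if "x \<in> supp f" for x using assms that by auto
  obtain g where g: "g \<in> ker_cauchy I \<kappa>" "z = cls g" using z by (auto simp: carrier_completion)
  have "(\<lambda>n. frm (g n) f) \<longlonglongrightarrow> cinner K z (emb f)"
    unfolding g(2) by (rule cinner_cls[OF g(1) cauchy_const[OF assms]])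
  moreover have "(\<lambda>n. frm (g n) f) \<longlonglongrightarrow> (\<Sum>x\<in>supp f. coef f x * cinner K z (e x))"
  proof -
    have eq: "frm (g n) f = (\<Sum>x\<in>supp f. coef f x * frm (g n) (Poly_Mapping.single x 1))" for n
    proof -
      have "frm (g n) (Poly_Mapping.single x 1) = (\<Sum>y\<in>supp (g n). cnj (coef (g n) y) * \<kappa> y x)" for x
        by (subst ker_form_superset[of "supp (g n)" _ "{x}"]) auto
      then show ?thesis
        by (simp add: ker_form_def sum_distrib_left sum.swap[of _ "supp f"] mult_ac)
    qed
    show ?thesis unfolding eq
    proof (intro tendsto_sum tendsto_mult_left)
      fix x assume "x \<in> supp f"
      then have "supp (Poly_Mapping.single x (1::complex)) \<subseteq> I" using assms by auto
      from cinner_cls[OF g(1) cauchy_const[OF this]]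
      show "(\<lambda>n. frm (g n) (Poly_Mapping.single x 1)) \<longlonglongrightarrow> cinner K z (e x)"
        unfolding g(2) hcompl_elem_def .
    qed
  qed
  ultimately have "cinner K z (emb f) = (\<Sum>x\<in>supp f. coef f x * cinner K z (e x))"
    by (rule LIMSEQ_unique)
  also have "\<dots> = cinner K z (lincomb K e f)"
    by (rule K.cinner_lincomb_right[symmetric]) (use es z in auto)
  finally show "cinner K z (emb f) = cinner K z (lincomb K e f)" .
qed

lemma elem_total: "total_family K I e"
  unfolding total_family_def
proof (intro conjI ballI impI)
  fix z assume z: "z \<in> carrier K" and 0: "\<forall>x\<in>I. cinner K (e x) z = 0"
  obtain f where f: "f \<in> ker_cauchy I \<kappa>" "z = cls f" using z by (auto simp: carrier_completion)
  have ez: "cinner K z (e x) = 0" if "x \<in> I" for x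
    using 0 that K.cinner_commute[OF elem_closed[OF that] z] by simp
  have "cinner K z (emb (f n)) = 0" for n
  proof -
    have s: "e x \<in> carrier K" if "x \<in> supp (f n)" for x using cauchy_supp[OF f(1), of n] that by auto
    have "cinner K z (lincomb K e (f n)) = (\<Sum>x\<in>supp (f n). coef (f n) x * cinner K z (e x))"
      by (rule K.cinner_lincomb_right) (use s z in auto)
    also have "\<dots> = 0" using ez cauchy_supp[OF f(1), of n] by (intro sum.neutral) auto
    finally show ?thesis unfolding emb_eq_lincomb[OF cauchy_supp[OF f(1)]] .
  qed
  moreover have "(\<lambda>n. cinner K z (emb (f n))) \<longlonglongrightarrow> cinner K z z"
  proof (rule K.cinner_tendsto)
    show ec: "emb (f n) \<in> carrier K" for n by (rule emb_closed[OF cauchy_supp[OF f(1)]])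
    show "(\<lambda>n. hnorm K (emb (f n) \<ominus>\<^bsub>K\<^esub> z)) \<longlonglongrightarrow> 0"
      using emb_approx[OF f(1)] K.hnorm_diff_commute[OF ec z] f(2) by simp
  qed (use z in simp_all)
  ultimately have "cinner K z z = 0" by (simp add: LIMSEQ_const_iff)
  then show "z = \<zero>\<^bsub>K\<^esub>" using z K.cinner_definite by simp
qed simp

text \<open>A bound on formal linear combinations is enough: limits of Cauchy sequences of them exist in \<open>L\<close>.\<close>

lemma extend:
  assumes L: "hilbert_space L" and v: "\<And>x. x \<in> I \<Longrightarrow> v x \<in> carrier L"
    and bound: "\<And>f. supp f \<subseteq> I \<Longrightarrow> hnorm L (lincomb L v f) \<le> C * nrm f"
  shows "\<exists>A\<in>bop K L. \<forall>x\<in>I. A (e x) = v x"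
proof -
  interpret L: hilbert_space L by fact
  let ?v = "lincomb L v"
  have vc: "?v f \<in> carrier L" if "supp f \<subseteq> I" for f using v that by (auto intro!: L.lincomb_closed)
  have ldiff: "?v (f - g) = ?v f \<ominus>\<^bsub>L\<^esub> ?v g" if "supp f \<subseteq> I" "supp g \<subseteq> I" for f g
    by (rule L.lincomb_diff[where I = I]) (use v that in auto)
  have ladd: "?v (f + g) = ?v f \<oplus>\<^bsub>L\<^esub> ?v g" if "supp f \<subseteq> I" "supp g \<subseteq> I" for f g
    by (rule L.lincomb_add[where I = I]) (use v that in auto)
  have lsc: "?v (sc c f) = c \<odot>\<^bsub>L\<^esub> ?v f" if "supp f \<subseteq> I" for c f
    by (rule L.lincomb_sc[where I = I]) (use v that in auto)
  have C1: "hnorm L (?v f) \<le> (\<bar>C\<bar> + 1) * nrm f" if "supp f \<subseteq> I" for f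
  proof -
    have "C * nrm f \<le> (\<bar>C\<bar> + 1) * nrm f" using nrm_nonneg[OF that] by (intro mult_right_mono) auto
    then show ?thesis using bound[OF that] by linarith
  qed
  have lim: "\<exists>l\<in>carrier L. (\<lambda>n. hnorm L (?v (f n) \<ominus>\<^bsub>L\<^esub> l)) \<longlonglongrightarrow> 0" if f: "f \<in> ker_cauchy I \<kappa>" for f
  proof (rule L.complete)
    note s = cauchy_supp[OF f]
    show "?v (f n) \<in> carrier L" for n by (rule vc[OF s])
    show "\<forall>e>0. \<exists>k. \<forall>m\<ge>k. \<forall>n\<ge>k. hnorm L (?v (f m) \<ominus>\<^bsub>L\<^esub> ?v (f n)) < e"
    proof (intro allI impI)
      fix \<epsilon> :: real assume \<epsilon>: "0 < \<epsilon>"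
      then have pos: "0 < \<epsilon> / (\<bar>C\<bar> + 1)" by (simp add: add_nonneg_pos)
      obtain k where k: "\<And>m n. m \<ge> k \<Longrightarrow> n \<ge> k \<Longrightarrow> nrm (f m - f n) < \<epsilon> / (\<bar>C\<bar> + 1)"
        using ker_cauchyE[OF f pos] by blast
      have "hnorm L (?v (f m) \<ominus>\<^bsub>L\<^esub> ?v (f n)) < \<epsilon>" if "m \<ge> k" "n \<ge> k" for m n
      proof -
        have d: "supp (f m - f n) \<subseteq> I" using supp_diff[of "f m" "f n"] s by blast
        have "hnorm L (?v (f m) \<ominus>\<^bsub>L\<^esub> ?v (f n)) \<le> (\<bar>C\<bar> + 1) * nrm (f m - f n)"
          using C1[OF d] ldiff[OF s s] by simp
        also have "\<dots> < (\<bar>C\<bar> + 1) * (\<epsilon> / (\<bar>C\<bar> + 1))"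
          using k[OF that] by (intro mult_strict_left_mono) (simp_all add: add_nonneg_pos)
        also have "\<dots> = \<epsilon>" using abs_ge_zero[of C] by (simp add: add_nonneg_eq_0_iff)
        finally show ?thesis .
      qed
      then show "\<exists>k. \<forall>m\<ge>k. \<forall>n\<ge>k. hnorm L (?v (f m) \<ominus>\<^bsub>L\<^esub> ?v (f n)) < \<epsilon>" by blast
    qed
  qed
  have "\<exists>l\<in>carrier L. \<exists>f\<in>ker_cauchy I \<kappa>. z = cls f \<and> (\<lambda>n. hnorm L (?v (f n) \<ominus>\<^bsub>L\<^esub> l)) \<longlonglongrightarrow> 0"
    if z: "z \<in> carrier K" for z
  proof -
    obtain f where f: "z = cls f" "f \<in> ker_cauchy I \<kappa>"
      using z unfolding carrier_completion by (rule imageE)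
    from lim[OF f(2)] obtain l where "l \<in> carrier L" "(\<lambda>n. hnorm L (?v (f n) \<ominus>\<^bsub>L\<^esub> l)) \<longlonglongrightarrow> 0" ..
    with f show ?thesis by (intro bexI[of _ l] bexI[of _ f] conjI)
  qed
  then obtain A' where A': "\<And>z. z \<in> carrier K \<Longrightarrow> A' z \<in> carrier L \<and>
      (\<exists>f\<in>ker_cauchy I \<kappa>. z = cls f \<and> (\<lambda>n. hnorm L (?v (f n) \<ominus>\<^bsub>L\<^esub> A' z)) \<longlonglongrightarrow> 0)"
    by metis
  define A where "A = restrict A' (carrier K)"
  have Ac: "A z \<in> carrier L" if "z \<in> carrier K" for z using A'[OF that] that by (simp add: A_def)
  have lim_inner: "(\<lambda>n. cinner L y (?v (f n))) \<longlonglongrightarrow> cinner L y (A (cls f))"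
    if f: "f \<in> ker_cauchy I \<kappa>" and y: "y \<in> carrier L" for f y
  proof -
    have z: "cls f \<in> carrier K" using f by (simp add: carrier_completion)
    obtain g where g: "g \<in> ker_cauchy I \<kappa>" "cls f = cls g"
      "(\<lambda>n. hnorm L (?v (g n) \<ominus>\<^bsub>L\<^esub> A (cls f))) \<longlonglongrightarrow> 0"
      using A'[OF z] z by (auto simp: A_def)
    note sf = cauchy_supp[OF f] and sg = cauchy_supp[OF g(1)]
    have l1: "(\<lambda>n. cinner L y (?v (g n))) \<longlonglongrightarrow> cinner L y (A (cls f))"
      by (rule L.cinner_tendsto[OF vc[OF sg] Ac[OF z] y g(3)])
    have "(g, f) \<in> ker_rel I \<kappa>" using cls_eq_iff[OF g(1) f] g(2) by simp
    then have l0: "(\<lambda>n. nrm (g n - f n)) \<longlonglongrightarrow> 0" by (simp add: ker_rel_def)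
    have "(\<lambda>n. cinner L y (?v (g n)) - cinner L y (?v (f n))) \<longlonglongrightarrow> 0"
    proof (rule null_comparison)
      fix n
      have d: "supp (g n - f n) \<subseteq> I" using supp_diff[of "g n" "f n"] sf sg by blast
      have "cinner L y (?v (g n)) - cinner L y (?v (f n)) = cinner L y (?v (g n - f n))"
        using ldiff[OF sg sf, of n n] vc[OF sf] vc[OF sg] y by simp
      also have "cmod \<dots> \<le> hnorm L y * hnorm L (?v (g n - f n))"
        by (rule L.cauchy_schwarz[OF y vc[OF d]])
      also have "\<dots> \<le> hnorm L y * ((\<bar>C\<bar> + 1) * nrm (g n - f n))"
        using C1[OF d] y by (intro mult_left_mono) simp_all
      finally show "norm (cinner L y (?v (g n)) - cinner L y (?v (f n)))
        \<le> hnorm L y * ((\<bar>C\<bar> + 1) * nrm (g n - f n))" .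
      show "(\<lambda>n. hnorm L y * ((\<bar>C\<bar> + 1) * nrm (g n - f n))) \<longlonglongrightarrow> 0"
        using tendsto_mult_left[OF tendsto_mult_left[OF l0, of "\<bar>C\<bar> + 1"], of "hnorm L y"] by simp
    qed
    then show ?thesis by (rule Lim_transform2[OF l1])
  qed
  have "A \<in> bop K L"
    unfolding bop_def
  proof (intro CollectI conjI ballI allI)
    show "A \<in> carrier K \<rightarrow>\<^sub>E carrier L" using Ac by (auto simp: A_def)
    fix x assume x: "x \<in> carrier K"
    then obtain f where f: "f \<in> ker_cauchy I \<kappa>" "x = cls f" by (auto simp: carrier_completion)
    note sf = cauchy_supp[OF f(1)]
    fix c
    show "A (c \<odot>\<^bsub>K\<^esub> x) = c \<odot>\<^bsub>L\<^esub> A x"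
    proof (rule L.vec_eqI)
      fix y assume y: "y \<in> carrier L"
      have "(\<lambda>n. cinner L y (?v (sc c (f n)))) \<longlonglongrightarrow> cinner L y (A (c \<odot>\<^bsub>K\<^esub> x))"
        unfolding f(2) smult_cls[OF f(1)] by (rule lim_inner[OF cauchy_sc[OF f(1)] y])
      moreover have "(\<lambda>n. c * cinner L y (?v (f n))) \<longlonglongrightarrow> c * cinner L y (A x)"
        unfolding f(2) by (intro tendsto_mult_left lim_inner[OF f(1) y])
      moreover have "cinner L y (?v (sc c (f n))) = c * cinner L y (?v (f n))" for n
        using lsc[OF sf, of c n] vc[OF sf] y by simp
      ultimately show "cinner L y (A (c \<odot>\<^bsub>K\<^esub> x)) = cinner L y (c \<odot>\<^bsub>L\<^esub> A x)"
        using LIMSEQ_unique Ac[OF x] y by simp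
    qed (use x Ac in simp_all)
    fix x' assume x': "x' \<in> carrier K"
    then obtain g where g: "g \<in> ker_cauchy I \<kappa>" "x' = cls g" by (auto simp: carrier_completion)
    note sg = cauchy_supp[OF g(1)]
    show "A (x \<oplus>\<^bsub>K\<^esub> x') = A x \<oplus>\<^bsub>L\<^esub> A x'"
    proof (rule L.vec_eqI)
      fix y assume y: "y \<in> carrier L"
      have "(\<lambda>n. cinner L y (?v (f n + g n))) \<longlonglongrightarrow> cinner L y (A (x \<oplus>\<^bsub>K\<^esub> x'))"
        unfolding f(2) g(2) add_cls[OF f(1) g(1)] by (rule lim_inner[OF cauchy_add[OF f(1) g(1)] y])
      moreover have "(\<lambda>n. cinner L y (?v (f n)) + cinner L y (?v (g n)))
          \<longlonglongrightarrow> cinner L y (A x) + cinner L y (A x')"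
        unfolding f(2) g(2) by (intro tendsto_add lim_inner f g y)
      moreover have "cinner L y (?v (f n + g n)) = cinner L y (?v (f n)) + cinner L y (?v (g n))" for n
        using ladd[OF sf sg, of n n] vc[OF sf] vc[OF sg] y by simp
      ultimately show "cinner L y (A (x \<oplus>\<^bsub>K\<^esub> x')) = cinner L y (A x \<oplus>\<^bsub>L\<^esub> A x')"
        using LIMSEQ_unique Ac[OF x] Ac[OF x'] y by simp
    qed (use x x' Ac in simp_all)
  next
    have "hnorm L (A x) \<le> (\<bar>C\<bar> + 1) * hnorm K x" if x: "x \<in> carrier K" for x
    proof -
      obtain f where f: "f \<in> ker_cauchy I \<kappa>" "x = cls f" "(\<lambda>n. hnorm L (?v (f n) \<ominus>\<^bsub>L\<^esub> A x)) \<longlonglongrightarrow> 0"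
        using A'[OF x] x by (auto simp: A_def)
      note sf = cauchy_supp[OF f(1)]
      have "(\<lambda>n. hnorm L (?v (f n))) \<longlonglongrightarrow> hnorm L (A x)"
        by (rule L.hnorm_tendsto[OF vc[OF sf] Ac[OF x] f(3)])
      moreover have "(\<lambda>n. (\<bar>C\<bar> + 1) * nrm (f n)) \<longlonglongrightarrow> (\<bar>C\<bar> + 1) * hnorm K x"
        unfolding f(2) by (intro tendsto_mult_left hnorm_cls f(1))
      ultimately show ?thesis
        by (rule LIMSEQ_le) (use C1[OF sf] in blast)
    qed
    then show "\<exists>C. \<forall>x\<in>carrier K. hnorm L (A x) \<le> C * hnorm K x" by blast
  qed
  moreover have "A (e x) = v x" if x: "x \<in> I" for x
  proof (rule L.vec_eqI)
    fix y assume y: "y \<in> carrier L"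
    have s: "supp (Poly_Mapping.single x (1::complex)) \<subseteq> I" using x by auto
    have "(\<lambda>n. cinner L y (?v (Poly_Mapping.single x 1))) \<longlonglongrightarrow> cinner L y (A (e x))"
      unfolding hcompl_elem_def by (rule lim_inner[OF cauchy_const[OF s] y])
    then show "cinner L y (A (e x)) = cinner L y (v x)"
      using L.lincomb_single[of v x] v[OF x] by (simp add: LIMSEQ_const_iff)
  qed (use x Ac v in simp_all)
  ultimately show ?thesis by blast
qed

end

lemma gram_form:
  assumes "hilbert_space L" and v: "\<And>x. x \<in> I \<Longrightarrow> v x \<in> carrier L"
    and gram: "\<And>x y. x \<in> I \<Longrightarrow> y \<in> I \<Longrightarrow> \<kappa> x y = cinner L (v x) (v y)" and f: "supp f \<subseteq> I"
  shows "ker_form \<kappa> f f = cinner L (lincomb L v f) (lincomb L v f)"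
proof -
  interpret L: hilbert_space L by fact
  have fI: "x \<in> I" if "x \<in> supp f" for x using f that by blast
  have "cinner L (lincomb L v f) (lincomb L v f)
      = (\<Sum>x\<in>supp f. \<Sum>y\<in>supp f. cnj (coef f x) * coef f y * cinner L (v x) (v y))"
    by (rule L.cinner_lincomb) (use v fI in blast)+
  also have "\<dots> = ker_form \<kappa> f f"
    unfolding ker_form_def by (intro sum.cong refl) (simp only: gram fI)
  finally show ?thesis ..
qed

lemma gram_kernel_psd:
  assumes "hilbert_space L" "\<And>x. x \<in> I \<Longrightarrow> v x \<in> carrier L"
    "\<And>x y. x \<in> I \<Longrightarrow> y \<in> I \<Longrightarrow> \<kappa> x y = cinner L (v x) (v y)"
  shows "psd_kernel I \<kappa>"
proof
  interpret L: hilbert_space L by fact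
  show "\<kappa> y x = cnj (\<kappa> x y)" if "x \<in> I" "y \<in> I" for x y
    using assms(2,3) that L.cinner_commute[of "v x" "v y"] by simp
  fix f assume f: "supp f \<subseteq> I"
  have "lincomb L v f \<in> carrier L" using f assms(2) by (intro L.lincomb_closed) auto
  from L.cinner_nonneg[OF this] gram_form[where v = v and \<kappa> = \<kappa>, OF assms f]
  show "0 \<le> Re (ker_form \<kappa> f f)" by simp
qed

definition isometry :: "'a hspace \<Rightarrow> 'b hspace \<Rightarrow> ('a \<Rightarrow> 'b) \<Rightarrow> bool" where
  "isometry K L V \<longleftrightarrow> V \<in> bop K L \<and>
     (\<forall>x\<in>carrier K. \<forall>y\<in>carrier K. cinner L (V x) (V y) = cinner K x y)"

lemma isometryI_total:
  assumes "hilbert_space K" "hilbert_space L" "total_family K I e" "V \<in> bop K L"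
    "\<And>x y. x \<in> I \<Longrightarrow> y \<in> I \<Longrightarrow> cinner L (V (e x)) (V (e y)) = cinner K (e x) (e y)"
  shows "isometry K L V"
proof -
  interpret K: hilbert_space K by fact
  note V = bop_closed[OF assms(4)] and Va = adj_closed[OF assms(1,2,4)]
  have e: "e x \<in> carrier K" if "x \<in> I" for x
    using assms(3) that by (simp add: total_family_def)
  have "adj K L V (V (e y)) = e y" if "y \<in> I" for y
    by (rule total_family_eqI[OF assms(1,3)])
      (use that in \<open>simp_all add: e V Va cinner_adj_right[OF assms(1,2,4)] assms(5)\<close>)
  then have eq: "compose (carrier K) (adj K L V) V (e y) = op_one K (e y)" if "y \<in> I" for y
    using that by (simp add: compose_eq e op_one_def)
  have eq: "compose (carrier K) (adj K L V) V = op_one K"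
    by (rule bop_eq_on_total[OF assms(1,1,3) bop_compose[OF assms(1,2,4) adj_bop[OF assms(1,2,4)]]
        op_one_bop[OF assms(1)] eq])
  have *: "adj K L V (V y) = y" if "y \<in> carrier K" for y
  proof -
    have "adj K L V (V y) = compose (carrier K) (adj K L V) V y" using that by (simp add: compose_eq)
    also have "\<dots> = y" unfolding eq using that by (simp add: op_one_def)
    finally show ?thesis .
  qed
  have "cinner L (V x) (V y) = cinner K x y" if "x \<in> carrier K" "y \<in> carrier K" for x y
    using cinner_adj_right[OF assms(1,2,4) that(1) V[OF that(2)]] *[OF that(2)] by simp
  then show ?thesis using assms(4) by (simp add: isometry_def)
qed

text \<open>The completion for a Gram kernel is the closed span of the vectors that it comes from.\<close>

lemma gram_kernel_isometry:
  assumes "hilbert_space L" "\<And>x. x \<in> I \<Longrightarrow> v x \<in> carrier L"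
    "\<And>x y. x \<in> I \<Longrightarrow> y \<in> I \<Longrightarrow> \<kappa> x y = cinner L (v x) (v y)"
  defines "V \<equiv> op_ext (hcompletion I \<kappa>) L I (hcompl_elem I \<kappa>) v"
  shows "isometry (hcompletion I \<kappa>) L V" and "x \<in> I \<Longrightarrow> V (hcompl_elem I \<kappa> x) = v x"
proof -
  interpret psd_kernel I \<kappa>
    by (rule gram_kernel_psd[where v = v and L = L]) (use assms in blast)+
  interpret L: hilbert_space L by fact
  have "\<exists>A\<in>bop K L. \<forall>x\<in>I. A (e x) = v x"
  proof (rule extend[where v = v and C = 1, OF assms(1,2)])
    fix f assume f: "supp f \<subseteq> I"
    show "hnorm L (lincomb L v f) \<le> 1 * nrm f"
      using gram_form[OF assms(1-3) f] by (simp add: hnorm_def ker_norm_def)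
  qed
  then obtain A where A: "A \<in> bop K L" "\<And>x. x \<in> I \<Longrightarrow> A (e x) = v x" by blast
  have "V = A" unfolding V_def by (rule op_ext_eq[OF completion_hilbert assms(1) elem_total A])
  then show "x \<in> I \<Longrightarrow> V (e x) = v x" using A(2) by simp
  show "isometry K L V"
    unfolding \<open>V = A\<close>
    by (rule isometryI_total[OF completion_hilbert assms(1) elem_total A(1)])
      (simp add: A(2) cinner_elem assms(3))
qed

section \<open>Symmetric and positive operators\<close>

text \<open>
  A log-convex sequence has non-decreasing quotients, so its first quotient is at most its rate of
  exponential growth. This replaces the spectral radius formula: crude bounds for the powers of a
  symmetric operator give the sharp bound for the operator itself.
\<close>

lemma log_convex_growth:
  fixes a :: "nat \<Rightarrow> real"
  assumes nn: "\<And>k. 0 \<le> a k" and conv: "\<And>k. (a (Suc k))\<^sup>2 \<le> a k * a (Suc (Suc k))"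
    and growth: "\<And>k. a k \<le> B * d ^ k" and d: "0 \<le> d"
  shows "a 1 \<le> d * a 0"
proof (rule ccontr)
  assume "\<not> ?thesis"
  then have gt: "d * a 0 < a 1" by simp
  have a1: "0 < a 1" using gt d nn[of 0] mult_nonneg_nonneg[of d "a 0"] by linarith
  have a0: "0 < a 0"
  proof (rule ccontr)
    assume "\<not> 0 < a 0"
    then have "a 0 = 0" using nn[of 0] by simp
    then show False using conv[of 0] a1 by simp
  qed
  have ratio: "0 < a k \<and> a 1 * a k \<le> a (Suc k) * a 0" for k
  proof (induction k)
    case 0 then show ?case using a0 by simp
  next
    case (Suc k)
    have "0 < a (Suc k) * a 0"
      using Suc mult_pos_pos[OF a1, of "a k"] by linarith
    then have pos: "0 < a (Suc k)" using a0 by (simp add: zero_less_mult_iff)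
    have "a k * (a 1 * a (Suc k)) \<le> a k * (a (Suc (Suc k)) * a 0)"
    proof -
      have "a k * (a 1 * a (Suc k)) = (a 1 * a k) * a (Suc k)" by simp
      also have "\<dots> \<le> (a (Suc k) * a 0) * a (Suc k)"
        using Suc pos by (intro mult_right_mono) auto
      also have "\<dots> = (a (Suc k))\<^sup>2 * a 0" by (simp add: power2_eq_square)
      also have "\<dots> \<le> (a k * a (Suc (Suc k))) * a 0"
        using conv[of k] a0 by (intro mult_right_mono) auto
      finally show ?thesis by (simp only: mult.assoc)
    qed
    then have "a 1 * a (Suc k) \<le> a (Suc (Suc k)) * a 0"
      using Suc by (simp only: mult_le_cancel_left_pos)
    with pos show ?case by simp
  qed
  define r where "r = a 1 / a 0"
  have r: "d < r" using gt a0 by (simp add: r_def pos_less_divide_eq)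
  have low: "a 0 * r ^ k \<le> a k" for k
  proof (induction k)
    case (Suc k)
    have "a 0 * r ^ Suc k = r * (a 0 * r ^ k)" by simp
    also have "\<dots> \<le> r * a k" using Suc r d by (intro mult_left_mono) auto
    also have "\<dots> = a 1 * a k / a 0" by (simp add: r_def)
    also have "\<dots> \<le> a (Suc k)" using ratio[of k] a0 by (simp only: pos_divide_le_eq)
    finally show ?case .
  qed simp
  show False
  proof (cases "d = 0")
    case True
    then show False using growth[of 1] a1 by simp
  next
    case False
    then have d: "0 < d" using d by simp
    then have "1 < r / d" using r by simp
    then obtain n where n: "B / a 0 < (r / d) ^ n" using real_arch_pow by blast
    have "a 0 * r ^ n \<le> B * d ^ n" using low[of n] growth[of n] by linarith
    then have "(r / d) ^ n \<le> B / a 0"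
      using d a0 by (simp add: power_divide pos_divide_le_eq pos_le_divide_eq mult.commute)
    with n show False by simp
  qed
qed

text \<open>
  The squared norms of the vectors \<open>y k = A\<^sup>k y\<close> of an orbit are log-convex. The statement avoids the
  operator \<open>A\<close>, because it is applied where \<open>A\<close> is not yet known to be well defined.
\<close>

lemma (in hilbert_space) symmetric_orbit_bound:
  assumes y: "\<And>k. y k \<in> carrier H"
    and sym: "\<And>j k. cinner H (y (Suc j)) (y k) = cinner H (y j) (y (Suc k))"
    and growth: "\<And>k. hnorm H (y k) \<le> B * c ^ k" and c: "0 \<le> c"
  shows "hnorm H (y 1) \<le> c * hnorm H (y 0)"
proof -
  have "(hnorm H (y 1))\<^sup>2 \<le> c\<^sup>2 * (hnorm H (y 0))\<^sup>2"
  proof (rule log_convex_growth[where a = "\<lambda>k. (hnorm H (y k))\<^sup>2" and d = "c\<^sup>2" and B = "B\<^sup>2"])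
    fix k
    have "(hnorm H (y (Suc k)))\<^sup>2 = Re (cinner H (y k) (y (Suc (Suc k))))"
      using hnorm_sq[OF y] sym by simp
    also have "\<dots> \<le> hnorm H (y k) * hnorm H (y (Suc (Suc k)))"
      using cauchy_schwarz[OF y y] complex_Re_le_cmod order_trans by blast
    finally have "((hnorm H (y (Suc k)))\<^sup>2)\<^sup>2 \<le> (hnorm H (y k) * hnorm H (y (Suc (Suc k))))\<^sup>2"
      by (rule power_mono) simp
    then show "((hnorm H (y (Suc k)))\<^sup>2)\<^sup>2 \<le> (hnorm H (y k))\<^sup>2 * (hnorm H (y (Suc (Suc k))))\<^sup>2"
      by (simp only: power_mult_distrib)
    have "(hnorm H (y k))\<^sup>2 \<le> (B * c ^ k)\<^sup>2"
      using growth[of k] y by (intro power_mono) simp_all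
    then show "(hnorm H (y k))\<^sup>2 \<le> B\<^sup>2 * (c\<^sup>2) ^ k"
      by (simp only: power_mult_distrib power_mult[symmetric] mult.commute)
  qed simp_all
  then have "(hnorm H (y 1))\<^sup>2 \<le> (c * hnorm H (y 0))\<^sup>2" by (simp only: power_mult_distrib)
  then show ?thesis by (rule power2_le_imp_le) (use c y in simp)
qed

lemma (in hilbert_space) hnorm_finsum_le:
  assumes "finite K" "\<And>k. k \<in> K \<Longrightarrow> f k \<in> carrier H"
  shows "hnorm H (\<Oplus>k\<in>K. f k) \<le> (\<Sum>k\<in>K. hnorm H (f k))"
  using assms
proof (induction K rule: finite_induct)
  case empty then show ?case by (simp add: hnorm_def)
next
  case (insert k K)
  then have "hnorm H (f k \<oplus> (\<Oplus>k\<in>K. f k)) \<le> hnorm H (f k) + hnorm H (\<Oplus>k\<in>K. f k)"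
    by (intro hnorm_triangle) auto
  moreover have "(\<Oplus>k\<in>insert k K. f k) = f k \<oplus> (\<Oplus>k\<in>K. f k)"
    using insert by (intro M.finsum_insert) auto
  moreover have "hnorm H (\<Oplus>k\<in>K. f k) \<le> (\<Sum>k\<in>K. hnorm H (f k))" using insert by simp
  ultimately show ?case using insert(1,2) by simp
qed

locale symmetric_op = hilbert_space H for H :: "'a hspace" (structure) +
  fixes A :: "'a \<Rightarrow> 'a"
  assumes A_bop: "A \<in> bop H H"
    and symmetric: "\<lbrakk>x \<in> carrier H; y \<in> carrier H\<rbrakk> \<Longrightarrow> cinner H (A x) y = cinner H x (A y)"
begin

lemmas A_closed [simp] = bop_closed[OF A_bop]

lemma iter_closed [simp]: "x \<in> carrier H \<Longrightarrow> (A ^^ k) x \<in> carrier H"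
  by (induction k) simp_all

lemma iter_bop: "(\<lambda>x\<in>carrier H. (A ^^ k) x) \<in> bop H H"
proof (induction k)
  case 0
  have "(\<lambda>x\<in>carrier H. (A ^^ 0) x) = op_one H" by (simp add: op_one_def)
  then show ?case by (simp add: op_one_bop hilbert_space_axioms)
next
  case (Suc k)
  have "(\<lambda>x\<in>carrier H. (A ^^ Suc k) x) = compose (carrier H) A (\<lambda>x\<in>carrier H. (A ^^ k) x)"
    by (rule ext) (simp add: compose_def)
  then show ?case
    using bop_compose[OF hilbert_space_axioms hilbert_space_axioms Suc A_bop] by (simp only:)
qed

lemma iter_add:
  "x \<in> carrier H \<Longrightarrow> y \<in> carrier H \<Longrightarrow> (A ^^ k) (x \<oplus> y) = (A ^^ k) x \<oplus> (A ^^ k) y"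
  using bop_add[OF iter_bop, of x y k] by simp

lemma iter_scale: "x \<in> carrier H \<Longrightarrow> (A ^^ k) (c \<odot> x) = c \<odot> (A ^^ k) x"
  using bop_scale[OF iter_bop, of x k c] by simp

lemma cinner_iter: "\<lbrakk>x \<in> carrier H; y \<in> carrier H\<rbrakk>
    \<Longrightarrow> cinner H ((A ^^ j) x) ((A ^^ k) y) = cinner H x ((A ^^ (j + k)) y)"
proof (induction j arbitrary: k)
  case (Suc j)
  then show ?case using Suc.IH[of "Suc k"] symmetric[of "(A ^^ j) x" "(A ^^ k) y"] by simp
qed simp

end

locale positive_op = symmetric_op +
  assumes positive: "x \<in> carrier H \<Longrightarrow> 0 \<le> Re (cinner H x (A x))"
begin

lemma positive_cauchy_schwarz:
  assumes x: "x \<in> carrier H" and y: "y \<in> carrier H"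
  shows "(cmod (cinner H x (A y)))\<^sup>2 \<le> Re (cinner H x (A x)) * Re (cinner H y (A y))"
proof (rule cauchy_schwarz_scalar)
  fix c
  have xy: "A (x \<oplus> c \<odot> y) = A x \<oplus> c \<odot> A y"
    using x y by (simp add: bop_add[OF A_bop] bop_scale[OF A_bop])
  have "cinner H y (A x) = cnj (cinner H x (A y))"
    using symmetric[OF y x] cinner_commute[of x "A y"] x y by simp
  then have "cinner H (x \<oplus> c \<odot> y) (A (x \<oplus> c \<odot> y)) = cinner H x (A x)
      + (c * cinner H x (A y) + cnj (c * cinner H x (A y))) + of_real ((cmod c)\<^sup>2) * cinner H y (A y)"
    unfolding xy complex_norm_square using x y by (simp add: algebra_simps)
  then show "0 \<le> Re (cinner H x (A x)) + 2 * Re (c * cinner H x (A y)) + (cmod c)\<^sup>2 * Re (cinner H y (A y))"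
    using positive[of "x \<oplus> c \<odot> y"] x y by simp
qed (use positive x y in auto)

text \<open>\<open>A\<^sup>2 \<le> q A\<close> for \<open>0 \<le> A \<le> q\<close>, by the Cauchy-Schwarz inequality for the form of \<open>A\<close> at \<open>A z\<close> and \<open>z\<close>.\<close>

lemma norm_sq_le_form:
  assumes q: "0 \<le> q" "\<And>x. x \<in> carrier H \<Longrightarrow> Re (cinner H x (A x)) \<le> q * (hnorm H x)\<^sup>2"
    and z: "z \<in> carrier H"
  shows "(hnorm H (A z))\<^sup>2 \<le> q * Re (cinner H z (A z))"
proof (rule le_of_square_le)
  have "(hnorm H (A z))\<^sup>2 * (hnorm H (A z))\<^sup>2 = (cmod (cinner H (A z) (A z)))\<^sup>2"
    using z by (simp add: cinner_self norm_mult power2_eq_square)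
  also have "\<dots> \<le> Re (cinner H (A z) (A (A z))) * Re (cinner H z (A z))"
    using z by (intro positive_cauchy_schwarz) simp_all
  also have "\<dots> \<le> (q * (hnorm H (A z))\<^sup>2) * Re (cinner H z (A z))"
    using q(2)[of "A z"] z positive by (intro mult_right_mono) simp_all
  finally show "(hnorm H (A z))\<^sup>2 * (hnorm H (A z))\<^sup>2 \<le> (hnorm H (A z))\<^sup>2 * (q * Re (cinner H z (A z)))"
    by (simp only: mult_ac)
qed (use q positive[OF z] in simp_all)

text \<open>
  The odd powers of \<open>A\<close> are positive because \<open>A\<close> is, the even ones because they are squares.
\<close>

lemma moment_nonneg: "x \<in> carrier H \<Longrightarrow> 0 \<le> Re (cinner H x ((A ^^ k) x))"
proof (cases "even k")
  case True
  assume x: "x \<in> carrier H"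
  obtain j where "k = j + j" using True by (metis evenE mult_2)
  then show ?thesis using cinner_iter[OF x x, of j j] cinner_nonneg[of "(A ^^ j) x"] x by simp
next
  case False
  assume x: "x \<in> carrier H"
  obtain j where "k = j + Suc j" using False by (metis oddE mult_2 add_Suc_right Suc_eq_plus1)
  then show ?thesis using cinner_iter[OF x x, of j "Suc j"] positive[of "(A ^^ j) x"] x by simp
qed

lemma moment_decreasing:
  assumes q: "0 \<le> q" "\<And>x. x \<in> carrier H \<Longrightarrow> Re (cinner H x (A x)) \<le> q * (hnorm H x)\<^sup>2"
    and x: "x \<in> carrier H"
  shows "Re (cinner H x ((A ^^ Suc k) x)) \<le> q * Re (cinner H x ((A ^^ k) x))"
proof (cases "even k")
  case True
  obtain j where k: "k = j + j" using True by (metis evenE mult_2)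
  have "cinner H x ((A ^^ Suc k) x) = cinner H ((A ^^ j) x) (A ((A ^^ j) x))"
    using cinner_iter[OF x x, of j "Suc j"] k by simp
  moreover have "Re (cinner H x ((A ^^ k) x)) = (hnorm H ((A ^^ j) x))\<^sup>2"
    using cinner_iter[OF x x, of j j] k x hnorm_sq[of "(A ^^ j) x"] by simp
  ultimately show ?thesis using q(2)[of "(A ^^ j) x"] x by simp
next
  case False
  obtain j where k: "k = j + Suc j" using False by (metis oddE mult_2 add_Suc_right Suc_eq_plus1)
  have "Re (cinner H x ((A ^^ Suc k) x)) = (hnorm H (A ((A ^^ j) x)))\<^sup>2"
    using cinner_iter[OF x x, of "Suc j" "Suc j"] k x hnorm_sq[of "A ((A ^^ j) x)"] by simp
  moreover have "cinner H x ((A ^^ k) x) = cinner H ((A ^^ j) x) (A ((A ^^ j) x))"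
    using cinner_iter[OF x x, of j "Suc j"] k by simp
  ultimately show ?thesis using norm_sq_le_form[OF q, of "(A ^^ j) x"] x by simp
qed

end

subsection \<open>The binomial series of the inverse square root\<close>

text \<open>The Taylor coefficients of \<open>(1 - x)\<^bsup>-1/2\<^esup>\<close>.\<close>

definition invsqrt_coeff :: "nat \<Rightarrow> real" where
  "invsqrt_coeff k = pochhammer (1 / 2) k / fact k"

lemma invsqrt_coeff_nonneg: "0 \<le> invsqrt_coeff k"
  by (simp add: invsqrt_coeff_def pochhammer_nonneg)

text \<open>The square of the series is \<open>1 / (1 - x)\<close>; in coefficients this is the Vandermonde identity.\<close>

lemma invsqrt_coeff_convolution: "(\<Sum>j\<le>m. invsqrt_coeff j * invsqrt_coeff (m - j)) = 1"
proof -
  have b: "invsqrt_coeff k = (-1) ^ k * ((- (1 / 2)) gchoose k)" for k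
    by (simp add: invsqrt_coeff_def gbinomial_pochhammer power_mult_distrib[symmetric])
  have one: "((-1::real) gchoose m) = (-1) ^ m"
    by (simp add: gbinomial_pochhammer pochhammer_fact[symmetric])
  have "(\<Sum>j\<le>m. invsqrt_coeff j * invsqrt_coeff (m - j))
      = (\<Sum>j=0..m. (-1) ^ m * (((- (1 / 2)) gchoose j) * ((- (1 / 2)) gchoose (m - j))))"
    unfolding atLeast0AtMost
  proof (rule sum.cong[OF refl])
    fix j assume "j \<in> {..m}"
    then have "(-1::real) ^ m = (-1) ^ j * (-1) ^ (m - j)" by (simp add: power_add[symmetric])
    then show "invsqrt_coeff j * invsqrt_coeff (m - j)
      = (-1) ^ m * (((- (1 / 2)) gchoose j) * ((- (1 / 2)) gchoose (m - j)))"
      unfolding b by (simp only: mult_ac)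
  qed
  also have "\<dots> = (-1) ^ m * ((- (1 / 2) + - (1 / 2)) gchoose m)"
    unfolding sum_distrib_left[symmetric] gbinomial_Vandermonde ..
  also have "\<dots> = 1" by (simp add: one power_mult_distrib[symmetric])
  finally show ?thesis .
qed

text \<open>
  The square of a partial sum contains all products of total degree below \<open>n\<close> and none of degree
  \<open>2 n\<close> or more, so it lies between two partial sums of the geometric series.
\<close>

lemma square_sum_le:
  fixes g :: "nat \<Rightarrow> real"
  assumes "\<And>m. 0 \<le> g m"
  shows "(\<Sum>j<n. \<Sum>k<n. invsqrt_coeff j * invsqrt_coeff k * g (j + k)) \<le> (\<Sum>m<2*n. g m)"
proof -
  let ?f = "\<lambda>j k. invsqrt_coeff j * invsqrt_coeff k * g (j + k)"
  have "(\<Sum>j<n. \<Sum>k<n. ?f j k) = (\<Sum>(j,k)\<in>{..<n}\<times>{..<n}. ?f j k)"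
    by (rule sum.cartesian_product)
  also have "\<dots> \<le> (\<Sum>(j,k)\<in>{(j,k). j + k < 2*n}. ?f j k)"
  proof (rule sum_mono2)
    show "finite {(j,k). j + k < 2*n}"
      by (rule finite_subset[of _ "{..<2*n} \<times> {..<2*n}"]) auto
  qed (auto intro!: mult_nonneg_nonneg invsqrt_coeff_nonneg assms)
  also have "\<dots> = (\<Sum>m<2*n. \<Sum>j\<le>m. ?f j (m - j))"
    by (rule sum.triangle_reindex)
  also have "\<dots> = (\<Sum>m<2*n. (\<Sum>j\<le>m. invsqrt_coeff j * invsqrt_coeff (m - j)) * g m)"
    by (intro sum.cong refl) (simp add: sum_distrib_right)
  finally show ?thesis by (simp add: invsqrt_coeff_convolution)
qed

lemma square_sum_approx:
  fixes g :: "nat \<Rightarrow> complex"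
  assumes "\<And>m. cmod (g m) \<le> G m"
  shows "cmod ((\<Sum>j<n. \<Sum>k<n. of_real (invsqrt_coeff j * invsqrt_coeff k) * g (j + k)) - (\<Sum>m<n. g m))
    \<le> (\<Sum>m\<in>{n..<2*n}. G m)"
proof -
  let ?b = "\<lambda>j k. of_real (invsqrt_coeff j * invsqrt_coeff k) :: complex"
  let ?f = "\<lambda>j k. ?b j k * g (j + k)"
  let ?F = "\<lambda>j k. invsqrt_coeff j * invsqrt_coeff k * G (j + k)"
  define S T T2 where "S = {..<n}\<times>{..<n}" and "T = {(j,k). j + k < n}" and "T2 = {(j,k). j + k < 2*n}"
  have fin: "finite S" "finite T2" "T \<subseteq> S" "S \<subseteq> T2" "T \<subseteq> T2"
    unfolding S_def T_def T2_def
    by (auto intro: finite_subset[of _ "{..<2*n} \<times> {..<2*n}"])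
  have T: "(\<Sum>(j,k)\<in>T. ?f j k) = (\<Sum>m<n. g m)"
  proof -
    have "(\<Sum>(j,k)\<in>T. ?f j k) = (\<Sum>m<n. \<Sum>j\<le>m. ?f j (m - j))"
      unfolding T_def by (rule sum.triangle_reindex)
    also have "\<dots> = (\<Sum>m<n. of_real (\<Sum>j\<le>m. invsqrt_coeff j * invsqrt_coeff (m - j)) * g m)"
      by (intro sum.cong refl) (simp add: sum_distrib_right)
    finally show ?thesis by (simp add: invsqrt_coeff_convolution)
  qed
  have tri: "(\<Sum>(j,k)\<in>{(j,k). j + k < n}. ?F j k) = (\<Sum>m<n. G m)" for n
  proof -
    have "(\<Sum>(j,k)\<in>{(j,k). j + k < n}. ?F j k) = (\<Sum>m<n. \<Sum>j\<le>m. ?F j (m - j))"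
      by (rule sum.triangle_reindex)
    also have "\<dots> = (\<Sum>m<n. (\<Sum>j\<le>m. invsqrt_coeff j * invsqrt_coeff (m - j)) * G m)"
      by (intro sum.cong refl) (simp add: sum_distrib_right)
    finally show ?thesis by (simp add: invsqrt_coeff_convolution)
  qed
  have G: "0 \<le> G m" for m using assms[of m] norm_ge_zero order_trans by blast
  have Fnn: "0 \<le> ?F j k" for j k by (intro mult_nonneg_nonneg invsqrt_coeff_nonneg G)
  have "(\<Sum>j<n. \<Sum>k<n. ?f j k) = (\<Sum>(j,k)\<in>S. ?f j k)"
    unfolding S_def by (rule sum.cartesian_product)
  also have "\<dots> = (\<Sum>(j,k)\<in>T. ?f j k) + (\<Sum>(j,k)\<in>S - T. ?f j k)"
    using sum.subset_diff[OF fin(3,1), of "\<lambda>(j,k). ?f j k"] by simp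
  finally have "(\<Sum>j<n. \<Sum>k<n. ?f j k) - (\<Sum>m<n. g m) = (\<Sum>(j,k)\<in>S - T. ?f j k)"
    unfolding T by simp
  also have "cmod \<dots> \<le> (\<Sum>(j,k)\<in>S - T. ?F j k)"
  proof (rule sum_norm_le, clarify)
    fix j k
    show "cmod (?f j k) \<le> ?F j k"
      unfolding norm_mult norm_of_real
      by (rule mult_mono) (use assms invsqrt_coeff_nonneg in \<open>auto simp: abs_mult\<close>)
  qed
  also have "\<dots> \<le> (\<Sum>(j,k)\<in>T2 - T. ?F j k)"
    by (rule sum_mono2) (use fin Fnn in auto)
  also have "\<dots> = (\<Sum>(j,k)\<in>T2. ?F j k) - (\<Sum>(j,k)\<in>T. ?F j k)"
    using sum_diff[OF fin(2,5), of "\<lambda>(j,k). ?F j k"] by simp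
  also have "\<dots> = (\<Sum>m<2*n. G m) - (\<Sum>m<n. G m)"
    unfolding T_def T2_def tri ..
  also have "\<dots> = (\<Sum>m\<in>{n..<2*n}. G m)"
  proof -
    have "{..<2*n} - {..<n} = {n..<2*n}" by auto
    then show ?thesis using sum_diff[of "{..<2*n}" "{..<n}" G] by simp
  qed
  finally show ?thesis .
qed

text \<open>
  If \<open>Y\<close> satisfies \<open>\<parallel>Y a\<parallel>\<^sup>2 \<le> \<parallel>a\<^sup>* G a\<parallel>\<close> for every \<open>a\<close> commuting with \<open>\<M>\<close>, then \<open>Y\<^sup>* Y \<le> G\<close>.
  Heuristically one takes \<open>a = (G + \<epsilon>)\<^bsup>-1/2\<^esup>\<close>. Here \<open>a\<close> is a partial sum of the binomial series of
  \<open>(1 - A)\<^bsup>-1/2\<^esup>\<close>, where \<open>1 - A\<close> is a multiple of \<open>G + \<epsilon>\<close>; the coefficients of the square of a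
  partial sum are between \<open>0\<close> and those of the geometric series, which gives all the estimates.
\<close>

lemma domination_by_compression:
  fixes V :: "'v hspace" and L :: "'l hspace"
  assumes hV: "hilbert_space V" and hL: "hilbert_space L"
    and G: "positive_op V G" and Y: "Y \<in> bop V L"
    and comm: "\<And>m x. m \<in> MM \<Longrightarrow> x \<in> carrier V \<Longrightarrow> G (m x) = m (G x)" and MM: "MM \<subseteq> bop V V"
    and compr: "\<And>a C x. a \<in> bop V V \<Longrightarrow> (\<And>m x. m \<in> MM \<Longrightarrow> x \<in> carrier V \<Longrightarrow> a (m x) = m (a x))
      \<Longrightarrow> 0 \<le> C \<Longrightarrow> (\<And>x. x \<in> carrier V \<Longrightarrow> Re (cinner V (a x) (G (a x))) \<le> C\<^sup>2 * (hnorm V x)\<^sup>2)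
      \<Longrightarrow> x \<in> carrier V \<Longrightarrow> hnorm L (Y (a x)) \<le> C * hnorm V x"
    and h: "h \<in> carrier V"
  shows "(hnorm L (Y h))\<^sup>2 \<le> Re (cinner V h (G h))"
proof (rule field_le_epsilon)
  interpret V: hilbert_space V by fact
  interpret L: hilbert_space L by fact
  interpret G: positive_op V G by fact
  fix \<delta> :: real assume \<delta>: "0 < \<delta>"
  define \<epsilon> where "\<epsilon> = \<delta> / ((hnorm V h)\<^sup>2 + 1)"
  have \<epsilon>: "0 < \<epsilon>" using \<delta> by (simp add: \<epsilon>_def add_nonneg_pos)
  have \<epsilon>\<delta>: "\<epsilon> * (hnorm V h)\<^sup>2 \<le> \<delta>"
  proof -
    have "\<epsilon> * (hnorm V h)\<^sup>2 \<le> \<epsilon> * ((hnorm V h)\<^sup>2 + 1)" using \<epsilon> by (intro mult_left_mono) auto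
    also have "\<dots> = \<delta>" by (simp add: \<epsilon>_def add_nonneg_eq_0_iff)
    finally show ?thesis .
  qed
  define c where "c = opnorm V V G"
  have c: "0 \<le> c" unfolding c_def by (rule opnorm_nonneg[OF hV G.A_bop])
  have Gc: "Re (cinner V x (G x)) \<le> c * (hnorm V x)\<^sup>2" if x: "x \<in> carrier V" for x
    unfolding c_def by (rule form_le_opnorm[OF hV G.A_bop x])
  define s where "s = 1 / (c + \<epsilon>)"
  have s: "0 < s" "s * (c + \<epsilon>) = 1" using c \<epsilon> by (auto simp: s_def)
  define q where "q = 1 - s * \<epsilon>"
  have "s * \<epsilon> \<le> s * (c + \<epsilon>)" using c s by (intro mult_left_mono) auto
  then have q: "0 \<le> q" "q < 1" using s \<epsilon> by (auto simp: q_def)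
  \<comment> \<open>\<open>R = (G + \<epsilon>) / (\<parallel>G\<parallel> + \<epsilon>)\<close> and \<open>A = 1 - R\<close>, so that \<open>0 \<le> A \<le> q < 1\<close>.\<close>
  define R where "R = (\<lambda>x\<in>carrier V. of_real s \<odot>\<^bsub>V\<^esub> (G x \<oplus>\<^bsub>V\<^esub> of_real \<epsilon> \<odot>\<^bsub>V\<^esub> x))"
  define A where "A = (\<lambda>x\<in>carrier V. x \<oplus>\<^bsub>V\<^esub> (-1) \<odot>\<^bsub>V\<^esub> R x)"
  have R_bop: "R \<in> bop V V"
  proof -
    have "R = op_smult V V (of_real s) (op_add V V G (op_smult V V (of_real \<epsilon>) (op_one V)))"
      by (rule ext) (simp add: R_def op_smult_def op_add_def op_one_def)
    then show ?thesis using hV G.A_bop by (simp add: op_smult_bop op_add_bop op_one_bop)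
  qed
  have A_bop: "A \<in> bop V V"
  proof -
    have "A = op_add V V (op_one V) (op_smult V V (-1) R)"
      by (rule ext) (simp add: A_def op_smult_def op_add_def op_one_def)
    then show ?thesis using hV R_bop by (simp add: op_smult_bop op_add_bop op_one_bop)
  qed
  note Rc [simp] = bop_closed[OF R_bop]
  have Rinner: "cinner V x (R y) = of_real s * (cinner V x (G y) + of_real \<epsilon> * cinner V x y)"
    if "x \<in> carrier V" "y \<in> carrier V" for x y using that by (simp add: R_def)
  have Ainner: "cinner V x (A y) = cinner V x y - cinner V x (R y)"
    if "x \<in> carrier V" "y \<in> carrier V" for x y
    using that Rc[of y] by (simp add: A_def)
  have Rsym: "cinner V (R x) y = cinner V x (R y)" if "x \<in> carrier V" "y \<in> carrier V" for x y
    using that G.symmetric[of x y] by (simp add: R_def)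
  have Asym: "cinner V (A x) y = cinner V x (A y)" if "x \<in> carrier V" "y \<in> carrier V" for x y
    using that Rc[of x] Rc[of y] Rsym[of x y] by (simp add: A_def)
  have Rform: "Re (cinner V x (R x)) = s * (Re (cinner V x (G x)) + \<epsilon> * (hnorm V x)\<^sup>2)"
    if "x \<in> carrier V" for x using that by (simp add: Rinner V.hnorm_sq)
  have Apos: "0 \<le> Re (cinner V x (A x))" if x: "x \<in> carrier V" for x
  proof -
    have "s * (Re (cinner V x (G x)) + \<epsilon> * (hnorm V x)\<^sup>2) \<le> s * ((c + \<epsilon>) * (hnorm V x)\<^sup>2)"
      using Gc[OF x] s by (intro mult_left_mono) (auto simp: distrib_right)
    also have "\<dots> = (hnorm V x)\<^sup>2" using s(2) by (simp add: mult.assoc[symmetric])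
    finally show ?thesis using x V.hnorm_sq[OF x] Rform[OF x] by (simp add: Ainner)
  qed
  interpret A: positive_op V A
    by (intro positive_op.intro symmetric_op.intro symmetric_op_axioms.intro positive_op_axioms.intro
        hV A_bop Asym Apos)
  have Aq: "Re (cinner V x (A x)) \<le> q * (hnorm V x)\<^sup>2" if x: "x \<in> carrier V" for x
  proof -
    have "s * \<epsilon> * (hnorm V x)\<^sup>2 \<le> Re (cinner V x (R x))"
      using G.positive[OF x] s(1) unfolding Rform[OF x] by (simp add: distrib_left mult.assoc)
    then show ?thesis using x V.hnorm_sq[OF x] by (simp add: Ainner q_def left_diff_distrib)
  qed
  let ?b = invsqrt_coeff
  \<comment> \<open>\<open>a n\<close> approximates \<open>R\<^bsup>-1/2\<^esup>\<close>.\<close>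
  define a where "a n = (\<lambda>x\<in>carrier V. \<Oplus>\<^bsub>V\<^esub>k\<in>{..<n}. of_real (?b k) \<odot>\<^bsub>V\<^esub> (A ^^ k) x)" for n
  have a_inner: "cinner V y (a n x) = (\<Sum>k<n. of_real (?b k) * cinner V y ((A ^^ k) x))"
    if "x \<in> carrier V" "y \<in> carrier V" for x y n
    using that by (simp add: a_def V.cinner_finsum_right)
  have a_closed [simp]: "a n x \<in> carrier V" if "x \<in> carrier V" for n x
    using that by (simp add: a_def)
  have a_sym: "cinner V y (a n x) = cinner V (a n y) x" if "x \<in> carrier V" "y \<in> carrier V" for n x y
  proof -
    have "cinner V y ((A ^^ k) x) = cinner V ((A ^^ k) y) x" for k
      using A.cinner_iter[of y x k 0] that by simp
    then show ?thesis using that by (simp add: a_inner) (simp add: a_def V.cinner_finsum_left)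
  qed
  have a_bop: "a n \<in> bop V V" for n
  proof -
    define C where "C k = opnorm V V (\<lambda>x\<in>carrier V. (A ^^ k) x)" for k
    have C: "hnorm V ((A ^^ k) x) \<le> C k * hnorm V x" if "x \<in> carrier V" for k x
      using opnorm_bound[OF hV A.iter_bop that, of k] that by (simp add: C_def)
    show ?thesis
    proof (rule bopI_formal_adjoint[OF hV hV, where B = "a n" and C = "\<Sum>k<n. \<bar>?b k\<bar> * C k"])
      show "a n \<in> carrier V \<rightarrow>\<^sub>E carrier V" by (auto simp: a_def)
      fix x assume x: "x \<in> carrier V"
      have "hnorm V (a n x) \<le> (\<Sum>k<n. hnorm V (of_real (?b k) \<odot>\<^bsub>V\<^esub> (A ^^ k) x))"
        using x unfolding a_def restrict_apply'[OF x] by (intro V.hnorm_finsum_le) simp_all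
      also have "\<dots> \<le> (\<Sum>k<n. \<bar>?b k\<bar> * (C k * hnorm V x))"
        using C[OF x] x by (intro sum_mono) (simp add: V.hnorm_scale mult_left_mono)
      finally show "hnorm V (a n x) \<le> (\<Sum>k<n. \<bar>?b k\<bar> * C k) * hnorm V x"
        by (simp add: sum_distrib_right mult.assoc)
    qed (simp_all add: a_sym)
  qed
  have a_comm: "a n (m x) = m (a n x)" if m: "m \<in> MM" and x: "x \<in> carrier V" for n m x
  proof -
    have mb: "m \<in> bop V V" using m MM by auto
    note mc [simp] = bop_closed[OF mb] 
    note mlin = bop_add[OF mb] bop_scale[OF mb]
    have "R (m y) = m (R y)" if "y \<in> carrier V" for y
      using that comm[OF m that] by (simp add: R_def mlin)
    then have "A (m y) = m (A y)" if "y \<in> carrier V" for y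
      using that Rc[of y] by (simp add: A_def mlin)
    then have it: "(A ^^ k) (m x) = m ((A ^^ k) x)" for k
      using x by (induction k) simp_all
    have "m (\<Oplus>\<^bsub>V\<^esub>k\<in>{..<n}. of_real (?b k) \<odot>\<^bsub>V\<^esub> (A ^^ k) x)
        = (\<Oplus>\<^bsub>V\<^esub>k\<in>{..<n}. m (of_real (?b k) \<odot>\<^bsub>V\<^esub> (A ^^ k) x))"
      by (rule bop_finsum[OF hV hV mb]) (use x in simp_all)
    then show ?thesis using x by (simp add: a_def it mlin)
  qed
  have a_quad: "cinner V (a n x) (a n y) = (\<Sum>j<n. \<Sum>k<n. of_real (?b j * ?b k) * cinner V x ((A ^^ (j + k)) y))"
    if x: "x \<in> carrier V" and y: "y \<in> carrier V" for n x y
  proof -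
    have "cinner V (a n x) (a n y) = (\<Sum>j<n. of_real (?b j) * cinner V ((A ^^ j) x) (a n y))"
      using x y by (simp add: a_def V.cinner_finsum_left)
    also have "\<dots> = (\<Sum>j<n. \<Sum>k<n. of_real (?b j * ?b k) * cinner V x ((A ^^ (j + k)) y))"
      using x y by (simp add: a_inner A.cinner_iter sum_distrib_left mult.assoc)
    finally show ?thesis .
  qed
  have aR: "a n (R x) = R (a n x)" if x: "x \<in> carrier V" for n x
  proof -
    have "R (A y) = A (R y)" if y: "y \<in> carrier V" for y
    proof (rule V.vec_eqI)
      fix z assume z: "z \<in> carrier V"
      show "cinner V z (R (A y)) = cinner V z (A (R y))"
        using z y Rsym[OF z A.A_closed[OF y]] Asym[of z "R y"] Rsym[of z "R y"] Rsym[of z y]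
          Ainner[of "R z" y] Ainner[of z "R y"] by simp
    qed (use y in simp_all)
    then have it: "(A ^^ k) (R x) = R ((A ^^ k) x)" for k
      using x by (induction k) simp_all
    have "R (\<Oplus>\<^bsub>V\<^esub>k\<in>{..<n}. of_real (?b k) \<odot>\<^bsub>V\<^esub> (A ^^ k) x)
        = (\<Oplus>\<^bsub>V\<^esub>k\<in>{..<n}. R (of_real (?b k) \<odot>\<^bsub>V\<^esub> (A ^^ k) x))"
      by (rule bop_finsum[OF hV hV R_bop]) (use x in simp_all)
    then show ?thesis using x by (simp add: a_def it bop_scale[OF R_bop])
  qed
  have Ra: "Re (cinner V (a n x) (R (a n x))) \<le> (hnorm V x)\<^sup>2"
    and RRa: "(hnorm V (R (a n x)))\<^sup>2 \<le> Re (cinner V x (R x))" if x: "x \<in> carrier V" for n x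
  proof -
    \<comment> \<open>As \<open>R = 1 - A\<close>, the sums over \<open>e\<close> and over \<open>r\<close> telescope.\<close>
    define m where "m k = Re (cinner V x ((A ^^ k) x))" for k
    define e where "e k = Re (cinner V (R x) ((A ^^ k) x))" for k
    define r where "r k = Re (cinner V (R x) ((A ^^ k) (R x)))" for k
    have shift: "cinner V z ((A ^^ k) (R x)) = cinner V z ((A ^^ k) x) - cinner V z ((A ^^ Suc k) x)"
      if z: "z \<in> carrier V" for z k
    proof -
      have "R x = x \<oplus>\<^bsub>V\<^esub> (-1) \<odot>\<^bsub>V\<^esub> A x"
        using x by (intro V.vec_eqI) (simp_all add: Ainner)
      then have "(A ^^ k) (R x) = (A ^^ k) x \<oplus>\<^bsub>V\<^esub> (-1) \<odot>\<^bsub>V\<^esub> (A ^^ k) (A x)"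
        using x by (simp add: A.iter_add A.iter_scale)
      then show ?thesis using x z by (simp add: funpow_swap1)
    qed
    have em: "e k = m k - m (Suc k)" for k
    proof -
      have "cinner V (R x) ((A ^^ k) x) = cinner V ((A ^^ k) (R x)) x"
        using A.cinner_iter[of "R x" x k 0] x by simp
      then have "e k = Re (cinner V x ((A ^^ k) (R x)))"
        using V.cinner_commute[of x "(A ^^ k) (R x)"] x by (simp add: e_def)
      then show ?thesis using shift[OF x] by (simp add: m_def)
    qed
    have re: "r k = e k - e (Suc k)" for k
      using shift[of "R x"] x by (simp add: r_def e_def)
    have mnn: "0 \<le> m k" for k unfolding m_def by (rule A.moment_nonneg[OF x])
    have rnn: "0 \<le> r k" for k unfolding r_def by (rule A.moment_nonneg) (use x in simp)
    have mdec: "m (Suc k) \<le> m k" for k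
    proof -
      have "m (Suc k) \<le> q * m k"
        unfolding m_def by (rule A.moment_decreasing[OF q(1) Aq x])
      also have "\<dots> \<le> 1 * m k" using q mnn by (intro mult_right_mono) auto
      finally show ?thesis by simp
    qed
    have enn: "0 \<le> e k" for k using em mdec[of k] by simp
    have "Re (cinner V (a n x) (R (a n x))) = Re (cinner V (a n (R x)) (a n x))"
      using x Rsym[of "a n x" "a n x"] by (simp add: aR)
    also have "\<dots> = (\<Sum>j<n. \<Sum>k<n. ?b j * ?b k * e (j + k))"
      using a_quad[OF Rc[OF x] x, of n] by (simp add: e_def)
    also have "\<dots> \<le> (\<Sum>k<2*n. e k)" by (rule square_sum_le[OF enn])
    also have "\<dots> = m 0 - m (2*n)" unfolding em by (rule sum_lessThan_telescope')
    also have "\<dots> \<le> (hnorm V x)\<^sup>2" using mnn[of "2*n"] x by (simp add: m_def V.hnorm_sq)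
    finally show "Re (cinner V (a n x) (R (a n x))) \<le> (hnorm V x)\<^sup>2" .
    have "(hnorm V (R (a n x)))\<^sup>2 = Re (cinner V (a n (R x)) (a n (R x)))"
      using x by (simp add: aR V.hnorm_sq)
    also have "\<dots> = (\<Sum>j<n. \<Sum>k<n. ?b j * ?b k * r (j + k))"
      using a_quad[OF Rc[OF x] Rc[OF x], of n] by (simp add: r_def)
    also have "\<dots> \<le> (\<Sum>k<2*n. r k)" by (rule square_sum_le[OF rnn])
    also have "\<dots> = e 0 - e (2*n)" unfolding re by (rule sum_lessThan_telescope')
    also have "\<dots> \<le> Re (cinner V x (R x))" using enn[of "2*n"] x Rsym[OF x x] by (simp add: e_def)
    finally show "(hnorm V (R (a n x)))\<^sup>2 \<le> Re (cinner V x (R x))" .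
  qed
  \<comment> \<open>The hypothesis on \<open>Y\<close> is used for \<open>a n\<close>, at the vector \<open>R (a n h)\<close>.\<close>
  define D where "D = Re (cinner V h (G h)) + \<epsilon> * (hnorm V h)\<^sup>2"
  have D: "0 \<le> D" unfolding D_def using G.positive[OF h] \<epsilon> by simp
  have approx_bound: "hnorm L (Y (a n (R (a n h)))) \<le> sqrt D" for n
  proof -
    have "hnorm L (Y (a n (R (a n h)))) \<le> sqrt (c + \<epsilon>) * hnorm V (R (a n h))"
    proof (rule compr[OF a_bop a_comm])
      show "0 \<le> sqrt (c + \<epsilon>)" using c \<epsilon> by simp
      fix x assume x: "x \<in> carrier V"
      have "s * Re (cinner V (a n x) (G (a n x))) \<le> Re (cinner V (a n x) (R (a n x)))"
        unfolding Rform[OF a_closed[OF x]] using s \<epsilon> by (intro mult_left_mono) auto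
      also have "\<dots> \<le> (hnorm V x)\<^sup>2" by (rule Ra[OF x])
      finally have "(c + \<epsilon>) * (s * Re (cinner V (a n x) (G (a n x)))) \<le> (c + \<epsilon>) * (hnorm V x)\<^sup>2"
        using c \<epsilon> by (intro mult_left_mono) auto
      moreover have "(c + \<epsilon>) * (s * z) = z" for z
        using s(2) by (simp add: mult.assoc[symmetric] mult.commute)
      ultimately show "Re (cinner V (a n x) (G (a n x))) \<le> (sqrt (c + \<epsilon>))\<^sup>2 * (hnorm V x)\<^sup>2"
        using c \<epsilon> by simp
    qed (use h in simp_all)
    also have "\<dots> \<le> sqrt (c + \<epsilon>) * sqrt (s * D)"
    proof -
      have "hnorm V (R (a n h)) \<le> sqrt (s * D)"
        using RRa[OF h, of n] Rform[OF h] h unfolding D_def by (intro real_le_rsqrt) simp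
      then show ?thesis by (rule mult_left_mono) (use c \<epsilon> in simp)
    qed
    also have "\<dots> = sqrt D"
    proof -
      have "(c + \<epsilon>) * (s * D) = D" using s(2) by (metis mult.assoc mult.commute mult_1)
      then show ?thesis by (simp only: real_sqrt_mult[symmetric])
    qed
    finally show ?thesis .
  qed
  \<comment> \<open>\<open>a n (R (a n h))\<close> tends to \<open>h\<close>, weakly at \<open>z\<close>, since \<open>R\<close> is the inverse of the geometric series in \<open>A\<close>.\<close>
  define z where "z = adj V L Y (Y h)"
  have Yh: "Y h \<in> carrier L" by (rule bop_closed[OF Y h])
  have z: "z \<in> carrier V" unfolding z_def by (rule adj_closed[OF hV hL Y Yh])
  define g where "g k = cinner V z (R ((A ^^ k) h))" for k
  have norm_iter: "hnorm V ((A ^^ k) x) \<le> q ^ k * hnorm V x" if x: "x \<in> carrier V" for k x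
  proof (induction k)
    case (Suc k)
    have "(hnorm V (A y))\<^sup>2 \<le> (q * hnorm V y)\<^sup>2" if y: "y \<in> carrier V" for y
    proof -
      have "(hnorm V (A y))\<^sup>2 \<le> q * Re (cinner V y (A y))"
        by (rule A.norm_sq_le_form[OF q(1) Aq y])
      also have "\<dots> \<le> q * (q * (hnorm V y)\<^sup>2)" using Aq[OF y] q(1) by (rule mult_left_mono)
      finally show ?thesis by (simp add: power2_eq_square mult_ac)
    qed
    then have "hnorm V (A y) \<le> q * hnorm V y" if "y \<in> carrier V" for y
      by (rule power2_le_imp_le) (use that q in simp_all)
    then have "hnorm V (A ((A ^^ k) x)) \<le> q * hnorm V ((A ^^ k) x)" using x by simp
    also have "\<dots> \<le> q * (q ^ k * hnorm V x)" using Suc q(1) by (rule mult_left_mono)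
    finally show ?case by simp
  qed simp
  have gsum: "cinner V z (a n (R (a n h))) = (\<Sum>j<n. \<Sum>k<n. of_real (?b j * ?b k) * g (j + k))" for n
  proof -
    have "cinner V z (a n (R (a n h))) = cinner V z (R (a n (a n h)))" using h by (simp add: aR)
    also have "\<dots> = cinner V (R z) (a n (a n h))" using Rsym z h by simp
    also have "\<dots> = cinner V (a n (R z)) (a n h)" using z h by (simp add: a_sym)
    also have "\<dots> = (\<Sum>j<n. \<Sum>k<n. of_real (?b j * ?b k) * cinner V (R z) ((A ^^ (j + k)) h))"
      by (rule a_quad) (use z h in simp_all)
    finally show ?thesis using z h Rsym by (simp add: g_def)
  qed
  have tele: "(\<Sum>m<n. g m) = cinner V z h - cinner V z ((A ^^ n) h)" for n
  proof (induction n)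
    case (Suc n)
    then show ?case using z h Ainner[of z "(A ^^ n) h"] by (simp add: g_def)
  qed simp
  define C where "C = hnorm V z * (opnorm V V R * hnorm V h)"
  have gbound: "cmod (g k) \<le> C * q ^ k" for k
  proof -
    have "cmod (g k) \<le> hnorm V z * hnorm V (R ((A ^^ k) h))"
      unfolding g_def by (rule V.cauchy_schwarz) (use z h in simp_all)
    also have "\<dots> \<le> hnorm V z * (opnorm V V R * hnorm V ((A ^^ k) h))"
      by (intro mult_left_mono opnorm_bound[OF hV R_bop]) (use z h in simp_all)
    also have "\<dots> \<le> hnorm V z * (opnorm V V R * (q ^ k * hnorm V h))"
      by (intro mult_left_mono norm_iter opnorm_nonneg[OF hV R_bop]) (use z h in simp_all)
    finally show ?thesis by (simp add: C_def mult_ac)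
  qed
  have C: "0 \<le> C" unfolding C_def using z h opnorm_nonneg[OF hV R_bop] by simp
  have "(\<lambda>n. cinner V z (a n (R (a n h))) - cinner V z h) \<longlonglongrightarrow> 0"
  proof (rule null_comparison)
    fix n
    have "cmod ((\<Sum>j<n. \<Sum>k<n. of_real (?b j * ?b k) * g (j + k)) - (\<Sum>m<n. g m)) \<le> (\<Sum>m\<in>{n..<2*n}. C * q ^ m)"
      by (rule square_sum_approx[OF gbound])
    also have "\<dots> \<le> (\<Sum>m\<in>{n..<2*n}. C * q ^ n)"
      using q C by (intro sum_mono mult_left_mono power_decreasing) auto
    also have "\<dots> = C * (real n * q ^ n)" by simp
    finally have 1: "cmod ((\<Sum>j<n. \<Sum>k<n. of_real (?b j * ?b k) * g (j + k)) - (\<Sum>m<n. g m)) \<le> C * (real n * q ^ n)" .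
    have "cmod (cinner V z ((A ^^ n) h)) \<le> hnorm V z * hnorm V ((A ^^ n) h)"
      by (rule V.cauchy_schwarz) (use z h in simp_all)
    also have "\<dots> \<le> hnorm V z * (q ^ n * hnorm V h)"
      by (intro mult_left_mono norm_iter) (use z h in simp_all)
    finally have 2: "cmod (cinner V z ((A ^^ n) h)) \<le> hnorm V z * (q ^ n * hnorm V h)" .
    have "cinner V z (a n (R (a n h))) - cinner V z h
        = ((\<Sum>j<n. \<Sum>k<n. of_real (?b j * ?b k) * g (j + k)) - (\<Sum>m<n. g m)) - cinner V z ((A ^^ n) h)"
      unfolding gsum tele by simp
    also have "cmod \<dots> \<le> C * (real n * q ^ n) + hnorm V z * (q ^ n * hnorm V h)"
      by (rule order_trans[OF norm_triangle_ineq4 add_mono[OF 1 2]])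
    finally show "norm (cinner V z (a n (R (a n h))) - cinner V z h)
        \<le> C * (real n * q ^ n) + hnorm V z * (q ^ n * hnorm V h)" .
    have "(\<lambda>n. real n * q ^ n) \<longlonglongrightarrow> 0"
      using q by (intro powser_times_n_limit_0[where x = q]) simp
    moreover have "(\<lambda>n. q ^ n) \<longlonglongrightarrow> 0" by (rule LIMSEQ_realpow_zero[OF q])
    ultimately have "(\<lambda>n. C * (real n * q ^ n) + hnorm V z * (q ^ n * hnorm V h))
        \<longlonglongrightarrow> C * 0 + hnorm V z * (0 * hnorm V h)"
      by (intro tendsto_add tendsto_mult_left tendsto_mult_right)
    then show "(\<lambda>n. C * (real n * q ^ n) + hnorm V z * (q ^ n * hnorm V h)) \<longlonglongrightarrow> 0" by simp
  qed
  then have lim: "(\<lambda>n. cinner V z (a n (R (a n h)))) \<longlonglongrightarrow> cinner V z h"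
    by (simp add: LIM_zero_iff)
  have "Re (cinner V z h) \<le> hnorm L (Y h) * sqrt D"
  proof (rule LIMSEQ_le_const2[OF tendsto_Re[OF lim]], intro exI allI impI)
    fix n
    have "cinner V z (a n (R (a n h))) = cinner L (Y h) (Y (a n (R (a n h))))"
      unfolding z_def by (rule cinner_adj_left[OF hV hL Y _ Yh]) (use h in simp)
    also have "Re \<dots> \<le> hnorm L (Y h) * hnorm L (Y (a n (R (a n h))))"
    proof -
      have "Y (a n (R (a n h))) \<in> carrier L" by (rule bop_closed[OF Y]) (use h in simp)
      from L.cauchy_schwarz[OF Yh this] show ?thesis
        using complex_Re_le_cmod[of "cinner L (Y h) (Y (a n (R (a n h))))"] by linarith
    qed
    also have "\<dots> \<le> hnorm L (Y h) * sqrt D" using approx_bound Yh by (intro mult_left_mono) simp_all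
    finally show "Re (cinner V z (a n (R (a n h)))) \<le> hnorm L (Y h) * sqrt D" .
  qed
  moreover have "cinner V z h = cinner L (Y h) (Y h)"
    unfolding z_def by (rule cinner_adj_left[OF hV hL Y h Yh])
  ultimately have "(hnorm L (Y h))\<^sup>2 \<le> hnorm L (Y h) * sqrt D" using L.hnorm_sq[OF Yh] by simp
  then have "hnorm L (Y h) \<le> sqrt D"
    unfolding power2_eq_square by (rule le_of_square_le) (use Yh D in simp_all)
  then have "(hnorm L (Y h))\<^sup>2 \<le> (sqrt D)\<^sup>2" by (rule power_mono) (use Yh in simp)
  then show "(hnorm L (Y h))\<^sup>2 \<le> Re (cinner V h (G h)) + \<delta>"
    using D \<epsilon>\<delta> by (simp add: D_def)
qed

section \<open>Finite powers of a Hilbert space\<close>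

definition hpow :: "'a hspace \<Rightarrow> 'j set \<Rightarrow> ('j \<Rightarrow> 'a) hspace" where
  "hpow H J =
    \<lparr>carrier = J \<rightarrow>\<^sub>E carrier H,
     monoid.mult = undefined,
     monoid.one = undefined,
     ring.zero = (\<lambda>i\<in>J. \<zero>\<^bsub>H\<^esub>),
     ring.add = (\<lambda>x y. \<lambda>i\<in>J. x i \<oplus>\<^bsub>H\<^esub> y i),
     module.smult = (\<lambda>c x. \<lambda>i\<in>J. c \<odot>\<^bsub>H\<^esub> x i),
     cinner = (\<lambda>x y. \<Sum>i\<in>J. cinner H (x i) (y i))\<rparr>"

lemma hpow_simps [simp]:
  "carrier (hpow H J) = J \<rightarrow>\<^sub>E carrier H" "\<zero>\<^bsub>hpow H J\<^esub> = (\<lambda>i\<in>J. \<zero>\<^bsub>H\<^esub>)"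
  "x \<oplus>\<^bsub>hpow H J\<^esub> y = (\<lambda>i\<in>J. x i \<oplus>\<^bsub>H\<^esub> y i)" "c \<odot>\<^bsub>hpow H J\<^esub> x = (\<lambda>i\<in>J. c \<odot>\<^bsub>H\<^esub> x i)"
  "cinner (hpow H J) x y = (\<Sum>i\<in>J. cinner H (x i) (y i))"
  by (simp_all add: hpow_def)

definition blk :: "'a hspace \<Rightarrow> 'j set \<Rightarrow> 'j \<Rightarrow> 'a \<Rightarrow> 'j \<Rightarrow> 'a" where
  "blk H J i h = (\<lambda>k\<in>J. if k = i then h else \<zero>\<^bsub>H\<^esub>)"

definition diag_op :: "'a hspace \<Rightarrow> 'j set \<Rightarrow> ('a \<Rightarrow> 'a) \<Rightarrow> ('j \<Rightarrow> 'a) \<Rightarrow> 'j \<Rightarrow> 'a" where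
  "diag_op H J m = (\<lambda>x\<in>carrier (hpow H J). \<lambda>i\<in>J. m (x i))"

definition mat_op :: "'a hspace \<Rightarrow> 'j set \<Rightarrow> ('j \<Rightarrow> 'j \<Rightarrow> 'a \<Rightarrow> 'a) \<Rightarrow> ('j \<Rightarrow> 'a) \<Rightarrow> 'j \<Rightarrow> 'a" where
  "mat_op H J g = (\<lambda>x\<in>carrier (hpow H J). \<lambda>i\<in>J. \<Oplus>\<^bsub>H\<^esub>j\<in>J. g i j (x j))"

locale hilbert_power = hilbert_space H for H :: "'a hspace" (structure) +
  fixes J :: "'j set"
  assumes fin: "finite J"
begin

abbreviation "V \<equiv> hpow H J"

lemma pow_module: "Module.module complex_field V"
proof (rule module_complexI)
  fix x y z assume x: "x \<in> carrier V"
  then have xc: "x i \<in> carrier H" if "i \<in> J" for i using that by auto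
  have ext: "a = b" if "a \<in> extensional J" "b \<in> extensional J" "\<And>i. i \<in> J \<Longrightarrow> a i = b i" for a b :: "'j \<Rightarrow> 'a"
    using that by (rule extensionalityI)
  have xe: "x \<in> extensional J" using x by (simp add: PiE_def)
  show "c \<odot>\<^bsub>V\<^esub> x \<in> carrier V" for c using xc by auto
  show "\<zero>\<^bsub>V\<^esub> \<oplus>\<^bsub>V\<^esub> x = x" using xc xe by (intro ext) simp_all
  show "(-1) \<odot>\<^bsub>V\<^esub> x \<oplus>\<^bsub>V\<^esub> x = \<zero>\<^bsub>V\<^esub>"
  proof (rule ext)
    fix i assume "i \<in> J"
    then show "((-1) \<odot>\<^bsub>V\<^esub> x \<oplus>\<^bsub>V\<^esub> x) i = \<zero>\<^bsub>V\<^esub> i"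
      using xc[of i] by (simp, intro vec_eqI) simp_all
  qed simp_all
  show "(a + b) \<odot>\<^bsub>V\<^esub> x = a \<odot>\<^bsub>V\<^esub> x \<oplus>\<^bsub>V\<^esub> b \<odot>\<^bsub>V\<^esub> x" for a b
  proof (rule ext)
    fix i assume "i \<in> J"
    then show "((a + b) \<odot>\<^bsub>V\<^esub> x) i = (a \<odot>\<^bsub>V\<^esub> x \<oplus>\<^bsub>V\<^esub> b \<odot>\<^bsub>V\<^esub> x) i"
      using xc[of i] by (simp, intro vec_eqI) (simp_all add: distrib_right)
  qed simp_all
  show "(a * b) \<odot>\<^bsub>V\<^esub> x = a \<odot>\<^bsub>V\<^esub> (b \<odot>\<^bsub>V\<^esub> x)" for a b
    using xc by (intro ext) (simp_all add: scale_scale)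
  show "1 \<odot>\<^bsub>V\<^esub> x = x" using xc xe by (intro ext) simp_all
  assume y: "y \<in> carrier V"
  then have yc: "y i \<in> carrier H" if "i \<in> J" for i using that by auto
  show "x \<oplus>\<^bsub>V\<^esub> y \<in> carrier V" using xc yc by auto
  show "x \<oplus>\<^bsub>V\<^esub> y = y \<oplus>\<^bsub>V\<^esub> x" using xc yc by (intro ext) (simp_all add: M.a_comm)
  show "a \<odot>\<^bsub>V\<^esub> (x \<oplus>\<^bsub>V\<^esub> y) = a \<odot>\<^bsub>V\<^esub> x \<oplus>\<^bsub>V\<^esub> a \<odot>\<^bsub>V\<^esub> y" for a
    using xc yc by (intro ext) (simp_all add: scale_add)
  assume "z \<in> carrier V"
  then have zc: "z i \<in> carrier H" if "i \<in> J" for i using that by auto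
  show "x \<oplus>\<^bsub>V\<^esub> y \<oplus>\<^bsub>V\<^esub> z = x \<oplus>\<^bsub>V\<^esub> (y \<oplus>\<^bsub>V\<^esub> z)"
    using xc yc zc by (intro ext) (simp_all add: M.a_assoc)
qed auto

lemma pow_diff:
  assumes "x \<in> carrier V" "y \<in> carrier V" "i \<in> J"
  shows "(x \<ominus>\<^bsub>V\<^esub> y) i = x i \<ominus> y i"
proof -
  have "x i \<in> carrier H" "y i \<in> carrier H" using assms by auto
  then show ?thesis
    unfolding module_diff_eq[OF pow_module assms(1,2)] using assms(3) by (simp add: diff_eq)
qed

lemma pow_norm: "hnorm V x = sqrt (\<Sum>i\<in>J. (hnorm H (x i))\<^sup>2)" if "x \<in> carrier V"
proof -
  have "x i \<in> carrier H" if "i \<in> J" for i using \<open>x \<in> carrier V\<close> that by auto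
  then show ?thesis by (simp add: hnorm_def[of V] hnorm_sq)
qed

lemma coord_norm_le: "x \<in> carrier V \<Longrightarrow> i \<in> J \<Longrightarrow> hnorm H (x i) \<le> hnorm V x"
proof -
  assume x: "x \<in> carrier V" and i: "i \<in> J"
  have "(hnorm H (x i))\<^sup>2 \<le> (\<Sum>i\<in>J. (hnorm H (x i))\<^sup>2)"
    using fin i by (intro member_le_sum) auto
  then show ?thesis unfolding pow_norm[OF x] by (rule real_le_rsqrt)
qed

lemma pow_hilbert: "hilbert_space V"
proof (intro hilbert_space.intro pow_module hilbert_space_axioms.intro)
  fix x y assume x: "x \<in> carrier V" and y: "y \<in> carrier V"
  then have c: "x i \<in> carrier H" "y i \<in> carrier H" if "i \<in> J" for i using that by auto
  show "cinner V x (c \<odot>\<^bsub>V\<^esub> y) = c * cinner V x y" for c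
    using c by (simp add: sum_distrib_left)
  show "cinner V y x = cnj (cinner V x y)"
    using c by (simp add: cinner_commute[symmetric] cong: sum.cong)
  fix z assume "z \<in> carrier V"
  then have "z i \<in> carrier H" if "i \<in> J" for i using that by auto
  then show "cinner V x (y \<oplus>\<^bsub>V\<^esub> z) = cinner V x y + cinner V x z"
    using c by (simp add: sum.distrib)
next
  fix x assume x: "x \<in> carrier V"
  then have c: "x i \<in> carrier H" if "i \<in> J" for i using that by auto
  show "0 \<le> Re (cinner V x x)" using c by (auto intro!: sum_nonneg cinner_nonneg)
  assume "cinner V x x = 0"
  then have "Re (cinner V x x) = 0" by simp
  then have "(\<Sum>i\<in>J. Re (cinner H (x i) (x i))) = 0" by simp
  then have "Re (cinner H (x i) (x i)) = 0" if "i \<in> J" for i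
    using sum_nonneg_eq_0_iff[OF fin, of "\<lambda>i. Re (cinner H (x i) (x i))"] c cinner_nonneg that by auto
  then have "x i = \<zero>" if "i \<in> J" for i
    using that c[OF that] hnorm_zero_iff[of "x i"] by (simp add: hnorm_def)
  then show "x = \<zero>\<^bsub>V\<^esub>" using x by (intro extensionalityI[of _ J]) (auto simp: PiE_def)
next
  fix xs :: "nat \<Rightarrow> 'j \<Rightarrow> 'a"
  assume xs: "\<And>n. xs n \<in> carrier V"
    and cau: "\<forall>e>0. \<exists>k. \<forall>m\<ge>k. \<forall>n\<ge>k. hnorm V (xs m \<ominus>\<^bsub>V\<^esub> xs n) < e"
  have dc: "xs m \<ominus>\<^bsub>V\<^esub> xs n \<in> carrier V" for m n
    using abelian_group.minus_closed[OF module.axioms(2)[OF pow_module]] xs by blast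
  have c: "xs n i \<in> carrier H" if "i \<in> J" for n i using xs[of n] that by auto
  have "\<exists>l\<in>carrier H. (\<lambda>n. hnorm H (xs n i \<ominus> l)) \<longlonglongrightarrow> 0" if i: "i \<in> J" for i
  proof (rule complete[OF c[OF i]], intro allI impI)
    fix e :: real assume "0 < e"
    then obtain k where k: "\<And>m n. m \<ge> k \<Longrightarrow> n \<ge> k \<Longrightarrow> hnorm V (xs m \<ominus>\<^bsub>V\<^esub> xs n) < e"
      using cau by blast
    have "hnorm H (xs m i \<ominus> xs n i) < e" if "m \<ge> k" "n \<ge> k" for m n
      using coord_norm_le[OF dc[of m n] i] k[OF that] pow_diff[OF xs xs i, of m n] by simp
    then show "\<exists>k. \<forall>m\<ge>k. \<forall>n\<ge>k. hnorm H (xs m i \<ominus> xs n i) < e" by blast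
  qed
  then obtain l where l: "\<And>i. i \<in> J \<Longrightarrow> l i \<in> carrier H"
    "\<And>i. i \<in> J \<Longrightarrow> (\<lambda>n. hnorm H (xs n i \<ominus> l i)) \<longlonglongrightarrow> 0" by metis
  define l' where "l' = restrict l J"
  have l': "l' \<in> carrier V" using l(1) by (simp add: l'_def)
  have dl: "xs n \<ominus>\<^bsub>V\<^esub> l' \<in> carrier V" for n
    using abelian_group.minus_closed[OF module.axioms(2)[OF pow_module]] xs l' by blast
  have "(\<lambda>n. sqrt (\<Sum>i\<in>J. (hnorm H (xs n i \<ominus> l i))\<^sup>2)) \<longlonglongrightarrow> sqrt (\<Sum>i\<in>J. 0\<^sup>2)"
    by (intro tendsto_intros l(2))
  moreover have "hnorm V (xs n \<ominus>\<^bsub>V\<^esub> l') = sqrt (\<Sum>i\<in>J. (hnorm H (xs n i \<ominus> l i))\<^sup>2)" for n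
    unfolding pow_norm[OF dl] using pow_diff[OF xs l'] by (simp add: l'_def cong: sum.cong)
  ultimately show "\<exists>l\<in>carrier V. (\<lambda>n. hnorm V (xs n \<ominus>\<^bsub>V\<^esub> l)) \<longlonglongrightarrow> 0"
    using l' by (intro bexI[of _ l']) simp_all
qed

sublocale V: hilbert_space V by (rule pow_hilbert)

lemma coord_closed [simp]: "x \<in> J \<rightarrow>\<^sub>E carrier H \<Longrightarrow> i \<in> J \<Longrightarrow> x i \<in> carrier H"
  by auto

lemma pow_finsum_apply:
  assumes "finite A" "\<And>a. a \<in> A \<Longrightarrow> f a \<in> carrier V" "i \<in> J"
  shows "(\<Oplus>\<^bsub>V\<^esub>a\<in>A. f a) i = (\<Oplus>a\<in>A. f a i)"
  by (rule additive_finsum[OF V.M.abelian_monoid_axioms M.abelian_monoid_axioms assms(1), where f = "\<lambda>x. x i"])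
    (use assms(2,3) in auto)

lemma blk_closed [simp]: "h \<in> carrier H \<Longrightarrow> blk H J i h \<in> J \<rightarrow>\<^sub>E carrier H"
  by (auto simp: blk_def)

lemma cinner_blk: "x \<in> carrier V \<Longrightarrow> i \<in> J \<Longrightarrow> h \<in> carrier H \<Longrightarrow> cinner V x (blk H J i h) = cinner H (x i) h"
proof -
  assume x: "x \<in> carrier V" and i: "i \<in> J" and h: "h \<in> carrier H"
  have "cinner V x (blk H J i h) = (\<Sum>k\<in>J. if k = i then cinner H (x k) h else 0)"
    using x h by (auto simp: blk_def intro!: sum.cong)
  also have "\<dots> = cinner H (x i) h" using fin i by simp
  finally show ?thesis .
qed

lemma blk_norm: "i \<in> J \<Longrightarrow> h \<in> carrier H \<Longrightarrow> hnorm V (blk H J i h) = hnorm H h"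
  using cinner_blk[of "blk H J i h" i h] by (simp add: hnorm_def blk_def)

lemma sum_blk: "x \<in> carrier V \<Longrightarrow> (\<Oplus>\<^bsub>V\<^esub>i\<in>J. blk H J i (x i)) = x"
proof -
  assume x: "x \<in> carrier V"
  have c: "blk H J i (x i) \<in> carrier V" if "i \<in> J" for i using x that by simp
  show ?thesis
  proof (rule V.vec_eqI)
    fix z assume z: "z \<in> carrier V"
    have "cinner V z (\<Oplus>\<^bsub>V\<^esub>i\<in>J. blk H J i (x i)) = (\<Sum>i\<in>J. cinner V z (blk H J i (x i)))"
      by (rule V.cinner_finsum_right[OF fin c z])
    also have "\<dots> = (\<Sum>i\<in>J. cinner H (z i) (x i))"
      using z x by (intro sum.cong refl cinner_blk) auto
    finally show "cinner V z (\<Oplus>\<^bsub>V\<^esub>i\<in>J. blk H J i (x i)) = cinner V z x" by simp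
  qed (use c x in \<open>auto intro!: V.finsum_vec_closed simp del: hpow_simps\<close>)
qed

lemma pow_norm_le_sum:
  assumes x: "x \<in> carrier V"
  shows "hnorm V x \<le> (\<Sum>i\<in>J. hnorm H (x i))"
proof -
  have "hnorm V (\<Oplus>\<^bsub>V\<^esub>i\<in>J. blk H J i (x i)) \<le> (\<Sum>i\<in>J. hnorm V (blk H J i (x i)))"
    by (rule V.hnorm_finsum_le[OF fin]) (use x in simp)
  also have "\<dots> = (\<Sum>i\<in>J. hnorm H (x i))"
    using x by (intro sum.cong refl blk_norm) auto
  finally show ?thesis unfolding sum_blk[OF x] .
qed

lemma diag_op_bop: "m \<in> bop H H \<Longrightarrow> diag_op H J m \<in> bop V V"
proof -
  assume m: "m \<in> bop H H"
  note mc = bop_closed[OF m] and ac = adj_closed[OF hilbert_space_axioms hilbert_space_axioms m]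
  show ?thesis
  proof (rule bopI_formal_adjoint[OF pow_hilbert pow_hilbert,
        where B = "\<lambda>y. \<lambda>i\<in>J. adj H H m (y i)" and C = "opnorm H H m"])
    fix x assume x: "x \<in> carrier V"
    have dc: "diag_op H J m x \<in> carrier V" using x mc by (auto simp: diag_op_def)
    have "(hnorm V (diag_op H J m x))\<^sup>2 = (\<Sum>i\<in>J. (hnorm H (m (x i)))\<^sup>2)"
      unfolding pow_norm[OF dc] using x by (simp add: diag_op_def sum_nonneg)
    also have "\<dots> \<le> (\<Sum>i\<in>J. (opnorm H H m * hnorm H (x i))\<^sup>2)"
      using x mc by (intro sum_mono power_mono opnorm_bound[OF hilbert_space_axioms m]) auto
    also have "\<dots> = (opnorm H H m * hnorm V x)\<^sup>2"
      unfolding pow_norm[OF x] by (simp add: power_mult_distrib sum_distrib_left sum_nonneg)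
    finally show "hnorm V (diag_op H J m x) \<le> opnorm H H m * hnorm V x"
      by (rule power2_le_imp_le) (use x opnorm_nonneg[OF hilbert_space_axioms m] V.hnorm_nonneg in simp)
  next
    fix x y assume "x \<in> carrier V" "y \<in> carrier V"
    then show "cinner V y (diag_op H J m x) = cinner V (\<lambda>i\<in>J. adj H H m (y i)) x"
      by (simp add: diag_op_def cinner_adj_left[OF hilbert_space_axioms hilbert_space_axioms m])
  qed (use mc ac in \<open>auto simp: diag_op_def\<close>)
qed

lemma mat_op_closed:
  assumes "\<And>i j. i \<in> J \<Longrightarrow> j \<in> J \<Longrightarrow> g i j \<in> bop H H" "x \<in> carrier V"
  shows "mat_op H J g x \<in> carrier V"
proof -
  have "g i j (x j) \<in> carrier H" if "i \<in> J" "j \<in> J" for i j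
    using bop_closed[OF assms(1)[OF that]] assms(2) that by simp
  then show ?thesis using assms(2) by (auto simp: mat_op_def)
qed

lemma cinner_mat_op:
  assumes "\<And>i j. i \<in> J \<Longrightarrow> j \<in> J \<Longrightarrow> g i j \<in> bop H H" "x \<in> carrier V" "y \<in> carrier V"
  shows "cinner V x (mat_op H J g y) = (\<Sum>i\<in>J. \<Sum>j\<in>J. cinner H (x i) (g i j (y j)))"
proof -
  have "g i j (y j) \<in> carrier H" if "i \<in> J" "j \<in> J" for i j
    using bop_closed[OF assms(1)[OF that]] assms(3) that by simp
  then show ?thesis using assms(2,3) by (simp add: mat_op_def cinner_finsum_right fin)
qed

lemma mat_op_bop:
  assumes g: "\<And>i j. i \<in> J \<Longrightarrow> j \<in> J \<Longrightarrow> g i j \<in> bop H H"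
  shows "mat_op H J g \<in> bop V V"
proof -
  note hH = hilbert_space_axioms
  let ?g' = "\<lambda>i j. adj H H (g j i)"
  have g': "?g' i j \<in> bop H H" if "i \<in> J" "j \<in> J" for i j
    by (rule adj_bop[OF hH hH g[OF that(2,1)]])
  show ?thesis
  proof (rule bopI_formal_adjoint[OF pow_hilbert pow_hilbert,
        where B = "mat_op H J ?g'" and C = "\<Sum>i\<in>J. \<Sum>j\<in>J. opnorm H H (g i j)"])
    show "mat_op H J g \<in> carrier V \<rightarrow>\<^sub>E carrier V"
      using mat_op_closed[OF g] by (auto simp: mat_op_def simp del: hpow_simps)
    show "mat_op H J ?g' y \<in> carrier V" if "y \<in> carrier V" for y
      by (rule mat_op_closed[OF g' that])
    fix x y assume x: "x \<in> carrier V" and y: "y \<in> carrier V"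
    have "cinner V y (mat_op H J g x) = (\<Sum>i\<in>J. \<Sum>j\<in>J. cinner H (y i) (g i j (x j)))"
      by (rule cinner_mat_op[OF g y x])
    also have "\<dots> = (\<Sum>j\<in>J. \<Sum>i\<in>J. cnj (cinner H (x j) (?g' j i (y i))))"
    proof (subst sum.swap, intro sum.cong refl)
      fix i j assume ij: "i \<in> J" "j \<in> J"
      note gij = g[OF ij]
      have c: "x j \<in> carrier H" "y i \<in> carrier H" using x y ij by auto
      show "cinner H (y i) (g i j (x j)) = cnj (cinner H (x j) (adj H H (g i j) (y i)))"
        unfolding cinner_adj_right[OF hH hH gij c]
        using cinner_commute[OF bop_closed[OF gij c(1)] c(2)] .
    qed
    also have "\<dots> = cnj (cinner V x (mat_op H J ?g' y))"
    proof -
      have "cinner V x (mat_op H J ?g' y) = (\<Sum>j\<in>J. \<Sum>i\<in>J. cinner H (x j) (?g' j i (y i)))"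
        by (rule cinner_mat_op[OF g' x y])
      then show ?thesis by (simp only: cnj_sum)
    qed
    also have "\<dots> = cinner V (mat_op H J ?g' y) x"
      using V.cinner_commute[OF x mat_op_closed[OF g' y]] by simp
    finally show "cinner V y (mat_op H J g x) = cinner V (mat_op H J ?g' y) x" .
  next
    fix x assume x: "x \<in> carrier V"
    have "hnorm V (mat_op H J g x) \<le> (\<Sum>i\<in>J. hnorm H (mat_op H J g x i))"
      by (rule pow_norm_le_sum[OF mat_op_closed[OF g x]])
    also have "\<dots> \<le> (\<Sum>i\<in>J. \<Sum>j\<in>J. opnorm H H (g i j) * hnorm V x)"
    proof (rule sum_mono)
      fix i assume i: "i \<in> J"
      have c: "g i j (x j) \<in> carrier H" if "j \<in> J" for j
        using bop_closed[OF g[OF i that]] x that by simp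
      have "hnorm H (mat_op H J g x i) \<le> (\<Sum>j\<in>J. hnorm H (g i j (x j)))"
        using hnorm_finsum_le[OF fin c] x i by (simp add: mat_op_def)
      also have "\<dots> \<le> (\<Sum>j\<in>J. opnorm H H (g i j) * hnorm V x)"
      proof (rule sum_mono)
        fix j assume j: "j \<in> J"
        have xj: "x j \<in> carrier H" using x j by auto
        have "hnorm H (g i j (x j)) \<le> opnorm H H (g i j) * hnorm H (x j)"
          by (rule opnorm_bound[OF hH g[OF i j] xj])
        also have "\<dots> \<le> opnorm H H (g i j) * hnorm V x"
          by (intro mult_left_mono coord_norm_le[OF x j] opnorm_nonneg[OF hH g[OF i j]])
        finally show "hnorm H (g i j (x j)) \<le> opnorm H H (g i j) * hnorm V x" .
      qed
      finally show "hnorm H (mat_op H J g x i) \<le> (\<Sum>j\<in>J. opnorm H H (g i j) * hnorm V x)" .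
    qed
    finally show "hnorm V (mat_op H J g x) \<le> (\<Sum>i\<in>J. \<Sum>j\<in>J. opnorm H H (g i j)) * hnorm V x"
      by (simp add: sum_distrib_right)
  qed
qed

text \<open>
  With \<open>\<M>\<close> the commutant of a von Neumann algebra, this shows that operators built from a matrix over
  the algebra, like its powers, are again matrices over the algebra.
\<close>

lemma entry_in_commutant:
  assumes D: "D \<in> bop V V" and MM: "MM \<subseteq> bop H H"
    and comm: "\<And>m x. m \<in> MM \<Longrightarrow> x \<in> carrier V \<Longrightarrow> D (diag_op H J m x) = diag_op H J m (D x)"
    and i: "i \<in> J"
  shows "(\<lambda>h\<in>carrier H. D (blk H J j h) i) \<in> commutant H MM"
proof -
  note hH = hilbert_space_axioms
  have Dc: "D (blk H J j h) \<in> carrier V" if "h \<in> carrier H" for h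
    by (rule bop_closed[OF D]) (use that in simp)
  then have Di: "D (blk H J j h) i \<in> carrier H" if "h \<in> carrier H" for h
    using that i by (auto simp: PiE_iff)
  have blk_add: "blk H J j (h \<oplus> k) = blk H J j h \<oplus>\<^bsub>V\<^esub> blk H J j k" if "h \<in> carrier H" "k \<in> carrier H" for h k
    using that by (auto simp: blk_def)
  have blk_scale: "blk H J j (c \<odot> h) = c \<odot>\<^bsub>V\<^esub> blk H J j h" if "h \<in> carrier H" for c h
    using that by (auto simp: blk_def)
  have bnorm: "hnorm V (blk H J j h) \<le> hnorm H h" if "h \<in> carrier H" for h
  proof (cases "j \<in> J")
    case True then show ?thesis using blk_norm that by simp
  next
    case False
    then have "blk H J j h = \<zero>\<^bsub>V\<^esub>" by (auto simp: blk_def)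
    then show ?thesis using that by (simp add: hnorm_def[of V])
  qed
  have "(\<lambda>h\<in>carrier H. D (blk H J j h) i) \<in> bop H H"
    unfolding bop_def
  proof (intro CollectI conjI ballI allI)
    show "(\<lambda>h\<in>carrier H. D (blk H J j h) i) \<in> carrier H \<rightarrow>\<^sub>E carrier H" using Di by auto
    fix h assume h: "h \<in> carrier H"
    show "(\<lambda>h\<in>carrier H. D (blk H J j h) i) (c \<odot> h) = c \<odot> (\<lambda>h\<in>carrier H. D (blk H J j h) i) h" for c
      using h i bop_scale[OF D, of "blk H J j h" c] by (simp add: blk_scale[OF h] del: hpow_simps(4)) simp
    fix k assume k: "k \<in> carrier H"
    show "(\<lambda>h\<in>carrier H. D (blk H J j h) i) (h \<oplus> k)
      = (\<lambda>h\<in>carrier H. D (blk H J j h) i) h \<oplus> (\<lambda>h\<in>carrier H. D (blk H J j h) i) k"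
      using h k i bop_add[OF D, of "blk H J j h" "blk H J j k"]
      by (simp add: blk_add[OF h k] del: hpow_simps(3)) simp
  next
    have "hnorm H (D (blk H J j h) i) \<le> opnorm V V D * hnorm H h" if h: "h \<in> carrier H" for h
    proof -
      have "hnorm H (D (blk H J j h) i) \<le> hnorm V (D (blk H J j h))"
        by (rule coord_norm_le[OF Dc[OF h] i])
      also have "\<dots> \<le> opnorm V V D * hnorm V (blk H J j h)"
        by (rule opnorm_bound[OF pow_hilbert D]) (use h in simp)
      also have "\<dots> \<le> opnorm V V D * hnorm H h"
        by (intro mult_left_mono bnorm[OF h] opnorm_nonneg[OF pow_hilbert D])
      finally show ?thesis .
    qed
    then show "\<exists>C. \<forall>h\<in>carrier H. hnorm H ((\<lambda>h\<in>carrier H. D (blk H J j h) i) h) \<le> C * hnorm H h"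
      by auto
  qed
  moreover have "compose (carrier H) m (\<lambda>h\<in>carrier H. D (blk H J j h) i)
      = compose (carrier H) (\<lambda>h\<in>carrier H. D (blk H J j h) i) m" if m: "m \<in> MM" for m
  proof (rule ext)
    fix h
    have mb: "m \<in> bop H H" using m MM by auto
    show "compose (carrier H) m (\<lambda>h\<in>carrier H. D (blk H J j h) i) h
      = compose (carrier H) (\<lambda>h\<in>carrier H. D (blk H J j h) i) m h"
    proof (cases "h \<in> carrier H")
      case True
      have "diag_op H J m (blk H J j h) = blk H J j (m h)"
        using True bop_zero[OF hH hH mb] by (auto simp: diag_op_def blk_def)
      then have "D (blk H J j (m h)) = diag_op H J m (D (blk H J j h))"
        using comm[OF m, of "blk H J j h"] True by simp
      then have "D (blk H J j (m h)) i = m (D (blk H J j h) i)"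
        using Dc[OF True] i by (simp add: diag_op_def)
      then show ?thesis using True bop_closed[OF mb True] by (simp add: compose_eq)
    qed (simp add: compose_def)
  qed
  ultimately show ?thesis by (simp add: commutant_def)
qed

lemma apply_entries:
  assumes D: "D \<in> bop V V" and x: "x \<in> carrier V" and i: "i \<in> J"
  shows "D x i = (\<Oplus>j\<in>J. D (blk H J j (x j)) i)"
proof -
  have c: "blk H J j (x j) \<in> carrier V" if "j \<in> J" for j using x that by simp
  have "D x = D (\<Oplus>\<^bsub>V\<^esub>j\<in>J. blk H J j (x j))" using sum_blk[OF x] by simp
  also have "\<dots> = (\<Oplus>\<^bsub>V\<^esub>j\<in>J. D (blk H J j (x j)))"
    by (rule bop_finsum[OF pow_hilbert pow_hilbert D fin c])
  finally show ?thesis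
    using pow_finsum_apply[OF fin bop_closed[OF D c] i] by simp
qed

end

section \<open>Tensor products of Hilbert modules with representations\<close>

text \<open>
  How a linear map \<open>Z\<close> with the values \<open>z x\<close> at vectors \<open>u 0 x\<close> is shown to be bounded: if \<open>u k x\<close> are the
  values of what should be \<open>(Z\<^sup>* Z)\<^sup>k\<close>, crude bounds for each of these vectors give the bound for all linear
  combinations.
\<close>

lemma lincomb_orbit_bound:
  assumes K: "hilbert_space K" and L: "hilbert_space L"
    and u: "\<And>k x. x \<in> I \<Longrightarrow> u k x \<in> carrier K" and z: "\<And>x. x \<in> I \<Longrightarrow> z x \<in> carrier L"
    and sym: "\<And>j k x y. x \<in> I \<Longrightarrow> y \<in> I \<Longrightarrow> cinner K (u (Suc j) x) (u k y) = cinner K (u j x) (u (Suc k) y)"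
    and growth: "\<And>k x. x \<in> I \<Longrightarrow> hnorm K (u k x) \<le> B x * d ^ k" and d: "0 \<le> d"
    and zu: "\<And>x y. x \<in> I \<Longrightarrow> y \<in> I \<Longrightarrow> cinner L (z x) (z y) = cinner K (u 0 x) (u 1 y)"
    and f: "supp f \<subseteq> I"
  shows "hnorm L (lincomb L z f) \<le> sqrt d * hnorm K (lincomb K (u 0) f)"
proof -
  interpret K: hilbert_space K by fact
  interpret L: hilbert_space L by fact
  let ?y = "\<lambda>k. lincomb K (u k) f"
  have us: "u k x \<in> carrier K" if "x \<in> supp f" for k x using u f that by auto
  have zs: "z x \<in> carrier L" if "x \<in> supp f" for x using z f that by auto
  have yc: "?y k \<in> carrier K" for k using us by (rule K.lincomb_closed)
  have zl: "lincomb L z f \<in> carrier L" using zs by (rule L.lincomb_closed)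
  have yy: "cinner K (?y j) (?y k)
      = (\<Sum>x\<in>supp f. \<Sum>y\<in>supp f. cnj (coef f x) * coef f y * cinner K (u j x) (u k y))" for j k
    by (rule K.cinner_lincomb) (use us in auto)
  have zz: "cinner L (lincomb L z f) (lincomb L z f)
      = (\<Sum>x\<in>supp f. \<Sum>y\<in>supp f. cnj (coef f x) * coef f y * cinner L (z x) (z y))"
    by (rule L.cinner_lincomb) (use zs in auto)
  have "hnorm K (?y 1) \<le> d * hnorm K (?y 0)"
  proof (rule K.symmetric_orbit_bound[OF yc, where B = "\<Sum>x\<in>supp f. cmod (coef f x) * B x"])
    fix j k
    show "cinner K (?y (Suc j)) (?y k) = cinner K (?y j) (?y (Suc k))"
      unfolding yy
      by (intro sum.cong refl arg_cong2[of _ _ _ _ "(*)"] sym) (use f in auto)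
    have "hnorm K (?y k) \<le> (\<Sum>x\<in>supp f. hnorm K (coef f x \<odot>\<^bsub>K\<^esub> u k x))"
      unfolding lincomb_def by (rule K.hnorm_finsum_le) (use us in simp_all)
    also have "\<dots> \<le> (\<Sum>x\<in>supp f. cmod (coef f x) * (B x * d ^ k))"
    proof (rule sum_mono)
      fix x assume x: "x \<in> supp f"
      have "x \<in> I" using x f by auto
      from mult_left_mono[OF growth[OF this, of k], of "cmod (coef f x)"]
      show "hnorm K (coef f x \<odot>\<^bsub>K\<^esub> u k x) \<le> cmod (coef f x) * (B x * d ^ k)"
        using us[OF x, of k] by (simp add: K.hnorm_scale)
    qed
    finally show "hnorm K (?y k) \<le> (\<Sum>x\<in>supp f. cmod (coef f x) * B x) * d ^ k"
      by (simp add: sum_distrib_right mult.assoc)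
  qed (rule d)
  have "cinner L (lincomb L z f) (lincomb L z f) = cinner K (?y 0) (?y 1)"
    unfolding yy zz
    by (intro sum.cong refl arg_cong2[of _ _ _ _ "(*)"] zu) (use f in auto)
  then have "(hnorm L (lincomb L z f))\<^sup>2 = Re (cinner K (?y 0) (?y 1))"
    by (simp only: L.hnorm_sq[OF zl])
  also have "\<dots> \<le> hnorm K (?y 0) * hnorm K (?y 1)"
    using K.cauchy_schwarz[OF yc yc] complex_Re_le_cmod order_trans by blast
  also have "\<dots> \<le> hnorm K (?y 0) * (d * hnorm K (?y 0))"
    by (intro mult_left_mono K.hnorm_nonneg yc) fact
  also have "\<dots> = (sqrt d * hnorm K (?y 0))\<^sup>2"
    using d by (simp add: power_mult_distrib power2_eq_square)
  finally show ?thesis by (rule power2_le_imp_le) (use d yc in simp)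
qed

context hilbert_module begin

abbreviation M' where "M' \<equiv> commutant H N"

lemma N_bop: "a \<in> N \<Longrightarrow> a \<in> bop H H"
  using von_neumann by (auto simp: von_neumann_algebra_def)

lemma N_adj: "a \<in> N \<Longrightarrow> adj H H a \<in> N"
  using von_neumann by (auto simp: von_neumann_algebra_def)

lemma N_eq: "commutant H M' = N"
  using von_neumann by (auto simp: von_neumann_algebra_def)

lemma N_closed: "a \<in> N \<Longrightarrow> h \<in> carrier H \<Longrightarrow> a h \<in> carrier H"
  by (rule bop_closed[OF N_bop])

lemma M'_bop: "m \<in> M' \<Longrightarrow> m \<in> bop H H" by (simp add: commutant_def)

lemma M'_comm: "m \<in> M' \<Longrightarrow> a \<in> N \<Longrightarrow> h \<in> carrier H \<Longrightarrow> a (m h) = m (a h)"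
proof -
  assume "m \<in> M'" "a \<in> N" and h: "h \<in> carrier H"
  then have "compose (carrier H) a m = compose (carrier H) m a" by (simp add: commutant_def)
  then have "compose (carrier H) a m h = compose (carrier H) m a h" by simp
  then show ?thesis using h by (simp add: compose_eq)
qed

lemma N_I:
  assumes "a \<in> bop H H" "\<And>m h. m \<in> M' \<Longrightarrow> h \<in> carrier H \<Longrightarrow> a (m h) = m (a h)"
  shows "a \<in> N"
proof -
  have "compose (carrier H) m a = compose (carrier H) a m" if "m \<in> M'" for m
    by (rule ext) (use assms(2)[OF that] in \<open>simp add: compose_def\<close>)
  then have "a \<in> commutant H M'" using assms(1) by (simp add: commutant_def)
  then show ?thesis by (simp add: N_eq)
qed

lemma ip_bop: "\<xi> \<in> carrier E \<Longrightarrow> \<eta> \<in> carrier E \<Longrightarrow> ip E \<xi> \<eta> \<in> bop H H"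
  by (intro N_bop ip_closed)

lemma ip_apply_closed: "\<xi> \<in> carrier E \<Longrightarrow> \<eta> \<in> carrier E \<Longrightarrow> h \<in> carrier H \<Longrightarrow> ip E \<xi> \<eta> h \<in> carrier H"
  by (rule bop_closed[OF ip_bop])

lemma E_smult_closed: "\<xi> \<in> carrier E \<Longrightarrow> c \<odot> \<xi> \<in> carrier E"
  using smult_closed by simp

lemma ip_add_apply: "\<lbrakk>\<xi> \<in> carrier E; \<eta> \<in> carrier E; \<zeta> \<in> carrier E; h \<in> carrier H\<rbrakk>
    \<Longrightarrow> ip E \<xi> (\<eta> \<oplus> \<zeta>) h = ip E \<xi> \<eta> h \<oplus>\<^bsub>H\<^esub> ip E \<xi> \<zeta> h"
  by (simp add: ip_add op_add_def)

lemma ip_smult_apply: "\<lbrakk>\<xi> \<in> carrier E; \<eta> \<in> carrier E; h \<in> carrier H\<rbrakk>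
    \<Longrightarrow> ip E \<xi> (c \<odot> \<eta>) h = c \<odot>\<^bsub>H\<^esub> ip E \<xi> \<eta> h"
  by (simp add: ip_smult op_smult_def)

lemma ip_ract_apply: "\<lbrakk>\<xi> \<in> carrier E; \<eta> \<in> carrier E; a \<in> N; h \<in> carrier H\<rbrakk>
    \<Longrightarrow> ip E \<xi> (ract E \<eta> a) h = ip E \<xi> \<eta> (a h)"
  by (simp add: ip_ract compose_eq)

lemma ip_hermitian: "\<lbrakk>\<xi> \<in> carrier E; \<eta> \<in> carrier E; h \<in> carrier H; k \<in> carrier H\<rbrakk>
    \<Longrightarrow> cinner H k (ip E \<eta> \<xi> h) = cnj (cinner H h (ip E \<xi> \<eta> k))"
  using cinner_adj_right[OF H.hilbert_space_axioms H.hilbert_space_axioms ip_bop, of \<xi> \<eta> k h]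
    ip_adj[of \<xi> \<eta>] H.cinner_commute[of h "ip E \<xi> \<eta> k"] ip_apply_closed[of \<xi> \<eta> k] by simp

lemma ip_zero_apply: "\<xi> \<in> carrier E \<Longrightarrow> h \<in> carrier H \<Longrightarrow> ip E \<xi> \<zero> h = \<zero>\<^bsub>H\<^esub>"
  using ip_smult_apply[of \<xi> \<zero> h 0] smult_l_null[of \<zero>] ip_apply_closed[of \<xi> \<zero> h] by simp

lemma ip_finsum_apply:
  assumes "finite A" "\<And>i. i \<in> A \<Longrightarrow> \<eta> i \<in> carrier E" "\<xi> \<in> carrier E" "h \<in> carrier H" "k \<in> carrier H"
  shows "cinner H h (ip E \<xi> (\<Oplus>i\<in>A. \<eta> i) k) = (\<Sum>i\<in>A. cinner H h (ip E \<xi> (\<eta> i) k))"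
  using assms(1,2)
proof (induction A rule: finite_induct)
  case empty then show ?case using assms by (simp add: ip_zero_apply)
next
  case (insert i A)
  have s: "(\<Oplus>i\<in>A. \<eta> i) \<in> carrier E" using insert by (intro M.finsum_closed) auto
  have "(\<Oplus>i\<in>insert i A. \<eta> i) = \<eta> i \<oplus> (\<Oplus>i\<in>A. \<eta> i)"
    using insert by (intro M.finsum_insert) auto
  then show ?case
    using insert s assms by (simp add: ip_add_apply ip_apply_closed)
qed

lemma gram_commutes:
  assumes J: "finite J" and \<xi>: "\<And>i. i \<in> J \<Longrightarrow> \<xi> i \<in> carrier E" and m: "m \<in> M'" and x: "x \<in> carrier (hpow H J)"
  defines "G \<equiv> mat_op H J (\<lambda>i j. ip E (\<xi> i) (\<xi> j))"
  shows "G (diag_op H J m x) = diag_op H J m (G x)"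
proof -
  interpret P: hilbert_power H J
    by (intro hilbert_power.intro hilbert_power_axioms.intro H.hilbert_space_axioms J)
  note hH = H.hilbert_space_axioms
  have G: "G \<in> bop P.V P.V" unfolding G_def by (rule P.mat_op_bop) (intro ip_bop \<xi>)
  note db = P.diag_op_bop[OF M'_bop[OF m]]
  note mx = bop_closed[OF db x] and Gx = bop_closed[OF G x]
  have mc: "m h \<in> carrier H" if "h \<in> carrier H" for h by (rule bop_closed[OF M'_bop[OF m] that])
  have "G (diag_op H J m x) i = diag_op H J m (G x) i" if i: "i \<in> J" for i
  proof -
    have c: "ip E (\<xi> i) (\<xi> j) (x j) \<in> carrier H" if "j \<in> J" for j
      using x i that \<xi> by (intro ip_apply_closed) auto
    have "G (diag_op H J m x) i = (\<Oplus>\<^bsub>H\<^esub>j\<in>J. ip E (\<xi> i) (\<xi> j) (diag_op H J m x j))"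
      using mx i by (simp add: G_def mat_op_def)
    also have "\<dots> = (\<Oplus>\<^bsub>H\<^esub>j\<in>J. m (ip E (\<xi> i) (\<xi> j) (x j)))"
      by (rule H.M.finsum_cong')
        (use x i \<xi> M'_comm[OF m ip_closed] mc[OF c] in \<open>auto simp: diag_op_def\<close>)
    also have "\<dots> = m (\<Oplus>\<^bsub>H\<^esub>j\<in>J. ip E (\<xi> i) (\<xi> j) (x j))"
      by (rule bop_finsum[OF hH hH M'_bop[OF m] J c, symmetric])
    also have "\<dots> = diag_op H J m (G x) i"
      using x i Gx by (simp add: diag_op_def G_def mat_op_def)
    finally show ?thesis .
  qed
  then show ?thesis
    using bop_closed[OF G mx] bop_closed[OF db Gx] by (intro extensionalityI[of _ J]) (auto simp: PiE_def)
qed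

text \<open>
  The Gram operator \<open>G\<close> of a tuple in \<open>E\<close> is positive on vectors whose entries are of the form \<open>a\<^sub>i h\<close>
  with \<open>a\<^sub>i\<close> in \<open>N\<close>. A vector with one non-zero entry has this form and keeps it under the powers of
  \<open>C = \<parallel>G\<parallel> - G\<close>. So the powers of \<open>C\<close> do not grow faster on it than \<open>\<parallel>G\<parallel>\<^sup>k\<close>, hence nowhere
  faster, and \<open>C \<le> \<parallel>G\<parallel>\<close>.
\<close>

lemma gram_positive:
  assumes J: "finite J" and \<xi>: "\<And>i. i \<in> J \<Longrightarrow> \<xi> i \<in> carrier E"
  shows "positive_op (hpow H J) (mat_op H J (\<lambda>i j. ip E (\<xi> i) (\<xi> j)))"
proof -
  interpret P: hilbert_power H J
    by (intro hilbert_power.intro hilbert_power_axioms.intro H.hilbert_space_axioms J)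
  define G where "G = mat_op H J (\<lambda>i j. ip E (\<xi> i) (\<xi> j))"
  note hV = P.pow_hilbert
  have gb: "ip E (\<xi> i) (\<xi> j) \<in> bop H H" if "i \<in> J" "j \<in> J" for i j using that \<xi> by (intro ip_bop)
  have G_bop: "G \<in> bop P.V P.V" unfolding G_def by (rule P.mat_op_bop) (rule gb)
  note Gc = bop_closed[OF G_bop]
  have G_inner: "cinner P.V x (G y) = (\<Sum>i\<in>J. \<Sum>j\<in>J. cinner H (x i) (ip E (\<xi> i) (\<xi> j) (y j)))"
    if "x \<in> carrier P.V" "y \<in> carrier P.V" for x y
    unfolding G_def by (rule P.cinner_mat_op[OF gb that])
  have G_sym: "cinner P.V (G x) y = cinner P.V x (G y)" if x: "x \<in> carrier P.V" and y: "y \<in> carrier P.V" for x y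
  proof -
    have c: "x i \<in> carrier H" "y i \<in> carrier H" if "i \<in> J" for i using x y that by auto
    have "cinner P.V (G x) y = cnj (cinner P.V y (G x))" by (rule P.V.cinner_commute[OF y Gc[OF x]])
    also have "\<dots> = (\<Sum>i\<in>J. \<Sum>j\<in>J. cnj (cinner H (y i) (ip E (\<xi> i) (\<xi> j) (x j))))"
      unfolding G_inner[OF y x] by simp
    also have "\<dots> = (\<Sum>i\<in>J. \<Sum>j\<in>J. cinner H (x j) (ip E (\<xi> j) (\<xi> i) (y i)))"
      by (intro sum.cong refl ip_hermitian[symmetric] \<xi> c)
    also have "\<dots> = cinner P.V x (G y)" unfolding G_inner[OF x y] by (rule sum.swap)
    finally show ?thesis .
  qed
  have G_comm: "G (diag_op H J m x) = diag_op H J m (G x)" if "m \<in> M'" "x \<in> carrier P.V" for m x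
    unfolding G_def using that by (intro gram_commutes J \<xi>)
  define c where "c = opnorm P.V P.V G"
  have c: "0 \<le> c" unfolding c_def by (rule opnorm_nonneg[OF hV G_bop])
  define C where "C = op_add P.V P.V (op_smult P.V P.V (of_real c) (op_one P.V)) (op_smult P.V P.V (-1) G)"
  have C_bop: "C \<in> bop P.V P.V" unfolding C_def by (intro op_add_bop op_smult_bop op_one_bop hV G_bop)
  have C_apply: "C x = (of_real c \<odot>\<^bsub>P.V\<^esub> x) \<oplus>\<^bsub>P.V\<^esub> (-1) \<odot>\<^bsub>P.V\<^esub> G x" if "x \<in> carrier P.V" for x
    using that unfolding C_def op_add_def op_smult_def op_one_def by (simp del: hpow_simps)
  have C_inner: "cinner P.V x (C y) = of_real c * cinner P.V x y - cinner P.V x (G y)"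
    if "x \<in> carrier P.V" "y \<in> carrier P.V" for x y
    using that Gc[OF that(2)] by (simp add: C_apply del: hpow_simps)
  have C_sym: "cinner P.V (C x) y = cinner P.V x (C y)" if "x \<in> carrier P.V" "y \<in> carrier P.V" for x y
    using that Gc[OF that(1)] Gc[OF that(2)] G_sym[OF that] by (simp add: C_apply del: hpow_simps)
  have C_pos: "0 \<le> Re (cinner P.V x (C x))" if x: "x \<in> carrier P.V" for x
  proof -
    have "Re (cinner P.V x (G x)) \<le> c * (hnorm P.V x)\<^sup>2"
      unfolding c_def by (rule form_le_opnorm[OF hV G_bop x])
    then show ?thesis unfolding C_inner[OF x x] using P.V.hnorm_sq[OF x] by simp
  qed
  interpret C: positive_op P.V C
    by (intro positive_op.intro symmetric_op.intro symmetric_op_axioms.intro positive_op_axioms.intro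
        hV C_bop C_sym C_pos)
  have C_comm: "(C ^^ k) (diag_op H J m x) = diag_op H J m ((C ^^ k) x)"
    if m: "m \<in> M'" and x: "x \<in> carrier P.V" for m x k
  proof (induction k)
    case (Suc k)
    note db = P.diag_op_bop[OF M'_bop[OF m]]
    have y: "(C ^^ k) x \<in> carrier P.V" by (rule C.iter_closed[OF x])
    show ?case
      using Suc y Gc[OF y] bop_closed[OF db y] G_comm[OF m y]
      by (simp add: C_apply bop_add[OF db] bop_scale[OF db] del: hpow_simps)
  qed simp
  have block: "Re (cinner P.V v ((C ^^ Suc (j + j)) v)) \<le> c * Re (cinner P.V v ((C ^^ (j + j)) v))"
    if i: "i \<in> J" and h: "h \<in> carrier H" and v: "v = blk H J i h" for i h v j
  proof -
    have vc: "v \<in> carrier P.V" using h by (simp add: v)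
    let ?y = "(C ^^ j) v"
    have y: "?y \<in> carrier P.V" by (rule C.iter_closed[OF vc])
    \<comment> \<open>\<open>C\<^sup>j\<close> is a matrix over \<open>N\<close>; \<open>a\<close> is its column with index \<open>i\<close>.\<close>
    define a where "a l = (\<lambda>h\<in>carrier H. (\<lambda>x\<in>carrier P.V. (C ^^ j) x) (blk H J i h) l)" for l
    have a: "a l \<in> N" if "l \<in> J" for l
    proof -
      have "a l \<in> commutant H M'"
        unfolding a_def
      proof (rule P.entry_in_commutant[OF C.iter_bop _ _ that])
        show "M' \<subseteq> bop H H" using M'_bop by blast
        fix m x assume m: "m \<in> M'" and x: "x \<in> carrier P.V"
        have "diag_op H J m x \<in> carrier P.V" by (rule bop_closed[OF P.diag_op_bop[OF M'_bop[OF m]] x])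
        then show "(\<lambda>x\<in>carrier P.V. (C ^^ j) x) (diag_op H J m x)
          = diag_op H J m ((\<lambda>x\<in>carrier P.V. (C ^^ j) x) x)"
          using C_comm[OF m x] x by (simp del: hpow_simps)
      qed
      then show ?thesis by (simp add: N_eq)
    qed
    have ya: "?y l = a l h" if "l \<in> J" for l using h vc by (simp add: a_def v)
    define \<zeta> where "\<zeta> = (\<Oplus>l\<in>J. ract E (\<xi> l) (a l))"
    have ra: "ract E (\<xi> l) (a l) \<in> carrier E" if "l \<in> J" for l by (intro ract_closed \<xi> a that)
    have \<zeta>: "\<zeta> \<in> carrier E" unfolding \<zeta>_def using ra by (intro M.finsum_closed) auto
    have ah: "a l h \<in> carrier H" if "l \<in> J" for l by (rule N_closed[OF a[OF that] h])
    have "cinner H h (ip E \<zeta> \<zeta> h) = (\<Sum>l\<in>J. cinner H h (ip E \<zeta> (\<xi> l) (a l h)))"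
      using ip_finsum_apply[where A = J and \<eta> = "\<lambda>l. ract E (\<xi> l) (a l)", OF J ra \<zeta> h h] h \<zeta> \<xi> a
      by (simp add: ip_ract_apply \<zeta>_def[symmetric] cong: sum.cong)
    also have "\<dots> = (\<Sum>l\<in>J. cnj (cinner H (a l h) (ip E (\<xi> l) \<zeta> h)))"
      by (intro sum.cong refl ip_hermitian \<xi> \<zeta> ah h)
    also have "\<dots> = (\<Sum>l\<in>J. cnj (\<Sum>k\<in>J. cinner H (a l h) (ip E (\<xi> l) (\<xi> k) (a k h))))"
    proof (intro sum.cong refl arg_cong[of _ _ cnj])
      fix l assume l: "l \<in> J"
      show "cinner H (a l h) (ip E (\<xi> l) \<zeta> h) = (\<Sum>k\<in>J. cinner H (a l h) (ip E (\<xi> l) (\<xi> k) (a k h)))"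
        unfolding \<zeta>_def
        using ip_finsum_apply[where A = J and \<eta> = "\<lambda>l. ract E (\<xi> l) (a l)", OF J ra \<xi>[OF l] ah[OF l] h] h \<xi> a l
        by (simp add: ip_ract_apply cong: sum.cong)
    qed
    also have "\<dots> = cnj (cinner P.V ?y (G ?y))"
      unfolding G_inner[OF y y] by (simp add: ya cong: sum.cong)
    finally have "Re (cinner H h (ip E \<zeta> \<zeta> h)) = Re (cinner P.V ?y (G ?y))"
      by (simp only: cnj.sel)
    moreover have "0 \<le> Re (cinner H h (ip E \<zeta> \<zeta> h))"
      using ip_nonneg[OF \<zeta>] h by (simp add: op_le_def op_zero_def)
    ultimately have "0 \<le> Re (cinner P.V ?y (G ?y))" by (simp only:)
    then have "Re (cinner P.V ?y (C ?y)) \<le> c * Re (cinner P.V ?y ?y)"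
      using C_inner[OF y y] by simp
    then show ?thesis
      using C.cinner_iter[OF vc vc, of j "Suc j"] C.cinner_iter[OF vc vc, of j j] by (simp del: hpow_simps)
  qed
  have block_norm: "hnorm P.V ((C ^^ k) (blk H J i h)) \<le> c ^ k * hnorm H h"
    if i: "i \<in> J" and h: "h \<in> carrier H" for i h k
  proof (induction k)
    case 0 then show ?case using P.blk_norm[OF i h] by simp
  next
    case (Suc k)
    let ?v = "blk H J i h"
    define m where "m k = Re (cinner P.V ?v ((C ^^ k) ?v))" for k
    have vc: "?v \<in> carrier P.V" using h by simp
    have mnn: "0 \<le> m k" for k unfolding m_def by (rule C.moment_nonneg[OF vc])
    have even: "m (Suc (j + j)) \<le> c * m (j + j)" for j
      unfolding m_def by (rule block[OF i h refl])
    have odd: "m (Suc (Suc (j + j))) \<le> c * m (Suc (j + j))" for j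
    proof (rule le_of_square_le)
      let ?x = "(C ^^ j) ?v" and ?y = "(C ^^ Suc j) ?v"
      have xy: "?x \<in> carrier P.V" "?y \<in> carrier P.V" using C.iter_closed[OF vc] by blast+
      have m2: "cinner P.V ?x (C ?y) = cinner P.V ?v ((C ^^ Suc (Suc (j + j))) ?v)"
        using C.cinner_iter[OF vc vc, of j "Suc (Suc j)"] by (simp del: hpow_simps)
      have m1: "cinner P.V ?x (C ?x) = cinner P.V ?v ((C ^^ Suc (j + j)) ?v)"
        using C.cinner_iter[OF vc vc, of j "Suc j"] by (simp del: hpow_simps)
      have m3: "cinner P.V ?y (C ?y) = cinner P.V ?v ((C ^^ Suc (Suc j + Suc j)) ?v)"
        using C.cinner_iter[OF vc vc, of "Suc j" "Suc (Suc j)"] by (simp del: hpow_simps)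
      have "(m (Suc (Suc (j + j))))\<^sup>2 \<le> (cmod (cinner P.V ?x (C ?y)))\<^sup>2"
        unfolding m2 m_def by (rule power_mono[OF complex_Re_le_cmod mnn[of "Suc (Suc (j + j))", unfolded m_def]])
      also have "\<dots> \<le> m (Suc (j + j)) * m (Suc (Suc j + Suc j))"
        using C.positive_cauchy_schwarz[OF xy] unfolding m1 m3 m_def by (simp only:)
      also have "\<dots> \<le> m (Suc (j + j)) * (c * m (Suc j + Suc j))"
        by (intro mult_left_mono even mnn)
      finally show "m (Suc (Suc (j + j))) * m (Suc (Suc (j + j)))
          \<le> m (Suc (Suc (j + j))) * (c * m (Suc (j + j)))"
        by (simp add: power2_eq_square mult_ac)
    qed (use c mnn in simp_all)
    have nm: "(hnorm P.V ((C ^^ k) ?v))\<^sup>2 = m (k + k)" for k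
      unfolding m_def using C.cinner_iter[OF vc vc, of k k] P.V.hnorm_sq[OF C.iter_closed[OF vc], of k] by simp
    have "(hnorm P.V ((C ^^ Suc k) ?v))\<^sup>2 = m (Suc (Suc (k + k)))" unfolding nm by simp
    also have "\<dots> \<le> c * (c * m (k + k))"
      by (rule order_trans[OF odd mult_left_mono[OF even c]])
    also have "\<dots> = (c * hnorm P.V ((C ^^ k) ?v))\<^sup>2"
      unfolding power_mult_distrib nm by (simp add: power2_eq_square)
    finally have "hnorm P.V ((C ^^ Suc k) ?v) \<le> c * hnorm P.V ((C ^^ k) ?v)"
      by (rule power2_le_imp_le) (use c P.V.hnorm_nonneg[OF C.iter_closed[OF vc]] in simp)
    also have "\<dots> \<le> c * (c ^ k * hnorm H h)" by (rule mult_left_mono[OF Suc c])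
    finally show ?case by simp
  qed
  have "0 \<le> Re (cinner P.V w (G w))" if w: "w \<in> carrier P.V" for w
  proof -
    have wc: "w i \<in> carrier H" if "i \<in> J" for i using w that by auto
    have "hnorm P.V ((C ^^ 1) w) \<le> c * hnorm P.V ((C ^^ 0) w)"
    proof (rule P.V.symmetric_orbit_bound[where B = "\<Sum>i\<in>J. hnorm H (w i)", OF C.iter_closed[OF w] _ _ c])
      show "cinner P.V ((C ^^ Suc j) w) ((C ^^ k) w) = cinner P.V ((C ^^ j) w) ((C ^^ Suc k) w)" for j k
        using C.cinner_iter[OF w w, of "Suc j" k] C.cinner_iter[OF w w, of j "Suc k"] by (simp del: hpow_simps)
      fix k
      have bc: "blk H J i (w i) \<in> carrier P.V" if "i \<in> J" for i using wc[OF that] by simp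
      have "(C ^^ k) w = (\<lambda>x\<in>carrier P.V. (C ^^ k) x) (\<Oplus>\<^bsub>P.V\<^esub>i\<in>J. blk H J i (w i))"
        using P.sum_blk[OF w] w by (simp del: hpow_simps)
      also have "\<dots> = (\<Oplus>\<^bsub>P.V\<^esub>i\<in>J. (\<lambda>x\<in>carrier P.V. (C ^^ k) x) (blk H J i (w i)))"
        by (rule bop_finsum[OF hV hV C.iter_bop J bc])
      finally have "hnorm P.V ((C ^^ k) w)
          = hnorm P.V (\<Oplus>\<^bsub>P.V\<^esub>i\<in>J. (\<lambda>x\<in>carrier P.V. (C ^^ k) x) (blk H J i (w i)))" by (simp only:)
      also have "\<dots> \<le> (\<Sum>i\<in>J. hnorm P.V ((\<lambda>x\<in>carrier P.V. (C ^^ k) x) (blk H J i (w i))))"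
        by (rule P.V.hnorm_finsum_le[OF J bop_closed[OF C.iter_bop bc]])
      also have "\<dots> \<le> (\<Sum>i\<in>J. c ^ k * hnorm H (w i))"
        using block_norm wc bc by (intro sum_mono) (simp del: hpow_simps)
      also have "\<dots> = (\<Sum>i\<in>J. hnorm H (w i)) * c ^ k"
        unfolding mult.commute[of _ "c ^ k"] sum_distrib_left ..
      finally show "hnorm P.V ((C ^^ k) w) \<le> (\<Sum>i\<in>J. hnorm H (w i)) * c ^ k" .
    qed
    then have Cw: "hnorm P.V (C w) \<le> c * hnorm P.V w" by (simp del: hpow_simps)
    have "Re (cinner P.V w (C w)) \<le> hnorm P.V w * hnorm P.V (C w)"
      using P.V.cauchy_schwarz[OF w C.A_closed[OF w]] complex_Re_le_cmod order_trans by blast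
    also have "\<dots> \<le> hnorm P.V w * (c * hnorm P.V w)"
      by (intro mult_left_mono Cw P.V.hnorm_nonneg w)
    finally have "Re (cinner P.V w (C w)) \<le> c * (hnorm P.V w)\<^sup>2" by (simp add: power2_eq_square mult_ac)
    then show ?thesis unfolding C_inner[OF w w] using P.V.hnorm_sq[OF w] by simp
  qed
  then show ?thesis
    unfolding G_def[symmetric]
    by (intro positive_op.intro symmetric_op.intro symmetric_op_axioms.intro positive_op_axioms.intro
        hV G_bop G_sym)
qed

text \<open>The form at a formal sum is that of the Gram operator at the tuple of its weighted vectors in \<open>H\<close>.\<close>

lemma hten_kernel_psd: "psd_kernel (carrier E \<times> carrier H) (hten_ker E H id)"
proof
  fix x y assume "x \<in> carrier E \<times> carrier H" "y \<in> carrier E \<times> carrier H"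
  then have "fst x \<in> carrier E" "snd x \<in> carrier H" "fst y \<in> carrier E" "snd y \<in> carrier H" by auto
  then show "hten_ker E H id y x = cnj (hten_ker E H id x y)"
    unfolding hten_ker_def case_prod_beta id_apply by (intro ip_hermitian)
next
  fix f :: "('e \<times> 'h) \<Rightarrow>\<^sub>0 complex" assume f: "supp f \<subseteq> carrier E \<times> carrier H"
  define J where "J = supp f"
  have J: "finite J" by (simp add: J_def)
  interpret P: hilbert_power H J
    by (intro hilbert_power.intro hilbert_power_axioms.intro H.hilbert_space_axioms J)
  interpret G: positive_op "hpow H J" "mat_op H J (\<lambda>i j. ip E (fst i) (fst j))"
    by (rule gram_positive[OF J]) (use f in \<open>auto simp: J_def\<close>)
  define w where "w = (\<lambda>x\<in>J. coef f x \<odot>\<^bsub>H\<^esub> snd x)"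
  have w: "w \<in> carrier P.V" using f by (auto simp: w_def J_def)
  have "cinner P.V w (mat_op H J (\<lambda>i j. ip E (fst i) (fst j)) w)
      = (\<Sum>i\<in>J. \<Sum>j\<in>J. cinner H (w i) (ip E (fst i) (fst j) (w j)))"
    by (rule P.cinner_mat_op[OF _ w w]) (use f in \<open>auto simp: J_def intro!: ip_bop\<close>)
  also have "\<dots> = ker_form (hten_ker E H id) f f"
    unfolding ker_form_def J_def[symmetric]
  proof (intro sum.cong refl)
    fix i j assume "i \<in> J" "j \<in> J"
    moreover from this have "fst i \<in> carrier E" "snd i \<in> carrier H" "fst j \<in> carrier E" "snd j \<in> carrier H"
      using f by (auto simp: J_def)
    ultimately show "cinner H (w i) (ip E (fst i) (fst j) (w j))
      = cnj (coef f i) * coef f j * hten_ker E H id i j"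
      by (simp add: w_def hten_ker_def case_prod_beta bop_scale[OF ip_bop] ip_apply_closed)
  qed
  finally show "0 \<le> Re (ker_form (hten_ker E H id) f f)"
    using G.positive[OF w] by simp
qed

end

lemma formal_adjoint_total:
  assumes K: "hilbert_space K" and L: "hilbert_space L"
    and e: "total_family K I e" and f: "total_family L J f"
    and A: "A \<in> bop K L" and B: "B \<in> bop L K"
    and AB: "\<And>x y. x \<in> I \<Longrightarrow> y \<in> J \<Longrightarrow> cinner L (f y) (A (e x)) = cinner K (B (f y)) (e x)"
    and u: "u \<in> carrier L" and v: "v \<in> carrier K"
  shows "cinner L u (A v) = cinner K (B u) v"
proof -
  have ec: "e x \<in> carrier K" if "x \<in> I" for x using e that by (simp add: total_family_def)
  have fc: "f y \<in> carrier L" if "y \<in> J" for y using f that by (simp add: total_family_def)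
  have "adj L K B (e x) = A (e x)" if x: "x \<in> I" for x
    by (rule total_family_eqI[OF L f adj_closed[OF L K B ec[OF x]] bop_closed[OF A ec[OF x]]])
      (simp add: cinner_adj_right[OF L K B fc ec[OF x]] AB[OF x])
  then have "adj L K B = A" by (rule bop_eq_on_total[OF K L e adj_bop[OF L K B] A])
  then show ?thesis using cinner_adj_right[OF L K B u v] by simp
qed

text \<open>
  A representation of \<open>N\<close> on \<open>K\<close> for which the tensor product of \<open>E\<close> with \<open>K\<close> is defined.
\<close>

locale module_rep = hilbert_module H N E + K: hilbert_space K
  for H :: "'h hspace" and N and E :: "('h \<Rightarrow> 'h, 'e, 'z) corr_scheme" (structure)
    and K :: "'k hspace" +
  fixes \<sigma> :: "('h \<Rightarrow> 'h) \<Rightarrow> 'k \<Rightarrow> 'k"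
  assumes rep_bop: "a \<in> N \<Longrightarrow> \<sigma> a \<in> bop K K"
    and rep_adj: "\<lbrakk>a \<in> N; x \<in> carrier K; y \<in> carrier K\<rbrakk>
      \<Longrightarrow> cinner K x (\<sigma> a y) = cinner K (\<sigma> (adj H H a) x) y"
    and rep_psd: "psd_kernel (carrier E \<times> carrier K) (hten_ker E K \<sigma>)"
begin

sublocale T: psd_kernel "carrier E \<times> carrier K" "hten_ker E K \<sigma>" by (rule rep_psd)

abbreviation ET where "ET \<equiv> htensor E K \<sigma>"
abbreviation te where "te \<equiv> hten E K \<sigma>"

lemma ET_hilbert: "hilbert_space ET"
  unfolding htensor_def by (rule T.completion_hilbert)

sublocale ET: hilbert_space ET by (rule ET_hilbert)

lemma te_closed: "\<xi> \<in> carrier E \<Longrightarrow> x \<in> carrier K \<Longrightarrow> te \<xi> x \<in> carrier ET"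
  unfolding htensor_def hten_def by (rule T.elem_closed) simp

lemma rep_closed: "a \<in> N \<Longrightarrow> x \<in> carrier K \<Longrightarrow> \<sigma> a x \<in> carrier K"
  by (rule bop_closed[OF rep_bop])

lemma cinner_te:
  "\<lbrakk>\<xi> \<in> carrier E; x \<in> carrier K; \<eta> \<in> carrier E; y \<in> carrier K\<rbrakk>
    \<Longrightarrow> cinner ET (te \<xi> x) (te \<eta> y) = cinner K x (\<sigma> (ip E \<xi> \<eta>) y)"
  unfolding htensor_def hten_def by (subst T.cinner_elem) (simp_all add: hten_ker_def)

lemma te_eq_elem: "(\<lambda>(\<xi>, x). te \<xi> x) = T.e"
  by (auto simp: hten_def)

lemma te_total: "total_family ET (carrier E \<times> carrier K) (\<lambda>(\<xi>, x). te \<xi> x)"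
  unfolding te_eq_elem htensor_def by (rule T.elem_total)

lemma te_eqI:
  assumes "u \<in> carrier ET" "v \<in> carrier ET"
    "\<And>\<xi> x. \<xi> \<in> carrier E \<Longrightarrow> x \<in> carrier K \<Longrightarrow> cinner ET (te \<xi> x) u = cinner ET (te \<xi> x) v"
  shows "u = v"
  by (rule total_family_eqI[OF ET_hilbert te_total assms(1,2)]) (use assms(3) in auto)

lemma bop_eqI_te:
  assumes "hilbert_space L" "A \<in> bop ET L" "B \<in> bop ET L"
    "\<And>\<xi> x. \<xi> \<in> carrier E \<Longrightarrow> x \<in> carrier K \<Longrightarrow> A (te \<xi> x) = B (te \<xi> x)"
  shows "A = B"
  by (rule bop_eq_on_total[OF ET_hilbert assms(1) te_total assms(2,3)]) (use assms(4) in auto)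

lemma te_extend:
  assumes L: "hilbert_space L"
    and v: "\<And>\<xi> x. \<xi> \<in> carrier E \<Longrightarrow> x \<in> carrier K \<Longrightarrow> v (\<xi>, x) \<in> carrier L"
    and bound: "\<And>f. supp f \<subseteq> carrier E \<times> carrier K
      \<Longrightarrow> hnorm L (lincomb L v f) \<le> C * hnorm ET (lincomb ET (\<lambda>(\<xi>, x). te \<xi> x) f)"
  obtains A where "A \<in> bop ET L" "\<And>\<xi> x. \<xi> \<in> carrier E \<Longrightarrow> x \<in> carrier K \<Longrightarrow> A (te \<xi> x) = v (\<xi>, x)"
proof -
  have "\<exists>A\<in>bop T.K L. \<forall>x\<in>carrier E \<times> carrier K. A (T.e x) = v x"
  proof (rule T.extend[OF L])
    show "v x \<in> carrier L" if "x \<in> carrier E \<times> carrier K" for x using that v by auto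
    fix f assume f: "supp f \<subseteq> carrier E \<times> carrier K"
    have "hnorm ET (lincomb ET (\<lambda>(\<xi>, x). te \<xi> x) f) = T.nrm f"
      unfolding te_eq_elem htensor_def T.emb_eq_lincomb[OF f, symmetric] by (rule T.hnorm_emb[OF f])
    then show "hnorm L (lincomb L v f) \<le> C * T.nrm f" using bound[OF f] by simp
  qed
  then obtain A where A: "A \<in> bop T.K L" "\<And>x. x \<in> carrier E \<times> carrier K \<Longrightarrow> A (T.e x) = v x" by blast
  show thesis
  proof (rule that)
    show "A \<in> bop ET L" unfolding htensor_def by (rule A(1))
    show "A (te \<xi> x) = v (\<xi>, x)" if "\<xi> \<in> carrier E" "x \<in> carrier K" for \<xi> x
      using A(2)[of "(\<xi>, x)"] that by (simp add: hten_def)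
  qed
qed

lemma te_op_ext:
  assumes "hilbert_space L" "A \<in> bop ET L"
    "\<And>\<xi> x. \<xi> \<in> carrier E \<Longrightarrow> x \<in> carrier K \<Longrightarrow> A (te \<xi> x) = v (\<xi>, x)"
  shows "op_ext ET L (carrier E \<times> carrier K) (\<lambda>(\<xi>, x). te \<xi> x) v = A"
  by (rule op_ext_eq[OF ET_hilbert assms(1) te_total assms(2)]) (use assms(3) in auto)

lemma te_add_right: "\<lbrakk>\<xi> \<in> carrier E; x \<in> carrier K; y \<in> carrier K\<rbrakk>
    \<Longrightarrow> te \<xi> (x \<oplus>\<^bsub>K\<^esub> y) = te \<xi> x \<oplus>\<^bsub>ET\<^esub> te \<xi> y"
  by (rule te_eqI) (simp_all add: te_closed cinner_te bop_add[OF rep_bop] ip_closed rep_closed)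

lemma te_scale_right: "\<lbrakk>\<xi> \<in> carrier E; x \<in> carrier K\<rbrakk>
    \<Longrightarrow> te \<xi> (c \<odot>\<^bsub>K\<^esub> x) = c \<odot>\<^bsub>ET\<^esub> te \<xi> x"
  by (rule te_eqI) (simp_all add: te_closed cinner_te bop_scale[OF rep_bop] ip_closed rep_closed)

definition L_op :: "'e \<Rightarrow> 'k \<Rightarrow> ('e \<times> 'k) hcompl" where
  "L_op \<xi> = (\<lambda>x\<in>carrier K. te \<xi> x)"

lemma te_norm_sq: "\<xi> \<in> carrier E \<Longrightarrow> x \<in> carrier K
    \<Longrightarrow> (hnorm ET (te \<xi> x))\<^sup>2 = Re (cinner K x (\<sigma> (ip E \<xi> \<xi>) x))"
  using ET.hnorm_sq[OF te_closed] cinner_te by simp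

lemma te_norm:
  assumes \<xi>: "\<xi> \<in> carrier E" and x: "x \<in> carrier K"
  shows "hnorm ET (te \<xi> x) \<le> sqrt (opnorm K K (\<sigma> (ip E \<xi> \<xi>))) * hnorm K x"
proof (rule power2_le_imp_le)
  have ipN: "ip E \<xi> \<xi> \<in> N" by (rule ip_closed[OF \<xi> \<xi>])
  have nn: "0 \<le> opnorm K K (\<sigma> (ip E \<xi> \<xi>))"
    by (rule opnorm_nonneg[OF K.hilbert_space_axioms rep_bop[OF ipN]])
  have "(hnorm ET (te \<xi> x))\<^sup>2 \<le> opnorm K K (\<sigma> (ip E \<xi> \<xi>)) * (hnorm K x)\<^sup>2"
    unfolding te_norm_sq[OF assms] by (rule form_le_opnorm[OF K.hilbert_space_axioms rep_bop[OF ipN] x])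
  also have "\<dots> = (sqrt (opnorm K K (\<sigma> (ip E \<xi> \<xi>))) * hnorm K x)\<^sup>2"
    using nn by (simp add: power_mult_distrib)
  finally show "(hnorm ET (te \<xi> x))\<^sup>2 \<le> (sqrt (opnorm K K (\<sigma> (ip E \<xi> \<xi>))) * hnorm K x)\<^sup>2" .
  show "0 \<le> sqrt (opnorm K K (\<sigma> (ip E \<xi> \<xi>))) * hnorm K x" using nn x by simp
qed

lemma L_bop: "\<xi> \<in> carrier E \<Longrightarrow> L_op \<xi> \<in> bop K ET"
  unfolding bop_def L_op_def using te_norm
  by (auto simp: te_closed te_add_right te_scale_right)

end

text \<open>
  \<open>I \<otimes> A\<close> is bounded with the bound of \<open>A\<close>: on formal sums the powers of \<open>I \<otimes> A\<^sup>*A\<close> have obvious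
  bounds of the right exponential order.
\<close>

locale module_rep_pair = R1: module_rep H N E K \<sigma> + R2: module_rep H N E L \<rho>
  for H :: "'h hspace" and N and E :: "('h \<Rightarrow> 'h, 'e, 'z) corr_scheme" (structure)
    and K :: "'k hspace" and \<sigma> and L :: "'l hspace" and \<rho>
begin

lemma id_hten:
  assumes A: "A \<in> bop K L"
    and comm: "\<And>a x. a \<in> N \<Longrightarrow> x \<in> carrier K \<Longrightarrow> A (\<sigma> a x) = \<rho> a (A x)"
  shows id_hten_bop: "id_hten E K \<sigma> L \<rho> A \<in> bop R1.ET R2.ET"
    and id_hten_te: "\<lbrakk>\<xi> \<in> carrier E; x \<in> carrier K\<rbrakk>
      \<Longrightarrow> id_hten E K \<sigma> L \<rho> A (R1.te \<xi> x) = R2.te \<xi> (A x)"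
proof -
  note hK = R1.K.hilbert_space_axioms and hL = R2.K.hilbert_space_axioms
  note Ac = bop_closed[OF A]
  define C where "C = compose (carrier K) (adj K L A) A"
  have C_bop: "C \<in> bop K K" unfolding C_def by (rule bop_compose[OF hK hL A adj_bop[OF hK hL A]])
  have C_inner: "cinner K x (C y) = cinner L (A x) (A y)" if "x \<in> carrier K" "y \<in> carrier K" for x y
    using that cinner_adj_right[OF hK hL A that(1) Ac[OF that(2)]] by (simp add: C_def compose_eq)
  have C_inner': "cinner K (C x) y = cinner L (A x) (A y)" if "x \<in> carrier K" "y \<in> carrier K" for x y
    using that cinner_adj_left[OF hK hL A that(2) Ac[OF that(1)]] by (simp add: C_def compose_eq)
  interpret C: symmetric_op K C
    by (intro symmetric_op.intro symmetric_op_axioms.intro hK C_bop) (simp add: C_inner C_inner')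
  have C_comm: "C (\<sigma> a x) = \<sigma> a (C x)" if a: "a \<in> N" and x: "x \<in> carrier K" for a x
  proof (rule R1.K.vec_eqI)
    note a' = R1.N_adj[OF a]
    show "C (\<sigma> a x) \<in> carrier K" "\<sigma> a (C x) \<in> carrier K" using a x by (simp_all add: R1.rep_closed)
    fix y assume y: "y \<in> carrier K"
    have "cinner K y (C (\<sigma> a x)) = cinner L (A y) (\<rho> a (A x))"
      using a x y by (simp add: C_inner R1.rep_closed comm)
    also have "\<dots> = cinner L (A (\<sigma> (adj H H a) y)) (A x)"
      using a a' x y by (simp add: R2.rep_adj Ac comm)
    also have "\<dots> = cinner K (\<sigma> (adj H H a) y) (C x)"
      using a' x y by (simp add: C_inner R1.rep_closed)
    also have "\<dots> = cinner K y (\<sigma> a (C x))" using a x y by (simp add: R1.rep_adj)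
    finally show "cinner K y (C (\<sigma> a x)) = cinner K y (\<sigma> a (C x))" .
  qed
  have C_iter_comm: "(C ^^ k) (\<sigma> a x) = \<sigma> a ((C ^^ k) x)" if "a \<in> N" "x \<in> carrier K" for a x k
    using that by (induction k) (simp_all add: C_comm)
  define d where "d = opnorm K K C"
  have d: "0 \<le> d" unfolding d_def by (rule opnorm_nonneg[OF hK C_bop])
  have C_norm: "hnorm K ((C ^^ k) x) \<le> d ^ k * hnorm K x" if x: "x \<in> carrier K" for k x
  proof (induction k)
    case (Suc k)
    have "hnorm K (C ((C ^^ k) x)) \<le> d * hnorm K ((C ^^ k) x)"
      unfolding d_def by (rule opnorm_bound[OF hK C_bop]) (use x in simp)
    also have "\<dots> \<le> d * (d ^ k * hnorm K x)" by (rule mult_left_mono[OF Suc d])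
    finally show ?case by simp
  qed simp
  let ?u = "\<lambda>k (\<xi>, x). R1.te \<xi> ((C ^^ k) x)" and ?z = "\<lambda>(\<xi>, x). R2.te \<xi> (A x)"
  obtain B where B: "B \<in> bop R1.ET R2.ET"
    "\<And>\<xi> x. \<xi> \<in> carrier E \<Longrightarrow> x \<in> carrier K \<Longrightarrow> B (R1.te \<xi> x) = ?z (\<xi>, x)"
  proof (rule R1.te_extend[OF R2.ET_hilbert, where v = ?z and C = "sqrt d"])
    show "?z (\<xi>, x) \<in> carrier R2.ET" if "\<xi> \<in> carrier E" "x \<in> carrier K" for \<xi> x
      using that by (simp add: R2.te_closed Ac)
    fix f assume f: "supp f \<subseteq> carrier E \<times> carrier K"
    have "hnorm R2.ET (lincomb R2.ET ?z f) \<le> sqrt d * hnorm R1.ET (lincomb R1.ET (?u 0) f)"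
    proof (rule lincomb_orbit_bound[OF R1.ET_hilbert R2.ET_hilbert, where I = "carrier E \<times> carrier K"
          and B = "\<lambda>(\<xi>, x). sqrt (opnorm K K (\<sigma> (ip E \<xi> \<xi>))) * hnorm K x"])
      fix p q assume p: "p \<in> carrier E \<times> carrier K" and q: "q \<in> carrier E \<times> carrier K"
      obtain \<xi> x \<eta> y where pq: "p = (\<xi>, x)" "q = (\<eta>, y)" "\<xi> \<in> carrier E" "x \<in> carrier K"
          "\<eta> \<in> carrier E" "y \<in> carrier K" using p q by auto
      have ipN: "ip E \<xi> \<eta> \<in> N" by (rule R1.ip_closed[OF pq(3,5)])
      show "?u k p \<in> carrier R1.ET" for k using pq by (simp add: R1.te_closed)
      show "?z p \<in> carrier R2.ET" using pq by (simp add: R2.te_closed Ac)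
      show "cinner R1.ET (?u (Suc j) p) (?u k q) = cinner R1.ET (?u j p) (?u (Suc k) q)" for j k
        using pq ipN C.symmetric[of "(C ^^ j) x" "\<sigma> (ip E \<xi> \<eta>) ((C ^^ k) y)"]
        by (simp add: R1.cinner_te R1.rep_closed C_comm)
      show "cinner R2.ET (?z p) (?z q) = cinner R1.ET (?u 0 p) (?u 1 q)"
        using pq ipN by (simp add: R1.cinner_te R2.cinner_te Ac comm[symmetric]) 
          (simp add: C_inner[symmetric] R1.rep_closed C_comm)
      have "hnorm R1.ET (R1.te \<xi> ((C ^^ k) x)) \<le> sqrt (opnorm K K (\<sigma> (ip E \<xi> \<xi>))) * (d ^ k * hnorm K x)" for k
      proof -
        have "0 \<le> sqrt (opnorm K K (\<sigma> (ip E \<xi> \<xi>)))"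
          using opnorm_nonneg[OF hK R1.rep_bop[OF R1.ip_closed[OF pq(3,3)]]] by simp
        from mult_left_mono[OF C_norm[OF pq(4), of k] this] R1.te_norm[OF pq(3) C.iter_closed[OF pq(4)], of k]
        show ?thesis by linarith
      qed
      then show "hnorm R1.ET (?u k p) \<le> (\<lambda>(\<xi>, x). sqrt (opnorm K K (\<sigma> (ip E \<xi> \<xi>))) * hnorm K x) p * d ^ k" for k
        by (simp add: pq mult_ac)
    qed (use d f in auto)
    moreover have "?u 0 = (\<lambda>(\<xi>, x). R1.te \<xi> x)" by auto
    ultimately show "hnorm R2.ET (lincomb R2.ET ?z f)
        \<le> sqrt d * hnorm R1.ET (lincomb R1.ET (\<lambda>(\<xi>, x). R1.te \<xi> x) f)" by (simp only:)
  qed blast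
  have eq: "id_hten E K \<sigma> L \<rho> A = B"
    unfolding id_hten_def by (rule R1.te_op_ext[OF R2.ET_hilbert B(1)]) (use B(2) in auto)
  show "id_hten E K \<sigma> L \<rho> A \<in> bop R1.ET R2.ET" unfolding eq by (rule B(1))
  show "\<lbrakk>\<xi> \<in> carrier E; x \<in> carrier K\<rbrakk> \<Longrightarrow> id_hten E K \<sigma> L \<rho> A (R1.te \<xi> x) = R2.te \<xi> (A x)"
    unfolding eq using B(2) by simp
qed

end

subsection \<open>The identity representation and self-duality\<close>

context hilbert_module begin

lemma id_module_rep: "module_rep H N E H id"
proof (intro module_rep.intro module_rep_axioms.intro)
  show "hilbert_module H N E" by (rule hilbert_module_axioms)
  show "hilbert_space H" by (rule H.hilbert_space_axioms)
  show "id a \<in> bop H H" if "a \<in> N" for a using N_bop[OF that] by simp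
  show "cinner H x (id a y) = cinner H (id (adj H H a) x) y"
    if "a \<in> N" "x \<in> carrier H" "y \<in> carrier H" for a x y
    using cinner_adj_left[OF H.hilbert_space_axioms H.hilbert_space_axioms N_bop[OF that(1)] that(3,2)] by simp
  show "psd_kernel (carrier E \<times> carrier H) (hten_ker E H id)" by (rule hten_kernel_psd)
qed

sublocale I: module_rep H N E H id by (rule id_module_rep)

lemma cinner_te_id:
  "\<lbrakk>\<xi> \<in> carrier E; x \<in> carrier H; \<eta> \<in> carrier E; y \<in> carrier H\<rbrakk>
    \<Longrightarrow> cinner I.ET (I.te \<xi> x) (I.te \<eta> y) = cinner H x (ip E \<xi> \<eta> y)"
  by (simp add: I.cinner_te)

lemma te_add_left: "\<lbrakk>\<xi> \<in> carrier E; \<eta> \<in> carrier E; x \<in> carrier H\<rbrakk>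
    \<Longrightarrow> I.te (\<xi> \<oplus> \<eta>) x = I.te \<xi> x \<oplus>\<^bsub>I.ET\<^esub> I.te \<eta> x"
  by (rule I.te_eqI) (simp_all add: I.te_closed cinner_te_id ip_add_apply ip_apply_closed)

lemma te_scale_left: "\<lbrakk>\<xi> \<in> carrier E; x \<in> carrier H\<rbrakk>
    \<Longrightarrow> I.te (c \<odot> \<xi>) x = c \<odot>\<^bsub>I.ET\<^esub> I.te \<xi> x"
  by (rule I.te_eqI) (simp_all add: I.te_closed cinner_te_id ip_smult_apply ip_apply_closed E_smult_closed)

lemma te_ract: "\<lbrakk>\<xi> \<in> carrier E; a \<in> N; x \<in> carrier H\<rbrakk> \<Longrightarrow> I.te (ract E \<xi> a) x = I.te \<xi> (a x)"
  by (rule I.te_eqI) (simp_all add: I.te_closed cinner_te_id ip_ract_apply ract_closed N_closed)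

lemma module_eqI:
  assumes "\<xi> \<in> carrier E" "\<eta> \<in> carrier E" "\<And>\<zeta>. \<zeta> \<in> carrier E \<Longrightarrow> ip E \<zeta> \<xi> = ip E \<zeta> \<eta>"
  shows "\<xi> = \<eta>"
proof -
  let ?m = "(-1) \<odot> \<eta>"
  have m: "?m \<in> carrier E" by (rule E_smult_closed[OF assms(2)])
  have d: "\<xi> \<oplus> ?m \<in> carrier E" using assms(1) m by simp
  have "ip E (\<xi> \<oplus> ?m) (\<xi> \<oplus> ?m) h = op_zero H H h" if h: "h \<in> carrier H" for h
  proof -
    have "ip E (\<xi> \<oplus> ?m) (\<xi> \<oplus> ?m) h = ip E (\<xi> \<oplus> ?m) \<eta> h \<oplus>\<^bsub>H\<^esub> (-1) \<odot>\<^bsub>H\<^esub> ip E (\<xi> \<oplus> ?m) \<eta> h"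
      using assms m d h by (simp add: ip_add_apply ip_smult_apply)
    also have "\<dots> = \<zero>\<^bsub>H\<^esub>"
      by (rule H.vec_eqI) (use ip_apply_closed[OF d assms(2) h] in simp_all)
    finally show ?thesis using h by (simp add: op_zero_def)
  qed
  then have "ip E (\<xi> \<oplus> ?m) (\<xi> \<oplus> ?m) = op_zero H H"
    by (intro bop_eqI[OF ip_bop[OF d d] op_zero_bop]) (simp_all add: H.hilbert_space_axioms)
  then have "\<xi> \<oplus> ?m = \<zero>" by (rule ip_definite[OF d])
  then have "\<xi> \<ominus> \<eta> = \<zero>" using module_diff_eq[OF module_axioms assms(1,2)] by simp
  then show ?thesis using M.minus_equality[of \<xi> "\<ominus> \<eta>"] M.minus_minus[of \<eta>] assms(1,2)
    by (simp add: M.minus_eq)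
qed

abbreviation amp where "amp m \<equiv> id_hten E H id H id m"

lemma amp_bop: "m \<in> M' \<Longrightarrow> amp m \<in> bop I.ET I.ET"
  and amp_te: "m \<in> M' \<Longrightarrow> \<xi> \<in> carrier E \<Longrightarrow> x \<in> carrier H \<Longrightarrow> amp m (I.te \<xi> x) = I.te \<xi> (m x)"
proof -
  assume m: "m \<in> M'"
  interpret module_rep_pair H N E H id H id
    by (intro module_rep_pair.intro id_module_rep)
  have c: "m (id a x) = id a (m x)" if "a \<in> N" "x \<in> carrier H" for a x
    using M'_comm[OF m that] by simp
  show "amp m \<in> bop I.ET I.ET" by (rule id_hten_bop[OF M'_bop[OF m] c])
  show "\<xi> \<in> carrier E \<Longrightarrow> x \<in> carrier H \<Longrightarrow> amp m (I.te \<xi> x) = I.te \<xi> (m x)"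
    by (rule id_hten_te[OF M'_bop[OF m] c])
qed

lemma M'_closed: "m \<in> M' \<Longrightarrow> x \<in> carrier H \<Longrightarrow> m x \<in> carrier H"
  by (rule bop_closed[OF M'_bop])

lemma M'_adj: "m \<in> M' \<Longrightarrow> adj H H m \<in> M'"
proof -
  note hH = H.hilbert_space_axioms
  assume m: "m \<in> M'"
  note mb = M'_bop[OF m]
  have "a (adj H H m h) = adj H H m (a h)" if a: "a \<in> N" and h: "h \<in> carrier H" for a h
  proof (rule H.vec_eqI)
    show "a (adj H H m h) \<in> carrier H" by (rule N_closed[OF a adj_closed[OF hH hH mb h]])
    show "adj H H m (a h) \<in> carrier H" by (rule adj_closed[OF hH hH mb N_closed[OF a h]])
    fix k assume k: "k \<in> carrier H"
    have "cinner H k (a (adj H H m h)) = cinner H (m (adj H H a k)) h"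
      using cinner_adj_left[OF hH hH N_bop[OF a] adj_closed[OF hH hH mb h] k]
        cinner_adj_right[OF hH hH mb N_closed[OF N_adj[OF a] k] h] by simp
    also have "\<dots> = cinner H (m k) (a h)"
      using M'_comm[OF m N_adj[OF a] k] cinner_adj_left[OF hH hH N_bop[OF a] h M'_closed[OF m k]] by simp
    also have "\<dots> = cinner H k (adj H H m (a h))"
      using cinner_adj_right[OF hH hH mb k N_closed[OF a h]] by simp
    finally show "cinner H k (a (adj H H m h)) = cinner H k (adj H H m (a h))" .
  qed
  then have "compose (carrier H) a (adj H H m) = compose (carrier H) (adj H H m) a" if "a \<in> N" for a
    using that by (intro ext) (simp add: compose_def)
  then show ?thesis using adj_bop[OF hH hH mb] by (simp add: commutant_def)
qed

lemma amp_adj: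
  assumes m: "m \<in> M'" and u: "u \<in> carrier I.ET" and v: "v \<in> carrier I.ET"
  shows "cinner I.ET u (amp m v) = cinner I.ET (amp (adj H H m) u) v"
proof (rule formal_adjoint_total[OF I.ET_hilbert I.ET_hilbert I.te_total I.te_total
      amp_bop[OF m] amp_bop[OF M'_adj[OF m]] _ u v])
  note hH = H.hilbert_space_axioms
  fix p q assume "p \<in> carrier E \<times> carrier H" "q \<in> carrier E \<times> carrier H"
  then obtain \<xi> x \<eta> y where pq: "p = (\<xi>, x)" "q = (\<eta>, y)" and \<xi>: "\<xi> \<in> carrier E" and x: "x \<in> carrier H"
    and \<eta>: "\<eta> \<in> carrier E" and y: "y \<in> carrier H" by auto
  have "cinner I.ET (I.te \<eta> y) (amp m (I.te \<xi> x)) = cinner H y (m (ip E \<eta> \<xi> x))"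
    unfolding amp_te[OF m \<xi> x] using M'_comm[OF m ip_closed[OF \<eta> \<xi>] x]
    by (simp add: cinner_te_id \<eta> \<xi> x y M'_closed[OF m])
  also have "\<dots> = cinner H (adj H H m y) (ip E \<eta> \<xi> x)"
    by (rule cinner_adj_left[OF hH hH M'_bop[OF m] ip_apply_closed[OF \<eta> \<xi> x] y, symmetric])
  also have "\<dots> = cinner I.ET (amp (adj H H m) (I.te \<eta> y)) (I.te \<xi> x)"
    unfolding amp_te[OF M'_adj[OF m] \<eta> y]
    by (rule cinner_te_id[symmetric]) (use \<eta> \<xi> x y in \<open>simp_all add: M'_closed[OF M'_adj[OF m]]\<close>)
  finally show "cinner I.ET (case q of (\<xi>, x) \<Rightarrow> I.te \<xi> x) (amp m (case p of (\<xi>, x) \<Rightarrow> I.te \<xi> x))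
    = cinner I.ET (amp (adj H H m) (case q of (\<xi>, x) \<Rightarrow> I.te \<xi> x)) (case p of (\<xi>, x) \<Rightarrow> I.te \<xi> x)"
    by (simp add: pq)
qed

end

text \<open>
  A self-dual module is recovered from the tensor product: an operator intertwining the commutant
  defines a bounded module map \<open>\<eta> \<mapsto> R\<^sup>* L\<^sub>\<eta>\<close>, and self-duality represents it.
\<close>

lemma (in w_correspondence) intertwiner_represented:
  assumes R: "R \<in> bop H I.ET"
    and comm: "\<And>m h. m \<in> M' \<Longrightarrow> h \<in> carrier H \<Longrightarrow> R (m h) = amp m (R h)"
  obtains \<xi> where "\<xi> \<in> carrier E" "\<And>h. h \<in> carrier H \<Longrightarrow> R h = I.te \<xi> h"
proof -
  note hH = H.hilbert_space_axioms and hT = I.ET_hilbert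
  note Ra = adj_bop[OF hH hT R] and Rac = adj_closed[OF hH hT R] and Rr = cinner_adj_right[OF hH hT R]
  define f where "f \<eta> = (\<lambda>h\<in>carrier H. adj H I.ET R (I.te \<eta> h))" for \<eta>
  have f_compose: "f \<eta> = compose (carrier H) (adj H I.ET R) (I.L_op \<eta>)" for \<eta>
    by (rule ext) (simp add: f_def compose_def I.L_op_def)
  have f_bop: "f \<eta> \<in> bop H H" if "\<eta> \<in> carrier E" for \<eta>
    unfolding f_compose by (rule bop_compose[OF hH hT I.L_bop[OF that] Ra])
  have f_inner: "cinner H k (f \<eta> h) = cinner I.ET (R k) (I.te \<eta> h)"
    if "\<eta> \<in> carrier E" "h \<in> carrier H" "k \<in> carrier H" for \<eta> h k
    using that by (simp add: f_def Rr I.te_closed)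
  have f_closed: "f \<eta> h \<in> carrier H" if "\<eta> \<in> carrier E" "h \<in> carrier H" for \<eta> h
    by (rule bop_closed[OF f_bop[OF that(1)] that(2)])
  note Rc = bop_closed[OF R]
  have "bounded_module_map H N E (carrier E) f"
    unfolding bounded_module_map_def
  proof (intro conjI ballI allI)
    show "f \<in> carrier E \<rightarrow> N"
    proof
      fix \<eta> assume \<eta>: "\<eta> \<in> carrier E"
      show "f \<eta> \<in> N"
      proof (rule N_I[OF f_bop[OF \<eta>]])
        fix m h assume m: "m \<in> M'" and h: "h \<in> carrier H"
        show "f \<eta> (m h) = m (f \<eta> h)"
        proof (rule H.vec_eqI)
          show "f \<eta> (m h) \<in> carrier H" "m (f \<eta> h) \<in> carrier H"
            using m h \<eta> by (simp_all add: f_closed M'_closed)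
          fix k assume k: "k \<in> carrier H"
          have "cinner H k (f \<eta> (m h)) = cinner I.ET (R k) (amp m (I.te \<eta> h))"
            using m h \<eta> k by (simp add: f_inner M'_closed amp_te)
          also have "\<dots> = cinner I.ET (R (adj H H m k)) (I.te \<eta> h)"
            using amp_adj[OF m Rc[OF k] I.te_closed[OF \<eta> h]] comm[OF M'_adj[OF m] k] by simp
          also have "\<dots> = cinner H (adj H H m k) (f \<eta> h)"
            using \<eta> h M'_closed[OF M'_adj[OF m] k] by (simp add: f_inner)
          also have "\<dots> = cinner H k (m (f \<eta> h))"
            by (rule cinner_adj_left[OF hH hH M'_bop[OF m] f_closed[OF \<eta> h] k])
          finally show "cinner H k (f \<eta> (m h)) = cinner H k (m (f \<eta> h))" .
        qed
      qed
    qed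
    fix \<eta> assume \<eta>: "\<eta> \<in> carrier E"
    show "f (c \<odot> \<eta>) = op_smult H H c (f \<eta>)" for c
      using \<eta> by (intro bop_eqI[OF f_bop op_smult_bop[OF hH hH f_bop]])
        (simp_all add: E_smult_closed op_smult_def, simp add: f_def te_scale_left bop_scale[OF Ra] I.te_closed)
    show "f (ract E \<eta> a) = compose (carrier H) (f \<eta>) a" if "a \<in> N" for a
      using \<eta> that by (intro bop_eqI[OF f_bop bop_compose[OF hH hH N_bop f_bop]])
        (simp_all add: ract_closed compose_eq, simp add: f_def te_ract N_closed)
    fix \<zeta> assume \<zeta>: "\<zeta> \<in> carrier E"
    show "f (\<eta> \<oplus> \<zeta>) = op_add H H (f \<eta>) (f \<zeta>)"
      using \<eta> \<zeta> by (intro bop_eqI[OF f_bop op_add_bop[OF hH hH f_bop f_bop]])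
        (simp_all add: op_add_def, simp add: f_def te_add_left bop_add[OF Ra] I.te_closed)
  next
    define C where "C = opnorm I.ET H (adj H I.ET R)"
    have C: "0 \<le> C" unfolding C_def by (rule opnorm_nonneg[OF hT Ra])
    have "opnorm H H (f \<eta>) \<le> C * enorm H E \<eta>" if \<eta>: "\<eta> \<in> carrier E" for \<eta>
    proof (rule opnorm_le)
      have nn: "0 \<le> enorm H E \<eta>"
        unfolding enorm_def using opnorm_nonneg[OF hH ip_bop[OF \<eta> \<eta>]] by simp
      show "0 \<le> C * enorm H E \<eta>" using C nn by simp
      fix h assume h: "h \<in> carrier H"
      have "hnorm H (f \<eta> h) \<le> C * hnorm I.ET (I.te \<eta> h)"
        unfolding C_def f_def restrict_apply'[OF h] by (rule opnorm_bound[OF hT Ra I.te_closed[OF \<eta> h]])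
      also have "\<dots> \<le> C * (enorm H E \<eta> * hnorm H h)"
        using I.te_norm[OF \<eta> h] C unfolding enorm_def id_apply by (rule mult_left_mono)
      finally show "hnorm H (f \<eta> h) \<le> C * enorm H E \<eta> * hnorm H h" by (simp add: mult.assoc)
    qed
    then show "\<exists>C. \<forall>\<eta>\<in>carrier E. opnorm H H (f \<eta>) \<le> C * enorm H E \<eta>" by blast
  qed
  then have "\<exists>!\<xi>. \<xi> \<in> carrier E \<and> (\<forall>x\<in>carrier E. f x = ip E \<xi> x)"
    by (rule self_dual[unfolded represents_dual_def, rule_format])
  then obtain \<xi> where "\<xi> \<in> carrier E \<and> (\<forall>x\<in>carrier E. f x = ip E \<xi> x)" by (rule ex1E)
  then have \<xi>: "\<xi> \<in> carrier E" "\<And>\<eta>. \<eta> \<in> carrier E \<Longrightarrow> f \<eta> = ip E \<xi> \<eta>" by simp_all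
  have "R k = I.te \<xi> k" if k: "k \<in> carrier H" for k
  proof (rule I.te_eqI[OF Rc[OF k] I.te_closed[OF \<xi>(1) k]])
    fix \<eta> x assume \<eta>: "\<eta> \<in> carrier E" and x: "x \<in> carrier H"
    have "cinner I.ET (R k) (I.te \<eta> x) = cinner I.ET (I.te \<xi> k) (I.te \<eta> x)"
      using f_inner[OF \<eta> x k] \<xi> \<eta> x k by (simp add: cinner_te_id)
    then show "cinner I.ET (I.te \<eta> x) (R k) = cinner I.ET (I.te \<eta> x) (I.te \<xi> k)"
      using I.ET.cinner_commute[OF Rc[OF k] I.te_closed[OF \<eta> x]]
        I.ET.cinner_commute[OF I.te_closed[OF \<xi>(1) k] I.te_closed[OF \<eta> x]] by simp
  qed
  with \<xi>(1) show thesis by (rule that)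
qed

subsection \<open>The left action on the tensor product\<close>

context w_correspondence begin

lemma op_one_N: "op_one H \<in> N"
  by (rule N_I[OF op_one_bop[OF H.hilbert_space_axioms]]) (simp add: op_one_def M'_closed)

lemma compose_N:
  assumes a: "a \<in> N" and b: "b \<in> N"
  shows "compose (carrier H) a b \<in> N"
proof (rule N_I)
  show "compose (carrier H) a b \<in> bop H H"
    by (rule bop_compose[OF H.hilbert_space_axioms H.hilbert_space_axioms N_bop[OF b] N_bop[OF a]])
  fix m h assume m: "m \<in> M'" and h: "h \<in> carrier H"
  show "compose (carrier H) a b (m h) = m (compose (carrier H) a b h)"
    using m h a b M'_comm[OF m b h] M'_comm[OF m a N_closed[OF b h]] by (simp add: compose_eq M'_closed)
qed

lemma scalar_N: "op_smult H H c (op_one H) \<in> N"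
proof (rule N_I[OF op_smult_bop[OF H.hilbert_space_axioms H.hilbert_space_axioms op_one_bop[OF H.hilbert_space_axioms]]])
  fix m h assume "m \<in> M'" "h \<in> carrier H"
  then show "op_smult H H c (op_one H) (m h) = m (op_smult H H c (op_one H) h)"
    by (simp add: op_smult_def op_one_def M'_closed bop_scale[OF M'_bop])
qed

text \<open>A normal map is monotone, because the larger of two comparable elements is their supremum.\<close>

lemma lact_mono:
  assumes a: "a \<in> N" "adj H H a = a" and b: "b \<in> N" "adj H H b = b" and le: "op_le H a b"
    and \<xi>: "\<xi> \<in> carrier E"
  shows "op_le H (ip E \<xi> (lact E a \<xi>)) (ip E \<xi> (lact E b \<xi>))"
proof -
  let ?P = "sa_part H N" and ?Q = "sa_adjointable H E" and ?\<phi> = "\<lambda>a. \<lambda>\<xi>\<in>carrier E. lact E a \<xi>"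
  have lub: "is_lub ?P b {a, b}"
    using a b le by (auto simp: least_def Upper_def sa_part_def op_le_def)
  have \<phi>c: "?\<phi> c \<in> carrier ?Q" if "c \<in> N" "adj H H c = c" for c
    using that lact_adj[OF that(1)] by (auto simp: sa_adjointable_def lact_closed)
  have "is_lub ?Q (?\<phi> b) (?\<phi> ` {a, b})"
  proof (rule lact_normal[unfolded normal_map_def, rule_format])
    show "{a, b} \<subseteq> carrier ?P" using a b by (simp add: sa_part_def)
    fix x y assume "x \<in> {a, b}" "y \<in> {a, b}"
    then show "\<exists>z\<in>{a, b}. x \<sqsubseteq>\<^bsub>?P\<^esub> z \<and> y \<sqsubseteq>\<^bsub>?P\<^esub> z"
      using le by (intro bexI[of _ b]) (auto simp: sa_part_def op_le_def)
  qed (use lub in simp_all)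
  then have "?\<phi> a \<sqsubseteq>\<^bsub>?Q\<^esub> ?\<phi> b"
    using \<phi>c[OF a] by (auto simp: least_def Upper_def)
  then show ?thesis using \<xi> by (simp add: sa_adjointable_def)
qed

text \<open>
  From \<open>d\<^sup>* d \<le> \<parallel>d\<parallel>\<^sup>2\<close> and monotonicity. As the left action need not be unital, the unit acts as a
  projection, which does not increase the norm.
\<close>

lemma lact_te_bound:
  assumes d: "d \<in> N" and \<xi>: "\<xi> \<in> carrier E" and h: "h \<in> carrier H"
  shows "hnorm I.ET (I.te (lact E d \<xi>) h) \<le> opnorm H H d * hnorm I.ET (I.te \<xi> h)"
proof -
  note hH = H.hilbert_space_axioms
  define c where "c = opnorm H H d"
  have c: "0 \<le> c" unfolding c_def by (rule opnorm_nonneg[OF hH N_bop[OF d]])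
  define D where "D = compose (carrier H) (adj H H d) d"
  have D: "D \<in> N" unfolding D_def by (rule compose_N[OF N_adj[OF d] d])
  have D_adj: "adj H H D = D"
    unfolding D_def adj_compose[OF hH hH hH N_bop[OF d] adj_bop[OF hH hH N_bop[OF d]]]
      adj_adj[OF hH hH N_bop[OF d]] ..
  define b where "b = op_smult H H (of_real (c\<^sup>2)) (op_one H)"
  have b: "b \<in> N" unfolding b_def by (rule scalar_N)
  have b_apply: "b x = of_real (c\<^sup>2) \<odot>\<^bsub>H\<^esub> x" if "x \<in> carrier H" for x
    using that by (simp add: b_def op_smult_def op_one_def)
  have b_adj: "adj H H b = b"
    by (rule adj_unique[OF hH hH N_bop[OF b] N_bop[OF b]]) (simp add: b_apply)
  have "op_le H D b"
    unfolding op_le_def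
  proof
    fix x assume x: "x \<in> carrier H"
    have "Re (cinner H x (D x)) = (hnorm H (d x))\<^sup>2"
      using x cinner_adj_right[OF hH hH N_bop[OF d] x N_closed[OF d x]] N_closed[OF d x]
      by (simp add: D_def compose_eq H.hnorm_sq)
    also have "\<dots> \<le> (c * hnorm H x)\<^sup>2"
      unfolding c_def by (rule power_mono[OF opnorm_bound[OF hH N_bop[OF d] x] H.hnorm_nonneg[OF N_closed[OF d x]]])
    also have "\<dots> = Re (cinner H x (b x))" using x by (simp add: b_apply H.hnorm_sq power_mult_distrib)
    finally show "Re (cinner H x (D x)) \<le> Re (cinner H x (b x))" .
  qed
  note le = lact_mono[OF D D_adj b b_adj this \<xi>]
  note dc = lact_closed[OF d \<xi>] and one = lact_closed[OF op_one_N \<xi>]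
  have "(hnorm I.ET (I.te (lact E d \<xi>) h))\<^sup>2 = Re (cinner H h (ip E \<xi> (lact E D \<xi>) h))"
    using I.te_norm_sq[OF dc h] lact_adj[OF d \<xi> dc] lact_mult[OF N_adj[OF d] d \<xi>] by (simp add: D_def)
  also have "\<dots> \<le> Re (cinner H h (ip E \<xi> (lact E b \<xi>) h))"
    using le h by (simp add: op_le_def)
  also have "\<dots> = c\<^sup>2 * Re (cinner H h (ip E \<xi> (lact E (op_one H) \<xi>) h))"
    using \<xi> h one lact_smult[OF op_one_N \<xi>] by (simp add: b_def ip_smult_apply ip_apply_closed)
  also have "\<dots> \<le> c\<^sup>2 * (hnorm I.ET (I.te \<xi> h))\<^sup>2"
  proof (rule mult_left_mono)
    let ?p = "I.te (lact E (op_one H) \<xi>) h" and ?t = "I.te \<xi> h"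
    have pc: "?p \<in> carrier I.ET" "?t \<in> carrier I.ET" using one \<xi> h by (simp_all add: I.te_closed)
    have adj1: "adj H H (op_one H) = op_one H"
      by (rule adj_unique[OF hH hH op_one_bop[OF hH] op_one_bop[OF hH]]) (simp add: op_one_def)
    have idem: "compose (carrier H) (op_one H) (op_one H) = op_one H"
      by (rule ext) (simp add: compose_def op_one_def)
    have pp: "cinner I.ET ?p ?p = cinner I.ET ?t ?p"
      using lact_adj[OF op_one_N \<xi> one] lact_mult[OF op_one_N op_one_N \<xi>] \<xi> one h
      by (simp add: cinner_te_id adj1 idem)
    have eq: "Re (cinner H h (ip E \<xi> (lact E (op_one H) \<xi>) h)) = (hnorm I.ET ?p)\<^sup>2"
      using I.ET.hnorm_sq[OF pc(1)] pp cinner_te_id[OF \<xi> h one h] by simp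
    have "hnorm I.ET ?p * hnorm I.ET ?p \<le> hnorm I.ET ?p * hnorm I.ET ?t"
      using I.ET.hnorm_sq[OF pc(1)] pp I.ET.cauchy_schwarz[OF pc(2,1)] complex_Re_le_cmod[of "cinner I.ET ?t ?p"]
      by (simp add: power2_eq_square mult.commute)
    then have "hnorm I.ET ?p \<le> hnorm I.ET ?t"
      by (rule le_of_square_le) (use pc in simp_all)
    then show "Re (cinner H h (ip E \<xi> (lact E (op_one H) \<xi>) h)) \<le> (hnorm I.ET ?t)\<^sup>2"
      unfolding eq using I.ET.hnorm_nonneg[OF pc(1)] by (rule power_mono)
  qed simp
  finally have "(hnorm I.ET (I.te (lact E d \<xi>) h))\<^sup>2 \<le> (c * hnorm I.ET (I.te \<xi> h))\<^sup>2"
    by (simp only: power_mult_distrib)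
  then show ?thesis unfolding c_def[symmetric]
    by (rule power2_le_imp_le) (use c I.ET.hnorm_nonneg[OF I.te_closed[OF \<xi> h]] in simp)
qed

abbreviation lrep where "lrep d \<equiv> hten_rep E H d"

text \<open>
  The bound for single elementary tensors extends to all vectors by the orbit of \<open>d\<^sup>* d\<close>, acting on the
  first factor.
\<close>

lemma lrep_bop: "d \<in> N \<Longrightarrow> lrep d \<in> bop I.ET I.ET"
  and lrep_te: "\<lbrakk>d \<in> N; \<xi> \<in> carrier E; x \<in> carrier H\<rbrakk> \<Longrightarrow> lrep d (I.te \<xi> x) = I.te (lact E d \<xi>) x"
proof -
  assume d: "d \<in> N"
  note hH = H.hilbert_space_axioms
  define D where "D = compose (carrier H) (adj H H d) d"
  have D: "D \<in> N" unfolding D_def by (rule compose_N[OF N_adj[OF d] d])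
  have D_adj: "adj H H D = D"
    unfolding D_def adj_compose[OF hH hH hH N_bop[OF d] adj_bop[OF hH hH N_bop[OF d]]]
      adj_adj[OF hH hH N_bop[OF d]] ..
  let ?l = "\<lambda>k. lact E D ^^ k"
  have lc: "?l k \<xi> \<in> carrier E" if "\<xi> \<in> carrier E" for k \<xi>
    using that by (induction k) (simp_all add: lact_closed[OF D])
  define c where "c = opnorm H H D"
  have c: "0 \<le> c" unfolding c_def by (rule opnorm_nonneg[OF hH N_bop[OF D]])
  have bound: "hnorm I.ET (I.te (?l k \<xi>) x) \<le> hnorm I.ET (I.te \<xi> x) * c ^ k"
    if \<xi>: "\<xi> \<in> carrier E" and x: "x \<in> carrier H" for \<xi> x k
  proof (induction k)
    case (Suc k)
    have "hnorm I.ET (I.te (?l (Suc k) \<xi>) x) \<le> c * hnorm I.ET (I.te (?l k \<xi>) x)"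
      unfolding c_def using lact_te_bound[OF D lc[OF \<xi>] x] by simp
    also have "\<dots> \<le> c * (hnorm I.ET (I.te \<xi> x) * c ^ k)" by (rule mult_left_mono[OF Suc c])
    finally show ?case by (simp only: power_Suc mult_ac)
  qed simp
  let ?u = "\<lambda>k (\<xi>, x). I.te (?l k \<xi>) x" and ?z = "\<lambda>(\<xi>, x). I.te (lact E d \<xi>) x"
  obtain B where B: "B \<in> bop I.ET I.ET"
    "\<And>\<xi> x. \<xi> \<in> carrier E \<Longrightarrow> x \<in> carrier H \<Longrightarrow> B (I.te \<xi> x) = ?z (\<xi>, x)"
  proof (rule I.te_extend[OF I.ET_hilbert, where v = ?z and C = "sqrt c"])
    show "?z (\<xi>, x) \<in> carrier I.ET" if "\<xi> \<in> carrier E" "x \<in> carrier H" for \<xi> x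
      using that by (simp add: I.te_closed lact_closed[OF d])
    fix f assume f: "supp f \<subseteq> carrier E \<times> carrier H"
    have "hnorm I.ET (lincomb I.ET ?z f) \<le> sqrt c * hnorm I.ET (lincomb I.ET (?u 0) f)"
    proof (rule lincomb_orbit_bound[OF I.ET_hilbert I.ET_hilbert, where I = "carrier E \<times> carrier H"
          and B = "\<lambda>(\<xi>, x). hnorm I.ET (I.te \<xi> x)"])
      fix p q assume p: "p \<in> carrier E \<times> carrier H" and q: "q \<in> carrier E \<times> carrier H"
      obtain \<xi> x \<eta> y where pq: "p = (\<xi>, x)" "q = (\<eta>, y)" "\<xi> \<in> carrier E" "x \<in> carrier H"
          "\<eta> \<in> carrier E" "y \<in> carrier H" using p q by auto
      show "?u k p \<in> carrier I.ET" for k using pq by (simp add: I.te_closed lc)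
      show "?z p \<in> carrier I.ET" using pq by (simp add: I.te_closed lact_closed[OF d])
      show "cinner I.ET (?u (Suc j) p) (?u k q) = cinner I.ET (?u j p) (?u (Suc k) q)" for j k
        using pq lact_adj[OF D lc[OF pq(3)] lc[OF pq(5)], of j k]
        by (simp add: cinner_te_id lc lact_closed[OF D] D_adj)
      show "cinner I.ET (?z p) (?z q) = cinner I.ET (?u 0 p) (?u 1 q)"
        using pq lact_adj[OF d pq(3) lact_closed[OF d pq(5)]] lact_mult[OF N_adj[OF d] d pq(5)]
        by (simp add: cinner_te_id lact_closed[OF d] lact_closed[OF D]) (simp add: D_def)
      show "hnorm I.ET (?u k p) \<le> (\<lambda>(\<xi>, x). hnorm I.ET (I.te \<xi> x)) p * c ^ k" for k
        using bound pq by simp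
    qed (use c f in auto)
    moreover have "?u 0 = (\<lambda>(\<xi>, x). I.te \<xi> x)" by auto
    ultimately show "hnorm I.ET (lincomb I.ET ?z f)
        \<le> sqrt c * hnorm I.ET (lincomb I.ET (\<lambda>(\<xi>, x). I.te \<xi> x) f)" by (simp only:)
  qed blast
  have eq: "lrep d = B"
    unfolding hten_rep_def map_hten_def by (rule I.te_op_ext[OF I.ET_hilbert B(1)]) (use B(2) in auto)
  show "lrep d \<in> bop I.ET I.ET" unfolding eq by (rule B(1))
  show "\<lbrakk>\<xi> \<in> carrier E; x \<in> carrier H\<rbrakk> \<Longrightarrow> lrep d (I.te \<xi> x) = I.te (lact E d \<xi>) x"
    unfolding eq using B(2) by simp
qed

lemma lrep_adj:
  assumes d: "d \<in> N" and u: "u \<in> carrier I.ET" and v: "v \<in> carrier I.ET"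
  shows "cinner I.ET u (lrep d v) = cinner I.ET (lrep (adj H H d) u) v"
proof (rule formal_adjoint_total[OF I.ET_hilbert I.ET_hilbert I.te_total I.te_total
      lrep_bop[OF d] lrep_bop[OF N_adj[OF d]] _ u v])
  fix p q assume "p \<in> carrier E \<times> carrier H" "q \<in> carrier E \<times> carrier H"
  then obtain \<xi> x \<eta> y where pq: "p = (\<xi>, x)" "q = (\<eta>, y)" and \<xi>: "\<xi> \<in> carrier E" and x: "x \<in> carrier H"
    and \<eta>: "\<eta> \<in> carrier E" and y: "y \<in> carrier H" by auto
  have "ip E (lact E (adj H H d) \<eta>) \<xi> = ip E \<eta> (lact E d \<xi>)"
    using lact_adj[OF N_adj[OF d] \<eta> \<xi>] adj_adj[OF H.hilbert_space_axioms H.hilbert_space_axioms N_bop[OF d]] by simp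
  then show "cinner I.ET (case q of (\<xi>, x) \<Rightarrow> I.te \<xi> x) (lrep d (case p of (\<xi>, x) \<Rightarrow> I.te \<xi> x))
    = cinner I.ET (lrep (adj H H d) (case q of (\<xi>, x) \<Rightarrow> I.te \<xi> x)) (case p of (\<xi>, x) \<Rightarrow> I.te \<xi> x)"
    using \<xi> x \<eta> y d by (simp add: pq lrep_te N_adj cinner_te_id lact_closed)
qed

lemma amp_lrep: "m \<in> M' \<Longrightarrow> d \<in> N \<Longrightarrow> u \<in> carrier I.ET \<Longrightarrow> amp m (lrep d u) = lrep d (amp m u)"
proof -
  assume m: "m \<in> M'" and d: "d \<in> N" and u: "u \<in> carrier I.ET"
  note hT = I.ET_hilbert
  have "compose (carrier I.ET) (amp m) (lrep d) = compose (carrier I.ET) (lrep d) (amp m)"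
    by (rule I.bop_eqI_te[OF hT bop_compose[OF hT hT lrep_bop[OF d] amp_bop[OF m]]
          bop_compose[OF hT hT amp_bop[OF m] lrep_bop[OF d]]])
      (simp add: compose_eq I.te_closed amp_te m lrep_te d lact_closed M'_closed)
  from compose_eqD[OF this u] show ?thesis .
qed

lemma te_zero: "h \<in> carrier H \<Longrightarrow> I.te \<zero> h = \<zero>\<^bsub>I.ET\<^esub>"
  using te_scale_left[of \<zero> h 0] smult_l_null[of \<zero>] I.te_closed[of \<zero> h] by simp

lemma te_finsum_left:
  assumes "finite A" "\<And>i. i \<in> A \<Longrightarrow> \<eta> i \<in> carrier E" "h \<in> carrier H"
  shows "I.te (\<Oplus>i\<in>A. \<eta> i) h = (\<Oplus>\<^bsub>I.ET\<^esub>i\<in>A. I.te (\<eta> i) h)"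
  by (rule additive_finsum[OF M.abelian_monoid_axioms I.ET.M.abelian_monoid_axioms assms(1),
        where f = "\<lambda>\<xi>. I.te \<xi> h"])
    (simp_all add: I.te_closed te_zero te_add_left assms(2,3))

end

section \<open>Completely contractive representations\<close>

locale injective_rep = w_correspondence H N E
  for H :: "'h hspace" and N and E :: "('h \<Rightarrow> 'h, 'e, 'z) corr_scheme" (structure) +
  fixes T :: "'e \<Rightarrow> 'h \<Rightarrow> 'h"
  assumes cc: "cc_rep H N E T" and inj: "inj_on T (carrier E)"
begin

lemma T_bop: "\<xi> \<in> carrier E \<Longrightarrow> T \<xi> \<in> bop H H"
  using cc by (auto simp: cc_rep_def)

lemma T_closed: "\<xi> \<in> carrier E \<Longrightarrow> h \<in> carrier H \<Longrightarrow> T \<xi> h \<in> carrier H"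
  by (rule bop_closed[OF T_bop])

lemma T_add: "\<xi> \<in> carrier E \<Longrightarrow> \<eta> \<in> carrier E \<Longrightarrow> h \<in> carrier H \<Longrightarrow> T (\<xi> \<oplus> \<eta>) h = T \<xi> h \<oplus>\<^bsub>H\<^esub> T \<eta> h"
  using cc by (simp add: cc_rep_def op_add_def)

lemma T_scale: "\<xi> \<in> carrier E \<Longrightarrow> h \<in> carrier H \<Longrightarrow> T (c \<odot> \<xi>) h = c \<odot>\<^bsub>H\<^esub> T \<xi> h"
  using cc by (simp add: cc_rep_def op_smult_def)

lemma T_bimodule: "a \<in> N \<Longrightarrow> b \<in> N \<Longrightarrow> \<xi> \<in> carrier E \<Longrightarrow> h \<in> carrier H
    \<Longrightarrow> T (ract E (lact E a \<xi>) b) h = a (T \<xi> (b h))"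
  using cc N_closed[of b h] by (simp add: cc_rep_def compose_eq)

lemma T_zero: "h \<in> carrier H \<Longrightarrow> T \<zero> h = \<zero>\<^bsub>H\<^esub>"
  using T_scale[of \<zero> h 0] smult_l_null[of \<zero>] T_closed[of \<zero> h] by simp

lemma T_lact: "a \<in> N \<Longrightarrow> \<xi> \<in> carrier E \<Longrightarrow> h \<in> carrier H \<Longrightarrow> T (lact E a \<xi>) h = a (T \<xi> h)"
  using T_bimodule[OF _ op_one_N, of a \<xi> h] ract_one[of "lact E a \<xi>"] lact_closed[of a \<xi>]
  by (simp add: op_one_def)

lemma T_eqI:
  assumes "\<xi> \<in> carrier E" "\<eta> \<in> carrier E" "\<And>h. h \<in> carrier H \<Longrightarrow> T \<xi> h = T \<eta> h"
  shows "\<xi> = \<eta>"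
proof -
  have "T \<xi> = T \<eta>" by (rule bop_eqI[OF T_bop T_bop]) (use assms in auto)
  then show ?thesis using inj assms(1,2) by (simp add: inj_on_eq_iff)
qed

text \<open>\<open>\<xi>\<close> and \<open>1 \<xi>\<close> have the same image under the injective map \<open>T\<close>.\<close>

lemma lact_one: "\<xi> \<in> carrier E \<Longrightarrow> lact E (op_one H) \<xi> = \<xi>"
  by (rule T_eqI) (simp_all add: lact_closed[OF op_one_N] T_lact[OF op_one_N], simp add: op_one_def T_closed)

lemma T_ract:
  assumes a: "a \<in> N" and \<xi>: "\<xi> \<in> carrier E" and h: "h \<in> carrier H"
  shows "T (ract E \<xi> a) h = T \<xi> (a h)"
  using T_bimodule[OF op_one_N a \<xi> h] T_closed[OF \<xi> N_closed[OF a h]]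
  unfolding lact_one[OF \<xi>] by (simp add: op_one_def)

lemma T_finsum:
  assumes "finite A" "\<And>i. i \<in> A \<Longrightarrow> \<eta> i \<in> carrier E" "h \<in> carrier H"
  shows "T (\<Oplus>i\<in>A. \<eta> i) h = (\<Oplus>\<^bsub>H\<^esub>i\<in>A. T (\<eta> i) h)"
  by (rule additive_finsum[OF M.abelian_monoid_axioms H.M.abelian_monoid_axioms assms(1),
        where f = "\<lambda>\<xi>. T \<xi> h"])
    (simp_all add: T_closed T_zero T_add assms(2,3))

text \<open>
  The norm of a matrix of operators is an infimum over a non-empty set of bounds, so complete
  contractivity can be used entrywise in the form of an inequality for vectors.
\<close>

lemma op_matrix_bound:
  fixes Xm :: "nat \<Rightarrow> nat \<Rightarrow> 'e" and h :: "nat \<Rightarrow> 'h"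
  assumes Xm: "\<And>i j. i < n \<Longrightarrow> j < n \<Longrightarrow> Xm i j \<in> carrier E" and C: "module_matrix_norm H N E n Xm \<le> C"
    and i: "i < n" and h: "\<And>j. j < n \<Longrightarrow> h j \<in> carrier H"
  shows "hnorm H (\<Oplus>\<^bsub>H\<^esub>j\<in>{..<n}. T (Xm i j) (h j)) \<le> C * sqrt (\<Sum>j<n. (hnorm H (h j))\<^sup>2)"
proof -
  interpret P: hilbert_power H "{..<n}"
    by (intro hilbert_power.intro hilbert_power_axioms.intro H.hilbert_space_axioms) simp
  let ?A = "\<lambda>i j. T (Xm i j)"
  let ?lhs = "\<lambda>h. sqrt (\<Sum>i<n. (hnorm H (\<Oplus>\<^bsub>H\<^esub>j\<in>{..<n}. ?A i j (h j)))\<^sup>2)"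
    and ?nh = "\<lambda>h. sqrt (\<Sum>j<n. (hnorm H (h j))\<^sup>2)"
  let ?S = "{C. 0 \<le> C \<and> (\<forall>h. (\<forall>j<n. h j \<in> carrier H) \<longrightarrow> ?lhs h \<le> C * ?nh h)}"
  have Ab: "?A i j \<in> bop H H" if "i \<in> {..<n}" "j \<in> {..<n}" for i j using that Xm by (intro T_bop) auto
  note mb = P.mat_op_bop[of ?A, OF Ab]
  have norm: "?lhs h = hnorm P.V (mat_op H {..<n} ?A (restrict h {..<n}))"
    "?nh h = hnorm P.V (restrict h {..<n})" if h: "\<forall>j<n. h j \<in> carrier H" for h
  proof -
    have r: "restrict h {..<n} \<in> carrier P.V" using h by auto
    show "?nh h = hnorm P.V (restrict h {..<n})" unfolding P.pow_norm[OF r] by simp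
    have "(\<Oplus>\<^bsub>H\<^esub>j\<in>{..<n}. ?A i j (restrict h {..<n} j)) = (\<Oplus>\<^bsub>H\<^esub>j\<in>{..<n}. ?A i j (h j))" if "i < n" for i
      by (rule H.M.finsum_cong') (use h that Xm in \<open>auto intro!: T_closed\<close>)
    then have row: "mat_op H {..<n} ?A (restrict h {..<n}) i = (\<Oplus>\<^bsub>H\<^esub>j\<in>{..<n}. ?A i j (h j))" if "i < n" for i
      unfolding mat_op_def restrict_apply'[OF r] using that by (simp only: restrict_apply' lessThan_iff)
    have "hnorm P.V (mat_op H {..<n} ?A (restrict h {..<n}))
        = sqrt (\<Sum>i<n. (hnorm H (mat_op H {..<n} ?A (restrict h {..<n}) i))\<^sup>2)"
      by (rule P.pow_norm[OF bop_closed[OF mb r]])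
    also have "\<dots> = ?lhs h" by (intro arg_cong[of _ _ sqrt] sum.cong refl) (simp only: row lessThan_iff)
    finally show "?lhs h = hnorm P.V (mat_op H {..<n} ?A (restrict h {..<n}))" by (rule sym)
  qed
  have ne: "?S \<noteq> {}"
  proof -
    have "opnorm P.V P.V (mat_op H {..<n} ?A) \<in> ?S"
    proof (intro CollectI conjI allI impI opnorm_nonneg[OF P.pow_hilbert mb])
      fix h assume h: "\<forall>j<n. h j \<in> carrier H"
      then have r: "restrict h {..<n} \<in> carrier P.V" by auto
      show "?lhs h \<le> opnorm P.V P.V (mat_op H {..<n} ?A) * ?nh h"
        unfolding norm[OF h] by (rule opnorm_bound[OF P.pow_hilbert mb r])
    qed
    then show ?thesis by blast
  qed
  have "op_matrix_norm H n (\<lambda>i j. T (Xm i j)) \<le> module_matrix_norm H N E n Xm"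
    using cc Xm unfolding cc_rep_def by blast
  then have Inf: "Inf ?S \<le> C" using C unfolding op_matrix_norm_def by linarith
  have hj: "\<forall>j<n. h j \<in> carrier H" using h by simp
  have nn: "0 \<le> ?nh h" by (simp add: sum_nonneg)
  have "?lhs h \<le> Inf ?S * ?nh h"
  proof (cases "?nh h = 0")
    case True
    obtain C' where "C' \<in> ?S" using ne by blast
    then have "?lhs h \<le> C' * ?nh h" using hj by blast
    then show ?thesis unfolding True by (simp only: mult_zero_right)
  next
    case False
    then have pos: "0 < ?nh h" using nn by linarith
    have "?lhs h / ?nh h \<le> Inf ?S"
      using ne
    proof (rule cInf_greatest)
      fix C' assume "C' \<in> ?S"
      then have "?lhs h \<le> C' * ?nh h" using hj by blast
      then show "?lhs h / ?nh h \<le> C'" using pos by (simp only: pos_divide_le_eq)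
    qed
    then show ?thesis using pos by (simp only: pos_divide_le_eq)
  qed
  also have "\<dots> \<le> C * ?nh h" by (rule mult_right_mono[OF Inf nn])
  finally have "?lhs h \<le> C * ?nh h" .
  moreover have "hnorm H (\<Oplus>\<^bsub>H\<^esub>j\<in>{..<n}. ?A i j (h j)) \<le> ?lhs h"
    by (rule real_le_rsqrt, rule member_le_sum) (use i in auto)
  ultimately show ?thesis by linarith
qed

text \<open>
  \<open>\<Sum> T \<xi>\<^sub>i h\<^sub>i\<close> is at most \<open>\<Sum> \<xi>\<^sub>i \<otimes> h\<^sub>i\<close> in norm: complete contractivity, applied to the rows \<open>\<xi> a\<close> for matrices
  \<open>a\<close> over \<open>N\<close>, gives the hypothesis of the domination lemma for the Gram matrix of the \<open>\<xi>\<^sub>i\<close>.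
\<close>

lemma row_contractive:
  fixes n :: nat
  assumes \<xi>: "\<And>i. i < n \<Longrightarrow> \<xi> i \<in> carrier E" and w: "\<And>i. i < n \<Longrightarrow> w i \<in> carrier H"
  shows "hnorm H (\<Oplus>\<^bsub>H\<^esub>i\<in>{..<n}. T (\<xi> i) (w i)) \<le> hnorm I.ET (\<Oplus>\<^bsub>I.ET\<^esub>i\<in>{..<n}. I.te (\<xi> i) (w i))"
proof -
  interpret P: hilbert_power H "{..<n}"
    by (intro hilbert_power.intro hilbert_power_axioms.intro H.hilbert_space_axioms) simp
  note hH = H.hilbert_space_axioms and hV = P.pow_hilbert
  define G where "G = mat_op H {..<n} (\<lambda>i j. ip E (\<xi> i) (\<xi> j))"
  interpret G: positive_op P.V G
  proof -
    have "positive_op P.V (mat_op H {..<n} (\<lambda>i j. ip E (\<xi> i) (\<xi> j)))"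
      by (rule gram_positive) (simp_all add: \<xi>)
    then show "positive_op P.V G" unfolding G_def .
  qed
  have gb: "ip E (\<xi> i) (\<xi> j) \<in> bop H H" if "i \<in> {..<n}" "j \<in> {..<n}" for i j
    using that \<xi> by (intro ip_bop) auto
  define row where "row x = (\<Oplus>\<^bsub>I.ET\<^esub>i\<in>{..<n}. I.te (\<xi> i) (x i))" for x
  have tec: "I.te (\<xi> i) (x i) \<in> carrier I.ET" if "x \<in> carrier P.V" "i < n" for x i
    using that \<xi> by (intro I.te_closed) auto
  have row_closed: "row x \<in> carrier I.ET" if "x \<in> carrier P.V" for x
    unfolding row_def using tec[OF that] by (intro I.ET.finsum_vec_closed) auto
  have row_norm: "(hnorm I.ET (row x))\<^sup>2 = Re (cinner P.V x (G x))" if x: "x \<in> carrier P.V" for x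
  proof -
    have xc: "x i \<in> carrier H" if "i < n" for i using x that by auto
    have "cinner I.ET (row x) (row x) = (\<Sum>i<n. cinner I.ET (I.te (\<xi> i) (x i)) (row x))"
      unfolding row_def using tec[OF x] row_closed[OF x, unfolded row_def]
      by (intro I.ET.cinner_finsum_left) auto
    also have "\<dots> = (\<Sum>i<n. \<Sum>j<n. cinner I.ET (I.te (\<xi> i) (x i)) (I.te (\<xi> j) (x j)))"
      unfolding row_def using tec[OF x] by (intro sum.cong refl I.ET.cinner_finsum_right) auto
    also have "\<dots> = (\<Sum>i<n. \<Sum>j<n. cinner H (x i) (ip E (\<xi> i) (\<xi> j) (x j)))"
      by (intro sum.cong refl cinner_te_id) (use \<xi> xc in auto)
    also have "\<dots> = cinner P.V x (G x)"
      unfolding G_def by (rule P.cinner_mat_op[OF gb x x, symmetric])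
    finally show ?thesis using I.ET.hnorm_sq[OF row_closed[OF x]] by (simp only:)
  qed
  define Y where "Y = (\<lambda>x\<in>carrier P.V. \<Oplus>\<^bsub>H\<^esub>i\<in>{..<n}. T (\<xi> i) (x i))"
  have Tc: "T (\<xi> i) (x i) \<in> carrier H" if "x \<in> carrier P.V" "i < n" for x i
    using that \<xi> by (intro T_closed) auto
  have Y_inner: "cinner H k (Y x) = (\<Sum>i<n. cinner H k (T (\<xi> i) (x i)))"
    if x: "x \<in> carrier P.V" and k: "k \<in> carrier H" for k x
    unfolding Y_def restrict_apply'[OF x] using Tc[OF x] k by (intro H.cinner_finsum_right) auto
  have Y_closed: "Y x \<in> carrier H" if x: "x \<in> carrier P.V" for x
    unfolding Y_def restrict_apply'[OF x] using Tc[OF x] by (intro H.finsum_vec_closed) auto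
  have Y: "Y \<in> bop P.V H"
  proof (rule bopI_formal_adjoint[OF hV hH, where B = "\<lambda>k. \<lambda>i\<in>{..<n}. adj H H (T (\<xi> i)) k"
        and C = "\<Sum>i<n. opnorm H H (T (\<xi> i))"])
    show "Y \<in> carrier P.V \<rightarrow>\<^sub>E carrier H" using Y_closed by (auto simp: Y_def simp del: hpow_simps)
    show "(\<lambda>i\<in>{..<n}. adj H H (T (\<xi> i)) k) \<in> carrier P.V" if "k \<in> carrier H" for k
      using adj_closed[OF hH hH T_bop[OF \<xi>] that] by auto
    fix x assume x: "x \<in> carrier P.V"
    show "cinner H k (Y x) = cinner P.V (\<lambda>i\<in>{..<n}. adj H H (T (\<xi> i)) k) x" if "k \<in> carrier H" for k
      unfolding Y_inner[OF x that] using x cinner_adj_left[OF hH hH T_bop[OF \<xi>] _ that] by auto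
    have "hnorm H (Y x) \<le> (\<Sum>i<n. hnorm H (T (\<xi> i) (x i)))"
      unfolding Y_def restrict_apply'[OF x] using Tc[OF x] by (intro H.hnorm_finsum_le) auto
    also have "\<dots> \<le> (\<Sum>i<n. opnorm H H (T (\<xi> i)) * hnorm P.V x)"
    proof (rule sum_mono)
      fix i assume i: "i \<in> {..<n}"
      then have xi: "x i \<in> carrier H" using x by auto
      have Ti: "T (\<xi> i) \<in> bop H H" using i \<xi> by (intro T_bop) auto
      have "hnorm H (T (\<xi> i) (x i)) \<le> opnorm H H (T (\<xi> i)) * hnorm H (x i)"
        by (rule opnorm_bound[OF hH Ti xi])
      also have "\<dots> \<le> opnorm H H (T (\<xi> i)) * hnorm P.V x"
        by (rule mult_left_mono[OF P.coord_norm_le[OF x i] opnorm_nonneg[OF hH Ti]])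
      finally show "hnorm H (T (\<xi> i) (x i)) \<le> opnorm H H (T (\<xi> i)) * hnorm P.V x" .
    qed
    finally show "hnorm H (Y x) \<le> (\<Sum>i<n. opnorm H H (T (\<xi> i))) * hnorm P.V x"
      by (simp only: sum_distrib_right)
  qed
  let ?MM = "diag_op H {..<n} ` M'"
  have MM: "?MM \<subseteq> bop P.V P.V" using P.diag_op_bop[OF M'_bop] by blast
  have G_comm: "G (m x) = m (G x)" if "m \<in> ?MM" and x: "x \<in> carrier P.V" for m x
    using that(1) gram_commutes[where J = "{..<n}" and \<xi> = \<xi>, OF _ _ _ x, folded G_def] \<xi> by auto
  have compr: "hnorm H (Y (a x)) \<le> C * hnorm P.V x"
    if a: "a \<in> bop P.V P.V" and acomm: "\<And>m x. m \<in> ?MM \<Longrightarrow> x \<in> carrier P.V \<Longrightarrow> a (m x) = m (a x)"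
      and C: "0 \<le> C" and form: "\<And>x. x \<in> carrier P.V \<Longrightarrow> Re (cinner P.V (a x) (G (a x))) \<le> C\<^sup>2 * (hnorm P.V x)\<^sup>2"
      and x: "x \<in> carrier P.V" for a C x
  proof (cases "n = 0")
    case True
    then have "Y (a x) = \<zero>\<^bsub>H\<^esub>" using bop_closed[OF a x] by (simp add: Y_def)
    then show ?thesis using C P.V.hnorm_nonneg[OF x] by (simp add: hnorm_def[of H])
  next
    case False
    \<comment> \<open>\<open>a\<close> commutes with the diagonal operators of the commutant, so its entries are in \<open>N\<close>.\<close>
    define b where "b i j = (\<lambda>h\<in>carrier H. a (blk H {..<n} j h) i)" for i j
    have bN: "b i j \<in> N" if "i < n" for i j
    proof -
      have "b i j \<in> commutant H M'"
        unfolding b_def by (rule P.entry_in_commutant[OF a]) (use that M'_bop acomm in auto)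
      then show ?thesis by (simp only: N_eq)
    qed
    have ab: "a y i = (\<Oplus>\<^bsub>H\<^esub>j\<in>{..<n}. b i j (y j))" if y: "y \<in> carrier P.V" and i: "i < n" for y i
    proof -
      have "(\<Oplus>\<^bsub>H\<^esub>j\<in>{..<n}. a (blk H {..<n} j (y j)) i) = (\<Oplus>\<^bsub>H\<^esub>j\<in>{..<n}. b i j (y j))"
      proof (rule H.M.finsum_cong'[OF refl])
        show "(\<lambda>j. b i j (y j)) \<in> {..<n} \<rightarrow> carrier H"
          using y N_closed[OF bN[OF i]] by auto
        show "a (blk H {..<n} j (y j)) i = b i j (y j)" if "j \<in> {..<n}" for j
          using y that by (auto simp: b_def PiE_iff)
      qed
      then show ?thesis using P.apply_entries[OF a y] i by simp
    qed
    define \<rho> where "\<rho> j = (\<Oplus>i\<in>{..<n}. ract E (\<xi> i) (b i j))" for j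
    have rc: "ract E (\<xi> i) (b i j) \<in> carrier E" if "i < n" for i j by (rule ract_closed[OF \<xi>[OF that] bN[OF that]])
    have \<rho>: "\<rho> j \<in> carrier E" for j unfolding \<rho>_def using rc by (intro M.finsum_closed) auto
    have bc: "b i j (y j) \<in> carrier H" if "y \<in> carrier P.V" "i < n" "j < n" for y i j
      using that by (intro N_closed[OF bN]) auto
    have te\<rho>: "(\<Oplus>\<^bsub>I.ET\<^esub>j\<in>{..<n}. I.te (\<rho> j) (y j)) = row (a y)" if y: "y \<in> carrier P.V" for y
    proof (rule I.ET.vec_eqI)
      have yc: "y j \<in> carrier H" if "j < n" for j using y that by auto
      have tc: "I.te (\<rho> j) (y j) \<in> carrier I.ET" if "j < n" for j using \<rho> yc that by (intro I.te_closed) auto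
      show "(\<Oplus>\<^bsub>I.ET\<^esub>j\<in>{..<n}. I.te (\<rho> j) (y j)) \<in> carrier I.ET"
        using tc by (intro I.ET.finsum_vec_closed) auto
      show "row (a y) \<in> carrier I.ET" by (rule row_closed[OF bop_closed[OF a y]])
      fix u assume u: "u \<in> carrier I.ET"
      have ic: "I.te (\<xi> i) (b i j (y j)) \<in> carrier I.ET" if "i < n" "j < n" for i j
        using \<xi> bc[OF y] that by (intro I.te_closed) auto
      have "cinner I.ET u (I.te (\<rho> j) (y j)) = (\<Sum>i<n. cinner I.ET u (I.te (\<xi> i) (b i j (y j))))"
        if j: "j < n" for j
      proof -
        have "I.te (\<rho> j) (y j) = (\<Oplus>\<^bsub>I.ET\<^esub>i\<in>{..<n}. I.te (ract E (\<xi> i) (b i j)) (y j))"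
          unfolding \<rho>_def by (rule te_finsum_left) (use rc yc j in auto)
        also have "\<dots> = (\<Oplus>\<^bsub>I.ET\<^esub>i\<in>{..<n}. I.te (\<xi> i) (b i j (y j)))"
          by (rule I.ET.M.finsum_cong') (use ic j te_ract[OF \<xi> bN yc[OF j]] in auto)
        also have "cinner I.ET u \<dots> = (\<Sum>i<n. cinner I.ET u (I.te (\<xi> i) (b i j (y j))))"
          by (rule I.ET.cinner_finsum_right) (use ic j u in auto)
        finally show ?thesis .
      qed
      then have "cinner I.ET u (\<Oplus>\<^bsub>I.ET\<^esub>j\<in>{..<n}. I.te (\<rho> j) (y j))
          = (\<Sum>j<n. \<Sum>i<n. cinner I.ET u (I.te (\<xi> i) (b i j (y j))))"
        using I.ET.cinner_finsum_right[of "{..<n}" "\<lambda>j. I.te (\<rho> j) (y j)" u] tc u by simp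
      also have "\<dots> = (\<Sum>i<n. \<Sum>j<n. cinner I.ET u (I.te (\<xi> i) (b i j (y j))))" by (rule sum.swap)
      also have "\<dots> = (\<Sum>i<n. cinner I.ET u (I.te (\<xi> i) (a y i)))"
      proof (rule sum.cong[OF refl])
        fix i assume "i \<in> {..<n}"
        then have i: "i < n" by simp
        have bcj: "b i j (y j) \<in> carrier H" if "j \<in> {..<n}" for j using bc[OF y i] that by simp
        have "I.L_op (\<xi> i) (\<Oplus>\<^bsub>H\<^esub>j\<in>{..<n}. b i j (y j)) = (\<Oplus>\<^bsub>I.ET\<^esub>j\<in>{..<n}. I.L_op (\<xi> i) (b i j (y j)))"
          by (rule bop_finsum[OF hH I.ET_hilbert I.L_bop[OF \<xi>[OF i]] _ bcj]) simp
        moreover have "(\<Oplus>\<^bsub>I.ET\<^esub>j\<in>{..<n}. I.L_op (\<xi> i) (b i j (y j))) = (\<Oplus>\<^bsub>I.ET\<^esub>j\<in>{..<n}. I.te (\<xi> i) (b i j (y j)))"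
          by (rule I.ET.M.finsum_cong') (use bcj ic i in \<open>auto simp: I.L_op_def\<close>)
        moreover have "I.L_op (\<xi> i) (a y i) = I.te (\<xi> i) (a y i)"
          using bop_closed[OF a y] i by (auto simp: I.L_op_def PiE_iff)
        ultimately have "I.te (\<xi> i) (a y i) = (\<Oplus>\<^bsub>I.ET\<^esub>j\<in>{..<n}. I.te (\<xi> i) (b i j (y j)))"
          using ab[OF y i] by simp
        then show "(\<Sum>j<n. cinner I.ET u (I.te (\<xi> i) (b i j (y j)))) = cinner I.ET u (I.te (\<xi> i) (a y i))"
          using I.ET.cinner_finsum_right[of "{..<n}" "\<lambda>j. I.te (\<xi> i) (b i j (y j))" u] ic[OF i] u by simp
      qed
      also have "\<dots> = cinner I.ET u (row (a y))"
        unfolding row_def using tec[OF bop_closed[OF a y]] u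
        by (intro I.ET.cinner_finsum_right[symmetric]) auto
      finally show "cinner I.ET u (\<Oplus>\<^bsub>I.ET\<^esub>j\<in>{..<n}. I.te (\<rho> j) (y j)) = cinner I.ET u (row (a y))" .
    qed
    have T\<rho>: "(\<Oplus>\<^bsub>H\<^esub>j\<in>{..<n}. T (\<rho> j) (y j)) = Y (a y)" if y: "y \<in> carrier P.V" for y
    proof (rule H.vec_eqI)
      have yc: "y j \<in> carrier H" if "j < n" for j using y that by auto
      have tc: "T (\<rho> j) (y j) \<in> carrier H" if "j < n" for j using \<rho> yc that by (intro T_closed) auto
      show "(\<Oplus>\<^bsub>H\<^esub>j\<in>{..<n}. T (\<rho> j) (y j)) \<in> carrier H"
        using tc by (intro H.finsum_vec_closed) auto
      show "Y (a y) \<in> carrier H" by (rule Y_closed[OF bop_closed[OF a y]])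
      fix u assume u: "u \<in> carrier H"
      have ic: "T (\<xi> i) (b i j (y j)) \<in> carrier H" if "i < n" "j < n" for i j
        using \<xi> bc[OF y] that by (intro T_closed) auto
      have "cinner H u (T (\<rho> j) (y j)) = (\<Sum>i<n. cinner H u (T (\<xi> i) (b i j (y j))))"
        if j: "j < n" for j
      proof -
        have "T (\<rho> j) (y j) = (\<Oplus>\<^bsub>H\<^esub>i\<in>{..<n}. T (ract E (\<xi> i) (b i j)) (y j))"
          unfolding \<rho>_def by (rule T_finsum) (use rc yc j in auto)
        also have "\<dots> = (\<Oplus>\<^bsub>H\<^esub>i\<in>{..<n}. T (\<xi> i) (b i j (y j)))"
          by (rule H.M.finsum_cong') (use ic j T_ract[OF bN \<xi> yc[OF j]] in auto)
        also have "cinner H u \<dots> = (\<Sum>i<n. cinner H u (T (\<xi> i) (b i j (y j))))"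
          by (rule H.cinner_finsum_right) (use ic j u in auto)
        finally show ?thesis .
      qed
      then have "cinner H u (\<Oplus>\<^bsub>H\<^esub>j\<in>{..<n}. T (\<rho> j) (y j))
          = (\<Sum>j<n. \<Sum>i<n. cinner H u (T (\<xi> i) (b i j (y j))))"
        using H.cinner_finsum_right[of "{..<n}" "\<lambda>j. T (\<rho> j) (y j)" u] tc u by simp
      also have "\<dots> = (\<Sum>i<n. \<Sum>j<n. cinner H u (T (\<xi> i) (b i j (y j))))" by (rule sum.swap)
      also have "\<dots> = (\<Sum>i<n. cinner H u (T (\<xi> i) (a y i)))"
      proof (rule sum.cong[OF refl])
        fix i assume "i \<in> {..<n}"
        then have i: "i < n" by simp
        have bcj: "b i j (y j) \<in> carrier H" if "j \<in> {..<n}" for j using bc[OF y i] that by simp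
        have "T (\<xi> i) (a y i) = (\<Oplus>\<^bsub>H\<^esub>j\<in>{..<n}. T (\<xi> i) (b i j (y j)))"
          unfolding ab[OF y i] by (rule bop_finsum[OF hH hH T_bop[OF \<xi>[OF i]] _ bcj]) simp
        then show "(\<Sum>j<n. cinner H u (T (\<xi> i) (b i j (y j)))) = cinner H u (T (\<xi> i) (a y i))"
          using H.cinner_finsum_right[of "{..<n}" "\<lambda>j. T (\<xi> i) (b i j (y j))" u] ic[OF i] u by simp
      qed
      also have "\<dots> = cinner H u (Y (a y))" by (rule Y_inner[OF bop_closed[OF a y] u, symmetric])
      finally show "cinner H u (\<Oplus>\<^bsub>H\<^esub>j\<in>{..<n}. T (\<rho> j) (y j)) = cinner H u (Y (a y))" .
    qed
    \<comment> \<open>The row is the first row of a square matrix.\<close>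
    define Xm where "Xm i j = (if i = 0 then \<rho> j else \<zero>)" for i j :: nat
    have Xmc: "Xm i j \<in> carrier E" for i j using \<rho> by (simp add: Xm_def)
    have "module_matrix_norm H N E n Xm \<le> C"
      unfolding module_matrix_norm_def
    proof (rule cInf_lower)
      show "bdd_below {C. 0 \<le> C \<and> (\<forall>a. (\<forall>j<n. a j \<in> N) \<longrightarrow> module_tuple_norm H E n
        (\<lambda>i. \<Oplus>j\<in>{..<n}. ract E (Xm i j) (a j)) \<le> C * alg_tuple_norm H n a)}"
        by (rule bdd_belowI[of _ 0]) simp
      show "C \<in> {C. 0 \<le> C \<and> (\<forall>a. (\<forall>j<n. a j \<in> N) \<longrightarrow> module_tuple_norm H E n
        (\<lambda>i. \<Oplus>j\<in>{..<n}. ract E (Xm i j) (a j)) \<le> C * alg_tuple_norm H n a)}"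
      proof (intro CollectI conjI allI impI C)
        fix d :: "nat \<Rightarrow> 'h \<Rightarrow> 'h" assume "\<forall>j<n. d j \<in> N"
        then have d: "d j \<in> N" if "j < n" for j using that by simp
        define \<zeta> where "\<zeta> = (\<Oplus>j\<in>{..<n}. ract E (\<rho> j) (d j))"
        have rd: "ract E (\<rho> j) (d j) \<in> carrier E" if "j < n" for j by (rule ract_closed[OF \<rho> d[OF that]])
        have \<zeta>: "\<zeta> \<in> carrier E" unfolding \<zeta>_def using rd by (intro M.finsum_closed) auto
        define S where "S = (\<lambda>h\<in>carrier H. \<Oplus>\<^bsub>H\<^esub>j\<in>{..<n}. adj H H (d j) (d j h))"
        have adc: "adj H H (d j) (d j h) \<in> carrier H" if "h \<in> carrier H" "j < n" for h j
          by (rule adj_closed[OF hH hH N_bop[OF d[OF that(2)]] N_closed[OF d[OF that(2)] that(1)]])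
        have S_inner: "cinner H k (S h) = (\<Sum>j<n. cinner H (d j k) (d j h))"
          if h: "h \<in> carrier H" and k: "k \<in> carrier H" for h k
        proof -
          have "cinner H k (S h) = (\<Sum>j<n. cinner H k (adj H H (d j) (d j h)))"
            unfolding S_def restrict_apply'[OF h] using adc[OF h] k by (intro H.cinner_finsum_right) auto
          also have "\<dots> = (\<Sum>j<n. cinner H (d j k) (d j h))"
            by (intro sum.cong refl cinner_adj_right[OF hH hH N_bop[OF d] k])
              (use N_closed[OF d h] in auto)
          finally show ?thesis .
        qed
        have S_closed: "S h \<in> carrier H" if h: "h \<in> carrier H" for h
          unfolding S_def restrict_apply'[OF h] using adc[OF h] by (intro H.finsum_vec_closed) auto
        have S: "S \<in> bop H H"
        proof (rule bopI_formal_adjoint[OF hH hH, where B = S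
              and C = "\<Sum>j<n. opnorm H H (compose (carrier H) (adj H H (d j)) (d j))"])
          show "S \<in> carrier H \<rightarrow>\<^sub>E carrier H" using S_closed by (auto simp: S_def)
          fix h assume h: "h \<in> carrier H"
          show "cinner H k (S h) = cinner H (S k) h" if k: "k \<in> carrier H" for k
          proof -
            have "cinner H (S k) h = cnj (cinner H h (S k))" by (rule H.cinner_commute[OF h S_closed[OF k]])
            also have "\<dots> = (\<Sum>j<n. cnj (cinner H (d j h) (d j k)))" unfolding S_inner[OF k h] by simp
            also have "\<dots> = (\<Sum>j<n. cinner H (d j k) (d j h))"
              by (intro sum.cong refl H.cinner_commute[symmetric]) (use N_closed[OF d h] N_closed[OF d k] in auto)
            finally show ?thesis unfolding S_inner[OF h k] by simp
          qed
          have "hnorm H (S h) \<le> (\<Sum>j<n. hnorm H (adj H H (d j) (d j h)))"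
            unfolding S_def restrict_apply'[OF h] using adc[OF h] by (intro H.hnorm_finsum_le) auto
          also have "\<dots> \<le> (\<Sum>j<n. opnorm H H (compose (carrier H) (adj H H (d j)) (d j)) * hnorm H h)"
          proof (rule sum_mono)
            fix j assume "j \<in> {..<n}"
            then have dj: "d j \<in> bop H H" using N_bop[OF d] by simp
            show "hnorm H (adj H H (d j) (d j h)) \<le> opnorm H H (compose (carrier H) (adj H H (d j)) (d j)) * hnorm H h"
              using opnorm_bound[OF hH bop_compose[OF hH hH dj adj_bop[OF hH hH dj]] h] h by (simp add: compose_eq)
          qed
          finally show "hnorm H (S h) \<le> (\<Sum>j<n. opnorm H H (compose (carrier H) (adj H H (d j)) (d j))) * hnorm H h"
            by (simp only: sum_distrib_right)
        qed (rule S_closed)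
        have on: "0 \<le> opnorm H H S" by (rule opnorm_nonneg[OF hH S])
        define c2 where "c2 = C * sqrt (opnorm H H S)"
        have c2: "0 \<le> c2" unfolding c2_def using C on by simp
        have te\<zeta>: "hnorm I.ET (I.te \<zeta> h) \<le> c2 * hnorm H h" if h: "h \<in> carrier H" for h
        proof -
          define y where "y = (\<lambda>j\<in>{..<n}. d j h)"
          have y: "y \<in> carrier P.V" using N_closed[OF d h] by (auto simp: y_def)
          have "I.te \<zeta> h = (\<Oplus>\<^bsub>I.ET\<^esub>j\<in>{..<n}. I.te (ract E (\<rho> j) (d j)) h)"
            unfolding \<zeta>_def by (rule te_finsum_left) (use rd h in auto)
          also have "\<dots> = (\<Oplus>\<^bsub>I.ET\<^esub>j\<in>{..<n}. I.te (\<rho> j) (y j))"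
            by (rule I.ET.M.finsum_cong')
              (use te_ract[OF \<rho> d h] I.te_closed[OF \<rho> N_closed[OF d h]] in \<open>auto simp: y_def\<close>)
          finally have "I.te \<zeta> h = row (a y)" using te\<rho>[OF y] by simp
          then have "(hnorm I.ET (I.te \<zeta> h))\<^sup>2 \<le> C\<^sup>2 * (hnorm P.V y)\<^sup>2"
            using row_norm[OF bop_closed[OF a y]] form[OF y] by (simp only:)
          also have "(hnorm P.V y)\<^sup>2 = Re (cinner H h (S h))"
            unfolding S_inner[OF h h] P.V.hnorm_sq[OF y] by (simp add: y_def)
          also have "C\<^sup>2 * Re (cinner H h (S h)) \<le> C\<^sup>2 * (opnorm H H S * (hnorm H h)\<^sup>2)"
            by (rule mult_left_mono[OF form_le_opnorm[OF hH S h]]) simp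
          also have "\<dots> = (c2 * hnorm H h)\<^sup>2" using on by (simp add: c2_def power_mult_distrib)
          finally show ?thesis by (rule power2_le_imp_le) (use c2 H.hnorm_nonneg[OF h] in simp)
        qed
        have "opnorm H H (ip E \<zeta> \<zeta>) \<le> c2\<^sup>2"
        proof (rule opnorm_le)
          fix h assume h: "h \<in> carrier H"
          define k where "k = ip E \<zeta> \<zeta> h"
          have k: "k \<in> carrier H" unfolding k_def by (rule ip_apply_closed[OF \<zeta> \<zeta> h])
          have "(hnorm H k)\<^sup>2 = Re (cinner I.ET (I.te \<zeta> k) (I.te \<zeta> h))"
            using cinner_te_id[OF \<zeta> k \<zeta> h] H.hnorm_sq[OF k] by (simp add: k_def)
          also have "\<dots> \<le> hnorm I.ET (I.te \<zeta> k) * hnorm I.ET (I.te \<zeta> h)"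
            using I.ET.cauchy_schwarz[OF I.te_closed[OF \<zeta> k] I.te_closed[OF \<zeta> h]] complex_Re_le_cmod order_trans by blast
          also have "\<dots> \<le> (c2 * hnorm H k) * (c2 * hnorm H h)"
            by (intro mult_mono te\<zeta> h k I.ET.hnorm_nonneg I.te_closed \<zeta> mult_nonneg_nonneg c2 H.hnorm_nonneg)
          finally have "hnorm H k * hnorm H k \<le> hnorm H k * (c2\<^sup>2 * hnorm H h)"
            by (simp only: power2_eq_square mult_ac)
          then show "hnorm H (ip E \<zeta> \<zeta> h) \<le> c2\<^sup>2 * hnorm H h"
            unfolding k_def[symmetric] by (rule le_of_square_le) (simp_all add: H.hnorm_nonneg k h)
        qed simp
        then have le: "sqrt (opnorm H H (ip E \<zeta> \<zeta>)) \<le> c2" using c2 by (rule real_le_lsqrt[rotated])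
        have tuple: "(\<lambda>h\<in>carrier H. \<Oplus>\<^bsub>H\<^esub>i\<in>{..<n}. ip E (\<Oplus>j\<in>{..<n}. ract E (Xm i j) (d j))
            (\<Oplus>j\<in>{..<n}. ract E (Xm i j) (d j)) h) = ip E \<zeta> \<zeta>"
        proof (rule extensionalityI[of _ "carrier H"])
          show "ip E \<zeta> \<zeta> \<in> extensional (carrier H)"
            using bop_funcset[OF ip_bop[OF \<zeta> \<zeta>]] by (simp add: PiE_def)
          fix h assume h: "h \<in> carrier H"
          have zero: "(\<Oplus>j\<in>{..<n}. ract E (Xm i j) (d j)) = \<zero>" if "i \<noteq> 0" for i
          proof -
            have "ract E \<zero> (d j) = \<zero>" if "j < n" for j
              using ract_smult_left[OF M.zero_closed d[OF that], of 0] smult_l_null[OF M.zero_closed]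
                smult_l_null[OF ract_closed[OF M.zero_closed d[OF that]]] by simp
            then have "(\<Oplus>j\<in>{..<n}. ract E (Xm i j) (d j)) = (\<Oplus>j\<in>{..<n}. \<zero>)"
              using that by (intro M.finsum_cong') (auto simp: Xm_def)
            then show ?thesis by (simp add: M.finsum_zero)
          qed
          have first: "(\<Oplus>j\<in>{..<n}. ract E (Xm 0 j) (d j)) = \<zeta>" by (simp add: Xm_def \<zeta>_def)
          have "(\<Oplus>\<^bsub>H\<^esub>i\<in>{..<n}. ip E (\<Oplus>j\<in>{..<n}. ract E (Xm i j) (d j)) (\<Oplus>j\<in>{..<n}. ract E (Xm i j) (d j)) h)
              = (\<Oplus>\<^bsub>H\<^esub>i\<in>{..<n}. if 0 = i then ip E \<zeta> \<zeta> h else \<zero>\<^bsub>H\<^esub>)"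
            by (rule H.M.finsum_cong'[OF refl])
              (use zero first h in \<open>auto simp: ip_apply_closed \<zeta> ip_zero_apply\<close>)
          also have "\<dots> = ip E \<zeta> \<zeta> h"
            using False by (intro H.M.finsum_singleton) (simp_all add: ip_apply_closed \<zeta> h)
          finally show "(\<lambda>h\<in>carrier H. \<Oplus>\<^bsub>H\<^esub>i\<in>{..<n}. ip E (\<Oplus>j\<in>{..<n}. ract E (Xm i j) (d j))
            (\<Oplus>j\<in>{..<n}. ract E (Xm i j) (d j)) h) h = ip E \<zeta> \<zeta> h" using h by simp
        qed simp
        show "module_tuple_norm H E n (\<lambda>i. \<Oplus>j\<in>{..<n}. ract E (Xm i j) (d j)) \<le> C * alg_tuple_norm H n d"
          unfolding module_tuple_norm_def alg_tuple_norm_def tuple S_def[symmetric]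
          using le unfolding c2_def .
      qed
    qed
    then have "hnorm H (\<Oplus>\<^bsub>H\<^esub>j\<in>{..<n}. T (Xm 0 j) (x j)) \<le> C * sqrt (\<Sum>j<n. (hnorm H (x j))\<^sup>2)"
      by (intro op_matrix_bound Xmc) (use False x in auto)
    moreover have "(\<Oplus>\<^bsub>H\<^esub>j\<in>{..<n}. T (Xm 0 j) (x j)) = Y (a x)"
      unfolding T\<rho>[OF x, symmetric] by (simp add: Xm_def)
    ultimately show ?thesis unfolding P.pow_norm[OF x] by simp
  qed
  define w' where "w' = restrict w {..<n}"
  have w': "w' \<in> carrier P.V" using w by (auto simp: w'_def)
  have "(hnorm H (Y w'))\<^sup>2 \<le> Re (cinner P.V w' (G w'))"
  proof (rule domination_by_compression[OF hV hH G.positive_op_axioms Y _ MM _ w'])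
    show "G (m x) = m (G x)" if "m \<in> ?MM" "x \<in> carrier P.V" for m x using that by (rule G_comm)
    show "hnorm H (Y (a x)) \<le> C * hnorm P.V x"
      if "a \<in> bop P.V P.V" "\<And>m x. m \<in> ?MM \<Longrightarrow> x \<in> carrier P.V \<Longrightarrow> a (m x) = m (a x)" "0 \<le> C"
        "\<And>x. x \<in> carrier P.V \<Longrightarrow> Re (cinner P.V (a x) (G (a x))) \<le> C\<^sup>2 * (hnorm P.V x)\<^sup>2"
        "x \<in> carrier P.V" for a C x
      by (rule compr) (use that in blast)+
  qed
  also have "\<dots> = (hnorm I.ET (row w'))\<^sup>2" by (rule row_norm[OF w', symmetric])
  finally have "hnorm H (Y w') \<le> hnorm I.ET (row w')"
    by (rule power2_le_imp_le[OF _ I.ET.hnorm_nonneg[OF row_closed[OF w']]])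
  moreover have "Y w' = (\<Oplus>\<^bsub>H\<^esub>i\<in>{..<n}. T (\<xi> i) (w i))"
    unfolding Y_def restrict_apply'[OF w']
    by (rule H.M.finsum_cong') (use T_closed[OF \<xi> w] in \<open>auto simp: w'_def\<close>)
  moreover have "row w' = (\<Oplus>\<^bsub>I.ET\<^esub>i\<in>{..<n}. I.te (\<xi> i) (w i))"
    unfolding row_def by (rule I.ET.M.finsum_cong') (use I.te_closed[OF \<xi> w] in \<open>auto simp: w'_def\<close>)
  ultimately show ?thesis by simp
qed

abbreviation Tt where "Tt \<equiv> tilde H E T"

lemma Tt_bop: "Tt \<in> bop I.ET H"
  and Tt_te: "\<lbrakk>\<xi> \<in> carrier E; h \<in> carrier H\<rbrakk> \<Longrightarrow> Tt (I.te \<xi> h) = T \<xi> h"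
proof -
  note hH = H.hilbert_space_axioms
  let ?z = "\<lambda>(\<xi>, h). T \<xi> h"
  obtain B where B: "B \<in> bop I.ET H"
    "\<And>\<xi> h. \<xi> \<in> carrier E \<Longrightarrow> h \<in> carrier H \<Longrightarrow> B (I.te \<xi> h) = ?z (\<xi>, h)"
  proof (rule I.te_extend[OF hH, where v = ?z and C = 1])
    show "?z (\<xi>, h) \<in> carrier H" if "\<xi> \<in> carrier E" "h \<in> carrier H" for \<xi> h
      using that by (simp add: T_closed)
    fix f :: "('e \<times> 'h) \<Rightarrow>\<^sub>0 complex" assume f: "supp f \<subseteq> carrier E \<times> carrier H"
    obtain b where b: "bij_betw b {..<card (supp f)} (supp f)"
      using ex_bij_betw_nat_finite[OF finite_keys[of f]] by (auto simp: lessThan_atLeast0)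
    let ?n = "card (supp f)"
    have bs: "b i \<in> supp f" if "i < ?n" for i using b that by (auto simp: bij_betw_def)
    have bc: "fst (b i) \<in> carrier E" "snd (b i) \<in> carrier H" if "i < ?n" for i
      using bs[OF that] f by auto
    have img: "b ` {..<?n} = supp f" and inj: "inj_on b {..<?n}" using b by (auto simp: bij_betw_def)
    let ?w = "\<lambda>i. coef f (b i) \<odot>\<^bsub>H\<^esub> snd (b i)"
    have wc: "?w i \<in> carrier H" if "i < ?n" for i using bc[OF that] by simp
    have "lincomb H ?z f = (\<Oplus>\<^bsub>H\<^esub>i\<in>{..<?n}. coef f (b i) \<odot>\<^bsub>H\<^esub> ?z (b i))"
    proof -
      have "(\<lambda>x. coef f x \<odot>\<^bsub>H\<^esub> ?z x) \<in> b ` {..<?n} \<rightarrow> carrier H"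
        unfolding img using f by (auto simp: T_closed)
      from H.M.finsum_reindex[OF this inj] show ?thesis unfolding lincomb_def img .
    qed
    also have "\<dots> = (\<Oplus>\<^bsub>H\<^esub>i\<in>{..<?n}. T (fst (b i)) (?w i))"
      by (rule H.M.finsum_cong')
        (use bc T_closed[OF bc(1) wc] in \<open>auto simp: case_prod_beta bop_scale[OF T_bop]\<close>)
    finally have 1: "lincomb H ?z f = (\<Oplus>\<^bsub>H\<^esub>i\<in>{..<?n}. T (fst (b i)) (?w i))" .
    let ?t = "\<lambda>(\<xi>, h). I.te \<xi> h"
    have "lincomb I.ET ?t f = (\<Oplus>\<^bsub>I.ET\<^esub>i\<in>{..<?n}. coef f (b i) \<odot>\<^bsub>I.ET\<^esub> ?t (b i))"
    proof -
      have "(\<lambda>x. coef f x \<odot>\<^bsub>I.ET\<^esub> ?t x) \<in> b ` {..<?n} \<rightarrow> carrier I.ET"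
        unfolding img using f by (auto simp: I.te_closed)
      from I.ET.M.finsum_reindex[OF this inj] show ?thesis unfolding lincomb_def img .
    qed
    also have "\<dots> = (\<Oplus>\<^bsub>I.ET\<^esub>i\<in>{..<?n}. I.te (fst (b i)) (?w i))"
      by (rule I.ET.M.finsum_cong')
        (use bc I.te_closed[OF bc(1) wc] in \<open>auto simp: case_prod_beta I.te_scale_right\<close>)
    finally have 2: "lincomb I.ET ?t f = (\<Oplus>\<^bsub>I.ET\<^esub>i\<in>{..<?n}. I.te (fst (b i)) (?w i))" .
    show "hnorm H (lincomb H ?z f) \<le> 1 * hnorm I.ET (lincomb I.ET ?t f)"
      unfolding 1 2 mult_1 by (rule row_contractive) (use bc wc in auto)
  qed blast
  have eq: "Tt = B"
    unfolding tilde_def by (rule I.te_op_ext[OF hH B(1)]) (use B(2) in auto)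
  show "Tt \<in> bop I.ET H" unfolding eq by (rule B(1))
  show "\<lbrakk>\<xi> \<in> carrier E; h \<in> carrier H\<rbrakk> \<Longrightarrow> Tt (I.te \<xi> h) = T \<xi> h"
    unfolding eq using B(2) by simp
qed

end

section \<open>The correspondence of the completely positive map\<close>

lemma isometryD:
  assumes "isometry K L V"
  shows isometry_bop: "V \<in> bop K L"
    and isometry_inner: "x \<in> carrier K \<Longrightarrow> y \<in> carrier K \<Longrightarrow> cinner L (V x) (V y) = cinner K x y"
  using assms by (auto simp: isometry_def)

lemma isometry_adj:
  assumes K: "hilbert_space K" and L: "hilbert_space L" and V: "isometry K L V" and x: "x \<in> carrier K"
  shows "adj K L V (V x) = x"
proof -
  interpret K: hilbert_space K by fact
  note Vb = isometry_bop[OF V]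
  note Vx = bop_closed[OF Vb x]
  show ?thesis
    by (rule K.vec_eqI[OF adj_closed[OF K L Vb Vx] x])
      (simp add: cinner_adj_right[OF K L Vb _ Vx] isometry_inner[OF V _ x])
qed

lemma isometry_inj:
  assumes "hilbert_space K" "hilbert_space L" "isometry K L V" "x \<in> carrier K" "y \<in> carrier K" "V x = V y"
  shows "x = y"
proof -
  have "x = adj K L V (V x)" by (rule isometry_adj[OF assms(1-4), symmetric])
  also have "\<dots> = adj K L V (V y)" by (simp only: assms(6))
  also have "\<dots> = y" by (rule isometry_adj[OF assms(1-3,5)])
  finally show ?thesis .
qed

lemma isometry_ontoI:
  assumes K: "hilbert_space K" and L: "hilbert_space L" and V: "isometry K L V"
    and orth: "\<And>z. z \<in> carrier L \<Longrightarrow> (\<And>x. x \<in> carrier K \<Longrightarrow> cinner L (V x) z = 0) \<Longrightarrow> z = \<zero>\<^bsub>L\<^esub>"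
  shows "V ` carrier K = carrier L"
proof
  interpret K: hilbert_space K by fact
  interpret L: hilbert_space L by fact
  note Vb = isometry_bop[OF V]
  show "V ` carrier K \<subseteq> carrier L" using bop_closed[OF Vb] by blast
  show "carrier L \<subseteq> V ` carrier K"
  proof
    fix y assume y: "y \<in> carrier L"
    let ?x = "adj K L V y"
    have x: "?x \<in> carrier K" by (rule adj_closed[OF K L Vb y])
    note Vx = bop_closed[OF Vb x]
    have "y \<ominus>\<^bsub>L\<^esub> V ?x = \<zero>\<^bsub>L\<^esub>"
    proof (rule orth)
      show "y \<ominus>\<^bsub>L\<^esub> V ?x \<in> carrier L" using y Vx by simp
      fix w assume w: "w \<in> carrier K"
      show "cinner L (V w) (y \<ominus>\<^bsub>L\<^esub> V ?x) = 0"
        using L.cinner_diff_right[OF bop_closed[OF Vb w] y Vx] cinner_adj_right[OF K L Vb w y]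
          isometry_inner[OF V w x] by simp
    qed
    then have "V ?x = y"
      using L.cinner_diff_right[OF _ y Vx] y Vx by (intro L.vec_eqI) (metis L.cinner_zero_right eq_iff_diff_eq_0)+
    then show "y \<in> V ` carrier K" using x by force
  qed
qed

lemma op_ext_transport:
  assumes K: "hilbert_space K1" "hilbert_space K2" and L: "hilbert_space L1" "hilbert_space L2"
    and e: "total_family K1 I e" and V1: "V1 \<in> bop K1 L1" and V2: "isometry K2 L2 V2"
    and B: "B \<in> bop L1 L2" and f: "\<And>x. x \<in> I \<Longrightarrow> f x \<in> carrier K2"
    and Bf: "\<And>x. x \<in> I \<Longrightarrow> B (V1 (e x)) = V2 (f x)"
  shows op_ext_transport_bop: "op_ext K1 K2 I e f \<in> bop K1 K2"
    and op_ext_transport_elem: "x \<in> I \<Longrightarrow> op_ext K1 K2 I e f (e x) = f x"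
    and op_ext_transport_apply: "u \<in> carrier K1 \<Longrightarrow> V2 (op_ext K1 K2 I e f u) = B (V1 u)"
proof -
  note V2b = isometry_bop[OF V2]
  define A where "A = compose (carrier K1) (adj K2 L2 V2) (compose (carrier K1) B V1)"
  have A: "A \<in> bop K1 K2" unfolding A_def
    by (rule bop_compose[OF K(1) L(2) bop_compose[OF K(1) L(1) V1 B] adj_bop[OF K(2) L(2) V2b]])
  have ec: "e x \<in> carrier K1" if "x \<in> I" for x using e that by (simp add: total_family_def)
  have Ae: "A (e x) = f x" if x: "x \<in> I" for x
    using ec[OF x] isometry_adj[OF K(2) L(2) V2 f[OF x]] by (simp add: A_def compose_eq Bf[OF x])
  have eq: "op_ext K1 K2 I e f = A" by (rule op_ext_eq[OF K e A Ae])
  show "op_ext K1 K2 I e f \<in> bop K1 K2" unfolding eq by (rule A)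
  show "x \<in> I \<Longrightarrow> op_ext K1 K2 I e f (e x) = f x" unfolding eq by (rule Ae)
  have "compose (carrier K1) V2 A = compose (carrier K1) B V1"
    by (rule bop_eq_on_total[OF K(1) L(2) e bop_compose[OF K A V2b] bop_compose[OF K(1) L(1) V1 B]])
      (simp add: compose_eq ec Ae Bf)
  then show "u \<in> carrier K1 \<Longrightarrow> V2 (op_ext K1 K2 I e f u) = B (V1 u)"
    unfolding eq by (rule compose_eqD)
qed

context hilbert_module begin

lemma M'_compose: "a \<in> M' \<Longrightarrow> b \<in> M' \<Longrightarrow> compose (carrier H) a b \<in> M'"
proof -
  assume a: "a \<in> M'" and b: "b \<in> M'"
  have "compose (carrier H) n (compose (carrier H) a b) = compose (carrier H) (compose (carrier H) a b) n"
    if n: "n \<in> N" for n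
    by (rule ext)
      (simp add: compose_def M'_closed[OF b] N_closed[OF n] M'_comm[OF a n M'_closed[OF b]] M'_comm[OF b n])
  then show ?thesis
    using bop_compose[OF H.hilbert_space_axioms H.hilbert_space_axioms M'_bop[OF b] M'_bop[OF a]]
    by (simp add: commutant_def)
qed

lemma M'_I:
  assumes "m \<in> bop H H" "\<And>a h. a \<in> N \<Longrightarrow> h \<in> carrier H \<Longrightarrow> a (m h) = m (a h)"
  shows "m \<in> M'"
proof -
  have "compose (carrier H) a m = compose (carrier H) m a" if "a \<in> N" for a
    by (rule ext) (use assms(2)[OF that] in \<open>simp add: compose_def\<close>)
  then show ?thesis using assms(1) by (simp add: commutant_def)
qed

lemma M'_one: "op_one H \<in> M'"
  by (rule M'_I[OF op_one_bop[OF H.hilbert_space_axioms]]) (simp add: op_one_def N_closed)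

lemma amp_closed: "m \<in> M' \<Longrightarrow> u \<in> carrier I.ET \<Longrightarrow> amp m u \<in> carrier I.ET"
  by (rule bop_closed[OF amp_bop])

lemma amp_compose:
  assumes a: "a \<in> M'" and b: "b \<in> M'" and u: "u \<in> carrier I.ET"
  shows "amp (compose (carrier H) a b) u = amp a (amp b u)"
proof -
  note hT = I.ET_hilbert
  have "amp (compose (carrier H) a b) = compose (carrier I.ET) (amp a) (amp b)"
    by (rule I.bop_eqI_te[OF hT amp_bop[OF M'_compose[OF a b]] bop_compose[OF hT hT amp_bop[OF b] amp_bop[OF a]]])
      (simp add: compose_eq I.te_closed amp_te a b M'_compose M'_closed)
  then show ?thesis using u by (simp add: compose_eq)
qed

lemma amp_one: "u \<in> carrier I.ET \<Longrightarrow> amp (op_one H) u = u"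
proof -
  assume u: "u \<in> carrier I.ET"
  have "amp (op_one H) = op_one I.ET"
    by (rule I.bop_eqI_te[OF I.ET_hilbert amp_bop[OF M'_one] op_one_bop[OF I.ET_hilbert]])
      (simp add: amp_te M'_one, simp add: op_one_def I.te_closed)
  then show ?thesis using u by (simp add: op_one_def)
qed

end

text \<open>
  The projection onto the complement of the range commutes with the commutant, so by self-duality it
  carries \<open>\<xi> \<otimes> h\<close> to \<open>\<zeta> \<otimes> h\<close> for some \<open>\<zeta>\<close>. Hence such a range is everything as soon as no non-zero
  \<open>\<zeta> \<otimes> h\<close> with \<open>\<zeta>\<close> independent of \<open>h\<close> is orthogonal to it.
\<close>

lemma (in w_correspondence) intertwining_isometry_onto:
  assumes hK: "hilbert_space K" and V: "isometry K I.ET V"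
    and inv: "\<And>m. m \<in> M' \<Longrightarrow> \<exists>B\<in>bop K K. \<forall>x\<in>carrier K. amp m (V x) = V (B x)"
    and sep: "\<And>\<zeta>. \<zeta> \<in> carrier E \<Longrightarrow>
      (\<And>x h. x \<in> carrier K \<Longrightarrow> h \<in> carrier H \<Longrightarrow> cinner I.ET (V x) (I.te \<zeta> h) = 0) \<Longrightarrow> \<zeta> = \<zero>"
  shows "V ` carrier K = carrier I.ET"
proof (rule isometry_ontoI[OF hK I.ET_hilbert V])
  note hT = I.ET_hilbert and hH = H.hilbert_space_axioms
  note V_bop = isometry_bop[OF V] and V_closed = bop_closed[OF isometry_bop[OF V]]
  \<comment> \<open>\<open>Q\<close> is the projection onto the range, and \<open>R = (1 - Q) (\<xi> \<otimes> \<cdot>)\<close>.\<close>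
  define Q where "Q u = V (adj K I.ET V u)" for u
  have Vs: "adj K I.ET V u \<in> carrier K" if "u \<in> carrier I.ET" for u
    by (rule adj_closed[OF hK hT V_bop that])
  have Qc: "Q u \<in> carrier I.ET" if "u \<in> carrier I.ET" for u
    unfolding Q_def by (rule V_closed[OF Vs[OF that]])
  have QV: "Q (V x) = V x" if "x \<in> carrier K" for x
    unfolding Q_def by (simp add: isometry_adj[OF hK hT V that])
  have Q_inner: "cinner I.ET v (Q u) = cinner K (adj K I.ET V v) (adj K I.ET V u)"
    if "u \<in> carrier I.ET" "v \<in> carrier I.ET" for u v
    unfolding Q_def using cinner_adj_left[OF hK hT V_bop Vs[OF that(1)] that(2)] by simp
  have Q_inner': "cinner I.ET (Q v) u = cinner K (adj K I.ET V v) (adj K I.ET V u)"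
    if "u \<in> carrier I.ET" "v \<in> carrier I.ET" for u v
    unfolding Q_def using cinner_adj_right[OF hK hT V_bop Vs[OF that(2)] that(1)] by simp
  have QampQ: "Q (amp m (Q u)) = amp m (Q u)" if m: "m \<in> M'" and u: "u \<in> carrier I.ET" for m u
  proof -
    obtain B where B: "B \<in> bop K K" "\<And>x. x \<in> carrier K \<Longrightarrow> amp m (V x) = V (B x)" using inv[OF m] by blast
    show ?thesis using QV[OF bop_closed[OF B(1) Vs[OF u]]] B(2)[OF Vs[OF u]] unfolding Q_def[of u] by simp
  qed
  have Qamp: "Q (amp m u) = amp m (Q u)" if m: "m \<in> M'" and u: "u \<in> carrier I.ET" for m u
  proof (rule I.ET.vec_eqI)
    note m' = M'_adj[OF m]
    show "Q (amp m u) \<in> carrier I.ET" "amp m (Q u) \<in> carrier I.ET"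
      using m u by (simp_all add: Qc amp_closed)
    fix v assume v: "v \<in> carrier I.ET"
    have "cinner I.ET v (Q (amp m u)) = cinner I.ET (Q v) (amp m u)"
      using Q_inner Q_inner' v amp_closed[OF m u] by simp
    also have "\<dots> = cinner I.ET (amp (adj H H m) (Q v)) u" by (rule amp_adj[OF m Qc[OF v] u])
    also have "\<dots> = cinner I.ET (Q (amp (adj H H m) (Q v))) u" using QampQ[OF m' v] by simp
    also have "\<dots> = cinner I.ET (amp (adj H H m) (Q v)) (Q u)"
      using Q_inner Q_inner' u amp_closed[OF m' Qc[OF v]] by simp
    also have "\<dots> = cinner I.ET (Q v) (amp m (Q u))" by (rule amp_adj[OF m Qc[OF v] Qc[OF u], symmetric])
    also have "\<dots> = cinner I.ET v (Q (amp m (Q u)))"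
      using Q_inner Q_inner' v amp_closed[OF m Qc[OF u]] by simp
    finally show "cinner I.ET v (Q (amp m u)) = cinner I.ET v (amp m (Q u))" unfolding QampQ[OF m u] .
  qed
  have Q_te: "Q (I.te \<xi> h) = I.te \<xi> h" if \<xi>: "\<xi> \<in> carrier E" and h: "h \<in> carrier H" for \<xi> h
  proof -
    define R where "R = (\<lambda>h\<in>carrier H. I.te \<xi> h \<oplus>\<^bsub>I.ET\<^esub> (-1) \<odot>\<^bsub>I.ET\<^esub> Q (I.te \<xi> h))"
    have R: "R \<in> bop H I.ET"
    proof -
      have "R = op_add H I.ET (I.L_op \<xi>) (op_smult H I.ET (-1)
          (compose (carrier H) V (compose (carrier H) (adj K I.ET V) (I.L_op \<xi>))))"
        by (rule ext) (simp add: R_def op_add_def op_smult_def I.L_op_def compose_def Q_def)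
      then show ?thesis
        using op_add_bop[OF hH hT I.L_bop[OF \<xi>] op_smult_bop[OF hH hT
          bop_compose[OF hH hK bop_compose[OF hH hT I.L_bop[OF \<xi>] adj_bop[OF hK hT V_bop]] V_bop]]] by simp
    qed
    have comm: "R (m h) = amp m (R h)" if m: "m \<in> M'" and h: "h \<in> carrier H" for m h
      using I.te_closed[OF \<xi> h] Qamp[OF m I.te_closed[OF \<xi> h]] m h \<xi> Qc[OF I.te_closed[OF \<xi> h]]
      by (simp add: R_def M'_closed amp_te[symmetric] bop_add[OF amp_bop[OF m]] bop_scale[OF amp_bop[OF m]])
    obtain \<zeta> where \<zeta>: "\<zeta> \<in> carrier E" "\<And>h. h \<in> carrier H \<Longrightarrow> R h = I.te \<zeta> h"
      using intertwiner_represented[OF R comm] by blast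
    have "cinner I.ET (V x) (I.te \<zeta> k) = 0" if x: "x \<in> carrier K" and k: "k \<in> carrier H" for x k
    proof -
      note t = I.te_closed[OF \<xi> k] and Vx = V_closed[OF x]
      have "cinner I.ET (V x) (R k) = cinner I.ET (V x) (I.te \<xi> k) - cinner I.ET (V x) (Q (I.te \<xi> k))"
        using k t Qc[OF t] Vx by (simp add: R_def)
      also have "cinner I.ET (V x) (Q (I.te \<xi> k)) = cinner I.ET (Q (V x)) (I.te \<xi> k)"
        using Q_inner Q_inner' t Vx by simp
      finally have "cinner I.ET (V x) (R k) = 0" unfolding QV[OF x] by (simp only: diff_self)
      then show ?thesis unfolding \<zeta>(2)[OF k] .
    qed
    then have "\<zeta> = \<zero>" by (rule sep[OF \<zeta>(1)])
    then have R0: "R h = \<zero>\<^bsub>I.ET\<^esub>" using \<zeta>(2)[OF h] te_zero[OF h] by simp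
    note t = I.te_closed[OF \<xi> h]
    show ?thesis
    proof (rule I.ET.vec_eqI[OF Qc[OF t] t])
      fix v assume v: "v \<in> carrier I.ET"
      have "cinner I.ET v (R h) = 0" unfolding R0 using v by simp
      then show "cinner I.ET v (Q (I.te \<xi> h)) = cinner I.ET v (I.te \<xi> h)"
        using v t Qc[OF t] h by (simp add: R_def)
    qed
  qed
  fix z assume z: "z \<in> carrier I.ET" and orth: "\<And>x. x \<in> carrier K \<Longrightarrow> cinner I.ET (V x) z = 0"
  show "z = \<zero>\<^bsub>I.ET\<^esub>"
  proof (rule I.te_eqI[OF z I.ET.zero_vec_closed])
    fix \<xi> h assume \<xi>: "\<xi> \<in> carrier E" and h: "h \<in> carrier H"
    note t = I.te_closed[OF \<xi> h]
    have "cinner I.ET (I.te \<xi> h) z = 0"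
      using orth[OF Vs[OF t]] Q_te[OF \<xi> h] unfolding Q_def by simp
    then show "cinner I.ET (I.te \<xi> h) z = cinner I.ET (I.te \<xi> h) \<zero>\<^bsub>I.ET\<^esub>" using t by simp
  qed
qed

context injective_rep begin

abbreviation Ts where "Ts \<equiv> adj I.ET H Tt"

lemmas Tt_closed = bop_closed[OF Tt_bop]

lemma Ts_bop: "Ts \<in> bop H I.ET"
  by (rule adj_bop[OF I.ET_hilbert H.hilbert_space_axioms Tt_bop])

lemmas Ts_closed = bop_closed[OF Ts_bop]

lemma cinner_Ts: "u \<in> carrier I.ET \<Longrightarrow> h \<in> carrier H \<Longrightarrow> cinner I.ET u (Ts h) = cinner H (Tt u) h"
  by (rule cinner_adj_right[OF I.ET_hilbert H.hilbert_space_axioms Tt_bop])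

lemma cinner_Ts_left: "u \<in> carrier I.ET \<Longrightarrow> h \<in> carrier H \<Longrightarrow> cinner I.ET (Ts h) u = cinner H h (Tt u)"
  by (rule cinner_adj_left[OF I.ET_hilbert H.hilbert_space_axioms Tt_bop])

lemma lrep_closed: "d \<in> N \<Longrightarrow> u \<in> carrier I.ET \<Longrightarrow> lrep d u \<in> carrier I.ET"
  by (rule bop_closed[OF lrep_bop])

lemma Tt_lrep: "d \<in> N \<Longrightarrow> u \<in> carrier I.ET \<Longrightarrow> Tt (lrep d u) = d (Tt u)"
proof -
  assume d: "d \<in> N" and u: "u \<in> carrier I.ET"
  note hT = I.ET_hilbert and hH = H.hilbert_space_axioms
  have "compose (carrier I.ET) Tt (lrep d) = compose (carrier I.ET) d Tt"
    by (rule I.bop_eqI_te[OF hH bop_compose[OF hT hT lrep_bop[OF d] Tt_bop] bop_compose[OF hT hH Tt_bop N_bop[OF d]]])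
      (simp add: compose_eq I.te_closed lrep_te d Tt_te lact_closed T_lact)
  from compose_eqD[OF this u] show ?thesis .
qed

lemma Ts_lrep: "d \<in> N \<Longrightarrow> h \<in> carrier H \<Longrightarrow> Ts (d h) = lrep d (Ts h)"
proof (rule I.ET.vec_eqI)
  assume d: "d \<in> N" and h: "h \<in> carrier H"
  show "Ts (d h) \<in> carrier I.ET" by (rule Ts_closed[OF N_closed[OF d h]])
  show "lrep d (Ts h) \<in> carrier I.ET" by (rule lrep_closed[OF d Ts_closed[OF h]])
  fix u assume u: "u \<in> carrier I.ET"
  note d' = N_adj[OF d]
  have "cinner I.ET u (Ts (d h)) = cinner H (adj H H d (Tt u)) h"
    using cinner_Ts[OF u N_closed[OF d h]]
      cinner_adj_left[OF H.hilbert_space_axioms H.hilbert_space_axioms N_bop[OF d] h Tt_closed[OF u]] by simp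
  also have "\<dots> = cinner I.ET (lrep (adj H H d) u) (Ts h)"
    using Tt_lrep[OF d' u] cinner_Ts[OF lrep_closed[OF d' u] h] by simp
  also have "\<dots> = cinner I.ET u (lrep d (Ts h))" by (rule lrep_adj[OF d u Ts_closed[OF h], symmetric])
  finally show "cinner I.ET u (Ts (d h)) = cinner I.ET u (lrep d (Ts h))" .
qed

definition cp where "cp = cp_map H M' E T"

lemma cp_apply: "a \<in> M' \<Longrightarrow> h \<in> carrier H \<Longrightarrow> cp a h = Tt (amp a (Ts h))"
  by (simp add: cp_def cp_map_def)

lemma cp_M': "a \<in> M' \<Longrightarrow> cp a \<in> M'"
proof (rule M'_I)
  assume a: "a \<in> M'"
  note hT = I.ET_hilbert and hH = H.hilbert_space_axioms
  have "cp a = compose (carrier H) Tt (compose (carrier H) (amp a) Ts)"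
    by (rule ext) (simp add: cp_def cp_map_def a compose_def)
  then show "cp a \<in> bop H H"
    using bop_compose[OF hH hT bop_compose[OF hH hT Ts_bop amp_bop[OF a]] Tt_bop] by simp
  fix d h assume d: "d \<in> N" and h: "h \<in> carrier H"
  show "d (cp a h) = cp a (d h)"
    using a d h by (simp add: cp_apply N_closed Ts_lrep amp_lrep Ts_closed Tt_lrep amp_closed)
qed

abbreviation St where "St \<equiv> stine H M' cp"
abbreviation se where "se \<equiv> stine_elem H M' cp"

lemma stine_gram:
  assumes "p \<in> M' \<times> carrier H" "q \<in> M' \<times> carrier H"
  shows "stine_ker H cp p q
    = cinner I.ET (case p of (a, h) \<Rightarrow> amp a (Ts h)) (case q of (a, h) \<Rightarrow> amp a (Ts h))"
proof -
  obtain a h b k where pq: "p = (a, h)" "q = (b, k)" and a: "a \<in> M'" and h: "h \<in> carrier H"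
    and b: "b \<in> M'" and k: "k \<in> carrier H" using assms by auto
  note a' = M'_adj[OF a]
  have "cinner I.ET (amp a (Ts h)) (amp b (Ts k)) = cinner I.ET (Ts h) (amp (adj H H a) (amp b (Ts k)))"
    using amp_adj[OF a' Ts_closed[OF h] amp_closed[OF b Ts_closed[OF k]]]
      adj_adj[OF H.hilbert_space_axioms H.hilbert_space_axioms M'_bop[OF a]] by simp
  also have "\<dots> = cinner H h (cp (compose (carrier H) (adj H H a) b) k)"
    using a' b h k by (simp add: cp_apply M'_compose amp_compose Ts_closed cinner_Ts_left amp_closed)
  finally show ?thesis by (simp add: stine_ker_def pq)
qed

lemma amp_Ts_closed: "p \<in> M' \<times> carrier H \<Longrightarrow> (case p of (a, h) \<Rightarrow> amp a (Ts h)) \<in> carrier I.ET"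
  by (auto simp: amp_closed Ts_closed)

sublocale S: psd_kernel "M' \<times> carrier H" "stine_ker H cp"
  by (rule gram_kernel_psd[OF I.ET_hilbert amp_Ts_closed stine_gram])

lemma St_hilbert: "hilbert_space St" unfolding stine_def by (rule S.completion_hilbert)

sublocale St: hilbert_space St by (rule St_hilbert)

lemma se_eq: "(\<lambda>(a, h). se a h) = S.e" by (auto simp: stine_elem_def)

lemma se_closed: "a \<in> M' \<Longrightarrow> h \<in> carrier H \<Longrightarrow> se a h \<in> carrier St"
  unfolding stine_def stine_elem_def by (rule S.elem_closed) simp

lemma se_total: "total_family St (M' \<times> carrier H) (\<lambda>(a, h). se a h)"
  unfolding se_eq stine_def by (rule S.elem_total)

text \<open>The isometry \<open>a \<otimes> h \<mapsto> (I \<otimes> a) T\<^sup>* h\<close> from \<open>M \<otimes>\<^sub>\<Theta> H\<close> to \<open>E \<otimes> H\<close>; here \<open>\<Theta>\<close> is called \<open>cp\<close>.\<close>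

definition V :: "(('h \<Rightarrow> 'h) \<times> 'h) hcompl \<Rightarrow> ('e \<times> 'h) hcompl" where
  "V = op_ext St I.ET (M' \<times> carrier H) (\<lambda>(a, h). se a h) (\<lambda>(a, h). amp a (Ts h))"

lemma V_isometry: "isometry St I.ET V"
  and V_se: "a \<in> M' \<Longrightarrow> h \<in> carrier H \<Longrightarrow> V (se a h) = amp a (Ts h)"
proof -
  note V = gram_kernel_isometry[OF I.ET_hilbert amp_Ts_closed stine_gram]
  show "isometry St I.ET V"
    unfolding V_def se_eq stine_def by (rule V(1))
  have "V (S.e p) = (case p of (a, h) \<Rightarrow> amp a (Ts h))" if "p \<in> M' \<times> carrier H" for p
    unfolding V_def se_eq stine_def by (rule V(2)) (assumption | rule that)+
  from this[of "(a, h)"] show "a \<in> M' \<Longrightarrow> h \<in> carrier H \<Longrightarrow> V (se a h) = amp a (Ts h)"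
    by (simp add: stine_elem_def)
qed

lemmas V_bop = isometry_bop[OF V_isometry]
lemmas V_closed = bop_closed[OF V_bop]
lemma stine_left_bop: "m \<in> M' \<Longrightarrow> stine_left H M' cp m \<in> bop St St"
  and V_stine_left: "m \<in> M' \<Longrightarrow> u \<in> carrier St \<Longrightarrow> V (stine_left H M' cp m u) = amp m (V u)"
proof -
  assume m: "m \<in> M'"
  note tr = op_ext_transport[OF St_hilbert St_hilbert I.ET_hilbert I.ET_hilbert se_total V_bop V_isometry
      amp_bop[OF m], where f = "\<lambda>(b, h). se (compose (carrier H) m b) h"]
  have 1: "(case p of (b, h) \<Rightarrow> se (compose (carrier H) m b) h) \<in> carrier St" if "p \<in> M' \<times> carrier H" for p
    using that m by (auto simp: se_closed M'_compose)
  have 2: "amp m (V (case p of (a, h) \<Rightarrow> se a h)) = V (case p of (b, h) \<Rightarrow> se (compose (carrier H) m b) h)"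
    if "p \<in> M' \<times> carrier H" for p
    using that m by (elim SigmaE) (simp add: V_se M'_compose amp_compose Ts_closed)
  show "stine_left H M' cp m \<in> bop St St" unfolding stine_left_def by (rule tr(1)[OF 1 2])
  show "u \<in> carrier St \<Longrightarrow> V (stine_left H M' cp m u) = amp m (V u)"
    unfolding stine_left_def by (rule tr(3)[OF 1 2])
qed

lemma stine_right_bop: "d \<in> N \<Longrightarrow> stine_right H M' cp d \<in> bop St St"
  and V_stine_right: "d \<in> N \<Longrightarrow> u \<in> carrier St \<Longrightarrow> V (stine_right H M' cp d u) = lrep d (V u)"
proof -
  assume d: "d \<in> N"
  note tr = op_ext_transport[OF St_hilbert St_hilbert I.ET_hilbert I.ET_hilbert se_total V_bop V_isometry
      lrep_bop[OF d], where f = "\<lambda>(b, h). se b (d h)"]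
  have 1: "(case p of (b, h) \<Rightarrow> se b (d h)) \<in> carrier St" if "p \<in> M' \<times> carrier H" for p
    using that d by (auto simp: se_closed N_closed)
  have 2: "lrep d (V (case p of (a, h) \<Rightarrow> se a h)) = V (case p of (b, h) \<Rightarrow> se b (d h))"
    if "p \<in> M' \<times> carrier H" for p
    using that d by (elim SigmaE) (simp add: V_se Ts_lrep amp_lrep[symmetric] Ts_closed N_closed)
  show "stine_right H M' cp d \<in> bop St St" unfolding stine_right_def by (rule tr(1)[OF 1 2])
  show "u \<in> carrier St \<Longrightarrow> V (stine_right H M' cp d u) = lrep d (V u)"
    unfolding stine_right_def by (rule tr(3)[OF 1 2])
qed

text \<open>\<open>T\<^sup>*\<close> takes its values in the range of \<open>V\<close>, so what is orthogonal to the range is killed by \<open>T\<close>.\<close>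

lemma V_onto: "V ` carrier St = carrier I.ET"
proof (rule intertwining_isometry_onto[OF St_hilbert V_isometry])
  show "\<exists>B\<in>bop St St. \<forall>x\<in>carrier St. amp m (V x) = V (B x)" if "m \<in> M'" for m
    using stine_left_bop[OF that] V_stine_left[OF that] by (intro bexI[of _ "stine_left H M' cp m"]) simp_all
  fix \<zeta> assume \<zeta>: "\<zeta> \<in> carrier E"
    and orth: "\<And>x h. x \<in> carrier St \<Longrightarrow> h \<in> carrier H \<Longrightarrow> cinner I.ET (V x) (I.te \<zeta> h) = 0"
  have "T \<zeta> k = T \<zero> k" if k: "k \<in> carrier H" for k
  proof (rule H.vec_eqI)
    show "T \<zeta> k \<in> carrier H" "T \<zero> k \<in> carrier H" using \<zeta> k by (simp_all add: T_closed)
    fix l assume l: "l \<in> carrier H"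
    have "V (se (op_one H) l) = Ts l" using V_se[OF M'_one l] amp_one[OF Ts_closed[OF l]] by simp
    then have "cinner I.ET (Ts l) (I.te \<zeta> k) = 0" using orth[OF se_closed[OF M'_one l] k] by simp
    then have "cinner H l (T \<zeta> k) = 0" using cinner_Ts_left[OF I.te_closed[OF \<zeta> k] l] Tt_te[OF \<zeta> k] by simp
    then show "cinner H l (T \<zeta> k) = cinner H l (T \<zero> k)" using l k by (simp add: T_zero)
  qed
  then show "\<zeta> = \<zero>" by (intro T_eqI) (use \<zeta> in auto)
qed

end

subsection \<open>Correspondences of intertwiners\<close>

lemma (in w_correspondence) corr_iso_inverse:
  assumes g: "corr_iso N E C g"
  shows "inj_on g (carrier E)"
    and "corr_iso N C E (\<lambda>R\<in>carrier C. the_inv_into (carrier E) g R)" (is "corr_iso N C E ?w")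
proof -
  have gc: "g \<xi> \<in> carrier C" if "\<xi> \<in> carrier E" for \<xi> using g that by (auto simp: corr_iso_def)
  have img: "g ` carrier E = carrier C" using g by (simp add: corr_iso_def)
  show inj: "inj_on g (carrier E)"
  proof (rule inj_onI)
    fix \<xi> \<eta> assume \<xi>: "\<xi> \<in> carrier E" and \<eta>: "\<eta> \<in> carrier E" and eq: "g \<xi> = g \<eta>"
    show "\<xi> = \<eta>"
    proof (rule module_eqI[OF \<xi> \<eta>])
      fix \<zeta> assume \<zeta>: "\<zeta> \<in> carrier E"
      have "ip E \<zeta> \<xi> = ip C (g \<zeta>) (g \<xi>)" "ip E \<zeta> \<eta> = ip C (g \<zeta>) (g \<eta>)"
        using g \<xi> \<eta> \<zeta> by (simp_all add: corr_iso_def)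
      then show "ip E \<zeta> \<xi> = ip E \<zeta> \<eta>" by (simp only: eq)
    qed
  qed
  have wg: "?w (g \<xi>) = \<xi>" if "\<xi> \<in> carrier E" for \<xi>
    using gc[OF that] the_inv_into_f_f[OF inj that] by simp
  show "corr_iso N C E ?w"
    unfolding corr_iso_def
  proof (intro conjI ballI allI)
    show "?w \<in> carrier C \<rightarrow>\<^sub>E carrier E"
    proof (rule restrict_PiE_iff[THEN iffD2], intro ballI)
      fix R assume "R \<in> carrier C"
      then show "the_inv_into (carrier E) g R \<in> carrier E"
        unfolding img[symmetric] by (rule the_inv_into_into[OF inj _ order_refl])
    qed
    show "?w ` carrier C = carrier E"
    proof -
      have "?w ` g ` carrier E = (\<lambda>\<xi>. \<xi>) ` carrier E"
        unfolding image_image by (rule image_cong[OF refl wg])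
      then show ?thesis unfolding img by simp
    qed
    fix R assume "R \<in> carrier C"
    then obtain \<xi> where \<xi>: "\<xi> \<in> carrier E" "R = g \<xi>" unfolding img[symmetric] by (rule imageE)
    show "?w (c \<odot>\<^bsub>C\<^esub> R) = c \<odot> ?w R" for c
    proof -
      have "c \<odot>\<^bsub>C\<^esub> R = g (c \<odot> \<xi>)" using g \<xi> by (simp add: corr_iso_def)
      then show ?thesis using wg[OF \<xi>(1)] wg[OF E_smult_closed[OF \<xi>(1)]] by (simp only: \<xi>(2))
    qed
    show "?w (lact C a R) = lact E a (?w R)" if a: "a \<in> N" for a
    proof -
      have "lact C a R = g (lact E a \<xi>)" using g \<xi> a by (simp add: corr_iso_def)
      then show ?thesis using wg[OF \<xi>(1)] wg[OF lact_closed[OF a \<xi>(1)]] by (simp only: \<xi>(2))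
    qed
    show "?w (ract C R a) = ract E (?w R) a" if a: "a \<in> N" for a
    proof -
      have "ract C R a = g (ract E \<xi> a)" using g \<xi> a by (simp add: corr_iso_def)
      then show ?thesis using wg[OF \<xi>(1)] wg[OF ract_closed[OF \<xi>(1) a]] by (simp only: \<xi>(2))
    qed
    fix R' assume "R' \<in> carrier C"
    then obtain \<eta> where \<eta>: "\<eta> \<in> carrier E" "R' = g \<eta>" unfolding img[symmetric] by (rule imageE)
    show "?w (R \<oplus>\<^bsub>C\<^esub> R') = ?w R \<oplus> ?w R'"
    proof -
      have "R \<oplus>\<^bsub>C\<^esub> R' = g (\<xi> \<oplus> \<eta>)" using g \<xi> \<eta> by (simp add: corr_iso_def)
      then show ?thesis using wg[OF \<xi>(1)] wg[OF \<eta>(1)] wg[OF M.a_closed[OF \<xi>(1) \<eta>(1)]] by (simp only: \<xi>(2) \<eta>(2))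
    qed
    show "ip E (?w R) (?w R') = ip C R R'"
      using g \<xi> \<eta> wg[OF \<xi>(1)] wg[OF \<eta>(1)] by (simp add: corr_iso_def)
  qed
qed

lemma (in w_correspondence) corr_iso_compose:
  assumes f: "corr_iso N E C f" and g: "corr_iso N C D g"
  shows "corr_iso N E D (\<lambda>\<xi>\<in>carrier E. g (f \<xi>))"
proof -
  have fc: "f \<xi> \<in> carrier C" if "\<xi> \<in> carrier E" for \<xi> using f that by (auto simp: corr_iso_def)
  have gc: "g \<xi> \<in> carrier D" if "\<xi> \<in> carrier C" for \<xi> using g that by (auto simp: corr_iso_def)
  have "(\<lambda>\<xi>\<in>carrier E. g (f \<xi>)) ` carrier E = g ` f ` carrier E" by (simp add: image_image)
  then have "(\<lambda>\<xi>\<in>carrier E. g (f \<xi>)) ` carrier E = carrier D" using f g by (simp add: corr_iso_def)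
  then show ?thesis
    using f g fc gc unfolding corr_iso_def by (simp add: E_smult_closed lact_closed ract_closed)
qed

text \<open>
  A Hilbert space carrying the two commuting actions that \<open>E \<otimes> H\<close> carries: by self-duality the
  intertwiners from \<open>H\<close> to it are the maps \<open>h \<mapsto> \<xi> \<otimes> h\<close>, so they form a copy of \<open>E\<close>.
\<close>

locale intertwiner_model = w_correspondence H N E + K: hilbert_space K
  for H :: "'h hspace" and N and E :: "('h \<Rightarrow> 'h, 'e, 'z) corr_scheme" (structure)
    and K :: "'k hspace" +
  fixes \<pi> \<rho> :: "('h \<Rightarrow> 'h) \<Rightarrow> 'k \<Rightarrow> 'k" and V :: "'k \<Rightarrow> ('e \<times> 'h) hcompl"
  assumes V_iso: "isometry K I.ET V"
    and V_surj: "V ` carrier K = carrier I.ET"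
    and \<pi>_bop: "m \<in> M' \<Longrightarrow> \<pi> m \<in> bop K K"
    and \<rho>_bop: "d \<in> N \<Longrightarrow> \<rho> d \<in> bop K K"
    and V_\<pi>: "\<lbrakk>m \<in> M'; x \<in> carrier K\<rbrakk> \<Longrightarrow> V (\<pi> m x) = amp m (V x)"
    and V_\<rho>: "\<lbrakk>d \<in> N; x \<in> carrier K\<rbrakk> \<Longrightarrow> V (\<rho> d x) = lrep d (V x)"
begin

abbreviation C where "C \<equiv> intertwiners H M' K \<pi> \<rho>"

lemma C_iff: "R \<in> carrier C \<longleftrightarrow> R \<in> bop H K \<and> (\<forall>m\<in>M'. \<forall>h\<in>carrier H. R (m h) = \<pi> m (R h))"
proof
  assume R: "R \<in> carrier C"
  show "R \<in> bop H K \<and> (\<forall>m\<in>M'. \<forall>h\<in>carrier H. R (m h) = \<pi> m (R h))"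
  proof (intro conjI ballI)
    show "R \<in> bop H K" using R by (simp add: intertwiners_def)
    fix m h assume m: "m \<in> M'" and h: "h \<in> carrier H"
    have "compose (carrier H) R m = compose (carrier H) (\<pi> m) R"
      using R m by (simp add: intertwiners_def)
    then have "compose (carrier H) R m h = compose (carrier H) (\<pi> m) R h" by simp
    then show "R (m h) = \<pi> m (R h)" using h by (simp add: compose_eq)
  qed
next
  assume R: "R \<in> bop H K \<and> (\<forall>m\<in>M'. \<forall>h\<in>carrier H. R (m h) = \<pi> m (R h))"
  then have "compose (carrier H) R m = compose (carrier H) (\<pi> m) R" if "m \<in> M'" for m
    by (intro ext) (use that in \<open>simp add: compose_def\<close>)
  then show "R \<in> carrier C" using R by (simp add: intertwiners_def)
qed

definition g :: "'e \<Rightarrow> 'h \<Rightarrow> 'k" where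
  "g = (\<lambda>\<xi>\<in>carrier E. compose (carrier H) (adj K I.ET V) (I.L_op \<xi>))"

lemma g_bop: "\<xi> \<in> carrier E \<Longrightarrow> g \<xi> \<in> bop H K"
  using bop_compose[OF H.hilbert_space_axioms I.ET_hilbert I.L_bop
      adj_bop[OF K.hilbert_space_axioms I.ET_hilbert isometry_bop[OF V_iso]]] by (simp add: g_def)

lemma g_apply_closed: "\<xi> \<in> carrier E \<Longrightarrow> h \<in> carrier H \<Longrightarrow> g \<xi> h \<in> carrier K"
  by (rule bop_closed[OF g_bop])

lemma V_g:
  assumes \<xi>: "\<xi> \<in> carrier E" and h: "h \<in> carrier H"
  shows "V (g \<xi> h) = I.te \<xi> h"
proof -
  obtain x where x: "x \<in> carrier K" "I.te \<xi> h = V x" using V_surj I.te_closed[OF \<xi> h] by blast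
  then show ?thesis
    using \<xi> h isometry_adj[OF K.hilbert_space_axioms I.ET_hilbert V_iso x(1)]
    by (simp add: g_def compose_eq I.L_op_def)
qed

lemmas V_cancel = isometry_inj[OF K.hilbert_space_axioms I.ET_hilbert V_iso]

lemma g_eqI:
  assumes Z: "Z \<in> bop H K" and \<xi>: "\<xi> \<in> carrier E" and eq: "\<And>h. h \<in> carrier H \<Longrightarrow> V (Z h) = I.te \<xi> h"
  shows "g \<xi> = Z"
proof (rule bop_eqI[OF g_bop[OF \<xi>] Z])
  fix h assume h: "h \<in> carrier H"
  show "g \<xi> h = Z h"
    by (rule V_cancel[OF g_apply_closed[OF \<xi> h] bop_closed[OF Z h]]) (simp add: V_g[OF \<xi> h] eq[OF h])
qed

lemma g_closed:
  assumes \<xi>: "\<xi> \<in> carrier E"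
  shows "g \<xi> \<in> carrier C"
  unfolding C_iff
proof (intro conjI ballI g_bop[OF \<xi>])
  fix m h assume m: "m \<in> M'" and h: "h \<in> carrier H"
  show "g \<xi> (m h) = \<pi> m (g \<xi> h)"
    by (rule V_cancel[OF g_apply_closed[OF \<xi> M'_closed[OF m h]] bop_closed[OF \<pi>_bop[OF m] g_apply_closed[OF \<xi> h]]])
      (simp add: V_g \<xi> h m M'_closed V_\<pi> g_apply_closed amp_te)
qed

lemma g_surj:
  assumes R: "R \<in> carrier C"
  obtains \<xi> where "\<xi> \<in> carrier E" "g \<xi> = R"
proof -
  have Rb: "R \<in> bop H K" using R by (simp add: C_iff)
  note Rc = bop_closed[OF Rb]
  have "compose (carrier H) V R (m h) = amp m (compose (carrier H) V R h)" if "m \<in> M'" "h \<in> carrier H" for m h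
    using that R V_\<pi>[OF that(1) Rc[OF that(2)]] by (simp add: compose_eq M'_closed C_iff)
  then obtain \<xi> where \<xi>: "\<xi> \<in> carrier E" "\<And>h. h \<in> carrier H \<Longrightarrow> compose (carrier H) V R h = I.te \<xi> h"
    using intertwiner_represented[OF bop_compose[OF H.hilbert_space_axioms K.hilbert_space_axioms Rb
          isometry_bop[OF V_iso]]] by blast
  have "g \<xi> = R" by (rule g_eqI[OF Rb \<xi>(1)]) (simp add: \<xi>(2)[symmetric] compose_eq)
  with \<xi>(1) show thesis by (rule that)
qed

lemma g_iso: "corr_iso N E C g"
  unfolding corr_iso_def
proof (intro conjI ballI allI)
  note hT = I.ET_hilbert and hK = K.hilbert_space_axioms and hH = H.hilbert_space_axioms
  note V_bop = isometry_bop[OF V_iso]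
  show "g \<in> carrier E \<rightarrow>\<^sub>E carrier C" using g_closed by (auto simp: g_def)
  show "g ` carrier E = carrier C"
  proof
    show "g ` carrier E \<subseteq> carrier C" using g_closed by blast
    show "carrier C \<subseteq> g ` carrier E" using g_surj by blast
  qed
  fix \<xi> assume \<xi>: "\<xi> \<in> carrier E"
  note gb = g_bop[OF \<xi>] and gc = g_apply_closed[OF \<xi>] and Vg = V_g[OF \<xi>]
  show "g (c \<odot> \<xi>) = c \<odot>\<^bsub>C\<^esub> g \<xi>" for c
  proof (rule g_eqI[OF _ E_smult_closed[OF \<xi>]])
    show "c \<odot>\<^bsub>C\<^esub> g \<xi> \<in> bop H K" using op_smult_bop[OF hH hK gb] by (simp add: intertwiners_def)
    show "V ((c \<odot>\<^bsub>C\<^esub> g \<xi>) h) = I.te (c \<odot> \<xi>) h" if "h \<in> carrier H" for h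
      using that by (simp add: intertwiners_def op_smult_def bop_scale[OF V_bop] gc Vg te_scale_left \<xi>)
  qed
  show "g (lact E d \<xi>) = lact C d (g \<xi>)" if d: "d \<in> N" for d
  proof (rule g_eqI[OF _ lact_closed[OF d \<xi>]])
    show "lact C d (g \<xi>) \<in> bop H K" using bop_compose[OF hH hK gb \<rho>_bop[OF d]] by (simp add: intertwiners_def)
    show "V (lact C d (g \<xi>) h) = I.te (lact E d \<xi>) h" if "h \<in> carrier H" for h
      using that d by (simp add: intertwiners_def compose_eq V_\<rho> gc Vg lrep_te \<xi>)
  qed
  show "g (ract E \<xi> d) = ract C (g \<xi>) d" if d: "d \<in> N" for d
  proof (rule g_eqI[OF _ ract_closed[OF \<xi> d]])
    show "ract C (g \<xi>) d \<in> bop H K" using bop_compose[OF hH hH N_bop[OF d] gb] by (simp add: intertwiners_def)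
    show "V (ract C (g \<xi>) d h) = I.te (ract E \<xi> d) h" if "h \<in> carrier H" for h
      using that d by (simp add: intertwiners_def compose_eq N_closed Vg te_ract \<xi>)
  qed
  fix \<eta> assume \<eta>: "\<eta> \<in> carrier E"
  show "g (\<xi> \<oplus> \<eta>) = g \<xi> \<oplus>\<^bsub>C\<^esub> g \<eta>"
  proof (rule g_eqI[OF _ M.a_closed[OF \<xi> \<eta>]])
    show "g \<xi> \<oplus>\<^bsub>C\<^esub> g \<eta> \<in> bop H K" using op_add_bop[OF hH hK gb g_bop[OF \<eta>]] by (simp add: intertwiners_def)
    show "V ((g \<xi> \<oplus>\<^bsub>C\<^esub> g \<eta>) h) = I.te (\<xi> \<oplus> \<eta>) h" if "h \<in> carrier H" for h
      using that by (simp add: intertwiners_def op_add_def bop_add[OF V_bop] gc g_apply_closed[OF \<eta>] Vg V_g[OF \<eta>]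
          te_add_left \<xi> \<eta>)
  qed
  show "ip C (g \<xi>) (g \<eta>) = ip E \<xi> \<eta>"
  proof -
    have ipb: "ip C (g \<xi>) (g \<eta>) \<in> bop H H"
      using bop_compose[OF hH hK g_bop[OF \<eta>] adj_bop[OF hH hK gb]] by (simp add: intertwiners_def)
    show ?thesis
    proof (rule bop_eqI[OF ipb ip_bop[OF \<xi> \<eta>]])
      fix h assume h: "h \<in> carrier H"
      show "ip C (g \<xi>) (g \<eta>) h = ip E \<xi> \<eta> h"
      proof (rule H.vec_eqI[OF bop_closed[OF ipb h] ip_apply_closed[OF \<xi> \<eta> h]])
        fix k assume k: "k \<in> carrier H"
        note gh = g_apply_closed[OF \<eta> h]
        have "cinner H k (ip C (g \<xi>) (g \<eta>) h) = cinner K (g \<xi> k) (g \<eta> h)"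
          using h cinner_adj_right[OF hH hK gb k gh] by (simp add: intertwiners_def compose_eq)
        also have "\<dots> = cinner I.ET (I.te \<xi> k) (I.te \<eta> h)"
          using isometry_inner[OF V_iso gc[OF k] gh] Vg[OF k] V_g[OF \<eta> h] by simp
        finally show "cinner H k (ip C (g \<xi>) (g \<eta>) h) = cinner H k (ip E \<xi> \<eta> h)"
          using cinner_te_id[OF \<xi> k \<eta> h] by simp
      qed
    qed
  qed
qed

definition w :: "('h \<Rightarrow> 'k) \<Rightarrow> 'e" where
  "w = (\<lambda>R\<in>carrier C. the_inv_into (carrier E) g R)"

lemma w_iso: "corr_iso N C E w" unfolding w_def by (rule corr_iso_inverse(2)[OF g_iso])

lemma w_g: "\<xi> \<in> carrier E \<Longrightarrow> w (g \<xi>) = \<xi>"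
  using g_closed the_inv_into_f_f[OF corr_iso_inverse(1)[OF g_iso]] by (simp add: w_def)

lemma w_closed: "R \<in> carrier C \<Longrightarrow> w R \<in> carrier E"
  using w_iso by (auto simp: corr_iso_def)

lemma g_w: "R \<in> carrier C \<Longrightarrow> g (w R) = R"
  by (elim g_surj) (use w_g in auto)

lemma V_w: "R \<in> carrier C \<Longrightarrow> h \<in> carrier H \<Longrightarrow> V (R h) = I.te (w R) h"
  using V_g[OF w_closed] g_w by metis

end

context injective_rep begin

sublocale cor: intertwiner_model H N E St "stine_left H M' cp" "stine_right H M' cp" V
  by (intro intertwiner_model.intro intertwiner_model_axioms.intro w_correspondence_axioms St_hilbert V_isometry V_onto)
    (erule stine_left_bop stine_right_bop V_stine_left V_stine_right, assumption?)+

lemma cor_C: "cor.C = cp_corr H M' cp" by (simp add: cp_corr_def)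

lemma T_eq_cp_rep:
  assumes R: "R \<in> carrier cor.C"
  shows "T (cor.w R) = cp_rep H M' cp R"
proof -
  note hT = I.ET_hilbert and hS = St_hilbert and hH = H.hilbert_space_axioms
  have Rb: "R \<in> bop H St" using R by (simp add: cor.C_iff)
  note Rc = bop_closed[OF Rb] and wR = cor.w_closed[OF R]
  \<comment> \<open>\<open>V W = T\<^sup>*\<close>, hence \<open>W\<^sup>* R\<close> is \<open>T\<close> applied to \<open>V R\<close>.\<close>
  define W where "W = (\<lambda>h\<in>carrier H. se (op_one H) h)"
  have VW: "V (W h) = Ts h" if "h \<in> carrier H" for h
    using that by (simp add: W_def V_se M'_one amp_one Ts_closed)
  have "W = compose (carrier H) (adj St I.ET V) Ts"
    by (rule ext) (use isometry_adj[OF hS hT V_isometry se_closed[OF M'_one]] V_se[OF M'_one] amp_one[OF Ts_closed]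
      in \<open>auto simp: W_def compose_def\<close>)
  then have W: "W \<in> bop H St" using bop_compose[OF hH hT Ts_bop adj_bop[OF hS hT V_bop]] by simp
  have rep: "cp_rep H M' cp R = compose (carrier H) (adj H St W) R" by (simp add: cp_rep_def W_def)
  have rb: "compose (carrier H) (adj H St W) R \<in> bop H H"
    by (rule bop_compose[OF hH hS Rb adj_bop[OF hH hS W]])
  show ?thesis
    unfolding rep
  proof (rule bop_eqI[OF T_bop[OF wR] rb])
    fix h assume h: "h \<in> carrier H"
    show "T (cor.w R) h = compose (carrier H) (adj H St W) R h"
    proof (rule H.vec_eqI[OF T_closed[OF wR h] bop_closed[OF rb h]])
      fix k assume k: "k \<in> carrier H"
      have "cinner H k (compose (carrier H) (adj H St W) R h) = cinner St (W k) (R h)"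
        using h cinner_adj_right[OF hH hS W k Rc[OF h]] by (simp add: compose_eq)
      also have "\<dots> = cinner I.ET (Ts k) (I.te (cor.w R) h)"
        using isometry_inner[OF V_isometry bop_closed[OF W k] Rc[OF h]] VW[OF k] cor.V_w[OF R h] by simp
      also have "\<dots> = cinner H k (T (cor.w R) h)"
        using cinner_Ts_left[OF I.te_closed[OF wR h] k] Tt_te[OF wR h] by simp
      finally show "cinner H k (T (cor.w R) h) = cinner H k (compose (carrier H) (adj H St W) R h)" by simp
    qed
  qed
qed

end

section \<open>Balanced tensor products\<close>

context w_correspondence begin

lemma cinner_te_enorm:
  assumes "\<xi> \<in> carrier E" "h \<in> carrier H"
  shows "hnorm I.ET (I.te \<xi> h) \<le> enorm H E \<xi> * hnorm H h"
  using I.te_norm[OF assms] unfolding enorm_def id_apply .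

lemma enorm_nonneg: "\<xi> \<in> carrier E \<Longrightarrow> 0 \<le> enorm H E \<xi>"
  unfolding enorm_def using opnorm_nonneg[OF H.hilbert_space_axioms ip_bop] by simp

text \<open>Cauchy-Schwarz for the module, read off from the vectors \<open>p \<otimes> k\<close> and \<open>x \<otimes> h\<close>.\<close>

lemma ip_bounded_module_map:
  assumes p: "p \<in> carrier E" and U: "U \<subseteq> carrier E"
  shows "bounded_module_map H N E U (\<lambda>x. ip E p x)"
  unfolding bounded_module_map_def
proof (intro conjI ballI allI exI)
  fix x assume "x \<in> U"
  then have x: "x \<in> carrier E" using U by blast
  show "ip E p (c \<odot> x) = op_smult H H c (ip E p x)" for c by (rule ip_smult[OF p x])
  show "ip E p (ract E x a) = compose (carrier H) (ip E p x) a" if "a \<in> N" for a by (rule ip_ract[OF p x that])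
  show "ip E p (x \<oplus> y) = op_add H H (ip E p x) (ip E p y)" if "y \<in> U" for y
    by (rule ip_add[OF p x]) (use that U in blast)
  show "opnorm H H (ip E p x) \<le> enorm H E p * enorm H E x"
  proof (rule opnorm_le)
    show "0 \<le> enorm H E p * enorm H E x" using enorm_nonneg p x by simp
    fix h assume h: "h \<in> carrier H"
    define k where "k = ip E p x h"
    have k: "k \<in> carrier H" unfolding k_def by (rule ip_apply_closed[OF p x h])
    have "(hnorm H k)\<^sup>2 = Re (cinner I.ET (I.te p k) (I.te x h))"
      using cinner_te_id[OF p k x h] H.hnorm_sq[OF k] by (simp add: k_def)
    also have "\<dots> \<le> hnorm I.ET (I.te p k) * hnorm I.ET (I.te x h)"
      using I.ET.cauchy_schwarz[OF I.te_closed[OF p k] I.te_closed[OF x h]] complex_Re_le_cmod order_trans by blast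
    also have "\<dots> \<le> (enorm H E p * hnorm H k) * (enorm H E x * hnorm H h)"
      by (intro mult_mono cinner_te_enorm I.ET.hnorm_nonneg I.te_closed mult_nonneg_nonneg
          enorm_nonneg H.hnorm_nonneg p x h k)
    finally have "hnorm H k * hnorm H k \<le> hnorm H k * (enorm H E p * enorm H E x * hnorm H h)"
      by (simp only: power2_eq_square mult_ac)
    then show "hnorm H (ip E p x h) \<le> enorm H E p * enorm H E x * hnorm H h"
      unfolding k_def[symmetric] by (rule le_of_square_le) (simp_all add: H.hnorm_nonneg k h enorm_nonneg p x)
  qed
qed (use ip_closed[OF p] U in auto)

lemma te_diff_left:
  assumes "\<xi> \<in> carrier E" "\<eta> \<in> carrier E" "h \<in> carrier H"
  shows "I.te (\<xi> \<ominus> \<eta>) h = I.te \<xi> h \<ominus>\<^bsub>I.ET\<^esub> I.te \<eta> h"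
  unfolding module_diff_eq[OF module_axioms assms(1,2)]
    I.ET.diff_eq[OF I.te_closed[OF assms(1,3)] I.te_closed[OF assms(2,3)]]
    te_add_left[OF assms(1) E_smult_closed[OF assms(2)] assms(3)] te_scale_left[OF assms(2,3)] ..

end

text \<open>
  By continuity both elements define the same module map on the closed span of the elementary tensors,
  so the uniqueness in the self-dual extension applies.
\<close>

lemma is_tensor_separating:
  assumes P: "is_tensor H N E F P" and p: "p \<in> carrier P" and q: "q \<in> carrier P"
    and eq: "\<And>\<xi> \<eta>. \<xi> \<in> carrier E \<Longrightarrow> \<eta> \<in> carrier F \<Longrightarrow> ip P p (tens P \<xi> \<eta>) = ip P q (tens P \<xi> \<eta>)"
  shows "p = q"
proof -
  interpret P: w_correspondence H N P using P by (simp add: is_tensor_def)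
  let ?U = "tens_closure H E F P"
  have U: "?U \<subseteq> carrier P" by (auto simp: tens_closure_def)
  have tc: "tens P \<xi> \<eta> \<in> carrier P" if "\<xi> \<in> carrier E" "\<eta> \<in> carrier F" for \<xi> \<eta>
    using P that by (simp add: is_tensor_def)
  have agree: "ip P p x = ip P q x" if x: "x \<in> ?U" for x
  proof (rule bop_eqI)
    have xP: "x \<in> carrier P" using x U by blast
    show "ip P p x \<in> bop H H" "ip P q x \<in> bop H H" using p q xP by (simp_all add: P.ip_bop)
    fix h assume h: "h \<in> carrier H"
    show "ip P p x h = ip P q x h"
    proof (rule P.H.vec_eqI[OF P.ip_apply_closed[OF p xP h] P.ip_apply_closed[OF q xP h]])
      fix k assume k: "k \<in> carrier H"
      define u where "u = P.I.te p k \<ominus>\<^bsub>P.I.ET\<^esub> P.I.te q k"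
      note pk = P.I.te_closed[OF p k] and qk = P.I.te_closed[OF q k]
      have u: "u \<in> carrier P.I.ET" unfolding u_def using pk qk by simp
      have ut: "cinner P.I.ET u (P.I.te y h) = cinner H k (ip P p y h) - cinner H k (ip P q y h)"
        if "y \<in> carrier P" for y
        unfolding u_def using P.I.ET.cinner_diff_left[OF P.I.te_closed[OF that h] pk qk]
          P.cinner_te_id[OF p k that h] P.cinner_te_id[OF q k that h] by simp
      have small: "cmod (cinner P.I.ET u (P.I.te x h)) \<le> hnorm P.I.ET u * (\<epsilon> * hnorm H h)" if \<epsilon>: "0 < \<epsilon>" for \<epsilon>
      proof -
        obtain n :: nat and \<xi> \<eta> where \<xi>\<eta>: "\<And>i. i < n \<Longrightarrow> \<xi> i \<in> carrier E \<and> \<eta> i \<in> carrier F"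
          and close: "enorm H P (x \<ominus>\<^bsub>P\<^esub> (\<Oplus>\<^bsub>P\<^esub>i\<in>{..<n}. tens P (\<xi> i) (\<eta> i))) < \<epsilon>"
          using x \<epsilon> unfolding tens_closure_def by blast
        define s where "s = (\<Oplus>\<^bsub>P\<^esub>i\<in>{..<n}. tens P (\<xi> i) (\<eta> i))"
        have tci: "tens P (\<xi> i) (\<eta> i) \<in> carrier P" if "i \<in> {..<n}" for i using \<xi>\<eta> that tc by simp
        have s: "s \<in> carrier P" unfolding s_def using tci by (intro P.M.finsum_closed) auto
        have sh: "cinner P.I.ET u (P.I.te s h) = 0"
        proof -
          have "P.I.te s h = (\<Oplus>\<^bsub>P.I.ET\<^esub>i\<in>{..<n}. P.I.te (tens P (\<xi> i) (\<eta> i)) h)"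
            unfolding s_def by (rule P.te_finsum_left[OF finite_lessThan tci h])
          then have "cinner P.I.ET u (P.I.te s h) = (\<Sum>i<n. cinner P.I.ET u (P.I.te (tens P (\<xi> i) (\<eta> i)) h))"
            using P.I.ET.cinner_finsum_right[OF finite_lessThan P.I.te_closed[OF tci h] u] by simp
          also have "\<dots> = 0"
            by (rule sum.neutral) (use tci ut \<xi>\<eta> eq in simp)
          finally show ?thesis .
        qed
        have d: "x \<ominus>\<^bsub>P\<^esub> s \<in> carrier P" using xP s by (rule P.M.minus_closed)
        note xh = P.I.te_closed[OF xP h] and sc = P.I.te_closed[OF s h]
        have "cinner P.I.ET u (P.I.te x h) = cinner P.I.ET u (P.I.te (x \<ominus>\<^bsub>P\<^esub> s) h)"
          unfolding P.te_diff_left[OF xP s h] using P.I.ET.cinner_diff_right[OF u xh sc] sh by simp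
        also have "cmod \<dots> \<le> hnorm P.I.ET u * hnorm P.I.ET (P.I.te (x \<ominus>\<^bsub>P\<^esub> s) h)"
          by (rule P.I.ET.cauchy_schwarz[OF u P.I.te_closed[OF d h]])
        also have "\<dots> \<le> hnorm P.I.ET u * (enorm H P (x \<ominus>\<^bsub>P\<^esub> s) * hnorm H h)"
          by (intro mult_left_mono P.cinner_te_enorm d h P.I.ET.hnorm_nonneg u)
        also have "\<dots> \<le> hnorm P.I.ET u * (\<epsilon> * hnorm H h)"
          using close[folded s_def] by (intro mult_left_mono mult_right_mono P.I.ET.hnorm_nonneg P.H.hnorm_nonneg u h) simp
        finally show ?thesis .
      qed
      have "cmod (cinner P.I.ET u (P.I.te x h)) \<le> 0"
      proof (rule field_le_epsilon)
        fix \<delta> :: real assume \<delta>: "0 < \<delta>"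
        define c where "c = hnorm P.I.ET u * hnorm H h"
        have c: "0 \<le> c" unfolding c_def using P.I.ET.hnorm_nonneg[OF u] P.H.hnorm_nonneg[OF h] by simp
        then have "0 < \<delta> / (c + 1)" using \<delta> by (simp add: add_nonneg_pos)
        note small[OF this]
        also have "hnorm P.I.ET u * (\<delta> / (c + 1) * hnorm H h) = c * (\<delta> / (c + 1))"
          by (simp only: c_def mult_ac)
        also have "\<dots> \<le> (c + 1) * (\<delta> / (c + 1))"
          using c \<delta> by (intro mult_right_mono) (simp_all add: add_nonneg_pos)
        also have "\<dots> = \<delta>" using c by (simp add: add_nonneg_eq_0_iff)
        finally show "cmod (cinner P.I.ET u (P.I.te x h)) \<le> 0 + \<delta>" by simp
      qed
      then show "cinner H k (ip P p x h) = cinner H k (ip P q x h)" using ut[OF xP] by simp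
    qed
  qed
  have "bounded_module_map H N P ?U (\<lambda>x. ip P p x)" by (rule P.ip_bounded_module_map[OF p U])
  then have "\<exists>!\<xi>. \<xi> \<in> carrier P \<and> (\<forall>x\<in>?U. ip P p x = ip P \<xi> x)"
    using P unfolding is_tensor_def represents_dual_def by simp
  moreover have "p \<in> carrier P \<and> (\<forall>x\<in>?U. ip P p x = ip P p x)" using p by simp
  moreover have "q \<in> carrier P \<and> (\<forall>x\<in>?U. ip P p x = ip P q x)" using q agree by simp
  ultimately show ?thesis by (metis (no_types, lifting) the1_equality)
qed

text \<open>
  The map \<open>\<tau>\<close> of elementary tensors is a parameter of its own, so that a tensor product of two
  correspondences is at once one of any isomorphic correspondences.
\<close>

locale tensor = E: w_correspondence H N E + F: w_correspondence H N F + P: w_correspondence H N P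
  for H :: "'h hspace" and N and E :: "('h \<Rightarrow> 'h, 'e) corr" and F :: "('h \<Rightarrow> 'h, 'f) corr"
    and P :: "('h \<Rightarrow> 'h, 'p, 'z) corr_scheme" +
  fixes \<tau> :: "'e \<Rightarrow> 'f \<Rightarrow> 'p"
  assumes \<tau>_closed: "\<lbrakk>\<xi> \<in> carrier E; \<eta> \<in> carrier F\<rbrakk> \<Longrightarrow> \<tau> \<xi> \<eta> \<in> carrier P"
    and ip_\<tau>: "\<lbrakk>\<xi> \<in> carrier E; \<eta> \<in> carrier F; \<xi>' \<in> carrier E; \<eta>' \<in> carrier F\<rbrakk>
      \<Longrightarrow> ip P (\<tau> \<xi> \<eta>) (\<tau> \<xi>' \<eta>') = ip F \<eta> (lact F (ip E \<xi> \<xi>') \<eta>')"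
    and lact_\<tau>: "\<lbrakk>a \<in> N; \<xi> \<in> carrier E; \<eta> \<in> carrier F\<rbrakk> \<Longrightarrow> lact P a (\<tau> \<xi> \<eta>) = \<tau> (lact E a \<xi>) \<eta>"
    and separating: "\<lbrakk>p \<in> carrier P; q \<in> carrier P;
        \<And>\<xi> \<eta>. \<xi> \<in> carrier E \<Longrightarrow> \<eta> \<in> carrier F \<Longrightarrow> ip P p (\<tau> \<xi> \<eta>) = ip P q (\<tau> \<xi> \<eta>)\<rbrakk> \<Longrightarrow> p = q"
begin

text \<open>
  For fixed \<open>\<xi>\<close> the map \<open>\<eta> \<otimes> h \<mapsto> (\<xi> \<otimes> \<eta>) \<otimes> h\<close> is bounded, because the Gram kernel of its values is that of
  the left action of \<open>\<langle>\<xi>, \<xi>\<rangle>\<close> on \<open>F \<otimes> H\<close>.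
\<close>

lemma j_exists:
  assumes \<xi>: "\<xi> \<in> carrier E"
  shows "\<exists>A. A \<in> bop F.I.ET P.I.ET \<and>
    (\<forall>\<eta>\<in>carrier F. \<forall>h\<in>carrier H. A (F.I.te \<eta> h) = P.I.te (\<tau> \<xi> \<eta>) h)"
proof -
  note hF = F.I.ET_hilbert and hP = P.I.ET_hilbert
  let ?n = "ip E \<xi> \<xi>" and ?v = "\<lambda>(\<eta>, h). P.I.te (\<tau> \<xi> \<eta>) h" and ?t = "\<lambda>(\<eta>, h). F.I.te \<eta> h"
  have n: "?n \<in> N" by (rule E.ip_closed[OF \<xi> \<xi>])
  define c where "c = opnorm F.I.ET F.I.ET (F.lrep ?n)"
  have c: "0 \<le> c" unfolding c_def by (rule opnorm_nonneg[OF hF F.lrep_bop[OF n]])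
  obtain A where "A \<in> bop F.I.ET P.I.ET"
    "\<And>\<eta> h. \<eta> \<in> carrier F \<Longrightarrow> h \<in> carrier H \<Longrightarrow> A (F.I.te \<eta> h) = ?v (\<eta>, h)"
  proof (rule F.I.te_extend[OF hP, where v = ?v and C = "sqrt c"])
    show "?v (\<eta>, h) \<in> carrier P.I.ET" if "\<eta> \<in> carrier F" "h \<in> carrier H" for \<eta> h
      using that \<xi> by (simp add: P.I.te_closed \<tau>_closed)
    fix f assume f: "supp f \<subseteq> carrier F \<times> carrier H"
    have tc: "?t x \<in> carrier F.I.ET" if "x \<in> supp f" for x using f that by (auto simp: F.I.te_closed)
    have vc: "?v x \<in> carrier P.I.ET" if "x \<in> supp f" for x
      using f that \<xi> by (auto simp: P.I.te_closed \<tau>_closed)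
    let ?y = "lincomb F.I.ET ?t f" and ?w = "lincomb P.I.ET ?v f"
    have y: "?y \<in> carrier F.I.ET" using tc by (rule F.I.ET.lincomb_closed)
    have w: "?w \<in> carrier P.I.ET" using vc by (rule P.I.ET.lincomb_closed)
    have "cinner P.I.ET ?w ?w = (\<Sum>x\<in>supp f. \<Sum>y\<in>supp f. cnj (coef f x) * coef f y * cinner P.I.ET (?v x) (?v y))"
      by (rule P.I.ET.cinner_lincomb[OF vc vc])
    also have "\<dots> = (\<Sum>x\<in>supp f. \<Sum>y\<in>supp f. cnj (coef f x) * coef f y * cinner F.I.ET (?t x) (F.lrep ?n (?t y)))"
    proof (intro sum.cong refl)
      fix x y assume "x \<in> supp f" "y \<in> supp f"
      then have "x \<in> carrier F \<times> carrier H" "y \<in> carrier F \<times> carrier H" using f by blast+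
      then obtain \<eta> h \<eta>' h' where xy: "x = (\<eta>, h)" "y = (\<eta>', h')" "\<eta> \<in> carrier F" "h \<in> carrier H"
        "\<eta>' \<in> carrier F" "h' \<in> carrier H" by auto
      show "cnj (coef f x) * coef f y * cinner P.I.ET (?v x) (?v y)
        = cnj (coef f x) * coef f y * cinner F.I.ET (?t x) (F.lrep ?n (?t y))"
        using \<xi> xy n by (simp add: P.cinner_te_id F.cinner_te_id \<tau>_closed ip_\<tau> F.lrep_te F.lact_closed)
    qed
    also have "\<dots> = cinner F.I.ET ?y (lincomb F.I.ET (\<lambda>x. F.lrep ?n (?t x)) f)"
      by (rule F.I.ET.cinner_lincomb[symmetric]) (use tc bop_closed[OF F.lrep_bop[OF n]] in blast)+
    also have "\<dots> = cinner F.I.ET ?y (F.lrep ?n ?y)"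
      by (rule arg_cong[OF bop_lincomb[OF hF hF F.lrep_bop[OF n], where v = ?t, symmetric]]) (rule tc)
    finally have "(hnorm P.I.ET ?w)\<^sup>2 = Re (cinner F.I.ET ?y (F.lrep ?n ?y))"
      using P.I.ET.hnorm_sq[OF w] by simp
    also have "\<dots> \<le> c * (hnorm F.I.ET ?y)\<^sup>2"
      unfolding c_def by (rule form_le_opnorm[OF hF F.lrep_bop[OF n] y])
    also have "\<dots> = (sqrt c * hnorm F.I.ET ?y)\<^sup>2" using c by (simp add: power_mult_distrib)
    finally show "hnorm P.I.ET ?w \<le> sqrt c * hnorm F.I.ET ?y"
      by (rule power2_le_imp_le) (use c F.I.ET.hnorm_nonneg[OF y] in simp)
  qed blast
  then show ?thesis by auto
qed

definition j :: "'e \<Rightarrow> ('f \<times> 'h) hcompl \<Rightarrow> ('p \<times> 'h) hcompl" where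
  "j \<xi> = (SOME A. A \<in> bop F.I.ET P.I.ET \<and>
    (\<forall>\<eta>\<in>carrier F. \<forall>h\<in>carrier H. A (F.I.te \<eta> h) = P.I.te (\<tau> \<xi> \<eta>) h))"

lemma j_bop: "\<xi> \<in> carrier E \<Longrightarrow> j \<xi> \<in> bop F.I.ET P.I.ET"
  and j_te: "\<lbrakk>\<xi> \<in> carrier E; \<eta> \<in> carrier F; h \<in> carrier H\<rbrakk> \<Longrightarrow> j \<xi> (F.I.te \<eta> h) = P.I.te (\<tau> \<xi> \<eta>) h"
  using someI_ex[OF j_exists, of \<xi>] unfolding j_def[symmetric] by auto

lemma j_closed: "\<xi> \<in> carrier E \<Longrightarrow> u \<in> carrier F.I.ET \<Longrightarrow> j \<xi> u \<in> carrier P.I.ET"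
  by (rule bop_closed[OF j_bop])

lemma j_inner:
  assumes \<xi>: "\<xi> \<in> carrier E" and \<xi>': "\<xi>' \<in> carrier E" and u: "u \<in> carrier F.I.ET" and v: "v \<in> carrier F.I.ET"
  shows "cinner P.I.ET (j \<xi> u) (j \<xi>' v) = cinner F.I.ET u (F.lrep (ip E \<xi> \<xi>') v)"
proof -
  note hF = F.I.ET_hilbert and hP = P.I.ET_hilbert
  have n: "ip E \<xi> \<xi>' \<in> N" by (rule E.ip_closed[OF \<xi> \<xi>'])
  note ja = cinner_adj_right[OF hF hP j_bop[OF \<xi>]]
  let ?B = "compose (carrier F.I.ET) (adj F.I.ET P.I.ET (j \<xi>)) (j \<xi>')"
  have B: "?B \<in> bop F.I.ET F.I.ET"
    by (rule bop_compose[OF hF hP j_bop[OF \<xi>'] adj_bop[OF hF hP j_bop[OF \<xi>]]])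
  have "?B = F.lrep (ip E \<xi> \<xi>')"
  proof (rule F.I.bop_eqI_te[OF hF B F.lrep_bop[OF n]])
    fix \<eta>' h' assume \<eta>': "\<eta>' \<in> carrier F" and h': "h' \<in> carrier H"
    note t' = F.I.te_closed[OF \<eta>' h']
    show "?B (F.I.te \<eta>' h') = F.lrep (ip E \<xi> \<xi>') (F.I.te \<eta>' h')"
    proof (rule F.I.te_eqI[OF bop_closed[OF B t'] bop_closed[OF F.lrep_bop[OF n] t']])
      fix \<eta> h assume \<eta>: "\<eta> \<in> carrier F" and h: "h \<in> carrier H"
      note t = F.I.te_closed[OF \<eta> h]
      show "cinner F.I.ET (F.I.te \<eta> h) (?B (F.I.te \<eta>' h')) = cinner F.I.ET (F.I.te \<eta> h) (F.lrep (ip E \<xi> \<xi>') (F.I.te \<eta>' h'))"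
        using ja[OF t j_closed[OF \<xi>' t']] t' \<xi> \<xi>' \<eta> \<eta>' h h' n
        by (simp add: compose_eq j_te P.cinner_te_id F.cinner_te_id \<tau>_closed ip_\<tau> F.lrep_te F.lact_closed)
    qed
  qed
  then have "F.lrep (ip E \<xi> \<xi>') v = adj F.I.ET P.I.ET (j \<xi>) (j \<xi>' v)" using compose_eqD'[OF _ v] by metis
  then show ?thesis using ja[OF u j_closed[OF \<xi>' v]] by simp
qed

lemma j_amp: "m \<in> E.M' \<Longrightarrow> \<xi> \<in> carrier E \<Longrightarrow> u \<in> carrier F.I.ET \<Longrightarrow> P.amp m (j \<xi> u) = j \<xi> (F.amp m u)"
proof -
  assume m: "m \<in> E.M'" and \<xi>: "\<xi> \<in> carrier E" and u: "u \<in> carrier F.I.ET"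
  note hF = F.I.ET_hilbert and hP = P.I.ET_hilbert
  have "compose (carrier F.I.ET) (P.amp m) (j \<xi>) = compose (carrier F.I.ET) (j \<xi>) (F.amp m)"
    by (rule F.I.bop_eqI_te[OF hP bop_compose[OF hF hP j_bop[OF \<xi>] P.amp_bop[OF m]]
          bop_compose[OF hF hF F.amp_bop[OF m] j_bop[OF \<xi>]]])
      (simp add: compose_eq F.I.te_closed j_te \<xi> P.amp_te F.amp_te m \<tau>_closed E.M'_closed)
  then show ?thesis using u by (rule compose_eqD)
qed

lemma j_lrep: "d \<in> N \<Longrightarrow> \<xi> \<in> carrier E \<Longrightarrow> u \<in> carrier F.I.ET \<Longrightarrow> P.lrep d (j \<xi> u) = j (lact E d \<xi>) u"
proof -
  assume d: "d \<in> N" and \<xi>: "\<xi> \<in> carrier E" and u: "u \<in> carrier F.I.ET"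
  note hF = F.I.ET_hilbert and hP = P.I.ET_hilbert
  have "compose (carrier F.I.ET) (P.lrep d) (j \<xi>) = j (lact E d \<xi>)"
    by (rule F.I.bop_eqI_te[OF hP bop_compose[OF hF hP j_bop[OF \<xi>] P.lrep_bop[OF d]] j_bop[OF E.lact_closed[OF d \<xi>]]])
      (simp add: compose_eq F.I.te_closed j_te \<xi> P.lrep_te d \<tau>_closed E.lact_closed lact_\<tau>)
  then show ?thesis using u by (rule compose_eqD')
qed

lemma nested_gram:
  assumes "p \<in> carrier E \<times> carrier F.I.ET" "q \<in> carrier E \<times> carrier F.I.ET"
  shows "hten_ker E F.I.ET F.lrep p q = cinner P.I.ET (case p of (\<xi>, u) \<Rightarrow> j \<xi> u) (case q of (\<xi>, u) \<Rightarrow> j \<xi> u)"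
  using assms by (auto simp: hten_ker_def j_inner)

lemma nested_closed: "p \<in> carrier E \<times> carrier F.I.ET \<Longrightarrow> (case p of (\<xi>, u) \<Rightarrow> j \<xi> u) \<in> carrier P.I.ET"
  by (auto simp: j_closed)

text \<open>
  The form on \<open>E \<otimes> (F \<otimes> H)\<close> is positive because it is the Gram kernel of vectors of \<open>P \<otimes> H\<close>.
\<close>

lemma nested_rep: "module_rep H N E F.I.ET F.lrep"
proof (intro module_rep.intro module_rep_axioms.intro)
  show "hilbert_module H N E" by (rule E.hilbert_module_axioms)
  show "hilbert_space F.I.ET" by (rule F.I.ET_hilbert)
  show "F.lrep a \<in> bop F.I.ET F.I.ET" if "a \<in> N" for a by (rule F.lrep_bop[OF that])
  show "cinner F.I.ET x (F.lrep a y) = cinner F.I.ET (F.lrep (adj H H a) x) y"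
    if "a \<in> N" "x \<in> carrier F.I.ET" "y \<in> carrier F.I.ET" for a x y
    by (rule F.lrep_adj[OF that])
  show "psd_kernel (carrier E \<times> carrier F.I.ET) (hten_ker E F.I.ET F.lrep)"
    by (rule gram_kernel_psd[OF P.I.ET_hilbert]) (erule nested_closed, erule (1) nested_gram)
qed

sublocale EF: module_rep H N E F.I.ET F.lrep by (rule nested_rep)

lemma htensor2_eq: "htensor2 E F H = EF.ET" by (simp add: htensor2_def)

definition J :: "('e \<times> ('f \<times> 'h) hcompl) hcompl \<Rightarrow> ('p \<times> 'h) hcompl" where
  "J = op_ext EF.ET P.I.ET (carrier E \<times> carrier F.I.ET) (\<lambda>(\<xi>, u). EF.te \<xi> u) (\<lambda>(\<xi>, u). j \<xi> u)"

lemma J_isometry: "isometry EF.ET P.I.ET J"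
  and J_te: "\<xi> \<in> carrier E \<Longrightarrow> u \<in> carrier F.I.ET \<Longrightarrow> J (EF.te \<xi> u) = j \<xi> u"
proof -
  note J = gram_kernel_isometry[OF P.I.ET_hilbert nested_closed nested_gram]
  show "isometry EF.ET P.I.ET J"
    unfolding J_def EF.te_eq_elem htensor_def[of E] by (rule J(1))
  have "J (EF.T.e p) = (case p of (\<xi>, u) \<Rightarrow> j \<xi> u)" if "p \<in> carrier E \<times> carrier F.I.ET" for p
    unfolding J_def EF.te_eq_elem htensor_def[of E] by (rule J(2)) (assumption | rule that)+
  from this[of "(\<xi>, u)"] show "\<xi> \<in> carrier E \<Longrightarrow> u \<in> carrier F.I.ET \<Longrightarrow> J (EF.te \<xi> u) = j \<xi> u"
    by (simp add: hten_def[of E])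
qed

lemmas J_bop = isometry_bop[OF J_isometry]
lemmas J_closed = bop_closed[OF J_bop]

abbreviation amp2 where "amp2 m \<equiv> id_hten E F.I.ET F.lrep F.I.ET F.lrep (F.amp m)"

lemma amp2_bop: "m \<in> E.M' \<Longrightarrow> amp2 m \<in> bop EF.ET EF.ET"
  and amp2_te: "m \<in> E.M' \<Longrightarrow> \<xi> \<in> carrier E \<Longrightarrow> u \<in> carrier F.I.ET \<Longrightarrow> amp2 m (EF.te \<xi> u) = EF.te \<xi> (F.amp m u)"
proof -
  assume m: "m \<in> E.M'"
  interpret pr: module_rep_pair H N E F.I.ET F.lrep F.I.ET F.lrep
    by (intro module_rep_pair.intro nested_rep)
  note c = F.amp_lrep[OF m]
  show "amp2 m \<in> bop EF.ET EF.ET" by (rule pr.id_hten_bop[OF F.amp_bop[OF m] c])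
  show "\<xi> \<in> carrier E \<Longrightarrow> u \<in> carrier F.I.ET \<Longrightarrow> amp2 m (EF.te \<xi> u) = EF.te \<xi> (F.amp m u)"
    by (rule pr.id_hten_te[OF F.amp_bop[OF m] c])
qed

lemma J_amp2: "m \<in> E.M' \<Longrightarrow> u \<in> carrier EF.ET \<Longrightarrow> P.amp m (J u) = J (amp2 m u)"
proof -
  assume m: "m \<in> E.M'" and u: "u \<in> carrier EF.ET"
  note hE = EF.ET_hilbert and hP = P.I.ET_hilbert
  have "compose (carrier EF.ET) (P.amp m) J = compose (carrier EF.ET) J (amp2 m)"
    by (rule EF.bop_eqI_te[OF hP bop_compose[OF hE hP J_bop P.amp_bop[OF m]] bop_compose[OF hE hE amp2_bop[OF m] J_bop]])
      (simp add: compose_eq EF.te_closed J_te amp2_te m j_amp F.amp_closed)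
  then show ?thesis using u by (rule compose_eqD)
qed

text \<open>A vector \<open>\<zeta> \<otimes> k\<close> orthogonal to the range for all \<open>k\<close> has \<open>\<langle>\<zeta>, \<xi> \<otimes> \<eta>\<rangle> = 0\<close> for all \<open>\<xi>\<close> and \<open>\<eta>\<close>.\<close>

lemma J_onto: "J ` carrier EF.ET = carrier P.I.ET"
proof (rule P.intertwining_isometry_onto[OF EF.ET_hilbert J_isometry])
  show "\<exists>B\<in>bop EF.ET EF.ET. \<forall>x\<in>carrier EF.ET. P.amp m (J x) = J (B x)" if "m \<in> E.M'" for m
    using amp2_bop[OF that] J_amp2[OF that] by (intro bexI[of _ "amp2 m"]) simp_all
  fix \<zeta> assume \<zeta>: "\<zeta> \<in> carrier P"
    and orth: "\<And>x h. x \<in> carrier EF.ET \<Longrightarrow> h \<in> carrier H \<Longrightarrow> cinner P.I.ET (J x) (P.I.te \<zeta> h) = 0"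
  show "\<zeta> = \<zero>\<^bsub>P\<^esub>"
  proof (rule separating[OF \<zeta>])
    fix \<xi> \<eta> assume \<xi>: "\<xi> \<in> carrier E" and \<eta>: "\<eta> \<in> carrier F"
    note t = \<tau>_closed[OF \<xi> \<eta>]
    have z: "\<zero>\<^bsub>P\<^esub> \<in> carrier P" by simp
    show "ip P \<zeta> (\<tau> \<xi> \<eta>) = ip P \<zero>\<^bsub>P\<^esub> (\<tau> \<xi> \<eta>)"
    proof (rule bop_eqI[OF P.ip_bop[OF \<zeta> t] P.ip_bop[OF z t]])
      fix h assume h: "h \<in> carrier H"
      show "ip P \<zeta> (\<tau> \<xi> \<eta>) h = ip P \<zero>\<^bsub>P\<^esub> (\<tau> \<xi> \<eta>) h"
      proof (rule E.H.vec_eqI[OF P.ip_apply_closed[OF \<zeta> t h] P.ip_apply_closed[OF z t h]])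
        fix k assume k: "k \<in> carrier H"
        note f = F.I.te_closed[OF \<eta> h]
        have "cinner P.I.ET (P.I.te (\<tau> \<xi> \<eta>) h) (P.I.te \<zeta> k) = 0"
          using orth[OF EF.te_closed[OF \<xi> f] k] J_te[OF \<xi> f] j_te[OF \<xi> \<eta> h] by simp
        then have "cinner P.I.ET (P.I.te \<zeta> k) (P.I.te (\<tau> \<xi> \<eta>) h) = 0"
          using P.I.ET.cinner_commute[OF P.I.te_closed[OF t h] P.I.te_closed[OF \<zeta> k]] by simp
        moreover have "cinner P.I.ET (P.I.te \<zero>\<^bsub>P\<^esub> k) (P.I.te (\<tau> \<xi> \<eta>) h) = 0"
          using P.te_zero[OF k] P.I.te_closed[OF t h] by simp
        ultimately show "cinner H k (ip P \<zeta> (\<tau> \<xi> \<eta>) h) = cinner H k (ip P \<zero>\<^bsub>P\<^esub> (\<tau> \<xi> \<eta>) h)"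
          using P.cinner_te_id[OF \<zeta> k t h] P.cinner_te_id[OF z k t h] by simp
      qed
    qed
  qed simp
qed

definition Ji :: "('p \<times> 'h) hcompl \<Rightarrow> ('e \<times> ('f \<times> 'h) hcompl) hcompl" where
  "Ji = adj EF.ET P.I.ET J"

lemma Ji_bop: "Ji \<in> bop P.I.ET EF.ET"
  unfolding Ji_def by (rule adj_bop[OF EF.ET_hilbert P.I.ET_hilbert J_bop])

lemmas Ji_closed = bop_closed[OF Ji_bop]

lemma Ji_J: "u \<in> carrier EF.ET \<Longrightarrow> Ji (J u) = u"
  unfolding Ji_def by (rule isometry_adj[OF EF.ET_hilbert P.I.ET_hilbert J_isometry])

lemma J_Ji: "v \<in> carrier P.I.ET \<Longrightarrow> J (Ji v) = v"
proof -
  assume "v \<in> carrier P.I.ET"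
  then obtain u where u: "u \<in> carrier EF.ET" "v = J u" using J_onto by blast
  show ?thesis unfolding u(2) Ji_J[OF u(1)] ..
qed

lemma nested_total: "total_family EF.ET (carrier E \<times> carrier F \<times> carrier H) (\<lambda>(\<xi>, \<eta>, h). EF.te \<xi> (F.I.te \<eta> h))"
  unfolding total_family_def
proof (intro conjI ballI impI)
  show "(case p of (\<xi>, \<eta>, h) \<Rightarrow> EF.te \<xi> (F.I.te \<eta> h)) \<in> carrier EF.ET"
    if "p \<in> carrier E \<times> carrier F \<times> carrier H" for p
    using that by (auto simp: EF.te_closed F.I.te_closed)
  fix z assume z: "z \<in> carrier EF.ET"
    and 0: "\<forall>p\<in>carrier E \<times> carrier F \<times> carrier H. cinner EF.ET (case p of (\<xi>, \<eta>, h) \<Rightarrow> EF.te \<xi> (F.I.te \<eta> h)) z = 0"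
  note hF = F.I.ET_hilbert and hE = EF.ET_hilbert
  show "z = \<zero>\<^bsub>EF.ET\<^esub>"
  proof (rule EF.te_eqI[OF z EF.ET.zero_vec_closed])
    fix \<xi> u assume \<xi>: "\<xi> \<in> carrier E" and u: "u \<in> carrier F.I.ET"
    note L = EF.L_bop[OF \<xi>]
    have "adj F.I.ET EF.ET (EF.L_op \<xi>) z = \<zero>\<^bsub>F.I.ET\<^esub>"
    proof (rule F.I.te_eqI[OF adj_closed[OF hF hE L z] F.I.ET.zero_vec_closed])
      fix \<eta> h assume \<eta>: "\<eta> \<in> carrier F" and h: "h \<in> carrier H"
      note t = F.I.te_closed[OF \<eta> h]
      have "cinner EF.ET (EF.te \<xi> (F.I.te \<eta> h)) z = 0" using 0 \<xi> \<eta> h by auto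
      then show "cinner F.I.ET (F.I.te \<eta> h) (adj F.I.ET EF.ET (EF.L_op \<xi>) z)
        = cinner F.I.ET (F.I.te \<eta> h) \<zero>\<^bsub>F.I.ET\<^esub>"
        unfolding cinner_adj_right[OF hF hE L t z] using t by (simp add: EF.L_op_def)
    qed
    then show "cinner EF.ET (EF.te \<xi> u) z = cinner EF.ET (EF.te \<xi> u) \<zero>\<^bsub>EF.ET\<^esub>"
      using cinner_adj_right[OF hF hE L u z] u EF.te_closed[OF \<xi> u] by (simp add: EF.L_op_def)
  qed
qed

text \<open>A preimage of \<open>g' p\<close> under \<open>g\<close> has the same inner products with elementary tensors as \<open>p\<close>.\<close>

lemma iso_unique:
  assumes g: "corr_iso N P D g" and g': "corr_iso N P D g'"
    and eq: "\<And>\<xi> \<eta>. \<xi> \<in> carrier E \<Longrightarrow> \<eta> \<in> carrier F \<Longrightarrow> g (\<tau> \<xi> \<eta>) = g' (\<tau> \<xi> \<eta>)"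
  shows "g = g'"
proof (rule extensionalityI[of _ "carrier P"])
  show "g \<in> extensional (carrier P)" "g' \<in> extensional (carrier P)"
    using g g' by (auto simp: corr_iso_def PiE_def)
  fix p assume p: "p \<in> carrier P"
  have "g' p \<in> carrier D" using g' p by (auto simp: corr_iso_def)
  then have "g' p \<in> g ` carrier P" using g by (simp add: corr_iso_def)
  then obtain q where q: "q \<in> carrier P" "g q = g' p" by force
  have "q = p"
  proof (rule separating[OF q(1) p])
    fix \<xi> \<eta> assume \<xi>: "\<xi> \<in> carrier E" and \<eta>: "\<eta> \<in> carrier F"
    note t = \<tau>_closed[OF \<xi> \<eta>]
    have "ip P q (\<tau> \<xi> \<eta>) = ip D (g q) (g (\<tau> \<xi> \<eta>))" using g q(1) t by (simp add: corr_iso_def)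
    also have "\<dots> = ip D (g' p) (g' (\<tau> \<xi> \<eta>))" using q(2) eq[OF \<xi> \<eta>] by simp
    also have "\<dots> = ip P p (\<tau> \<xi> \<eta>)" using g' p t by (simp add: corr_iso_def)
    finally show "ip P q (\<tau> \<xi> \<eta>) = ip P p (\<tau> \<xi> \<eta>)" .
  qed
  with q(2) show "g p = g' p" by simp
qed

end

text \<open>
  After tensoring with \<open>H\<close> both \<open>P\<close> and \<open>Q\<close> are identified with \<open>E \<otimes> (F \<otimes> H)\<close>, so that both are copies of
  the same correspondence of intertwiners.
\<close>

lemma tensor_isomorphic:
  fixes P :: "('h \<Rightarrow> 'h, 'p, 'y) corr_scheme" and Q :: "('h \<Rightarrow> 'h, 'q, 'z) corr_scheme"
  assumes "tensor H N E F P \<tau>" "tensor H N E F Q \<upsilon>"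
  obtains W where "corr_iso N P Q W"
    "\<And>\<xi> \<eta>. \<xi> \<in> carrier E \<Longrightarrow> \<eta> \<in> carrier F \<Longrightarrow> W (\<tau> \<xi> \<eta>) = \<upsilon> \<xi> \<eta>"
proof -
  interpret P: tensor H N E F P \<tau> by fact
  interpret Q: tensor H N E F Q \<upsilon> by fact
  note hP = P.P.I.ET_hilbert and hQ = Q.P.I.ET_hilbert and hE = P.EF.ET_hilbert
  define U where "U = compose (carrier P.P.I.ET) Q.J P.Ji"
  have UJ: "U (P.J y) = Q.J y" if "y \<in> carrier P.EF.ET" for y
    using that by (simp add: U_def compose_eq P.J_closed P.Ji_J)
  have onto: "\<exists>y\<in>carrier P.EF.ET. x = P.J y" if "x \<in> carrier P.P.I.ET" for x
    using P.J_onto that by blast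
  have iso: "isometry P.P.I.ET Q.P.I.ET U"
    unfolding isometry_def
  proof (intro conjI ballI)
    show "U \<in> bop P.P.I.ET Q.P.I.ET" unfolding U_def by (rule bop_compose[OF hP hE P.Ji_bop Q.J_bop])
    fix x x' assume x: "x \<in> carrier P.P.I.ET" and x': "x' \<in> carrier P.P.I.ET"
    obtain y y' where "y \<in> carrier P.EF.ET" "x = P.J y" "y' \<in> carrier P.EF.ET" "x' = P.J y'"
      using onto[OF x] onto[OF x'] by blast
    then show "cinner Q.P.I.ET (U x) (U x') = cinner P.P.I.ET x x'"
      by (simp add: UJ isometry_inner[OF P.J_isometry] isometry_inner[OF Q.J_isometry])
  qed
  have surj: "U ` carrier P.P.I.ET = carrier Q.P.I.ET"
  proof -
    have "U ` P.J ` carrier P.EF.ET = Q.J ` carrier P.EF.ET"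
      unfolding image_image by (rule image_cong[OF refl UJ])
    then show ?thesis unfolding P.J_onto Q.J_onto .
  qed
  have Uamp: "U (P.P.amp m x) = Q.P.amp m (U x)" if m: "m \<in> P.E.M'" and x: "x \<in> carrier P.P.I.ET" for m x
  proof -
    obtain y where y: "y \<in> carrier P.EF.ET" "x = P.J y" using onto[OF x] by blast
    show ?thesis
      using UJ[OF y(1)] UJ[OF bop_closed[OF P.amp2_bop[OF m] y(1)]] P.J_amp2[OF m y(1)] Q.J_amp2[OF m y(1)]
      by (simp only: y(2))
  qed
  have Ulrep: "U (P.P.lrep d x) = Q.P.lrep d (U x)" if d: "d \<in> N" and x: "x \<in> carrier P.P.I.ET" for d x
  proof -
    note Pb = P.P.lrep_bop[OF d] and Qb = Q.P.lrep_bop[OF d] and Ub = isometry_bop[OF iso]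
    note total = total_family_image[OF hE hP P.EF.te_total P.J_bop P.J_onto]
    have "compose (carrier P.P.I.ET) U (P.P.lrep d) = compose (carrier P.P.I.ET) (Q.P.lrep d) U"
    proof (rule bop_eq_on_total[OF hP hQ total bop_compose[OF hP hP Pb Ub] bop_compose[OF hP hQ Ub Qb]])
      fix p assume "p \<in> carrier E \<times> carrier P.F.I.ET"
      then obtain \<xi> u where p: "p = (\<xi>, u)" and \<xi>: "\<xi> \<in> carrier E" and u: "u \<in> carrier P.F.I.ET" by auto
      note t = P.EF.te_closed[OF \<xi> u] and l = P.E.lact_closed[OF d \<xi>]
      have "U (P.P.lrep d (P.J (P.EF.te \<xi> u))) = U (P.J (P.EF.te (lact E d \<xi>) u))"
        by (simp only: P.J_te[OF \<xi> u] P.J_te[OF l u] P.j_lrep[OF d \<xi> u])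
      also have "\<dots> = Q.P.lrep d (U (P.J (P.EF.te \<xi> u)))"
        by (simp only: UJ[OF t] UJ[OF P.EF.te_closed[OF l u]] Q.J_te[OF \<xi> u] Q.J_te[OF l u] Q.j_lrep[OF d \<xi> u])
      finally show "compose (carrier P.P.I.ET) U (P.P.lrep d) (P.J (case p of (\<xi>, u) \<Rightarrow> P.EF.te \<xi> u))
        = compose (carrier P.P.I.ET) (Q.P.lrep d) U (P.J (case p of (\<xi>, u) \<Rightarrow> P.EF.te \<xi> u))"
        by (simp only: p prod.case compose_eq[OF P.J_closed[OF t]])
    qed
    from compose_eqD[OF this x] show ?thesis .
  qed
  interpret mP: intertwiner_model H N P P.P.I.ET P.P.amp P.P.lrep "op_one P.P.I.ET"
  proof (intro intertwiner_model.intro intertwiner_model_axioms.intro P.P.w_correspondence_axioms hP)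
    show "isometry P.P.I.ET P.P.I.ET (op_one P.P.I.ET)"
      using op_one_bop[OF hP] by (simp add: isometry_def op_one_def)
    show "op_one P.P.I.ET ` carrier P.P.I.ET = carrier P.P.I.ET" by (simp add: op_one_def)
  qed (simp_all add: P.P.amp_bop P.P.lrep_bop P.P.amp_closed bop_closed[OF P.P.lrep_bop] op_one_def)
  interpret mQ: intertwiner_model H N Q P.P.I.ET P.P.amp P.P.lrep U
    by (intro intertwiner_model.intro intertwiner_model_axioms.intro Q.P.w_correspondence_axioms hP iso surj
        P.P.amp_bop P.P.lrep_bop Uamp Ulrep)
  show thesis
  proof (rule that)
    show "corr_iso N P Q (\<lambda>p\<in>carrier P. mQ.w (mP.g p))"
      by (rule P.P.corr_iso_compose[OF mP.g_iso mQ.w_iso])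
    fix \<xi> \<eta> assume \<xi>: "\<xi> \<in> carrier E" and \<eta>: "\<eta> \<in> carrier F"
    note p = P.\<tau>_closed[OF \<xi> \<eta>] and q = Q.\<tau>_closed[OF \<xi> \<eta>]
    have "mQ.g (\<upsilon> \<xi> \<eta>) = mP.g (\<tau> \<xi> \<eta>)"
    proof (rule mQ.g_eqI[OF mP.g_bop[OF p] q])
      fix h assume h: "h \<in> carrier H"
      note t = P.F.I.te_closed[OF \<eta> h]
      have "mP.g (\<tau> \<xi> \<eta>) h = P.J (P.EF.te \<xi> (P.F.I.te \<eta> h))"
        using mP.V_g[OF p h] mP.g_apply_closed[OF p h] P.J_te[OF \<xi> t] P.j_te[OF \<xi> \<eta> h] by (simp add: op_one_def)
      then show "U (mP.g (\<tau> \<xi> \<eta>) h) = Q.P.I.te (\<upsilon> \<xi> \<eta>) h"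
        using UJ[OF P.EF.te_closed[OF \<xi> t]] Q.J_te[OF \<xi> t] Q.j_te[OF \<xi> \<eta> h] by simp
    qed
    then show "(\<lambda>p\<in>carrier P. mQ.w (mP.g p)) (\<tau> \<xi> \<eta>) = \<upsilon> \<xi> \<eta>"
      using mQ.w_g[OF q] p by simp
  qed
qed

section \<open>The iterated Stinespring space\<close>

lemma adj_null:
  assumes K: "hilbert_space K" and L: "hilbert_space L" and A: "A \<in> bop K L" and e: "total_family K I e"
    and z: "z \<in> carrier L" and 0: "\<And>x. x \<in> I \<Longrightarrow> cinner L (A (e x)) z = 0" and y: "y \<in> carrier K"
  shows "cinner L (A y) z = 0"
proof -
  interpret K: hilbert_space K by fact
  have ec: "e x \<in> carrier K" if "x \<in> I" for x using e that by (simp add: total_family_def)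
  have "adj K L A z = \<zero>\<^bsub>K\<^esub>"
    by (rule total_family_eqI[OF K e adj_closed[OF K L A z] K.zero_vec_closed])
      (simp add: cinner_adj_right[OF K L A ec z] 0 ec)
  then show ?thesis using cinner_adj_right[OF K L A y z] y by simp
qed

locale rep_tensor = tensor H N E F P \<tau> + A: injective_rep H N E T + B: injective_rep H N F S
  for H :: "'h hspace" and N and E :: "('h \<Rightarrow> 'h, 'e) corr" and F :: "('h \<Rightarrow> 'h, 'f) corr"
    and P :: "('h \<Rightarrow> 'h, 'p, 'z) corr_scheme" and \<tau> and T :: "'e \<Rightarrow> 'h \<Rightarrow> 'h" and S :: "'f \<Rightarrow> 'h \<Rightarrow> 'h"
begin

text \<open>The operator \<open>(I \<otimes> a) S\<^sup>* b\<close> from \<open>H\<close> to \<open>F \<otimes> H\<close>.\<close>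

definition Y :: "('h \<Rightarrow> 'h) \<Rightarrow> ('h \<Rightarrow> 'h) \<Rightarrow> 'h \<Rightarrow> ('f \<times> 'h) hcompl" where
  "Y a b = (\<lambda>k\<in>carrier H. F.amp a (B.Ts (b k)))"

abbreviation IY where "IY a b \<equiv> id_hten E H id F.I.ET F.lrep (Y a b)"

lemma Y_bop: "a \<in> E.M' \<Longrightarrow> b \<in> E.M' \<Longrightarrow> Y a b \<in> bop H F.I.ET"
proof -
  assume a: "a \<in> E.M'" and b: "b \<in> E.M'"
  note hH = E.H.hilbert_space_axioms and hF = F.I.ET_hilbert
  have "Y a b = compose (carrier H) (compose (carrier H) (F.amp a) B.Ts) b"
    by (rule ext) (simp add: Y_def compose_def E.M'_closed[OF b])
  then show ?thesis
    using bop_compose[OF hH hH E.M'_bop[OF b] bop_compose[OF hH hF B.Ts_bop F.amp_bop[OF a]]] by simp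
qed

lemma Y_closed: "a \<in> E.M' \<Longrightarrow> b \<in> E.M' \<Longrightarrow> k \<in> carrier H \<Longrightarrow> Y a b k \<in> carrier F.I.ET"
  by (rule bop_closed[OF Y_bop])

lemma Y_lrep:
  assumes a: "a \<in> E.M'" and b: "b \<in> E.M'" and d: "d \<in> N" and k: "k \<in> carrier H"
  shows "Y a b (d k) = F.lrep d (Y a b k)"
proof -
  note bk = E.M'_closed[OF b k]
  have "b (d k) = d (b k)" by (rule E.M'_comm[OF b d k, symmetric])
  then show ?thesis
    using k by (simp add: Y_def E.N_closed[OF d] B.Ts_lrep[OF d bk] F.amp_lrep[OF a d B.Ts_closed[OF bk]])
qed

lemma IY_bop: "a \<in> E.M' \<Longrightarrow> b \<in> E.M' \<Longrightarrow> IY a b \<in> bop E.I.ET EF.ET"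
  and IY_te: "a \<in> E.M' \<Longrightarrow> b \<in> E.M' \<Longrightarrow> \<xi> \<in> carrier E \<Longrightarrow> k \<in> carrier H
    \<Longrightarrow> IY a b (E.I.te \<xi> k) = EF.te \<xi> (Y a b k)"
proof -
  assume a: "a \<in> E.M'" and b: "b \<in> E.M'"
  interpret pr: module_rep_pair H N E H id F.I.ET F.lrep
    by (intro module_rep_pair.intro nested_rep E.id_module_rep)
  have c: "Y a b (id d k) = F.lrep d (Y a b k)" if "d \<in> N" "k \<in> carrier H" for d k
    using Y_lrep[OF a b that] by simp
  show "IY a b \<in> bop E.I.ET EF.ET" by (rule pr.id_hten_bop[OF Y_bop[OF a b] c])
  show "\<xi> \<in> carrier E \<Longrightarrow> k \<in> carrier H \<Longrightarrow> IY a b (E.I.te \<xi> k) = EF.te \<xi> (Y a b k)"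
    by (rule pr.id_hten_te[OF Y_bop[OF a b] c])
qed

lemma IY_closed: "a \<in> E.M' \<Longrightarrow> b \<in> E.M' \<Longrightarrow> u \<in> carrier E.I.ET \<Longrightarrow> IY a b u \<in> carrier EF.ET"
  by (rule bop_closed[OF IY_bop])

lemma IY_amp:
  assumes a: "a \<in> E.M'" and b: "b \<in> E.M'" and u: "u \<in> carrier E.I.ET"
  shows "IY a (op_one H) (E.amp b u) = IY a b u"
proof -
  note hE = E.I.ET_hilbert and hEF = EF.ET_hilbert and one = E.M'_one
  have "compose (carrier E.I.ET) (IY a (op_one H)) (E.amp b) = IY a b"
    by (rule E.I.bop_eqI_te[OF hEF bop_compose[OF hE hE E.amp_bop[OF b] IY_bop[OF a one]] IY_bop[OF a b]])
      (simp add: compose_eq E.I.te_closed E.amp_te[OF b] IY_te a b one E.M'_closed,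
        simp add: Y_def op_one_def E.M'_closed[OF b])
  from compose_eqD'[OF this u] show ?thesis .
qed

lemma amp2_IY:
  assumes a: "a \<in> E.M'" and b: "b \<in> E.M'" and c: "c \<in> E.M'" and u: "u \<in> carrier E.I.ET"
  shows "amp2 c (IY a b u) = IY (compose (carrier H) c a) b u"
proof -
  note hE = E.I.ET_hilbert and hEF = EF.ET_hilbert and ca = E.M'_compose[OF c a]
  have "compose (carrier E.I.ET) (amp2 c) (IY a b) = IY (compose (carrier H) c a) b"
    by (rule E.I.bop_eqI_te[OF hEF bop_compose[OF hE hEF IY_bop[OF a b] amp2_bop[OF c]] IY_bop[OF ca b]])
      (simp add: compose_eq E.I.te_closed IY_te a b ca c amp2_te Y_closed,
        simp add: Y_def F.amp_compose[OF c a] B.Ts_closed E.M'_closed[OF b])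
  from compose_eqD'[OF this u] show ?thesis .
qed

lemma lrep_J_IY:
  assumes a: "a \<in> E.M'" and b: "b \<in> E.M'" and d: "d \<in> N" and u: "u \<in> carrier E.I.ET"
  shows "P.lrep d (J (IY a b u)) = J (IY a b (E.lrep d u))"
proof -
  note hE = E.I.ET_hilbert and hEF = EF.ET_hilbert and hP = P.I.ET_hilbert
  note JI = bop_compose[OF hE hEF IY_bop[OF a b] J_bop]
  have "compose (carrier E.I.ET) (P.lrep d) (compose (carrier E.I.ET) J (IY a b))
      = compose (carrier E.I.ET) (compose (carrier E.I.ET) J (IY a b)) (E.lrep d)"
    by (rule E.I.bop_eqI_te[OF hP bop_compose[OF hE hP JI P.lrep_bop[OF d]] bop_compose[OF hE hE E.lrep_bop[OF d] JI]])
      (simp add: compose_eq E.I.te_closed IY_te a b d E.lrep_te E.lact_closed J_te Y_closed j_lrep)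
  from compose_eqD[OF this u] show ?thesis using u by (simp add: compose_eq A.lrep_closed d)
qed

lemma Y_gram:
  assumes a: "a \<in> E.M'" and b: "b \<in> E.M'" and a': "a' \<in> E.M'" and b': "b' \<in> E.M'"
    and k: "k \<in> carrier H" and k': "k' \<in> carrier H"
  shows "cinner F.I.ET (Y a b k) (Y a' b' k') = cinner H k (compose (carrier H) (adj H H b)
    (compose (carrier H) (B.cp (compose (carrier H) (adj H H a) a')) b') k')"
proof -
  note hH = E.H.hilbert_space_axioms
  let ?c = "B.cp (compose (carrier H) (adj H H a) a')"
  have c: "?c \<in> E.M'" by (rule B.cp_M'[OF E.M'_compose[OF E.M'_adj[OF a] a']])
  note bk = E.M'_closed[OF b k] and bk' = E.M'_closed[OF b' k']
  have "cinner F.I.ET (Y a b k) (Y a' b' k') = cinner H (b k) (?c (b' k'))"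
    using B.stine_gram[of "(a, b k)" "(a', b' k')"] a a' bk bk' k k' by (simp add: stine_ker_def Y_def)
  also have "\<dots> = cinner H k (adj H H b (?c (b' k')))"
    by (rule cinner_adj_right[OF hH hH E.M'_bop[OF b] k E.M'_closed[OF c bk'], symmetric])
  finally show ?thesis using k' by (simp add: compose_eq)
qed

text \<open>
  \<open>(I \<otimes> Y\<^sub>1)\<^sup>* (I \<otimes> Y\<^sub>2) = I \<otimes> Y\<^sub>1\<^sup>* Y\<^sub>2\<close>, where \<open>Y\<^sub>1\<^sup>* Y\<^sub>2 = b\<^sup>* \<Phi>(a\<^sup>* a') b'\<close>. So the vectors \<open>lam\<close> below have the Gram
  kernel that defines \<open>M \<otimes>\<^sub>\<Phi> M \<otimes>\<^sub>\<Theta> H\<close>.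
\<close>

lemma IY_gram:
  assumes a: "a \<in> E.M'" and b: "b \<in> E.M'" and a': "a' \<in> E.M'" and b': "b' \<in> E.M'"
    and u: "u \<in> carrier E.I.ET" and v: "v \<in> carrier E.I.ET"
  shows "cinner EF.ET (IY a b u) (IY a' b' v) = cinner E.I.ET u (E.amp (compose (carrier H) (adj H H b)
    (compose (carrier H) (B.cp (compose (carrier H) (adj H H a) a')) b')) v)" (is "_ = cinner _ _ (E.amp ?m v)")
proof -
  note hE = E.I.ET_hilbert and hEF = EF.ET_hilbert
  have m: "?m \<in> E.M'"
    by (intro E.M'_compose E.M'_adj b b' B.cp_M' a a')
  note ab = IY_bop[OF a b] and ab' = IY_bop[OF a' b']
  have "compose (carrier E.I.ET) (adj E.I.ET EF.ET (IY a b)) (IY a' b') = E.amp ?m"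
  proof (rule E.I.bop_eqI_te[OF hE bop_compose[OF hE hEF ab' adj_bop[OF hE hEF ab]] E.amp_bop[OF m]])
    fix \<eta> k' assume \<eta>: "\<eta> \<in> carrier E" and k': "k' \<in> carrier H"
    note t' = E.I.te_closed[OF \<eta> k']
    have "adj E.I.ET EF.ET (IY a b) (IY a' b' (E.I.te \<eta> k')) = E.I.te \<eta> (?m k')"
    proof (rule E.I.te_eqI[OF adj_closed[OF hE hEF ab IY_closed[OF a' b' t']] E.I.te_closed[OF \<eta> E.M'_closed[OF m k']]])
      fix \<xi> k assume \<xi>: "\<xi> \<in> carrier E" and k: "k \<in> carrier H"
      note n = E.ip_closed[OF \<xi> \<eta>]
      have "cinner E.I.ET (E.I.te \<xi> k) (adj E.I.ET EF.ET (IY a b) (IY a' b' (E.I.te \<eta> k')))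
          = cinner EF.ET (EF.te \<xi> (Y a b k)) (EF.te \<eta> (Y a' b' k'))"
        using cinner_adj_right[OF hE hEF ab E.I.te_closed[OF \<xi> k] IY_closed[OF a' b' t']]
        by (simp add: IY_te a b a' b' \<xi> \<eta> k k')
      also have "\<dots> = cinner F.I.ET (Y a b k) (Y a' b' (ip E \<xi> \<eta> k'))"
        using EF.cinner_te[OF \<xi> Y_closed[OF a b k] \<eta> Y_closed[OF a' b' k']] Y_lrep[OF a' b' n k'] by simp
      also have "\<dots> = cinner H k (?m (ip E \<xi> \<eta> k'))"
        by (rule Y_gram[OF a b a' b' k E.N_closed[OF n k']])
      also have "\<dots> = cinner E.I.ET (E.I.te \<xi> k) (E.I.te \<eta> (?m k'))"
        unfolding E.cinner_te_id[OF \<xi> k \<eta> E.M'_closed[OF m k']] E.M'_comm[OF m n k'] ..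
      finally show "cinner E.I.ET (E.I.te \<xi> k) (adj E.I.ET EF.ET (IY a b) (IY a' b' (E.I.te \<eta> k')))
        = cinner E.I.ET (E.I.te \<xi> k) (E.I.te \<eta> (?m k'))" .
    qed
    then show "compose (carrier E.I.ET) (adj E.I.ET EF.ET (IY a b)) (IY a' b') (E.I.te \<eta> k') = E.amp ?m (E.I.te \<eta> k')"
      unfolding E.amp_te[OF m \<eta> k'] compose_eq[OF t'] .
  qed
  from compose_eqD'[OF this v] cinner_adj_right[OF hE hEF ab u IY_closed[OF a' b' v]] show ?thesis by simp
qed

definition lam :: "('h \<Rightarrow> 'h) \<times> ('h \<Rightarrow> 'h) \<times> 'h \<Rightarrow> ('e \<times> ('f \<times> 'h) hcompl) hcompl" where
  "lam = (\<lambda>(a, b, h). IY a b (A.Ts h))"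

abbreviation S2 where "S2 \<equiv> stine2 H E.M' B.cp A.cp"
abbreviation s2 where "s2 \<equiv> stine2_elem H E.M' B.cp A.cp"
abbreviation Lam where "Lam \<equiv> cp_Lambda H E.M' E F T S A.cp B.cp"

lemma lam_closed: "p \<in> E.M' \<times> E.M' \<times> carrier H \<Longrightarrow> lam p \<in> carrier EF.ET"
  by (auto simp: lam_def IY_closed A.Ts_closed)

lemma stine2_gram:
  assumes "p \<in> E.M' \<times> E.M' \<times> carrier H" "q \<in> E.M' \<times> E.M' \<times> carrier H"
  shows "stine2_ker H B.cp A.cp p q = cinner EF.ET (lam p) (lam q)"
proof -
  obtain a b h a' b' h' where pq: "p = (a, b, h)" "q = (a', b', h')" and a: "a \<in> E.M'" and b: "b \<in> E.M'"
    and h: "h \<in> carrier H" and a': "a' \<in> E.M'" and b': "b' \<in> E.M'" and h': "h' \<in> carrier H"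
    using assms by auto
  let ?m = "compose (carrier H) (adj H H b) (compose (carrier H) (B.cp (compose (carrier H) (adj H H a) a')) b')"
  have m: "?m \<in> E.M'" by (intro E.M'_compose E.M'_adj b b' B.cp_M' a a')
  have "cinner EF.ET (lam p) (lam q) = cinner E.I.ET (A.Ts h) (E.amp ?m (A.Ts h'))"
    unfolding pq lam_def prod.case by (rule IY_gram[OF a b a' b' A.Ts_closed[OF h] A.Ts_closed[OF h']])
  also have "\<dots> = cinner H h (A.cp ?m h')"
    unfolding A.cp_apply[OF m h'] by (rule A.cinner_Ts_left[OF E.amp_closed[OF m A.Ts_closed[OF h']] h])
  finally show ?thesis by (simp add: pq stine2_ker_def)
qed

sublocale S2: psd_kernel "E.M' \<times> E.M' \<times> carrier H" "stine2_ker H B.cp A.cp"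
  by (rule gram_kernel_psd[OF EF.ET_hilbert lam_closed stine2_gram])

lemma S2_hilbert: "hilbert_space S2" unfolding stine2_def by (rule S2.completion_hilbert)

lemma s2_eq: "(\<lambda>(a, b, h). s2 a b h) = S2.e" by (auto simp: stine2_elem_def)

lemma s2_total: "total_family S2 (E.M' \<times> E.M' \<times> carrier H) (\<lambda>(a, b, h). s2 a b h)"
  unfolding s2_eq stine2_def by (rule S2.elem_total)

lemma s2_closed: "a \<in> E.M' \<Longrightarrow> b \<in> E.M' \<Longrightarrow> h \<in> carrier H \<Longrightarrow> s2 a b h \<in> carrier S2"
  unfolding stine2_def stine2_elem_def by (rule S2.elem_closed) simp

lemma Lam_isometry: "isometry S2 EF.ET Lam"
  and Lam_s2: "a \<in> E.M' \<Longrightarrow> b \<in> E.M' \<Longrightarrow> h \<in> carrier H \<Longrightarrow> Lam (s2 a b h) = lam (a, b, h)"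
proof -
  note L = gram_kernel_isometry[OF EF.ET_hilbert lam_closed stine2_gram]
  have eq: "Lam = op_ext S2 EF.ET (E.M' \<times> E.M' \<times> carrier H) S2.e lam"
    unfolding cp_Lambda_def htensor2_eq Y_def[symmetric] s2_eq lam_def ..
  show "isometry S2 EF.ET Lam" unfolding eq stine2_def by (rule L(1))
  have "Lam (S2.e p) = lam p" if "p \<in> E.M' \<times> E.M' \<times> carrier H" for p
    unfolding eq stine2_def by (rule L(2)) (assumption | rule that)+
  from this[of "(a, b, h)"]
  show "a \<in> E.M' \<Longrightarrow> b \<in> E.M' \<Longrightarrow> h \<in> carrier H \<Longrightarrow> Lam (s2 a b h) = lam (a, b, h)"
    by (simp add: stine2_elem_def)
qed

text \<open>
  With \<open>b \<otimes> h\<close> ranging over \<open>M \<otimes>\<^sub>\<Theta> H\<close> the range contains \<open>(I \<otimes> Y) (\<xi> \<otimes> h)\<close> for all \<open>\<xi>\<close> and \<open>h\<close>, as \<open>V\<close> for \<open>T\<close>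
  is onto; these are the vectors \<open>\<xi> \<otimes> V (a \<otimes> h)\<close> with the \<open>V\<close> for \<open>S\<close>, which is onto as well.
\<close>

lemma Lam_onto: "Lam ` carrier S2 = carrier EF.ET"
proof (rule isometry_ontoI[OF S2_hilbert EF.ET_hilbert Lam_isometry])
  fix z assume z: "z \<in> carrier EF.ET" and 0: "\<And>x. x \<in> carrier S2 \<Longrightarrow> cinner EF.ET (Lam x) z = 0"
  note hE = E.I.ET_hilbert and hF = F.I.ET_hilbert and hEF = EF.ET_hilbert and one = E.M'_one
  note totalA = total_family_image[OF A.St_hilbert hE A.se_total A.V_bop A.V_onto]
    and totalB = total_family_image[OF B.St_hilbert hF B.se_total B.V_bop B.V_onto]
  have 1: "cinner EF.ET (IY a (op_one H) y) z = 0" if a: "a \<in> E.M'" and y: "y \<in> carrier E.I.ET" for a y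
  proof (rule adj_null[OF hE hEF IY_bop[OF a one] totalA z _ y])
    fix p assume "p \<in> E.M' \<times> carrier H"
    then obtain b h where p: "p = (b, h)" and b: "b \<in> E.M'" and h: "h \<in> carrier H" by auto
    have "IY a (op_one H) (A.V (A.se b h)) = Lam (s2 a b h)"
      using IY_amp[OF a b A.Ts_closed[OF h]] by (simp add: A.V_se b h Lam_s2[OF a b h] lam_def)
    then show "cinner EF.ET (IY a (op_one H) (A.V (case p of (a, h) \<Rightarrow> A.se a h))) z = 0"
      using 0[OF s2_closed[OF a b h]] by (simp add: p)
  qed
  show "z = \<zero>\<^bsub>EF.ET\<^esub>"
  proof (rule EF.te_eqI[OF z EF.ET.zero_vec_closed])
    fix \<xi> u assume \<xi>: "\<xi> \<in> carrier E" and u: "u \<in> carrier F.I.ET"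
    have "cinner EF.ET (EF.L_op \<xi> u) z = 0"
    proof (rule adj_null[OF hF hEF EF.L_bop[OF \<xi>] totalB z _ u])
      fix p assume "p \<in> E.M' \<times> carrier H"
      then obtain a h where p: "p = (a, h)" and a: "a \<in> E.M'" and h: "h \<in> carrier H" by auto
      have "EF.L_op \<xi> (B.V (B.se a h)) = IY a (op_one H) (E.I.te \<xi> h)"
        using B.V_closed[OF B.se_closed[OF a h]] B.V_se[OF a h] IY_te[OF a one \<xi> h] h
        by (simp add: EF.L_op_def Y_def op_one_def)
      then show "cinner EF.ET (EF.L_op \<xi> (B.V (case p of (a, h) \<Rightarrow> B.se a h))) z = 0"
        using 1[OF a E.I.te_closed[OF \<xi> h]] by (simp add: p)
    qed
    then show "cinner EF.ET (EF.te \<xi> u) z = cinner EF.ET (EF.te \<xi> u) \<zero>\<^bsub>EF.ET\<^esub>"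
      using u EF.te_closed[OF \<xi> u] by (simp add: EF.L_op_def)
  qed
qed

definition V2 :: "(('h \<Rightarrow> 'h) \<times> ('h \<Rightarrow> 'h) \<times> 'h) hcompl \<Rightarrow> ('p \<times> 'h) hcompl" where
  "V2 = compose (carrier S2) J Lam"

lemmas Lam_bop = isometry_bop[OF Lam_isometry]
lemmas Lam_closed = bop_closed[OF Lam_bop]

lemma V2_apply: "x \<in> carrier S2 \<Longrightarrow> V2 x = J (Lam x)"
  by (simp add: V2_def compose_eq)

lemma V2_isometry: "isometry S2 P.I.ET V2"
  unfolding isometry_def
proof (intro conjI ballI)
  show "V2 \<in> bop S2 P.I.ET" unfolding V2_def by (rule bop_compose[OF S2_hilbert EF.ET_hilbert Lam_bop J_bop])
  fix x y assume "x \<in> carrier S2" "y \<in> carrier S2"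
  then show "cinner P.I.ET (V2 x) (V2 y) = cinner S2 x y"
    by (simp add: V2_apply isometry_inner[OF J_isometry] isometry_inner[OF Lam_isometry] Lam_closed)
qed

lemma V2_onto: "V2 ` carrier S2 = carrier P.I.ET"
proof -
  have "V2 ` carrier S2 = J ` (Lam ` carrier S2)" unfolding image_image by (rule image_cong[OF refl V2_apply])
  then show ?thesis unfolding Lam_onto J_onto .
qed

lemmas V2_bop = isometry_bop[OF V2_isometry]

lemma V2_s2: "a \<in> E.M' \<Longrightarrow> b \<in> E.M' \<Longrightarrow> h \<in> carrier H \<Longrightarrow> V2 (s2 a b h) = J (IY a b (A.Ts h))"
  by (simp add: V2_apply s2_closed Lam_s2 lam_def)

lemma stine2_left_bop: "c \<in> E.M' \<Longrightarrow> stine2_left H E.M' B.cp A.cp c \<in> bop S2 S2"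
  and V2_stine2_left: "c \<in> E.M' \<Longrightarrow> u \<in> carrier S2 \<Longrightarrow> V2 (stine2_left H E.M' B.cp A.cp c u) = P.amp c (V2 u)"
proof -
  assume c: "c \<in> E.M'"
  note tr = op_ext_transport[OF S2_hilbert S2_hilbert P.I.ET_hilbert P.I.ET_hilbert s2_total V2_bop V2_isometry
      P.amp_bop[OF c], where f = "\<lambda>(a, b, h). s2 (compose (carrier H) c a) b h"]
  have 1: "(case p of (a, b, h) \<Rightarrow> s2 (compose (carrier H) c a) b h) \<in> carrier S2"
    if "p \<in> E.M' \<times> E.M' \<times> carrier H" for p
    using that c by (auto simp: s2_closed E.M'_compose)
  have 2: "P.amp c (V2 (case p of (a, b, h) \<Rightarrow> s2 a b h)) = V2 (case p of (a, b, h) \<Rightarrow> s2 (compose (carrier H) c a) b h)"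
    if "p \<in> E.M' \<times> E.M' \<times> carrier H" for p
    using that c by (elim SigmaE) (simp add: V2_s2 E.M'_compose J_amp2 IY_closed A.Ts_closed amp2_IY)
  show "stine2_left H E.M' B.cp A.cp c \<in> bop S2 S2" unfolding stine2_left_def by (rule tr(1)[OF 1 2])
  show "u \<in> carrier S2 \<Longrightarrow> V2 (stine2_left H E.M' B.cp A.cp c u) = P.amp c (V2 u)"
    unfolding stine2_left_def by (rule tr(3)[OF 1 2])
qed

lemma stine2_right_bop: "d \<in> N \<Longrightarrow> stine2_right H E.M' B.cp A.cp d \<in> bop S2 S2"
  and V2_stine2_right: "d \<in> N \<Longrightarrow> u \<in> carrier S2 \<Longrightarrow> V2 (stine2_right H E.M' B.cp A.cp d u) = P.lrep d (V2 u)"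
proof -
  assume d: "d \<in> N"
  note tr = op_ext_transport[OF S2_hilbert S2_hilbert P.I.ET_hilbert P.I.ET_hilbert s2_total V2_bop V2_isometry
      P.lrep_bop[OF d], where f = "\<lambda>(a, b, h). s2 a b (d h)"]
  have 1: "(case p of (a, b, h) \<Rightarrow> s2 a b (d h)) \<in> carrier S2" if "p \<in> E.M' \<times> E.M' \<times> carrier H" for p
    using that d by (auto simp: s2_closed E.N_closed)
  have 2: "P.lrep d (V2 (case p of (a, b, h) \<Rightarrow> s2 a b h)) = V2 (case p of (a, b, h) \<Rightarrow> s2 a b (d h))"
    if "p \<in> E.M' \<times> E.M' \<times> carrier H" for p
    using that d by (elim SigmaE) (simp add: V2_s2 E.N_closed lrep_J_IY A.Ts_closed A.Ts_lrep)
  show "stine2_right H E.M' B.cp A.cp d \<in> bop S2 S2" unfolding stine2_right_def by (rule tr(1)[OF 1 2])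
  show "u \<in> carrier S2 \<Longrightarrow> V2 (stine2_right H E.M' B.cp A.cp d u) = P.lrep d (V2 u)"
    unfolding stine2_right_def by (rule tr(3)[OF 1 2])
qed

sublocale cor2: intertwiner_model H N P S2 "stine2_left H E.M' B.cp A.cp" "stine2_right H E.M' B.cp A.cp" V2
  by (intro intertwiner_model.intro intertwiner_model_axioms.intro P.w_correspondence_axioms S2_hilbert V2_isometry V2_onto)
    (erule stine2_left_bop stine2_right_bop V2_stine2_left V2_stine2_right, assumption?)+

lemma stine_insert_closed: "a \<in> E.M' \<Longrightarrow> u \<in> carrier A.St \<Longrightarrow> stine_insert H E.M' B.cp A.cp a u \<in> carrier S2"
  and V2_stine_insert: "a \<in> E.M' \<Longrightarrow> u \<in> carrier A.St
    \<Longrightarrow> V2 (stine_insert H E.M' B.cp A.cp a u) = J (IY a (op_one H) (A.V u))"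
proof -
  assume a: "a \<in> E.M'"
  note hE = E.I.ET_hilbert and hEF = EF.ET_hilbert and hP = P.I.ET_hilbert and one = E.M'_one
  let ?B = "compose (carrier E.I.ET) J (IY a (op_one H))"
  note B = bop_compose[OF hE hEF IY_bop[OF a one] J_bop]
  note tr = op_ext_transport[OF A.St_hilbert S2_hilbert hE hP A.se_total A.V_bop V2_isometry
      B, where f = "\<lambda>(b, h). s2 a b h"]
  have 1: "(case p of (b, h) \<Rightarrow> s2 a b h) \<in> carrier S2" if "p \<in> E.M' \<times> carrier H" for p
    using that a by (auto simp: s2_closed)
  have 2: "?B (A.V (case p of (b, h) \<Rightarrow> A.se b h)) = V2 (case p of (b, h) \<Rightarrow> s2 a b h)"
    if "p \<in> E.M' \<times> carrier H" for p
    using that a by (elim SigmaE) (simp add: compose_eq A.V_closed A.se_closed V2_s2 A.V_se IY_amp E.amp_closed A.Ts_closed)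
  show "u \<in> carrier A.St \<Longrightarrow> stine_insert H E.M' B.cp A.cp a u \<in> carrier S2"
    unfolding stine_insert_def by (rule bop_closed[OF tr(1)[OF 1 2]])
  assume u: "u \<in> carrier A.St"
  show "V2 (stine_insert H E.M' B.cp A.cp a u) = J (IY a (op_one H) (A.V u))"
    using tr(3)[OF 1 2 u] A.V_closed[OF u] unfolding stine_insert_def by (simp add: compose_eq)
qed

lemma stine_map_bop: "R \<in> carrier A.cor.C \<Longrightarrow> stine_map H E.M' B.cp A.cp R \<in> bop B.St S2"
  and V2_stine_map: "R \<in> carrier A.cor.C \<Longrightarrow> u \<in> carrier B.St
    \<Longrightarrow> V2 (stine_map H E.M' B.cp A.cp R u) = j (A.cor.w R) (B.V u)"
proof -
  assume R: "R \<in> carrier A.cor.C"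
  then have Rc: "R h \<in> carrier A.St" if "h \<in> carrier H" for h
    using that bop_closed[of R H A.St] by (simp add: A.cor.C_iff)
  note hF = F.I.ET_hilbert and hP = P.I.ET_hilbert and wR = A.cor.w_closed[OF R] and one = E.M'_one
  note tr = op_ext_transport[OF B.St_hilbert S2_hilbert hF hP B.se_total B.V_bop V2_isometry
      j_bop[OF wR], where f = "\<lambda>(a, h). stine_insert H E.M' B.cp A.cp a (R h)"]
  have 1: "(case p of (a, h) \<Rightarrow> stine_insert H E.M' B.cp A.cp a (R h)) \<in> carrier S2" if "p \<in> E.M' \<times> carrier H" for p
    using that by (auto simp: stine_insert_closed Rc)
  have 2: "j (A.cor.w R) (B.V (case p of (a, h) \<Rightarrow> B.se a h))
      = V2 (case p of (a, h) \<Rightarrow> stine_insert H E.M' B.cp A.cp a (R h))" if "p \<in> E.M' \<times> carrier H" for p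
    using that wR by (elim SigmaE)
      (simp add: V2_stine_insert Rc A.cor.V_w[OF R] IY_te one J_te Y_closed, simp add: Y_def op_one_def B.V_se)
  show "stine_map H E.M' B.cp A.cp R \<in> bop B.St S2" unfolding stine_map_def by (rule tr(1)[OF 1 2])
  show "u \<in> carrier B.St \<Longrightarrow> V2 (stine_map H E.M' B.cp A.cp R u) = j (A.cor.w R) (B.V u)"
    unfolding stine_map_def by (rule tr(3)[OF 1 2])
qed

text \<open>On elementary tensors the model is the formula that defines \<open>\<Gamma>\<close>.\<close>

lemma cor2_elem:
  assumes R: "R \<in> carrier A.cor.C" and Z: "Z \<in> carrier B.cor.C"
  shows "cor2.g (\<tau> (A.cor.w R) (B.cor.w Z)) = compose (carrier H) (stine_map H E.M' B.cp A.cp R) Z"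
proof (rule cor2.g_eqI)
  note wR = A.cor.w_closed[OF R] and wZ = B.cor.w_closed[OF Z]
  have Zb: "Z \<in> bop H B.St" using Z by (simp add: B.cor.C_iff)
  show "compose (carrier H) (stine_map H E.M' B.cp A.cp R) Z \<in> bop H S2"
    by (rule bop_compose[OF E.H.hilbert_space_axioms B.St_hilbert Zb stine_map_bop[OF R]])
  show "\<tau> (A.cor.w R) (B.cor.w Z) \<in> carrier P" by (rule \<tau>_closed[OF wR wZ])
  fix h assume h: "h \<in> carrier H"
  then show "V2 (compose (carrier H) (stine_map H E.M' B.cp A.cp R) Z h) = P.I.te (\<tau> (A.cor.w R) (B.cor.w Z)) h"
    using V2_stine_map[OF R bop_closed[OF Zb h]] B.cor.V_w[OF Z h] j_te[OF wR wZ h] by (simp add: compose_eq)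
qed

end

section \<open>The exchange isomorphism\<close>

lemma (in w_correspondence) corr_iso_identity: "corr_iso N E E (\<lambda>\<xi>\<in>carrier E. \<xi>)"
  unfolding corr_iso_def by (simp add: E_smult_closed lact_closed ract_closed)

text \<open>For correspondences of intertwiners this reduces tensor products to those of \<open>E\<close> and \<open>F\<close> themselves.\<close>

lemma is_tensor_transport:
  fixes E :: "('h \<Rightarrow> 'h, 'e) corr" and F :: "('h \<Rightarrow> 'h, 'f) corr"
  assumes P: "is_tensor H N E' F' P" and E: "w_correspondence H N E" and F: "w_correspondence H N F"
    and f: "corr_iso N E E' f" and g: "corr_iso N F F' g"
    and \<tau>: "\<And>\<xi> \<eta>. \<xi> \<in> carrier E \<Longrightarrow> \<eta> \<in> carrier F \<Longrightarrow> \<tau> \<xi> \<eta> = tens P (f \<xi>) (g \<eta>)"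
  shows "tensor H N E F P \<tau>"
proof -
  interpret E: w_correspondence H N E by fact
  interpret F: w_correspondence H N F by fact
  have fc: "f \<xi> \<in> carrier E'" if "\<xi> \<in> carrier E" for \<xi> using f that by (auto simp: corr_iso_def)
  have gc: "g \<xi> \<in> carrier F'" if "\<xi> \<in> carrier F" for \<xi> using g that by (auto simp: corr_iso_def)
  show ?thesis
  proof (intro tensor.intro tensor_axioms.intro E F)
    show "w_correspondence H N P" using P by (simp add: is_tensor_def)
    fix \<xi> \<eta> assume \<xi>: "\<xi> \<in> carrier E" and \<eta>: "\<eta> \<in> carrier F"
    show "\<tau> \<xi> \<eta> \<in> carrier P" using P \<xi> \<eta> by (simp add: \<tau> is_tensor_def fc gc)
    show "lact P a (\<tau> \<xi> \<eta>) = \<tau> (lact E a \<xi>) \<eta>" if "a \<in> N" for a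
      using P f \<xi> \<eta> that by (simp add: \<tau> is_tensor_def fc gc E.lact_closed corr_iso_def)
    fix \<xi>' \<eta>' assume \<xi>': "\<xi>' \<in> carrier E" and \<eta>': "\<eta>' \<in> carrier F"
    note n = E.ip_closed[OF \<xi> \<xi>']
    have "ip P (\<tau> \<xi> \<eta>) (\<tau> \<xi>' \<eta>') = ip F' (g \<eta>) (lact F' (ip E' (f \<xi>) (f \<xi>')) (g \<eta>'))"
      using P \<xi> \<eta> \<xi>' \<eta>' by (simp add: \<tau> is_tensor_def fc gc)
    also have "ip E' (f \<xi>) (f \<xi>') = ip E \<xi> \<xi>'" using f \<xi> \<xi>' by (simp add: corr_iso_def)
    also have "lact F' (ip E \<xi> \<xi>') (g \<eta>') = g (lact F (ip E \<xi> \<xi>') \<eta>')" using g n \<eta>' by (simp add: corr_iso_def)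
    also have "ip F' (g \<eta>) \<dots> = ip F \<eta> (lact F (ip E \<xi> \<xi>') \<eta>')"
      using g \<eta> F.lact_closed[OF n \<eta>'] by (simp add: corr_iso_def)
    finally show "ip P (\<tau> \<xi> \<eta>) (\<tau> \<xi>' \<eta>') = ip F \<eta> (lact F (ip E \<xi> \<xi>') \<eta>')" .
  next
    fix p q assume p: "p \<in> carrier P" and q: "q \<in> carrier P"
      and eq: "\<And>\<xi> \<eta>. \<xi> \<in> carrier E \<Longrightarrow> \<eta> \<in> carrier F \<Longrightarrow> ip P p (\<tau> \<xi> \<eta>) = ip P q (\<tau> \<xi> \<eta>)"
    show "p = q"
    proof (rule is_tensor_separating[OF P p q])
      fix \<xi> \<eta> assume "\<xi> \<in> carrier E'" "\<eta> \<in> carrier F'"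
      then have "\<xi> \<in> f ` carrier E" "\<eta> \<in> g ` carrier F" using f g by (simp_all add: corr_iso_def)
      then obtain \<xi>' \<eta>' where "\<xi>' \<in> carrier E" "\<xi> = f \<xi>'" "\<eta>' \<in> carrier F" "\<eta> = g \<eta>'" by (elim imageE)
      then show "ip P p (tens P \<xi> \<eta>) = ip P q (tens P \<xi> \<eta>)" using eq[of \<xi>' \<eta>'] \<tau>[of \<xi>' \<eta>'] by simp
    qed
  qed
qed

lemma is_tensor_tensor:
  fixes E :: "('h \<Rightarrow> 'h, 'e) corr" and F :: "('h \<Rightarrow> 'h, 'f) corr"
  assumes "is_tensor H N E F P" "w_correspondence H N E" "w_correspondence H N F"
  shows "tensor H N E F P (tens P)"
  by (rule is_tensor_transport[OF assms w_correspondence.corr_iso_identity[OF assms(2)]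
        w_correspondence.corr_iso_identity[OF assms(3)]]) simp

text \<open>The canonical identification of \<open>(E \<otimes> F) \<otimes> H\<close> with \<open>E \<otimes> (F \<otimes> H)\<close> is the inverse of \<open>J\<close>.\<close>

lemma (in tensor) assoc_eq:
  "op_ext P.I.ET EF.ET (carrier E \<times> carrier F \<times> carrier H)
    (\<lambda>(\<xi>, \<eta>, h). P.I.te (\<tau> \<xi> \<eta>) h) (\<lambda>(\<xi>, \<eta>, h). EF.te \<xi> (F.I.te \<eta> h)) = Ji" (is "op_ext _ _ ?I ?e ?v = _")
proof (rule op_ext_eq[OF P.I.ET_hilbert EF.ET_hilbert _ Ji_bop])
  have eq: "J (?v x) = ?e x" if "x \<in> ?I" for x
    using that by (auto simp: J_te j_te F.I.te_closed)
  have "total_family P.I.ET ?I (\<lambda>x. J (?v x))"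
    by (rule total_family_image[OF EF.ET_hilbert P.I.ET_hilbert nested_total J_bop J_onto])
  then show "total_family P.I.ET ?I ?e" unfolding total_family_def using eq by simp
  fix x assume x: "x \<in> ?I"
  then have "?v x \<in> carrier EF.ET" by (auto simp: EF.te_closed F.I.te_closed)
  then show "Ji (?e x) = ?v x" using Ji_J eq[OF x] by metis
qed

lemma (in tensor) the_inv_Ji: "x \<in> carrier EF.ET \<Longrightarrow> the_inv_into (carrier P.I.ET) Ji x = J x"
  by (rule the_inv_into_f_eq) (auto intro: inj_on_inverseI[of _ J] simp: J_Ji Ji_J J_closed)

lemma map_hten_iso:
  assumes P: "w_correspondence H N P" and Q: "w_correspondence H N Q" and t: "corr_iso N P Q t"
    and p: "p \<in> carrier P" and h: "h \<in> carrier H"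
  shows "map_hten P Q H id t (hten P H id p h) = hten Q H id (t p) h"
proof -
  interpret P: w_correspondence H N P by fact
  interpret Q: w_correspondence H N Q by fact
  have tc: "t p \<in> carrier Q" if "p \<in> carrier P" for p using t that by (auto simp: corr_iso_def)
  have "op_ext P.I.T.K Q.I.ET (carrier P \<times> carrier H) P.I.T.e (\<lambda>(p, h). Q.I.te (t p) h) (P.I.T.e (p, h))
      = (case (p, h) of (p, h) \<Rightarrow> Q.I.te (t p) h)"
  proof (rule gram_kernel_isometry(2)[OF Q.I.ET_hilbert])
    show "(case x of (p, h) \<Rightarrow> Q.I.te (t p) h) \<in> carrier Q.I.ET" if "x \<in> carrier P \<times> carrier H" for x
      using that by (auto simp: Q.I.te_closed tc)
    show "hten_ker P H id x y = cinner Q.I.ET (case x of (p, h) \<Rightarrow> Q.I.te (t p) h) (case y of (p, h) \<Rightarrow> Q.I.te (t p) h)"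
      if "x \<in> carrier P \<times> carrier H" "y \<in> carrier P \<times> carrier H" for x y
      using that t by (auto simp: hten_ker_def Q.cinner_te_id tc corr_iso_def)
  qed (use p h in simp)
  then show ?thesis
    unfolding map_hten_def P.I.te_eq_elem htensor_def[of P] hten_def[of P] by simp
qed

text \<open>
  Under the identifications of \<open>E\<close> and \<open>F\<close> with their correspondences of intertwiners, a tensor
  product \<open>D\<close> of the latter becomes another tensor product of \<open>E\<close> and \<open>F\<close>, hence isomorphic to \<open>P\<close>,
  and \<open>\<Gamma>\<close> becomes the model of \<open>P\<close> inside the iterated Stinespring space.
\<close>

lemma (in rep_tensor) cp_tensor:
  assumes D: "is_tensor H N A.cor.C B.cor.C D"
  obtains W where "corr_iso N D P W"
    "(THE W. corr_iso N D P W \<and> (\<forall>R\<in>carrier A.cor.C. \<forall>Z\<in>carrier B.cor.C.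
      W (tens D R Z) = \<tau> (A.cor.w R) (B.cor.w Z))) = W"
    "cp_Gamma H E.M' B.cp A.cp D = (\<lambda>p\<in>carrier D. cor2.g (W p))"
    "corr_iso N D cor2.C (\<lambda>p\<in>carrier D. cor2.g (W p))"
proof -
  define \<tau>' where "\<tau>' \<xi> \<eta> = tens D (A.cor.g \<xi>) (B.cor.g \<eta>)" for \<xi> \<eta>
  interpret D: tensor H N E F D \<tau>'
    by (rule is_tensor_transport[OF D E.w_correspondence_axioms F.w_correspondence_axioms A.cor.g_iso B.cor.g_iso])
      (rule \<tau>'_def)
  obtain W where W: "corr_iso N D P W" and W\<tau>: "\<And>\<xi> \<eta>. \<xi> \<in> carrier E \<Longrightarrow> \<eta> \<in> carrier F \<Longrightarrow> W (\<tau>' \<xi> \<eta>) = \<tau> \<xi> \<eta>"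
    using tensor_isomorphic[OF D.tensor_axioms tensor_axioms] by blast
  have tD: "tens D R Z = \<tau>' (A.cor.w R) (B.cor.w Z)" if "R \<in> carrier A.cor.C" "Z \<in> carrier B.cor.C" for R Z
    using that by (simp add: \<tau>'_def A.cor.g_w B.cor.g_w)
  have WD: "W (tens D R Z) = \<tau> (A.cor.w R) (B.cor.w Z)"
    if "R \<in> carrier A.cor.C" "Z \<in> carrier B.cor.C" for R Z
    unfolding tD[OF that] by (rule W\<tau>[OF A.cor.w_closed[OF that(1)] B.cor.w_closed[OF that(2)]])
  have unique: "f = g" if "corr_iso N D G f" "corr_iso N D G g"
    "\<And>R Z. R \<in> carrier A.cor.C \<Longrightarrow> Z \<in> carrier B.cor.C \<Longrightarrow> f (tens D R Z) = g (tens D R Z)"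
    for f g and G :: "('h \<Rightarrow> 'h, 'x, 'y) corr_scheme"
    by (rule D.iso_unique[OF that(1,2)])
      (unfold \<tau>'_def, intro that(3) A.cor.g_closed B.cor.g_closed)
  let ?G = "\<lambda>p\<in>carrier D. cor2.g (W p)"
  have G: "corr_iso N D cor2.C ?G" by (rule D.P.corr_iso_compose[OF W cor2.g_iso])
  have GD: "?G (tens D R Z) = compose (carrier H) (stine_map H E.M' B.cp A.cp R) Z"
    if "R \<in> carrier A.cor.C" "Z \<in> carrier B.cor.C" for R Z
  proof -
    have "tens D R Z \<in> carrier D" using D that by (simp add: is_tensor_def)
    then show ?thesis using WD[OF that] cor2_elem[OF that] by simp
  qed
  have "cp_Gamma H E.M' B.cp A.cp D = ?G"
    unfolding cp_Gamma_def cp_corr_def cp_corr2_def E.N_eq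
  proof (rule the_equality, intro conjI ballI G)
    show "R \<in> carrier A.cor.C \<Longrightarrow> Z \<in> carrier B.cor.C
      \<Longrightarrow> ?G (tens D R Z) = compose (carrier H) (stine_map H E.M' B.cp A.cp R) Z" for R Z by (rule GD)
    fix g assume g: "corr_iso N D cor2.C g \<and> (\<forall>R\<in>carrier A.cor.C. \<forall>Z\<in>carrier B.cor.C.
      g (tens D R Z) = compose (carrier H) (stine_map H E.M' B.cp A.cp R) Z)"
    show "g = ?G" by (rule unique[OF _ G]) (use g GD in simp_all)
  qed
  then show thesis
  proof (rule that[OF W _ _ G, rotated])
    show "(THE W. corr_iso N D P W \<and> (\<forall>R\<in>carrier A.cor.C. \<forall>Z\<in>carrier B.cor.C.
      W (tens D R Z) = \<tau> (A.cor.w R) (B.cor.w Z))) = W"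
    proof (rule the_equality, intro conjI ballI W WD)
      fix W' assume W': "corr_iso N D P W' \<and> (\<forall>R\<in>carrier A.cor.C. \<forall>Z\<in>carrier B.cor.C.
        W' (tens D R Z) = \<tau> (A.cor.w R) (B.cor.w Z))"
      show "W' = W" by (rule unique[OF _ W]) (use W' WD in simp_all)
    qed
  qed
qed

locale rep_product_system = X: rep_tensor H N E F EF "tens EF" T S + Y: rep_tensor H N F E FE "tens FE" S T
  for H :: "'h hspace" and N and E :: "('h \<Rightarrow> 'h, 'e) corr" and F :: "('h \<Rightarrow> 'h, 'f) corr"
    and EF :: "('h \<Rightarrow> 'h, 'p, 'e, 'f) corr_tensor" and FE :: "('h \<Rightarrow> 'h, 'q, 'f, 'e) corr_tensor"
    and T :: "'e \<Rightarrow> 'h \<Rightarrow> 'h" and S :: "'f \<Rightarrow> 'h \<Rightarrow> 'h" +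
  fixes t :: "'p \<Rightarrow> 'q"
  assumes t_iso: "corr_iso N EF FE t"
begin

lemma t_closed: "p \<in> carrier EF \<Longrightarrow> t p \<in> carrier FE"
  using t_iso by (auto simp: corr_iso_def)

lemma assoc_Ji: "hten_assoc H E F EF = X.Ji" "hten_assoc H F E FE = Y.Ji"
  unfolding hten_assoc_def htensor2_def by (rule X.assoc_eq, rule Y.assoc_eq)

lemma flip_Ji:
  assumes p: "p \<in> carrier EF" and h: "h \<in> carrier H"
  shows "flip_hten H E F EF FE t (X.Ji (X.P.I.te p h)) = Y.Ji (Y.P.I.te (t p) h)"
proof -
  note te = X.P.I.te_closed[OF p h]
  have "the_inv_into (carrier X.P.I.ET) X.Ji (X.Ji (X.P.I.te p h)) = X.P.I.te p h"
    unfolding X.the_inv_Ji[OF X.Ji_closed[OF te]] by (rule X.J_Ji[OF te])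
  then show ?thesis
    unfolding flip_hten_def assoc_Ji X.htensor2_eq restrict_apply'[OF X.Ji_closed[OF te]]
    by (simp only: map_hten_iso[OF X.P.w_correspondence_axioms Y.P.w_correspondence_axioms t_iso p h])
qed

text \<open>In the models of \<open>E \<otimes> F\<close> and \<open>F \<otimes> E\<close> the unitary \<open>u\<close> is \<open>t\<close>.\<close>

lemma u_g:
  assumes p: "p \<in> carrier EF"
  shows "compose (carrier H) (cp_u H X.E.M' E F EF FE t T S X.A.cp X.B.cp) (X.cor2.g p) = Y.cor2.g (t p)"
proof (rule extensionalityI[of _ "carrier H"])
  note tp = t_closed[OF p]
  show "Y.cor2.g (t p) \<in> extensional (carrier H)"
    using bop_funcset[OF Y.cor2.g_bop[OF tp]] by (simp add: PiE_def)
  fix h assume h: "h \<in> carrier H"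
  note x = X.cor2.g_apply_closed[OF p h] and y = Y.cor2.g_apply_closed[OF tp h]
  have "X.J (X.Lam (X.cor2.g p h)) = X.P.I.te p h"
    using X.cor2.V_g[OF p h] X.V2_apply[OF x] by simp
  then have 1: "X.Lam (X.cor2.g p h) = X.Ji (X.P.I.te p h)" using X.Ji_J[OF X.Lam_closed[OF x]] by simp
  have "Y.J (Y.Lam (Y.cor2.g (t p) h)) = Y.P.I.te (t p) h"
    using Y.cor2.V_g[OF tp h] Y.V2_apply[OF y] by simp
  then have 2: "Y.Lam (Y.cor2.g (t p) h) = Y.Ji (Y.P.I.te (t p) h)" using Y.Ji_J[OF Y.Lam_closed[OF y]] by simp
  have inj: "inj_on Y.Lam (carrier Y.S2)"
    by (rule inj_onI) (rule isometry_inj[OF Y.S2_hilbert Y.EF.ET_hilbert Y.Lam_isometry])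
  have "cp_u H X.E.M' E F EF FE t T S X.A.cp X.B.cp (X.cor2.g p h)
      = the_inv_into (carrier Y.S2) Y.Lam (Y.Lam (Y.cor2.g (t p) h))"
    unfolding cp_u_def restrict_apply'[OF x] 1 2 flip_Ji[OF p h] ..
  also have "\<dots> = Y.cor2.g (t p) h" by (rule the_inv_into_f_f[OF inj y])
  finally show "compose (carrier H) (cp_u H X.E.M' E F EF FE t T S X.A.cp X.B.cp) (X.cor2.g p) h = Y.cor2.g (t p) h"
    using h by (simp add: compose_eq)
qed (simp add: compose_def)

lemma exchange:
  assumes D: "is_tensor H N X.A.cor.C X.B.cor.C D" and D': "is_tensor H N X.B.cor.C X.A.cor.C D'"
    and x: "x \<in> carrier D"
  shows "t (tens_map N X.A.cor.C X.B.cor.C D EF X.A.cor.w X.B.cor.w x) =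
    tens_map N X.B.cor.C X.A.cor.C D' FE X.B.cor.w X.A.cor.w
      (cp_t H X.E.M' E F EF FE t T S X.A.cp X.B.cp D D' x)"
proof -
  interpret D: w_correspondence H N D using D by (simp add: is_tensor_def)
  interpret D': w_correspondence H N D' using D' by (simp add: is_tensor_def)
  obtain W where W: "corr_iso N D EF W" and tm: "tens_map N X.A.cor.C X.B.cor.C D EF X.A.cor.w X.B.cor.w = W"
    and Gamma: "cp_Gamma H X.E.M' X.B.cp X.A.cp D = (\<lambda>p\<in>carrier D. X.cor2.g (W p))"
    using X.cp_tensor[OF D] unfolding tens_map_def by blast
  obtain W' where W': "corr_iso N D' FE W'"
    and tm': "tens_map N X.B.cor.C X.A.cor.C D' FE X.B.cor.w X.A.cor.w = W'"
    and Gamma': "cp_Gamma H X.E.M' X.A.cp X.B.cp D' = (\<lambda>p\<in>carrier D'. Y.cor2.g (W' p))"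
    and G': "corr_iso N D' Y.cor2.C (\<lambda>p\<in>carrier D'. Y.cor2.g (W' p))"
    using Y.cp_tensor[OF D'] unfolding tens_map_def by blast
  let ?G = "\<lambda>p\<in>carrier D'. Y.cor2.g (W' p)"
  have Wx: "W x \<in> carrier EF" using W x by (auto simp: corr_iso_def)
  note tW = t_closed[OF Wx]
  define y where "y = cp_t H X.E.M' E F EF FE t T S X.A.cp X.B.cp D D' x"
  have y_eq: "y = the_inv_into (carrier D') ?G (Y.cor2.g (t (W x)))"
    unfolding y_def cp_t_def restrict_apply'[OF x] Gamma Gamma' u_g[OF Wx] ..
  have inj: "inj_on ?G (carrier D')" by (rule D'.corr_iso_inverse(1)[OF G'])
  have img: "Y.cor2.g (t (W x)) \<in> ?G ` carrier D'"
    using G' Y.cor2.g_closed[OF tW] by (simp add: corr_iso_def)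
  have y: "y \<in> carrier D'" unfolding y_eq by (rule the_inv_into_into[OF inj img order_refl])
  have "?G y = Y.cor2.g (t (W x))" unfolding y_eq by (rule f_the_inv_into_f[OF inj img])
  then have "Y.cor2.g (W' y) = Y.cor2.g (t (W x))" using y by simp
  moreover have "W' y \<in> carrier FE" using W' y by (auto simp: corr_iso_def)
  ultimately have "W' y = t (W x)"
    using inj_onD[OF Y.P.corr_iso_inverse(1)[OF Y.cor2.g_iso]] tW by blast
  then show ?thesis unfolding tm tm' y_def ..
qed

end

theorem proposition5p7:
  fixes H :: "'h hspace" and M :: "('h \<Rightarrow> 'h) set"
    and E :: "('h \<Rightarrow> 'h, 'e) corr" and F :: "('h \<Rightarrow> 'h, 'f) corr"
    and EF :: "('h \<Rightarrow> 'h, 'p, 'e, 'f) corr_tensor"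
    and FE :: "('h \<Rightarrow> 'h, 'q, 'f, 'e) corr_tensor"
    and t :: "'p \<Rightarrow> 'q"
    and T :: "'e \<Rightarrow> 'h \<Rightarrow> 'h" and S :: "'f \<Rightarrow> 'h \<Rightarrow> 'h"
    and \<Theta> \<Phi> :: "('h \<Rightarrow> 'h) \<Rightarrow> 'h \<Rightarrow> 'h"
    and E\<Theta>\<Phi> :: "('h \<Rightarrow> 'h, 'r, 'h \<Rightarrow> (('h \<Rightarrow> 'h) \<times> 'h) hcompl,
      'h \<Rightarrow> (('h \<Rightarrow> 'h) \<times> 'h) hcompl) corr_tensor"
    and E\<Phi>\<Theta> :: "('h \<Rightarrow> 'h, 's, 'h \<Rightarrow> (('h \<Rightarrow> 'h) \<times> 'h) hcompl,
      'h \<Rightarrow> (('h \<Rightarrow> 'h) \<times> 'h) hcompl) corr_tensor"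
  assumes "hilbert_space H"
    and "von_neumann_algebra H M"
    and "product_system H (commutant H M) E F EF FE t"
    and "cc_product_rep H (commutant H M) E F EF FE t T S"
    and "inj_on T (carrier E)"
    and "inj_on S (carrier F)"
    and "\<Theta> = cp_map H M E T"
    and "\<Phi> = cp_map H M F S"
    and "is_tensor H (commutant H M) (cp_corr H M \<Theta>) (cp_corr H M \<Phi>) E\<Theta>\<Phi>"
    and "is_tensor H (commutant H M) (cp_corr H M \<Phi>) (cp_corr H M \<Theta>) E\<Phi>\<Theta>"
  shows "\<exists>w\<^sub>E w\<^sub>F. corr_iso (commutant H M) (cp_corr H M \<Theta>) E w\<^sub>E \<and>
      corr_iso (commutant H M) (cp_corr H M \<Phi>) F w\<^sub>F \<and>
      (\<forall>x\<in>carrier E\<Theta>\<Phi>.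
        t (tens_map (commutant H M) (cp_corr H M \<Theta>) (cp_corr H M \<Phi>) E\<Theta>\<Phi> EF w\<^sub>E w\<^sub>F x) =
        tens_map (commutant H M) (cp_corr H M \<Phi>) (cp_corr H M \<Theta>) E\<Phi>\<Theta> FE w\<^sub>F w\<^sub>E
          (cp_t H M E F EF FE t T S \<Theta> \<Phi> E\<Theta>\<Phi> E\<Phi>\<Theta> x)) \<and>
      (\<forall>R\<in>carrier (cp_corr H M \<Theta>). T (w\<^sub>E R) = cp_rep H M \<Theta> R) \<and>
      (\<forall>Y\<in>carrier (cp_corr H M \<Phi>). S (w\<^sub>F Y) = cp_rep H M \<Phi> Y)"
proof -
  let ?N = "commutant H M"
  have E: "w_correspondence H ?N E" and F: "w_correspondence H ?N F"
    and EF: "is_tensor H ?N E F EF" and FE: "is_tensor H ?N F E FE" and t: "corr_iso ?N EF FE t"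
    using assms(3) by (simp_all add: product_system_def)
  have T: "injective_rep H ?N E T" and S: "injective_rep H ?N F S"
    by (intro injective_rep.intro injective_rep_axioms.intro E F assms(5,6) assms(4)[unfolded cc_product_rep_def, THEN conjunct1]
        assms(4)[unfolded cc_product_rep_def, THEN conjunct2, THEN conjunct1])+
  interpret rep_product_system H ?N E F EF FE T S t
    by (intro rep_product_system.intro rep_product_system_axioms.intro rep_tensor.intro
        is_tensor_tensor[OF EF E F] is_tensor_tensor[OF FE F E] T S t)
  have M: "commutant H ?N = M" using assms(2) by (simp add: von_neumann_algebra_def)
  have \<Theta>: "X.A.cp = \<Theta>" and \<Phi>: "X.B.cp = \<Phi>"
    unfolding X.A.cp_def X.B.cp_def M using assms(7,8) by simp_all
  have CE: "X.A.cor.C = cp_corr H M \<Theta>" and CF: "X.B.cor.C = cp_corr H M \<Phi>"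
    using X.A.cor_C X.B.cor_C unfolding M \<Theta> \<Phi> .
  show ?thesis
  proof (intro exI conjI ballI)
    show "corr_iso ?N (cp_corr H M \<Theta>) E X.A.cor.w" using X.A.cor.w_iso unfolding CE .
    show "corr_iso ?N (cp_corr H M \<Phi>) F X.B.cor.w" using X.B.cor.w_iso unfolding CF .
    show "T (X.A.cor.w R) = cp_rep H M \<Theta> R" if "R \<in> carrier (cp_corr H M \<Theta>)" for R
      using X.A.T_eq_cp_rep[unfolded CE, OF that] unfolding M \<Theta> .
    show "S (X.B.cor.w Y) = cp_rep H M \<Phi> Y" if "Y \<in> carrier (cp_corr H M \<Phi>)" for Y
      using X.B.T_eq_cp_rep[unfolded CF, OF that] unfolding M \<Phi> .
    show "t (tens_map ?N (cp_corr H M \<Theta>) (cp_corr H M \<Phi>) E\<Theta>\<Phi> EF X.A.cor.w X.B.cor.w x) =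
        tens_map ?N (cp_corr H M \<Phi>) (cp_corr H M \<Theta>) E\<Phi>\<Theta> FE X.B.cor.w X.A.cor.w
          (cp_t H M E F EF FE t T S \<Theta> \<Phi> E\<Theta>\<Phi> E\<Phi>\<Theta> x)" if "x \<in> carrier E\<Theta>\<Phi>" for x
      using exchange[unfolded CE CF, OF assms(9,10) that] unfolding M \<Theta> \<Phi> .
  qed
qed

end
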